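(* Let $\lambda,\mu>0$, let $q\neq 0$ and $\rho$ be real constants with $|\rho q|<1$, let $\sigma^{+-},\sigma^{-+}$ be real-valued functions on $[0,1]$, and consider the controlled system on $\{(t,x): t>0,\ x\in[0,1]\}$ $$u_t(t,x)+\lambda u_x(t,x)=\sigma^{+-}(x)v(t,x),\qquad v_t(t,x)-\mu v_x(t,x)=\sigma^{-+}(x)u(t,x),$$ $$u(t,0)=q\,v(t,0),\qquad v(t,1)=\rho\,u(t,1)+U(t),$$ with initial conditions in $L^2([0,1])$. Let $K\in\mathbb R$ satisfy $$|K|<\frac{1-|\rho q|}{|q|},$$ and consider the control law $$U_{BS_2}(t)=-K u(t,1)-(\rho-K)\int_0^1\big(K^{uu}(1,\xi)u(t,\xi)+K^{uv}(1,\xi)v(t,\xi)\big)d\xi+\int_0^1\big(K^{vu}(1,\xi)u(t,\xi)+K^{vv}(1,\xi)v(t,\xi)\big)d\xi,$$ where $K^{uu},K^{uv},K^{vu},K^{vv}$ are the backstepping kernels defined in the context. Then the control law $U=U_{BS_2}$ delay-robustly stabilizes the system.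
   Context: Backstepping kernels: on $\mathcal T=\{(x,\xi)\in[0,1]^2:\xi\le x\}$, $K^{uu},K^{uv},K^{vu},K^{vv}\in L^\infty(\mathcal T)$ are the unique solution of $\lambda K^{uu}_x+\lambda K^{uu}_\xi=-K^{uv}(x,\xi)\sigma^{-+}(\xi)$, $\lambda K^{uv}_x-\mu K^{uv}_\xi=-K^{uu}(x,\xi)\sigma^{+-}(\xi)$, $\mu K^{vu}_x-\lambda K^{vu}_\xi=K^{vv}(x,\xi)\sigma^{-+}(\xi)$, $\mu K^{vv}_x+\mu K^{vv}_\xi=K^{vu}(x,\xi)\sigma^{+-}(\xi)$, with boundary conditions $K^{vu}(x,x)=-\frac{\sigma^{-+}(x)}{\lambda+\mu}$, $K^{vv}(x,0)=\frac{\lambda q}{\mu}K^{vu}(x,0)$, $K^{uv}(x,x)=\frac{\sigma^{+-}(x)}{\lambda+\mu}$, $K^{uv}(x,0)=\frac{\lambda q}{\mu}K^{uu}(x,0)$. The functions $\sigma^{+-},\sigma^{-+}$ are assumed regular enough that this kernel system has a unique solution in $L^\infty(\mathcal T)$ with well-defined bounded traces at $x=1$. Delay-robust stabilization: a controller $U(t)=\mathcal K[(u(t,\cdot),v(t,\cdot))]$ delay-robustly stabilizes the system if (i) the closed-loop system is exponentially stable in the $L^2$-norm of the state $(u,v)$, and (ii) the closed loop is robustly stable with respect to small delays in the loop, i.e. there is $\delta_0>0$ such that for every $\delta\in(0,\delta_0]$ the closed-loop system in which the input $U(t)$ is replaced by the delayed input $U(t-\delta)$ is still stable in this sense. *)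

theory Defs
  imports "HOL-Analysis.Analysis"
begin

text \<open>
  Elements of $L^\infty$ and $L^2$ are represented by Borel functions. All relations between them
  are required almost everywhere only.
\<close>

definition Linf_on :: "'a::euclidean_space set \<Rightarrow> ('a \<Rightarrow> real) \<Rightarrow> bool" where
  "Linf_on S f \<longleftrightarrow> set_borel_measurable borel S f \<and> bounded (f ` S)"

definition L2_on :: "'a::euclidean_space set \<Rightarrow> ('a \<Rightarrow> real) \<Rightarrow> bool" where
  "L2_on S f \<longleftrightarrow> set_borel_measurable borel S f \<and> set_integrable lborel S (\<lambda>x. (f x)\<^sup>2)"

definition L2norm_on :: "'a::euclidean_space set \<Rightarrow> ('a \<Rightarrow> real) \<Rightarrow> real" where
  "L2norm_on S f = sqrt (LBINT x:S. (f x)\<^sup>2)"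

text \<open>
  Broad solutions of $a f_y + b f_z = g$ on a convex set $S$, for $a > 0$: along almost every
  characteristic $s \mapsto (a s, c + b s)$, the function $f$ is absolutely continuous inside $S$
  with derivative $g$ almost everywhere. No differentiability in other directions is required.
\<close>

definition broad_solution ::
  "real \<Rightarrow> real \<Rightarrow> (real \<times> real) set \<Rightarrow> (real \<Rightarrow> real \<Rightarrow> real) \<Rightarrow> (real \<Rightarrow> real \<Rightarrow> real) \<Rightarrow> bool" where
  "broad_solution a b S f g \<longleftrightarrow>
    (AE c in lborel. \<forall>s0 s1. s0 \<le> s1 \<longrightarrow> (a * s0, c + b * s0) \<in> S \<longrightarrow> (a * s1, c + b * s1) \<in> S \<longrightarrow>
      set_integrable lborel {s0..s1} (\<lambda>s. g (a * s) (c + b * s)) \<and>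
      f (a * s1) (c + b * s1) - f (a * s0) (c + b * s0)
        = (LBINT s:{s0..s1}. g (a * s) (c + b * s)))"

definition triangle :: "(real \<times> real) set" where
  "triangle = {(x, \<xi>). 0 \<le> \<xi> \<and> \<xi> \<le> x \<and> x \<le> 1}"

text \<open>
  The kernel system. As usual, \<open>\<sigma>pm\<close> stands for $\sigma^{+-}$ and \<open>\<sigma>mp\<close> for $\sigma^{-+}$.
\<close>

definition backstepping_kernels ::
  "real \<Rightarrow> real \<Rightarrow> real \<Rightarrow> (real \<Rightarrow> real) \<Rightarrow> (real \<Rightarrow> real)
    \<Rightarrow> (real \<Rightarrow> real \<Rightarrow> real) \<Rightarrow> (real \<Rightarrow> real \<Rightarrow> real)
    \<Rightarrow> (real \<Rightarrow> real \<Rightarrow> real) \<Rightarrow> (real \<Rightarrow> real \<Rightarrow> real) \<Rightarrow> bool" where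
  "backstepping_kernels lam mu q \<sigma>pm \<sigma>mp Kuu Kuv Kvu Kvv \<longleftrightarrow>
    (\<forall>k \<in> {Kuu, Kuv, Kvu, Kvv}. Linf_on triangle (\<lambda>(x, \<xi>). k x \<xi>)) \<and>
    broad_solution lam lam triangle Kuu (\<lambda>x \<xi>. - Kuv x \<xi> * \<sigma>mp \<xi>) \<and>
    broad_solution lam (- mu) triangle Kuv (\<lambda>x \<xi>. - Kuu x \<xi> * \<sigma>pm \<xi>) \<and>
    broad_solution mu (- lam) triangle Kvu (\<lambda>x \<xi>. Kvv x \<xi> * \<sigma>mp \<xi>) \<and>
    broad_solution mu mu triangle Kvv (\<lambda>x \<xi>. Kvu x \<xi> * \<sigma>pm \<xi>) \<and>
    (AE x in lborel. x \<in> {0..1} \<longrightarrow>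
      Kvu x x = - \<sigma>mp x / (lam + mu) \<and>
      Kvv x 0 = lam * q / mu * Kvu x 0 \<and>
      Kuv x x = \<sigma>pm x / (lam + mu) \<and>
      Kuv x 0 = lam * q / mu * Kuu x 0)"

text \<open>
  Solutions with $L^2$ initial data of the plant driven by the input \<open>U\<close>. The functions \<open>u\<close>, \<open>v\<close>
  take the time as first argument. The outgoing traces \<open>u(\<cdot>,1)\<close> and \<open>v(\<cdot>,0)\<close> are locally square
  integrable, so that they may be used in a feedback law.
\<close>

definition plant_solution ::
  "real \<Rightarrow> real \<Rightarrow> real \<Rightarrow> real \<Rightarrow> (real \<Rightarrow> real) \<Rightarrow> (real \<Rightarrow> real)
    \<Rightarrow> (real \<Rightarrow> real) \<Rightarrow> (real \<Rightarrow> real) \<Rightarrow> (real \<Rightarrow> real)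
    \<Rightarrow> (real \<Rightarrow> real \<Rightarrow> real) \<Rightarrow> (real \<Rightarrow> real \<Rightarrow> real) \<Rightarrow> bool" where
  "plant_solution lam mu q \<rho> \<sigma>pm \<sigma>mp u0 v0 U u v \<longleftrightarrow>
    (\<forall>t\<ge>0. L2_on {0..1} (u t) \<and> L2_on {0..1} (v t)) \<and>
    (\<forall>T>0. L2_on ({0..T} \<times> {0..1}) (\<lambda>(t, x). u t x) \<and>
           L2_on ({0..T} \<times> {0..1}) (\<lambda>(t, x). v t x) \<and>
           L2_on {0..T} (\<lambda>t. u t 1) \<and> L2_on {0..T} (\<lambda>t. v t 0)) \<and>
    broad_solution 1 lam ({0..} \<times> {0..1}) u (\<lambda>t x. \<sigma>pm x * v t x) \<and>
    broad_solution 1 (- mu) ({0..} \<times> {0..1}) v (\<lambda>t x. \<sigma>mp x * u t x) \<and>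
    (AE t in lborel. 0 < t \<longrightarrow> u t 0 = q * v t 0 \<and> v t 1 = \<rho> * u t 1 + U t) \<and>
    (AE x in lborel. x \<in> {0..1} \<longrightarrow> u 0 x = u0 x \<and> v 0 x = v0 x)"

text \<open>
  A controller maps the current state (two functions on $[0,1]$) to an input value. With a delay
  \<open>\<delta>\<close> in the loop, the input $U(t-\delta)$ applied for $t < \delta$ is not determined by the
  initial state; it is part of the initial data, as a function \<open>\<phi>\<close> on $[-\delta,0)$.
  For \<open>\<delta> = 0\<close> the function \<open>\<phi>\<close> plays no role.
\<close>

definition delayed_input ::
  "real \<Rightarrow> ((real \<Rightarrow> real) \<Rightarrow> (real \<Rightarrow> real) \<Rightarrow> real) \<Rightarrow> (real \<Rightarrow> real)
    \<Rightarrow> (real \<Rightarrow> real \<Rightarrow> real) \<Rightarrow> (real \<Rightarrow> real \<Rightarrow> real) \<Rightarrow> real \<Rightarrow> real" where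
  "delayed_input \<delta> \<K> \<phi> u v t = (if t < \<delta> then \<phi> (t - \<delta>) else \<K> (u (t - \<delta>)) (v (t - \<delta>)))"

definition state_norm :: "(real \<Rightarrow> real) \<Rightarrow> (real \<Rightarrow> real) \<Rightarrow> real" where
  "state_norm f g = sqrt ((L2norm_on {0..1} f)\<^sup>2 + (L2norm_on {0..1} g)\<^sup>2)"

text \<open>
  Existence of a solution for all initial data is included. Uniqueness then follows from the
  estimate whenever the controller is linear.
\<close>

definition closed_loop_exp_stable ::
  "real \<Rightarrow> real \<Rightarrow> real \<Rightarrow> real \<Rightarrow> (real \<Rightarrow> real) \<Rightarrow> (real \<Rightarrow> real)
    \<Rightarrow> ((real \<Rightarrow> real) \<Rightarrow> (real \<Rightarrow> real) \<Rightarrow> real) \<Rightarrow> real \<Rightarrow> bool" where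
  "closed_loop_exp_stable lam mu q \<rho> \<sigma>pm \<sigma>mp \<K> \<delta> \<longleftrightarrow>
    (\<exists>C \<eta>. 0 < C \<and> 0 < \<eta> \<and>
      (\<forall>u0 v0 \<phi>. L2_on {0..1} u0 \<longrightarrow> L2_on {0..1} v0 \<longrightarrow> L2_on {- \<delta>..0} \<phi> \<longrightarrow>
        (\<exists>u v. plant_solution lam mu q \<rho> \<sigma>pm \<sigma>mp u0 v0 (delayed_input \<delta> \<K> \<phi> u v) u v) \<and>
        (\<forall>u v. plant_solution lam mu q \<rho> \<sigma>pm \<sigma>mp u0 v0 (delayed_input \<delta> \<K> \<phi> u v) u v \<longrightarrow>
          (\<forall>t\<ge>0. state_norm (u t) (v t)
            \<le> C * exp (- \<eta> * t) * (state_norm u0 v0 + L2norm_on {- \<delta>..0} \<phi>)))))"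

definition delay_robustly_stabilizes ::
  "real \<Rightarrow> real \<Rightarrow> real \<Rightarrow> real \<Rightarrow> (real \<Rightarrow> real) \<Rightarrow> (real \<Rightarrow> real)
    \<Rightarrow> ((real \<Rightarrow> real) \<Rightarrow> (real \<Rightarrow> real) \<Rightarrow> real) \<Rightarrow> bool" where
  "delay_robustly_stabilizes lam mu q \<rho> \<sigma>pm \<sigma>mp \<K> \<longleftrightarrow>
    closed_loop_exp_stable lam mu q \<rho> \<sigma>pm \<sigma>mp \<K> 0 \<and>
    (\<exists>\<delta>0>0. \<forall>\<delta>. 0 < \<delta> \<and> \<delta> \<le> \<delta>0 \<longrightarrow> closed_loop_exp_stable lam mu q \<rho> \<sigma>pm \<sigma>mp \<K> \<delta>)"

definition U_BS2 ::
  "real \<Rightarrow> real \<Rightarrow> (real \<Rightarrow> real \<Rightarrow> real) \<Rightarrow> (real \<Rightarrow> real \<Rightarrow> real)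
    \<Rightarrow> (real \<Rightarrow> real \<Rightarrow> real) \<Rightarrow> (real \<Rightarrow> real \<Rightarrow> real)
    \<Rightarrow> (real \<Rightarrow> real) \<Rightarrow> (real \<Rightarrow> real) \<Rightarrow> real" where
  "U_BS2 \<rho> K Kuu Kuv Kvu Kvv f g =
    - K * f 1
    - (\<rho> - K) * (LBINT \<xi>:{0..1}. Kuu 1 \<xi> * f \<xi> + Kuv 1 \<xi> * g \<xi>)
    + (LBINT \<xi>:{0..1}. Kvu 1 \<xi> * f \<xi> + Kvv 1 \<xi> * g \<xi>)"

end

theory Submission
  imports Defs
begin

text \<open>
  Write $\alpha = u - \int_0^x (K^{uu} u + K^{uv} v)$ and $\beta = v - \int_0^x (K^{vu} u + K^{vv} v)$.
  The kernel equations say that $\alpha$ and $\beta$ are constant along characteristics. For broad solutions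
  this follows by integrating the product of kernel and state over the region below a characteristic,
  so that no derivative in other directions is needed. Hence the state is governed by the trace
  $b(t) = \beta(t,1)$, with $\alpha(t,1) = q b(t-\tau)$ for $\tau = 1/\lambda + 1/\mu$. A Volterra adjoint rewrites
  the functional $\rho \int (K^{uu} u + K^{uv} v) - \int (K^{vu} u + K^{vv} v)$ at $x = 1$ as the
  convolution $N * b$ with a bounded, compactly supported $N$, and the control law becomes
  $$b(t) = \rho q\, b(t-\tau) - K q\, b(t-\tau-\delta) + (N * b)(t) - (N * b)(t-\delta).$$
  Translation is continuous in $L^2$, so the last difference is small for small $\delta$ and
  $|\rho q| + |K q| < 1$ forces decay of an exponentially weighted $L^2$-norm of $b$, at a rate that does not depend on $\delta$.
  Only during the first $\delta$ units of time are the terms at $t-\delta$ replaced by the data $\phi$.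
  Solutions exist because the integral equations along characteristics, with $v(t,1)$ as a third
  unknown, form a system whose Picard iteration converges in $L^2$ with a large exponential weight in time.
\<close>


text \<open>The equations hold only along almost every characteristic and for almost every boundary
  time, while the decay estimate is claimed at every t. Representations are therefore stated for
  almost every characteristic label c and all times on it. Affine images of null sets are null,
  which gives back statements in x at fixed t or in t at fixed x. All norms are
  \<open>ennreal\<close> integrals. Absorbing a term on the right requires its finiteness
  beforehand: for decay it comes from the trace v(t,0), which is part of the solution concept, and
  for existence from an induction over the iterates. The threshold |\<rho> q| + |K q| < 1 survives
  squaring only through a weighted Cauchy-Schwarz inequality whose weights are these two numbers
  plus a small reserve for the convolution. In the existence proof the relation v(t,1) = \<rho>
  u(t,1) + U(t) has neither a delay nor a small factor, so no single equation contracts; smallness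
  appears only after going around the loop from x = 1 to x = 0 and back. Estimates need globally
  Borel and bounded functions, whereas the hypotheses speak of the triangle and the strip;
  truncation bridges the two.\<close>

lemma AE_lborel_affine:
  fixes P :: "real \<Rightarrow> bool"
  assumes "c \<noteq> 0" "AE x in lborel. P x"
  shows "AE x in lborel. P (t + c * x)"
proof -
  obtain N where N: "N \<in> null_sets lborel" "{x. \<not> P x} \<subseteq> N"
    using assms(2) by (auto simp: eventually_ae_filter)
  have [measurable]: "N \<in> sets borel" using N(1) by auto
  have "AE x in lborel. t + c * x \<notin> N"
    using AE_borel_affine[of c "\<lambda>x. x \<notin> N" t] assms(1) AE_not_in[OF N(1)] by simp
  then show ?thesis by eventually_elim (use N(2) in auto)
qed

section \<open>Inequalities for \<open>ennreal\<close> integrals and translation in L2\<close>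

lemma ennreal_absorb:
  fixes x a :: ennreal
  assumes "x \<le> a + ennreal \<kappa> * x" "x < \<infinity>" "0 \<le> \<kappa>" "\<kappa> < 1"
  shows "x \<le> ennreal (1 / (1 - \<kappa>)) * a"
proof (cases a)
  case top then show ?thesis using assms by (simp add: ennreal_mult_top)
next
  case (real a')
  obtain x' where x': "x = ennreal x'" "0 \<le> x'" using assms(2) by (cases x) auto
  have "x' \<le> a' + \<kappa> * x'"
    using assms(1,3) real x' by (simp flip: ennreal_mult ennreal_plus)
  then have "x' \<le> 1 / (1 - \<kappa>) * a'" using assms(4) by (simp add: field_simps)
  then show ?thesis using assms x' real by (simp flip: ennreal_mult)
qed

lemma nn_integral_Icc_power2_le:
  fixes f :: "real \<Rightarrow> ennreal"
  assumes [measurable]: "f \<in> borel_measurable borel" and "a \<le> b"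
  shows "(\<integral>\<^sup>+x\<in>{a..b}. f x \<partial>lborel)\<^sup>2 \<le> ennreal (b - a) * (\<integral>\<^sup>+x\<in>{a..b}. (f x)\<^sup>2 \<partial>lborel)"
proof -
  have "(\<integral>\<^sup>+x. f x * indicator {a..b} x \<partial>lborel)\<^sup>2
      = (\<integral>\<^sup>+x. indicator {a..b} x * (f x * indicator {a..b} x) \<partial>lborel)\<^sup>2"
    by (intro arg_cong[where f="\<lambda>x. x\<^sup>2"] nn_integral_cong) (auto simp: indicator_def)
  also have "\<dots> \<le> (\<integral>\<^sup>+x. (indicator {a..b} x)\<^sup>2 \<partial>lborel) * (\<integral>\<^sup>+x. (f x * indicator {a..b} x)\<^sup>2 \<partial>lborel)"
    by (rule Cauchy_Schwarz_nn_integral) auto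
  also have "(\<integral>\<^sup>+x. (indicator {a..b} x)\<^sup>2 \<partial>lborel) = (\<integral>\<^sup>+x. indicator {a..b} x \<partial>lborel)"
    by (intro nn_integral_cong) (auto simp: indicator_def)
  also have "\<dots> = ennreal (b - a)" using assms by simp
  also have "(\<integral>\<^sup>+x. (f x * indicator {a..b} x)\<^sup>2 \<partial>lborel) = (\<integral>\<^sup>+x\<in>{a..b}. (f x)\<^sup>2 \<partial>lborel)"
    by (intro nn_integral_cong) (auto simp: indicator_def)
  finally show ?thesis .
qed

lemma ennreal_power2_add_le: "((a::ennreal) + b)\<^sup>2 \<le> 2 * a\<^sup>2 + 2 * b\<^sup>2"
proof (cases "a = \<infinity> \<or> b = \<infinity>")
  case True then show ?thesis by (auto simp: power2_eq_square ennreal_mult_top ennreal_top_mult)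
next
  case False
  then obtain x y where xy: "a = ennreal x" "b = ennreal y" "0 \<le> x" "0 \<le> y"
    by (cases a; cases b) auto
  have "(x + y)\<^sup>2 \<le> 2 * x\<^sup>2 + 2 * y\<^sup>2"
    using zero_le_power2[of "x - y"] by (simp add: power2_eq_square algebra_simps)
  then have "ennreal ((x + y)\<^sup>2) \<le> ennreal (2 * x\<^sup>2 + 2 * y\<^sup>2)" by (rule ennreal_leI)
  moreover have "(a + b)\<^sup>2 = ennreal ((x + y)\<^sup>2)"
    using xy by (simp add: ennreal_power flip: ennreal_plus)
  ultimately show ?thesis using xy by (simp add: ennreal_power ennreal_mult)
qed

text \<open>Multiplying by exp(-2 L x) and exchanging the integrals turns the Volterra term into at
  most half of the weighted left side, since L times the integral of exp(-2 L x) over x \<ge> y is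
  exp(-2 L y) / 2. Absorbing that half gives the factor 2, and removing the weight on [0,1] gives
  exp(2 L).\<close>

lemma gronwall_nn_integral:
  fixes f A :: "real \<Rightarrow> ennreal"
  assumes [measurable]: "f \<in> borel_measurable borel" "A \<in> borel_measurable borel" and L: "0 < L"
    and le: "AE x in lborel. x \<in> {0..1} \<longrightarrow> f x \<le> A x + ennreal L * (\<integral>\<^sup>+y\<in>{0..x}. f y \<partial>lborel)"
    and fin: "(\<integral>\<^sup>+x\<in>{0..1}. f x \<partial>lborel) < \<infinity>"
  shows "(\<integral>\<^sup>+x\<in>{0..1}. f x \<partial>lborel) \<le> ennreal (2 * exp (2 * L)) * (\<integral>\<^sup>+x\<in>{0..1}. A x \<partial>lborel)"
proof -
  define e where "e x = ennreal (exp (- 2 * L * x))" for x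
  have [measurable]: "e \<in> borel_measurable borel" unfolding e_def by measurable
  have [measurable]: "(\<lambda>x. \<integral>\<^sup>+y. f y * indicator {0..x} y \<partial>lborel) \<in> borel_measurable borel"
  proof -
    have "(\<lambda>x. \<integral>\<^sup>+y. f y * indicator {0..x} y \<partial>lborel)
      = (\<lambda>x. \<integral>\<^sup>+y. f y * (if 0 \<le> y \<and> y \<le> x then 1 else 0) \<partial>lborel)"
      by (intro ext nn_integral_cong) (auto simp: indicator_def)
    then show ?thesis by simp
  qed
  define q :: "real \<Rightarrow> real \<Rightarrow> ennreal" where "q x y = (if 0 \<le> y \<and> y \<le> x then 1 else 0)" for x y
  have [measurable]: "(\<lambda>(x,y). q x y) \<in> borel_measurable (borel \<Otimes>\<^sub>M borel)"
    unfolding q_def by measurable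
  define W where "W = (\<integral>\<^sup>+x. e x * f x * indicator {0..1} x \<partial>lborel)"
  define A' where "A' = (\<integral>\<^sup>+x. e x * A x * indicator {0..1} x \<partial>lborel)"
  have e1: "e x \<le> 1" if "0 \<le> x" for x using that L by (simp add: e_def mult_nonneg_nonneg)
  have tail: "(\<integral>\<^sup>+x. ennreal L * e x * indicator {y..} x \<partial>lborel) = ennreal (exp (-2*L*y) / 2)" for y
  proof -
    have "(\<integral>\<^sup>+x. ennreal (L * exp (-2*L*x)) * indicator {y..} x \<partial>lborel)
       = ennreal (0 - (- exp (-2*L*y) / 2))"
    proof (rule nn_integral_FTC_atLeast)
      show "((\<lambda>x. - exp (- 2 * L * x) / 2) has_real_derivative L * exp (- 2 * L * x)) (at x)" for x
        by (auto intro!: derivative_eq_intros)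
      have "filterlim (\<lambda>x. 2 * L * x) at_top at_top"
        using L by (intro filterlim_tendsto_pos_mult_at_top[OF tendsto_const] filterlim_ident) auto
      then have "((\<lambda>x. exp (- (2 * L * x))) \<longlongrightarrow> 0) at_top"
        by (intro filterlim_compose[OF exp_at_bot] filterlim_compose[OF filterlim_uminus_at_bot_at_top]) auto
      then show "((\<lambda>x. - exp (- 2 * L * x) / 2) \<longlongrightarrow> 0) at_top"
        using tendsto_minus[OF tendsto_divide[OF _ tendsto_const[of "2::real"]]] by fastforce
    qed (use L in auto)
    then show ?thesis using L by (simp add: e_def ennreal_mult)
  qed
  have "W \<le> (\<integral>\<^sup>+x. e x * A x * indicator {0..1} x
        + ennreal L * e x * indicator {0..1} x * (\<integral>\<^sup>+y. f y * indicator {0..x} y \<partial>lborel) \<partial>lborel)"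
    unfolding W_def
  proof (rule nn_integral_mono_AE)
    show "AE x in lborel. e x * f x * indicator {0..1} x \<le> e x * A x * indicator {0..1} x
        + ennreal L * e x * indicator {0..1} x * (\<integral>\<^sup>+y. f y * indicator {0..x} y \<partial>lborel)"
      using le
    proof eventually_elim
      case (elim x)
      show ?case
      proof (cases "x \<in> {0..1}")
        case True
        with elim have "e x * f x \<le> e x * (A x + ennreal L * (\<integral>\<^sup>+y\<in>{0..x}. f y \<partial>lborel))"
          by (intro mult_left_mono) auto
        then show ?thesis using True by (simp add: algebra_simps)
      qed auto
    qed
  qed
  also have "\<dots> = A' + (\<integral>\<^sup>+x. ennreal L * e x * indicator {0..1} x * (\<integral>\<^sup>+y. f y * indicator {0..x} y \<partial>lborel) \<partial>lborel)"
    unfolding A'_def by (rule nn_integral_add) auto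
  also have "(\<integral>\<^sup>+x. ennreal L * e x * indicator {0..1} x * (\<integral>\<^sup>+y. f y * indicator {0..x} y \<partial>lborel) \<partial>lborel)
     = (\<integral>\<^sup>+x. \<integral>\<^sup>+y. ennreal L * e x * indicator {0..1} x * (f y * q x y) \<partial>lborel \<partial>lborel)"
  proof (rule nn_integral_cong)
    fix x :: real
    have "(\<integral>\<^sup>+y. f y * indicator {0..x} y \<partial>lborel) = (\<integral>\<^sup>+y. f y * q x y \<partial>lborel)"
      by (rule nn_integral_cong) (auto simp: indicator_def q_def)
    then show "ennreal L * e x * indicator {0..1} x * (\<integral>\<^sup>+y. f y * indicator {0..x} y \<partial>lborel)
       = (\<integral>\<^sup>+y. ennreal L * e x * indicator {0..1} x * (f y * q x y) \<partial>lborel)"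
      by (simp only:) (rule nn_integral_cmult[symmetric], measurable)
  qed
  also have "\<dots> = (\<integral>\<^sup>+y. \<integral>\<^sup>+x. ennreal L * e x * indicator {0..1} x * (f y * q x y) \<partial>lborel \<partial>lborel)"
    by (rule lborel_pair.Fubini') measurable
  also have "\<dots> \<le> (\<integral>\<^sup>+y. f y * indicator {0..1} y * ennreal (exp (-2*L*y) / 2) \<partial>lborel)"
  proof (rule nn_integral_mono)
    fix y :: real
    have "(\<integral>\<^sup>+x. ennreal L * e x * indicator {0..1} x * (f y * q x y) \<partial>lborel)
       \<le> (\<integral>\<^sup>+x. f y * indicator {0..1} y * (ennreal L * e x * indicator {y..} x) \<partial>lborel)"
      by (rule nn_integral_mono) (auto simp: indicator_def q_def algebra_simps)
    also have "\<dots> = f y * indicator {0..1} y * ennreal (exp (-2*L*y) / 2)"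
      unfolding tail[symmetric] by (rule nn_integral_cmult) measurable
    finally show "(\<integral>\<^sup>+x. ennreal L * e x * indicator {0..1} x * (f y * q x y) \<partial>lborel)
       \<le> f y * indicator {0..1} y * ennreal (exp (-2*L*y) / 2)" .
  qed
  also have "\<dots> = (\<integral>\<^sup>+y. ennreal (1/2) * (e y * f y * indicator {0..1} y) \<partial>lborel)"
  proof (rule nn_integral_cong)
    fix y :: real
    have "ennreal (exp (-2*L*y) / 2) = ennreal (1/2) * e y"
      unfolding e_def by (subst ennreal_mult[symmetric]) auto
    then show "f y * indicator {0..1} y * ennreal (exp (-2*L*y) / 2) = ennreal (1/2) * (e y * f y * indicator {0..1} y)"
      by (simp add: mult_ac)
  qed
  also have "\<dots> = ennreal (1/2) * W" unfolding W_def by (rule nn_integral_cmult) measurable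
  finally have WW: "W \<le> A' + ennreal (1/2) * W" by (simp add: add_left_mono)
  have "W \<le> (\<integral>\<^sup>+x\<in>{0..1}. f x \<partial>lborel)" unfolding W_def
    by (rule nn_integral_mono) (auto simp: indicator_def intro: mult_right_mono[OF e1, of _ "f _", simplified])
  \<comment> \<open>The inequality \<open>WW\<close> says nothing if \<open>W\<close> is infinite;
    this is where the a priori finiteness enters.\<close>
  with fin have "W < \<infinity>" by simp
  from ennreal_absorb[OF WW this] have WA': "W \<le> ennreal 2 * A'" by simp
  have A'A: "A' \<le> (\<integral>\<^sup>+x\<in>{0..1}. A x \<partial>lborel)" unfolding A'_def
    by (rule nn_integral_mono) (auto simp: indicator_def intro: mult_right_mono[OF e1, of _ "A _", simplified])
  have "(\<integral>\<^sup>+x\<in>{0..1}. f x \<partial>lborel) \<le> (\<integral>\<^sup>+x. ennreal (exp (2*L)) * (e x * f x * indicator {0..1} x) \<partial>lborel)"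
  proof (rule nn_integral_mono)
    fix x :: real
    have "1 \<le> ennreal (exp (2*L)) * e x" if "x \<le> 1"
    proof -
      have "1 \<le> exp (2 * L) * exp (- 2*L*x)" using that L by (simp flip: exp_add)
      then have "ennreal 1 \<le> ennreal (exp (2 * L) * exp (- 2*L*x))" by (rule ennreal_leI)
      then show ?thesis by (simp add: e_def ennreal_mult)
    qed
    then show "f x * indicator {0..1} x \<le> ennreal (exp (2*L)) * (e x * f x * indicator {0..1} x)"
      by (auto simp: indicator_def mult.assoc[symmetric] intro: mult_right_mono[of 1 _ "f x", simplified])
  qed
  also have "\<dots> = ennreal (exp (2*L)) * W" unfolding W_def by (rule nn_integral_cmult) measurable
  also have "\<dots> \<le> ennreal (exp (2*L)) * (ennreal 2 * (\<integral>\<^sup>+x\<in>{0..1}. A x \<partial>lborel))"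
    using WA' A'A by (meson mult_left_mono order_trans zero_le)
  finally show ?thesis by (simp add: ennreal_mult mult_ac)
qed

text \<open>Continuous functions converge to N almost everywhere; dominated convergence makes this
  L2 convergence on [-1, c+1], and there the approximating function is uniformly continuous. That
  interval contains r and r - \<delta> for every r in [0, c+1] and \<delta> \<le> 1.\<close>

lemma L2_translation_continuous:
  fixes N :: "real \<Rightarrow> real" and c M e :: real
  assumes [measurable]: "N \<in> borel_measurable borel"
    and bdd: "\<And>r. \<bar>N r\<bar> \<le> M" and supp: "\<And>r. r \<notin> {0..c} \<Longrightarrow> N r = 0" and "0 \<le> c" "0 < e"
  shows "\<exists>d>0. \<forall>\<delta>. 0 \<le> \<delta> \<and> \<delta> \<le> d \<longrightarrow>
    (\<integral>\<^sup>+r. ennreal ((N r - N (r - \<delta>))\<^sup>2) \<partial>lborel) \<le> ennreal e"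
proof -
  have "N measurable_on UNIV"
    by (rule lebesgue_measurable_imp_measurable_on) (auto intro: measurable_completion)
  then obtain Z G where Z: "negligible Z" and G: "\<And>n. continuous_on UNIV (G n)"
    and lim: "\<And>x. x \<notin> Z \<Longrightarrow> (\<lambda>n. G n x) \<longlonglongrightarrow> N x"
    unfolding measurable_on_def by auto
  \<comment> \<open>Clamping to [-M, M] keeps continuity and the limit and supplies the dominating
    function.\<close>
  define H where "H n x = max (- M) (min M (G n x))" for n :: nat and x
  have H_cont: "continuous_on UNIV (H n)" for n
    unfolding H_def by (intro continuous_intros G)
  have [measurable]: "H n \<in> borel_measurable borel" for n
    using H_cont by (rule borel_measurable_continuous_onI)
  have H_bdd: "\<bar>H n x\<bar> \<le> M" for n x
    using bdd[of 0] unfolding H_def by auto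
  have H_lim: "(\<lambda>n. H n x) \<longlonglongrightarrow> N x" if "x \<notin> Z" for x
  proof -
    have "(\<lambda>n. H n x) \<longlonglongrightarrow> max (- M) (min M (N x))"
      unfolding H_def by (intro tendsto_intros lim that)
    then show ?thesis using bdd[of x] by (simp add: abs_le_iff min_def max_def split: if_splits)
  qed
  have AEZ: "AE x in lborel. x \<notin> Z"
    using Z AE_not_in[of Z lebesgue] by (simp add: negligible_iff_null_sets AE_completion_iff)
  have "(\<lambda>n. \<integral>\<^sup>+x. ennreal ((H n x - N x)\<^sup>2 * indicator {-1..c+1} x) \<partial>lborel)
      \<longlonglongrightarrow> integral\<^sup>N lborel (\<lambda>x::real. 0)"
  proof (rule nn_integral_dominated_convergence[where w="\<lambda>x. ennreal ((2*M)\<^sup>2 * indicator {-1..c+1} x)"])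
    show "AE x in lborel. ennreal ((H j x - N x)\<^sup>2 * indicator {-1..c+1} x) \<le> ennreal ((2*M)\<^sup>2 * indicator {-1..c+1} x)" for j
    proof (rule AE_I2, rule ennreal_leI)
      fix x
      have "\<bar>H j x - N x\<bar> \<le> \<bar>2 * M\<bar>" using H_bdd[of j x] bdd[of x] by linarith
      then have "(H j x - N x)\<^sup>2 \<le> (2 * M)\<^sup>2" by (simp only: abs_le_square_iff)
      then show "(H j x - N x)\<^sup>2 * indicator {-1..c+1} x \<le> (2*M)\<^sup>2 * indicator {-1..c+1} x"
        by (rule mult_right_mono) simp
    qed
    have "(\<integral>\<^sup>+x. ennreal ((2*M)\<^sup>2 * indicator {-1..c+1} x) \<partial>lborel)
      = (\<integral>\<^sup>+x. ennreal ((2*M)\<^sup>2) * indicator {-1..c+1} x \<partial>lborel)"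
      by (rule nn_integral_cong) (auto simp: indicator_def)
    also have "\<dots> < \<infinity>" by (simp add: nn_integral_cmult ennreal_mult_less_top emeasure_lborel_Icc_eq)
    finally show "(\<integral>\<^sup>+x. ennreal ((2*M)\<^sup>2 * indicator {-1..c+1} x) \<partial>lborel) < \<infinity>" .
    show "AE x in lborel. (\<lambda>n. ennreal ((H n x - N x)\<^sup>2 * indicator {-1..c+1} x)) \<longlonglongrightarrow> 0"
      using AEZ
    proof eventually_elim
      case (elim x)
      have "(\<lambda>n. (H n x - N x)\<^sup>2 * indicator {-1..c+1} x) \<longlonglongrightarrow> (N x - N x)\<^sup>2 * indicator {-1..c+1} x"
        by (intro tendsto_intros H_lim elim)
      then show ?case using tendsto_ennrealI by fastforce
    qed
  qed auto
  then have "(\<lambda>n. \<integral>\<^sup>+x. ennreal ((H n x - N x)\<^sup>2 * indicator {-1..c+1} x) \<partial>lborel) \<longlonglongrightarrow> 0" by simp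
  moreover have "0 < ennreal (e / 12)" using assms by simp
  ultimately have "\<forall>\<^sub>F n in sequentially. (\<integral>\<^sup>+x. ennreal ((H n x - N x)\<^sup>2 * indicator {-1..c+1} x) \<partial>lborel) < ennreal (e / 12)"
    by (rule order_tendstoD(2))
  then obtain n where n: "(\<integral>\<^sup>+x. ennreal ((H n x - N x)\<^sup>2 * indicator {-1..c+1} x) \<partial>lborel) < ennreal (e / 12)"
    by (auto simp: eventually_sequentially)
  define E where "E x = ennreal ((H n x - N x)\<^sup>2 * indicator {-1..c+1} x)" for x
  have [measurable]: "E \<in> borel_measurable borel" unfolding E_def by measurable
  \<comment> \<open>The squared difference is split into three parts at the cost of a factor 3. Each
    approximation error contributes 3 * e/12, and the continuous part 3 * e2 on length c + 1, so
    each part is e/4.\<close>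
  define e2 where "e2 = e / (12 * (c + 1))"
  have e2: "0 < e2" using assms by (simp add: e2_def)
  have "uniformly_continuous_on {-1..c+1} (H n)"
    by (intro compact_uniformly_continuous continuous_on_subset[OF H_cont]) auto
  then obtain d where d: "0 < d"
    "\<And>x y. x \<in> {-1..c+1} \<Longrightarrow> y \<in> {-1..c+1} \<Longrightarrow> \<bar>y - x\<bar> < d \<Longrightarrow> \<bar>H n y - H n x\<bar> < sqrt e2"
    unfolding uniformly_continuous_on_def dist_real_def using e2 by (meson real_sqrt_gt_zero)
  show ?thesis
  proof (intro exI[of _ "min 1 (d/2)"] conjI allI impI)
    show "0 < min 1 (d/2)" using d by simp
    fix \<delta> assume \<delta>: "0 \<le> \<delta> \<and> \<delta> \<le> min 1 (d/2)"
    have pt: "ennreal ((N r - N (r - \<delta>))\<^sup>2)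
        \<le> 3 * E r + 3 * E (r - \<delta>) + ennreal (3 * e2) * indicator {0..c+1} r" for r
    proof (cases "r \<in> {0..c+1}")
      case False
      then have "N r = 0" "N (r - \<delta>) = 0" using \<delta> by (auto intro!: supp)
      then show ?thesis by simp
    next
      case True
      have "\<bar>H n r - H n (r - \<delta>)\<bar> < sqrt e2" using True \<delta> d(1) by (intro d(2)) auto
      then have h: "(H n r - H n (r - \<delta>))\<^sup>2 \<le> e2"
        using e2 by (metis abs_le_square_iff abs_of_nonneg less_eq_real_def real_sqrt_ge_0_iff real_sqrt_pow2)
      have "(N r - N (r - \<delta>))\<^sup>2 \<le> 3 * (H n r - N r)\<^sup>2 + 3 * (H n (r-\<delta>) - N (r-\<delta>))\<^sup>2 + 3 * (H n r - H n (r - \<delta>))\<^sup>2"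
      proof -
        define a b cc where "a = N r - H n r" "b = H n r - H n (r-\<delta>)" "cc = H n (r-\<delta>) - N (r-\<delta>)"
        have "(a + b + cc)\<^sup>2 \<le> 3 * a\<^sup>2 + 3 * b\<^sup>2 + 3 * cc\<^sup>2"
          using zero_le_power2[of "a - b"] zero_le_power2[of "b - cc"] zero_le_power2[of "a - cc"]
          by (simp add: power2_eq_square algebra_simps)
        then show ?thesis by (simp add: a_b_cc_def power2_commute)
      qed
      also have "\<dots> \<le> 3 * (H n r - N r)\<^sup>2 + 3 * (H n (r-\<delta>) - N (r-\<delta>))\<^sup>2 + 3 * e2" using h by simp
      finally have "ennreal ((N r - N (r - \<delta>))\<^sup>2) \<le> ennreal (3 * (H n r - N r)\<^sup>2 + 3 * (H n (r-\<delta>) - N (r-\<delta>))\<^sup>2 + 3 * e2)"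
        by (rule ennreal_leI)
      then show ?thesis using True \<delta> e2 by (simp add: E_def ennreal_mult)
    qed
    have "(\<integral>\<^sup>+r. ennreal ((N r - N (r - \<delta>))\<^sup>2) \<partial>lborel)
       \<le> (\<integral>\<^sup>+r. 3 * E r + 3 * E (r - \<delta>) + ennreal (3 * e2) * indicator {0..c+1} r \<partial>lborel)"
      by (rule nn_integral_mono) (rule pt)
    also have "\<dots> = 3 * (\<integral>\<^sup>+r. E r \<partial>lborel) + 3 * (\<integral>\<^sup>+r. E (r - \<delta>) \<partial>lborel) + ennreal (3 * e2) * ennreal (c + 1)"
      using \<open>0 \<le> c\<close> by (simp add: nn_integral_add nn_integral_cmult)
    also have "(\<integral>\<^sup>+r. E (r - \<delta>) \<partial>lborel) = (\<integral>\<^sup>+r. E r \<partial>lborel)"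
      using nn_integral_real_affine[of E 1 "- \<delta>"] by simp
    also have "3 * (\<integral>\<^sup>+r. E r \<partial>lborel) + 3 * (\<integral>\<^sup>+r. E r \<partial>lborel) + ennreal (3 * e2) * ennreal (c + 1)
      \<le> 3 * ennreal (e/12) + 3 * ennreal (e/12) + ennreal (3 * e2) * ennreal (c + 1)"
      using n by (intro add_mono mult_left_mono) (auto simp: E_def)
    also have "3 * ennreal (e/12) = ennreal (e/4)" using ennreal_mult[of 3 "e/12"] assms by simp
    also have "ennreal (3 * e2) * ennreal (c + 1) = ennreal (e/4)"
    proof -
      have "3 * e2 * (c + 1) = e / 4" using assms(4) by (simp add: e2_def field_simps)
      moreover have "ennreal (3 * e2) * ennreal (c + 1) = ennreal (3 * e2 * (c + 1))"
        using assms(4) e2 by (intro ennreal_mult[symmetric]) auto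
      ultimately show ?thesis by (simp only:)
    qed
    also have "ennreal (e/4) + ennreal (e/4) + ennreal (e/4) \<le> ennreal e"
      using assms by (simp add: ennreal_leI flip: ennreal_plus)
    finally show "(\<integral>\<^sup>+r. ennreal ((N r - N (r - \<delta>))\<^sup>2) \<partial>lborel) \<le> ennreal e" .
  qed
qed

subsection \<open>Linear integral systems\<close>

text \<open>The integral operator with coefficients replaced by absolute values.
  \<open>k i j\<close> selects the unknown and \<open>h i j z y\<close> the point at which it is
  read. Point evaluations fit this scheme as well, with \<open>h\<close> constant in y and a
  coefficient of unit mass.\<close>

definition picard_op :: "nat \<Rightarrow> (nat \<Rightarrow> nat \<Rightarrow> 'z \<Rightarrow> real \<Rightarrow> real) \<Rightarrow> (nat \<Rightarrow> nat \<Rightarrow> nat)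
    \<Rightarrow> (nat \<Rightarrow> nat \<Rightarrow> 'z \<Rightarrow> real \<Rightarrow> 'z) \<Rightarrow> (nat \<Rightarrow> 'z \<Rightarrow> ennreal) \<Rightarrow> nat \<Rightarrow> 'z \<Rightarrow> ennreal" where
  "picard_op J c k h F i z = (\<Sum>j<J. \<integral>\<^sup>+y. ennreal \<bar>c i j z y\<bar> * F (k i j) (h i j z y) \<partial>lborel)"

text \<open>The system $F_i(z) = d_i(z) + \sum_j \int c_{ij}(z,y) F_{k(i,j)}(h_{ij}(z,y))\,dy$.
  Its Neumann series converges wherever the Neumann series of the absolute values is finite.\<close>

locale picard =
  fixes Z :: "'z measure" and J :: nat and d :: "nat \<Rightarrow> 'z \<Rightarrow> real"
    and c :: "nat \<Rightarrow> nat \<Rightarrow> 'z \<Rightarrow> real \<Rightarrow> real" and k :: "nat \<Rightarrow> nat \<Rightarrow> nat"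
    and h :: "nat \<Rightarrow> nat \<Rightarrow> 'z \<Rightarrow> real \<Rightarrow> 'z"
  assumes d_meas[measurable]: "\<And>i. d i \<in> borel_measurable Z"
    and c_meas[measurable]: "\<And>i j. (\<lambda>(z, y). c i j z y) \<in> borel_measurable (Z \<Otimes>\<^sub>M borel)"
    and h_meas[measurable]: "\<And>i j. (\<lambda>(z, y). h i j z y) \<in> measurable (Z \<Otimes>\<^sub>M borel) Z"
    and space_Z: "space Z = UNIV"
begin

abbreviation P :: "(nat \<Rightarrow> 'z \<Rightarrow> ennreal) \<Rightarrow> nat \<Rightarrow> 'z \<Rightarrow> ennreal" where
  "P \<equiv> picard_op J c k h"

text \<open>Iterates of the majorizing system, started at zero. The recursive form serves inductive
  bounds; the terms \<open>F\<close> with the same partial sums (\<open>S_eq_sum\<close>) serve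
  summation. \<open>g\<close> are the terms of the signed series.\<close>

primrec S :: "nat \<Rightarrow> nat \<Rightarrow> 'z \<Rightarrow> ennreal" where
  "S 0 i z = 0"
| "S (Suc n) i z = ennreal \<bar>d i z\<bar> + P (S n) i z"

primrec F :: "nat \<Rightarrow> nat \<Rightarrow> 'z \<Rightarrow> ennreal" where
  "F 0 i z = ennreal \<bar>d i z\<bar>"
| "F (Suc n) i z = P (F n) i z"

primrec g :: "nat \<Rightarrow> nat \<Rightarrow> 'z \<Rightarrow> real" where
  "g 0 i z = d i z"
| "g (Suc n) i z = (\<Sum>j<J. LINT y|lborel. c i j z y * g n (k i j) (h i j z y))"

definition majorant :: "nat \<Rightarrow> 'z \<Rightarrow> ennreal" where "majorant i z = (SUP n. S n i z)"

text \<open>The default 0 where the majorant is infinite keeps \<open>sol\<close> real-valued,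
  measurable and dominated by the majorant at every point; the equation itself is asserted only
  where the majorant is finite.\<close>

definition sol :: "nat \<Rightarrow> 'z \<Rightarrow> real" where
  "sol i z = (if majorant i z < \<infinity> then \<Sum>n. g n i z else 0)"

lemma c_meas2[measurable]: "(\<lambda>y. c i j z y) \<in> borel_measurable borel"
  using measurable_compose_Pair1[OF _ c_meas[of i j], of z] space_Z by simp

lemma h_meas2[measurable]: "(\<lambda>y. h i j z y) \<in> measurable borel Z"
  using measurable_compose_Pair1[OF _ h_meas[of i j], of z] space_Z by simp

lemma P_meas:
  assumes [measurable]: "\<And>i. G i \<in> borel_measurable Z"
  shows "P G i \<in> borel_measurable Z"
proof -
  have "(\<lambda>z. P G i z) \<in> borel_measurable Z" unfolding picard_op_def by measurable
  then show ?thesis .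
qed

lemma S_meas[measurable]: "S n i \<in> borel_measurable Z"
proof (induction n arbitrary: i)
  case (Suc n)
  have "(\<lambda>z. S (Suc n) i z) \<in> borel_measurable Z"
    using P_meas[OF Suc] by simp
  then show ?case .
next
  case 0
  have "(\<lambda>z. S 0 i z) \<in> borel_measurable Z" by simp
  then show ?case .
qed

lemma F_meas[measurable]: "F n i \<in> borel_measurable Z"
proof (induction n arbitrary: i)
  case (Suc n)
  have "(\<lambda>z. F (Suc n) i z) \<in> borel_measurable Z"
    using P_meas[OF Suc] by simp
  then show ?case .
next
  case 0
  have "(\<lambda>z. F 0 i z) \<in> borel_measurable Z" by simp
  then show ?case .
qed

lemma g_meas[measurable]: "g n i \<in> borel_measurable Z"
proof (induction n arbitrary: i)
  case (Suc n)
  note [measurable] = Suc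
  have "(\<lambda>z. g (Suc n) i z) \<in> borel_measurable Z" by simp
  then show ?case .
next
  case 0
  have "(\<lambda>z. g 0 i z) \<in> borel_measurable Z" by simp
  then show ?case .
qed

lemma majorant_meas[measurable]: "majorant i \<in> borel_measurable Z"
proof -
  have "(\<lambda>z. majorant i z) \<in> borel_measurable Z" unfolding majorant_def by measurable
  then show ?thesis .
qed

lemma sol_meas[measurable]: "sol i \<in> borel_measurable Z"
proof -
  have "(\<lambda>z. sol i z) \<in> borel_measurable Z" unfolding sol_def by measurable
  then show ?thesis .
qed

lemma P_sum:
  assumes "\<And>m i. G m i \<in> borel_measurable Z"
  shows "P (\<lambda>i z. \<Sum>m<n. G m i z) i z = (\<Sum>m<n. P (G m) i z)"
proof -
  note [measurable] = assms
  have "P (\<lambda>i z. \<Sum>m<n. G m i z) i z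
    = (\<Sum>j<J. \<Sum>m<n. \<integral>\<^sup>+y. ennreal \<bar>c i j z y\<bar> * G m (k i j) (h i j z y) \<partial>lborel)"
    unfolding picard_op_def by (simp add: sum_distrib_left nn_integral_sum)
  then show ?thesis unfolding picard_op_def by (simp add: sum.swap[of _ "{..<n}"])
qed

lemma S_eq_sum: "S n i z = (\<Sum>m<n. F m i z)"
proof (induction n arbitrary: i z)
  case (Suc n)
  have "S n = (\<lambda>i z. \<Sum>m<n. F m i z)" using Suc by (intro ext) simp
  then have "S (Suc n) i z = F 0 i z + (\<Sum>m<n. F (Suc m) i z)"
    by (simp add: P_sum)
  then show ?case by (simp only: sum.lessThan_Suc_shift)
qed simp

lemma majorant_eq: "majorant i z = (\<Sum>n. F n i z)"
  unfolding majorant_def S_eq_sum by (simp add: suminf_eq_SUP)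

lemma incseq_S: "incseq (\<lambda>n. S n i z)"
  unfolding S_eq_sum incseq_def by (auto intro: sum_mono2)

lemma S_le_Suc: "S n i z \<le> ennreal \<bar>d i z\<bar> + P (S n) i z"
  using incseq_SucD[OF incseq_S[of i z], of n] by simp

lemma P_suminf: "P majorant i z = (\<Sum>n. P (F n) i z)"
  unfolding picard_op_def majorant_eq
  by (simp add: nn_integral_suminf suminf_sum ennreal_suminf_cmult[symmetric] del: ennreal_suminf_cmult)

text \<open>Monotone convergence gives an equality, not just a bound. Hence finiteness at one point
  passes to all integrals on the right side at that point, and later the majorant can be compared at
  different points of a characteristic.\<close>

lemma majorant_fixpoint: "majorant i z = ennreal \<bar>d i z\<bar> + P majorant i z"
proof -
  have "majorant i z = (\<Sum>n. F (n + 1) i z) + (\<Sum>n<1. F n i z)"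
    unfolding majorant_eq by (rule suminf_offset) simp
  then show ?thesis by (simp add: P_suminf add.commute)
qed

text \<open>Holds at every point, even where an integral does not exist, because the Bochner
  integral is 0 there.\<close>

lemma g_le_F: "ennreal \<bar>g n i z\<bar> \<le> F n i z"
proof (induction n arbitrary: i z)
  case (Suc n)
  have "ennreal \<bar>g (Suc n) i z\<bar> \<le> (\<Sum>j<J. ennreal \<bar>LINT y|lborel. c i j z y * g n (k i j) (h i j z y)\<bar>)"
    by (simp add: ennreal_leI)
  also have "\<dots> \<le> (\<Sum>j<J. \<integral>\<^sup>+y. ennreal \<bar>c i j z y\<bar> * F n (k i j) (h i j z y) \<partial>lborel)"
  proof (rule sum_mono)
    fix j
    have "ennreal \<bar>LINT y|lborel. c i j z y * g n (k i j) (h i j z y)\<bar>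
       \<le> (\<integral>\<^sup>+y. ennreal \<bar>c i j z y * g n (k i j) (h i j z y)\<bar> \<partial>lborel)"
      using integral_norm_bound_ennreal[of lborel "\<lambda>y. c i j z y * g n (k i j) (h i j z y)"]
      by (cases "integrable lborel (\<lambda>y. c i j z y * g n (k i j) (h i j z y))")
         (auto simp: not_integrable_integral_eq)
    also have "\<dots> \<le> (\<integral>\<^sup>+y. ennreal \<bar>c i j z y\<bar> * F n (k i j) (h i j z y) \<partial>lborel)"
      by (intro nn_integral_mono) (simp add: abs_mult ennreal_mult Suc mult_left_mono)
    finally show "ennreal \<bar>LINT y|lborel. c i j z y * g n (k i j) (h i j z y)\<bar>
       \<le> (\<integral>\<^sup>+y. ennreal \<bar>c i j z y\<bar> * F n (k i j) (h i j z y) \<partial>lborel)" .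
  qed
  finally show ?case by (simp add: picard_op_def)
qed simp

lemma summable_g:
  assumes "majorant i z < \<infinity>"
  shows "summable (\<lambda>n. \<bar>g n i z\<bar>)"
proof (rule summable_suminf_not_top)
  have "(\<Sum>n. ennreal \<bar>g n i z\<bar>) \<le> majorant i z"
    unfolding majorant_eq by (intro suminf_le g_le_F) auto
  then show "(\<Sum>n. ennreal \<bar>g n i z\<bar>) \<noteq> top" using assms by auto
qed simp

lemma sol_le_majorant: "ennreal \<bar>sol i z\<bar> \<le> majorant i z"
proof (cases "majorant i z < \<infinity>")
  case True
  note s = summable_g[OF True]
  have "\<bar>\<Sum>n. g n i z\<bar> \<le> (\<Sum>n. \<bar>g n i z\<bar>)" using s by (rule summable_rabs)
  then have "ennreal \<bar>sol i z\<bar> \<le> ennreal (\<Sum>n. \<bar>g n i z\<bar>)" using True by (simp add: sol_def ennreal_leI)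
  also have "\<dots> = (\<Sum>n. ennreal \<bar>g n i z\<bar>)" using s by (simp add: suminf_ennreal2)
  also have "\<dots> \<le> majorant i z" unfolding majorant_eq by (intro suminf_le g_le_F) auto
  finally show ?thesis .
qed (simp add: sol_def)

text \<open>By the fixed-point equation, a finite majorant at z makes every integral of |c| times
  the majorant finite. This is exactly the absolute summability that permits exchanging the Neumann
  sum with the integrals.\<close>

lemma sol_equation:
  assumes fin: "majorant i z < \<infinity>"
  shows "j < J \<Longrightarrow> integrable lborel (\<lambda>y. c i j z y * sol (k i j) (h i j z y))"
    and "sol i z = d i z + (\<Sum>j<J. LINT y|lborel. c i j z y * sol (k i j) (h i j z y))"
proof -
  define t where "t n j y = c i j z y * g n (k i j) (h i j z y)" for n j y
  have [measurable]: "t n j \<in> borel_measurable borel" for n j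
  proof -
    have "(\<lambda>y. t n j y) \<in> borel_measurable borel" unfolding t_def by measurable
    then show ?thesis .
  qed
  have Pfin: "P majorant i z < \<infinity>" using fin unfolding majorant_fixpoint[of i z] by simp
  have jfin: "(\<integral>\<^sup>+y. ennreal \<bar>c i j z y\<bar> * majorant (k i j) (h i j z y) \<partial>lborel) < \<infinity>" if "j < J" for j
  proof -
    have "(\<integral>\<^sup>+y. ennreal \<bar>c i j z y\<bar> * majorant (k i j) (h i j z y) \<partial>lborel) \<le> P majorant i z"
      unfolding picard_op_def using that by (intro member_le_sum) auto
    then show ?thesis using Pfin by (rule le_less_trans)
  qed
  \<comment> \<open>Where the coefficient vanishes the majorant may be infinite at the target point;
    elsewhere it is finite for almost every y, so \<open>sol\<close> there is the sum of its
    series.\<close>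
  have AEj: "AE y in lborel. c i j z y = 0 \<or> majorant (k i j) (h i j z y) < \<infinity>" if "j < J" for j
  proof -
    have "AE y in lborel. ennreal \<bar>c i j z y\<bar> * majorant (k i j) (h i j z y) \<noteq> \<infinity>"
      by (rule nn_integral_noteq_infinite) (use jfin[OF that] in auto)
    then show ?thesis
      by eventually_elim (auto simp: ennreal_mult_eq_top_iff less_top)
  qed
  have tsum: "(\<Sum>n. \<integral>\<^sup>+y. ennreal \<bar>t n j y\<bar> \<partial>lborel) < \<infinity>" if "j < J" for j
  proof -
    have "(\<Sum>n. \<integral>\<^sup>+y. ennreal \<bar>t n j y\<bar> \<partial>lborel) = (\<integral>\<^sup>+y. (\<Sum>n. ennreal \<bar>t n j y\<bar>) \<partial>lborel)"
      by (rule nn_integral_suminf[symmetric]) measurable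
    also have "\<dots> \<le> (\<integral>\<^sup>+y. ennreal \<bar>c i j z y\<bar> * majorant (k i j) (h i j z y) \<partial>lborel)"
      unfolding majorant_eq ennreal_suminf_cmult[symmetric] t_def
      by (intro nn_integral_mono suminf_le) (auto simp: abs_mult ennreal_mult intro!: mult_left_mono g_le_F)
    finally show ?thesis using jfin[OF that] by (rule le_less_trans)
  qed
  have tint: "integrable lborel (t n j)" if "j < J" for n j
  proof (rule integrableI_bounded)
    have "(\<integral>\<^sup>+y. ennreal (norm (t n j y)) \<partial>lborel) \<le> (\<Sum>n. \<integral>\<^sup>+y. ennreal \<bar>t n j y\<bar> \<partial>lborel)"
      using sum_le_suminf[of "\<lambda>n. \<integral>\<^sup>+y. ennreal \<bar>t n j y\<bar> \<partial>lborel" "{n}"] by simp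
    then show "(\<integral>\<^sup>+y. ennreal (norm (t n j y)) \<partial>lborel) < \<infinity>" using tsum[OF that] by (rule le_less_trans)
  qed simp
  have s1: "AE y in lborel. summable (\<lambda>n. norm (t n j y))" if "j < J" for j
    using AEj[OF that]
  proof eventually_elim
    case (elim y)
    then show ?case
    proof
      assume "majorant (k i j) (h i j z y) < \<infinity>"
      then show ?thesis unfolding t_def by (auto simp: abs_mult intro!: summable_mult summable_g)
    qed (simp add: t_def)
  qed
  have s2: "summable (\<lambda>n. LINT y|lborel. norm (t n j y))" if "j < J" for j
  proof (rule summable_suminf_not_top)
    have "(\<lambda>n. ennreal (LINT y|lborel. norm (t n j y))) = (\<lambda>n. \<integral>\<^sup>+y. ennreal \<bar>t n j y\<bar> \<partial>lborel)"
      using integrable_norm[OF tint[OF that]] by (intro ext) (subst nn_integral_eq_integral[symmetric], auto)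
    then show "(\<Sum>n. ennreal (LINT y|lborel. norm (t n j y))) \<noteq> top" using tsum[OF that] by auto
  qed simp
  have ae: "AE y in lborel. (\<Sum>n. t n j y) = c i j z y * sol (k i j) (h i j z y)" if "j < J" for j
    using AEj[OF that]
  proof eventually_elim
    case (elim y)
    then show ?case
    proof
      assume a: "majorant (k i j) (h i j z y) < \<infinity>"
      have "summable (\<lambda>n. g n (k i j) (h i j z y))" using summable_g[OF a] by (rule summable_rabs_cancel)
      then show ?thesis using a unfolding t_def sol_def by (simp add: suminf_mult)
    qed (simp add: t_def)
  qed
  show "integrable lborel (\<lambda>y. c i j z y * sol (k i j) (h i j z y))" if "j < J" for j
    using integrable_suminf[of lborel "\<lambda>n. t n j", OF tint[OF that] s1[OF that] s2[OF that]]
      integrable_cong_AE[OF _ _ ae[OF that]] by simp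
  have i: "(LINT y|lborel. c i j z y * sol (k i j) (h i j z y)) = (\<Sum>n. LINT y|lborel. t n j y)"
    and sj: "summable (\<lambda>n. LINT y|lborel. t n j y)" if "j < J" for j
  proof -
    have "(LINT y|lborel. c i j z y * sol (k i j) (h i j z y)) = (LINT y|lborel. (\<Sum>n. t n j y))"
      by (rule integral_cong_AE) (use ae[OF that] in auto)
    also have "\<dots> = (\<Sum>n. LINT y|lborel. t n j y)"
      by (rule integral_suminf[OF tint[OF that] s1[OF that] s2[OF that]])
    finally show "(LINT y|lborel. c i j z y * sol (k i j) (h i j z y)) = (\<Sum>n. LINT y|lborel. t n j y)" .
    show "summable (\<lambda>n. LINT y|lborel. t n j y)"
      by (rule summable_comparison_test'[OF s2[OF that]]) (auto intro: integral_norm_bound)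
  qed
  have "sol i z = (\<Sum>n. g n i z)" using fin by (simp add: sol_def)
  also have "\<dots> = g 0 i z + (\<Sum>n. g (Suc n) i z)"
    using summable_rabs_cancel[OF summable_g[OF fin]] by (subst suminf_split_head) auto
  also have "(\<Sum>n. g (Suc n) i z) = (\<Sum>n. \<Sum>j<J. LINT y|lborel. t n j y)" by (simp add: t_def)
  also have "\<dots> = (\<Sum>j<J. \<Sum>n. LINT y|lborel. t n j y)" by (rule suminf_sum) (use sj in auto)
  finally show "sol i z = d i z + (\<Sum>j<J. LINT y|lborel. c i j z y * sol (k i j) (h i j z y))"
    by (simp add: i)
qed

end

subsection \<open>Weighted decay for delay inequalities\<close>

text \<open>Multiply by exp(2 \<eta> t) and integrate over t. A delay of at most \<tau> + 1 costs
  the factor \<open>e\<close>, and the window integral costs its length \<tau> + \<delta> by Fubini.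
  On [0, \<delta>) the coefficient C need not be small: it acts only for time \<delta> and
  contributes C * \<delta>. If the total \<open>\<kappa>\<close> is below 1 it is absorbed, with a
  bound independent of T.\<close>

lemma weighted_decay:
  fixes f g :: "real \<Rightarrow> ennreal" and \<tau> \<delta> \<eta> \<theta>1 \<theta>2 \<epsilon> C T :: real
  defines "e \<equiv> exp (2 * \<eta> * (\<tau> + 1))"
  defines "\<kappa> \<equiv> (\<theta>1 + \<theta>2 + \<epsilon> * (\<tau> + 1) + C * \<delta>) * e"
  assumes [measurable]: "f \<in> borel_measurable borel" "g \<in> borel_measurable borel"
    and pos: "0 < \<tau>" "0 \<le> \<delta>" "\<delta> \<le> 1" "0 < \<eta>" "0 \<le> \<theta>1" "0 \<le> \<theta>2" "0 \<le> \<epsilon>" "0 \<le> C" "0 \<le> T"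
    and f0: "\<And>s. s < - \<tau> \<Longrightarrow> f s = 0"
    and le: "AE t in lborel. 0 < t \<longrightarrow> f t \<le> ennreal \<theta>1 * f (t - \<tau>) + ennreal \<theta>2 * f (t - \<tau> - \<delta>)
        + ennreal \<epsilon> * (\<integral>\<^sup>+s\<in>{t - \<tau> - \<delta>..t}. f s \<partial>lborel)
        + (if t < \<delta> then ennreal C * (\<integral>\<^sup>+s\<in>{t - \<tau> - \<delta>..t}. f s \<partial>lborel) + g t else 0)"
    and fin: "(\<integral>\<^sup>+s\<in>{- \<tau>..T}. f s \<partial>lborel) < \<infinity>"
    and \<kappa>: "\<kappa> < 1"
  shows "(\<integral>\<^sup>+t\<in>{- \<tau>..T}. ennreal (exp (2 * \<eta> * t)) * f t \<partial>lborel)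
    \<le> ennreal (1 / (1 - \<kappa>)) * ((\<integral>\<^sup>+t\<in>{- \<tau>..0}. f t \<partial>lborel) + ennreal e * (\<integral>\<^sup>+t\<in>{0..\<delta>}. g t \<partial>lborel))"
proof -
  define w where "w t = ennreal (exp (2 * \<eta> * t))" for t
  have [measurable]: "w \<in> borel_measurable borel" unfolding w_def by measurable
  have e0: "0 \<le> e" by (simp add: e_def)
  \<comment> \<open>The cut at T makes the total mass finite so that absorption is legitimate;
    delayed arguments of some t \<le> T stay below the cut.\<close>
  define F where "F t = w t * f t * indicator {..T} t" for t
  have [measurable]: "F \<in> borel_measurable borel" unfolding F_def by measurable
  define G where "G = (\<integral>\<^sup>+t. F t \<partial>lborel)"
  have wadd: "w (a + b) = w a * w b" for a b by (simp add: w_def distrib_left exp_add ennreal_mult)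
  have wmono: "w a \<le> w b" if "a \<le> b" for a b
    using that pos by (simp add: w_def)
  have we: "w a \<le> ennreal e" if "a \<le> \<tau> + 1" for a
    using wmono[OF that] by (simp add: w_def e_def)
  have G_eq: "G = (\<integral>\<^sup>+t\<in>{- \<tau>..T}. w t * f t \<partial>lborel)"
    unfolding G_def F_def by (rule nn_integral_cong) (auto simp: indicator_def f0 not_le)
  have f_le: "f s \<le> ennreal e * F s" if "s \<le> T" for s
  proof (cases "s < - \<tau>")
    case False
    have "1 = w (- s) * w s" by (simp flip: wadd) (simp add: w_def)
    also have "\<dots> \<le> ennreal e * w s" by (intro mult_right_mono we) (use False in auto)
    finally have "1 * f s \<le> ennreal e * w s * f s" by (intro mult_right_mono) auto
    then show ?thesis using that by (simp add: F_def mult.assoc)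
  qed (simp add: f0)
  have G_fin: "G < \<infinity>"
  proof -
    have "G \<le> (\<integral>\<^sup>+t. w T * (f t * indicator {-\<tau>..T} t) \<partial>lborel)"
      unfolding G_eq
      by (rule nn_integral_mono) (auto simp: indicator_def intro: mult_right_mono wmono)
    also have "\<dots> < \<infinity>" using fin by (simp add: nn_integral_cmult ennreal_mult_less_top w_def)
    finally show ?thesis .
  qed
  let ?D = "{(t,s). t - \<tau> - \<delta> \<le> s \<and> s \<le> t}"
  have Dmeas[measurable]: "?D \<in> sets (borel \<Otimes>\<^sub>M borel)"
  proof -
    have "{x \<in> space (borel \<Otimes>\<^sub>M borel). fst x - \<tau> - \<delta> \<le> (snd x :: real) \<and> snd x \<le> fst x} \<in> sets (borel \<Otimes>\<^sub>M borel)"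
      by measurable
    moreover have "?D = {x \<in> space (borel \<Otimes>\<^sub>M borel). fst x - \<tau> - \<delta> \<le> (snd x :: real) \<and> snd x \<le> fst x}"
      by (auto simp: space_pair_measure)
    ultimately show ?thesis by simp
  qed
  have pt: "AE t in lborel. F t \<le> w t * f t * indicator {-\<tau>..0} t
      + (ennreal (\<theta>1 * e) * F (t - \<tau>) + (ennreal (\<theta>2 * e) * F (t - \<tau> - \<delta>)
      + (ennreal (\<epsilon> * e) * (\<integral>\<^sup>+s. F s * indicator ?D (t,s) \<partial>lborel)
      + (indicator {0..\<delta>} t * (ennreal (C * e) * G) + ennreal e * (g t * indicator {0..\<delta>} t)))))"
    (is "AE t in lborel. F t \<le> ?R t")
    using le
  proof eventually_elim
    case (elim t)
    consider "t \<le> 0" | "T < t" | "0 < t" "t \<le> T" by linarith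
    then show ?case
    proof cases
      case 1
      then have "F t \<le> w t * f t * indicator {-\<tau>..0} t"
        using pos by (auto simp: F_def indicator_def f0 not_le)
      then show ?thesis by (rule order_trans) (simp add: add_increasing2)
    next
      case 2 then show ?thesis by (simp add: F_def)
    next
      case 3
      define J where "J = (\<integral>\<^sup>+s\<in>{t - \<tau> - \<delta>..t}. f s \<partial>lborel)"
      have shift: "w t * f (t - r) \<le> ennreal e * F (t - r)" if "0 \<le> r" "r \<le> \<tau> + 1" for r
      proof -
        have "w t = w r * w (t - r)" by (simp flip: wadd)
        then have "w t * f (t - r) = w r * (w (t - r) * f (t - r))" by (simp add: mult.assoc)
        also have "\<dots> \<le> ennreal e * (w (t - r) * f (t - r))"
          by (intro mult_right_mono we) (use that in auto)
        finally show ?thesis using that 3 by (simp add: F_def)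
      qed
      have a: "w t * (ennreal \<theta>1 * f (t - \<tau>)) \<le> ennreal (\<theta>1 * e) * F (t - \<tau>)"
        using mult_left_mono[OF shift[of \<tau>], of "ennreal \<theta>1"] pos e0 by (simp add: ennreal_mult mult_ac)
      have b: "w t * (ennreal \<theta>2 * f (t - \<tau> - \<delta>)) \<le> ennreal (\<theta>2 * e) * F (t - \<tau> - \<delta>)"
        using mult_left_mono[OF shift[of "\<tau> + \<delta>"], of "ennreal \<theta>2"] pos e0 by (simp add: ennreal_mult mult_ac diff_diff_eq)
      have wJ: "w t * J \<le> ennreal e * (\<integral>\<^sup>+s. F s * indicator ?D (t,s) \<partial>lborel)"
      proof -
        have "w t * J = (\<integral>\<^sup>+s. w t * (f s * indicator {t - \<tau> - \<delta>..t} s) \<partial>lborel)"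
          unfolding J_def by (rule nn_integral_cmult[symmetric]) measurable
        also have "\<dots> \<le> (\<integral>\<^sup>+s. ennreal e * (F s * indicator ?D (t,s)) \<partial>lborel)"
        proof (rule nn_integral_mono)
          fix s
          show "w t * (f s * indicator {t - \<tau> - \<delta>..t} s) \<le> ennreal e * (F s * indicator ?D (t,s))"
            using shift[of "t - s"] pos by (auto simp: indicator_def)
        qed
        also have "\<dots> = ennreal e * (\<integral>\<^sup>+s. F s * indicator ?D (t,s) \<partial>lborel)"
          by (rule nn_integral_cmult) measurable
        finally show ?thesis .
      qed
      have c: "w t * (ennreal \<epsilon> * J) \<le> ennreal (\<epsilon> * e) * (\<integral>\<^sup>+s. F s * indicator ?D (t,s) \<partial>lborel)"
        using mult_left_mono[OF wJ, of "ennreal \<epsilon>"] pos e0 by (simp add: ennreal_mult mult_ac)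
      \<comment> \<open>A cruder bound than \<open>wJ\<close>: by the whole mass, independent of t,
        which is enough where only a time interval of length \<delta> is integrated.\<close>
      have JG: "w t * J \<le> ennreal e * G"
        by (rule order_trans[OF wJ]) (auto simp: G_def indicator_def intro!: mult_left_mono nn_integral_mono)
      have d: "w t * (if t < \<delta> then ennreal C * J + g t else 0)
         \<le> indicator {0..\<delta>} t * (ennreal (C * e) * G) + ennreal e * (g t * indicator {0..\<delta>} t)"
      proof (cases "t < \<delta>")
        case True
        have "w t * (ennreal C * J) \<le> ennreal (C * e) * G"
          using mult_left_mono[OF JG, of "ennreal C"] pos e0 by (simp add: ennreal_mult mult_ac)
        moreover have "w t * g t \<le> ennreal e * g t"
          using True pos by (intro mult_right_mono we) auto
        ultimately show ?thesis using True 3 by (simp add: distrib_left add_mono)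
      qed auto
      have "F t = w t * f t" using 3 by (simp add: F_def)
      also have "\<dots> \<le> w t * (ennreal \<theta>1 * f (t - \<tau>) + ennreal \<theta>2 * f (t - \<tau> - \<delta>) + ennreal \<epsilon> * J
          + (if t < \<delta> then ennreal C * J + g t else 0))"
        using elim 3 unfolding J_def by (intro mult_left_mono) auto
      also have "\<dots> \<le> ?R t"
        unfolding distrib_left using add_mono[OF a add_mono[OF b add_mono[OF c d]]]
        by (simp add: add.assoc add_increasing)
      finally show ?thesis .
    qed
  qed
  have shiftF: "(\<integral>\<^sup>+t. F (t - r) \<partial>lborel) = G" for r
    using nn_integral_real_affine[of F 1 "- r"] by (simp add: G_def)
  have shiftF2: "(\<integral>\<^sup>+t. F (t - \<tau> - \<delta>) \<partial>lborel) = G"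
    using shiftF[of "\<tau> + \<delta>"] by (simp add: diff_diff_eq)
  have DG: "(\<integral>\<^sup>+t. \<integral>\<^sup>+s. F s * indicator ?D (t,s) \<partial>lborel \<partial>lborel) = ennreal (\<tau> + \<delta>) * G"
  proof -
    have "(\<integral>\<^sup>+t. \<integral>\<^sup>+s. F s * indicator ?D (t,s) \<partial>lborel \<partial>lborel)
      = (\<integral>\<^sup>+s. \<integral>\<^sup>+t. F s * indicator ?D (t,s) \<partial>lborel \<partial>lborel)"
      by (rule lborel_pair.Fubini'[symmetric]) measurable
    also have "\<dots> = (\<integral>\<^sup>+s. ennreal (\<tau> + \<delta>) * F s \<partial>lborel)"
    proof (rule nn_integral_cong)
      fix s
      have "(\<integral>\<^sup>+t. F s * indicator ?D (t,s) \<partial>lborel) = (\<integral>\<^sup>+t. F s * indicator {s..s+\<tau>+\<delta>} t \<partial>lborel)"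
        by (rule nn_integral_cong) (auto simp: indicator_def)
      then show "(\<integral>\<^sup>+t. F s * indicator ?D (t,s) \<partial>lborel) = ennreal (\<tau> + \<delta>) * F s"
        using pos by (simp add: nn_integral_cmult mult.commute)
    qed
    finally show ?thesis by (simp add: nn_integral_cmult G_def)
  qed
  have "G \<le> (\<integral>\<^sup>+t. ?R t \<partial>lborel)"
    using nn_integral_mono_AE[OF pt] by (simp only: G_def[symmetric])
  also have "\<dots> = (\<integral>\<^sup>+t. w t * f t * indicator {-\<tau>..0} t \<partial>lborel)
      + (ennreal (\<theta>1 * e) * G + (ennreal (\<theta>2 * e) * G
      + (ennreal (\<epsilon> * e) * (ennreal (\<tau> + \<delta>) * G)
      + (ennreal \<delta> * (ennreal (C * e) * G) + ennreal e * (\<integral>\<^sup>+t\<in>{0..\<delta>}. g t \<partial>lborel)))))"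
    using pos by (simp add: nn_integral_add nn_integral_cmult nn_integral_multc shiftF shiftF2 DG)
  also have "\<dots> = ((\<integral>\<^sup>+t. w t * f t * indicator {-\<tau>..0} t \<partial>lborel) + ennreal e * (\<integral>\<^sup>+t\<in>{0..\<delta>}. g t \<partial>lborel))
      + ennreal ((\<theta>1 + \<theta>2 + \<epsilon> * (\<tau> + \<delta>) + C * \<delta>) * e) * G"
    using pos e0 by (simp add: algebra_simps ennreal_mult ennreal_plus)
  also have "\<dots> \<le> ((\<integral>\<^sup>+t\<in>{-\<tau>..0}. f t \<partial>lborel) + ennreal e * (\<integral>\<^sup>+t\<in>{0..\<delta>}. g t \<partial>lborel)) + ennreal \<kappa> * G"
  proof -
    have 1: "(\<integral>\<^sup>+t. w t * f t * indicator {-\<tau>..0} t \<partial>lborel) \<le> (\<integral>\<^sup>+t\<in>{-\<tau>..0}. f t \<partial>lborel)"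
    proof (rule nn_integral_mono)
      fix t show "w t * f t * indicator {- \<tau>..0} t \<le> f t * indicator {- \<tau>..0} t"
        using wmono[of t 0] by (auto simp: indicator_def w_def intro: mult_right_mono[of _ 1 "f t", simplified])
    qed
    have "(\<theta>1 + \<theta>2 + \<epsilon> * (\<tau> + \<delta>) + C * \<delta>) * e \<le> \<kappa>"
      unfolding \<kappa>_def using pos e0 by (intro mult_right_mono add_mono mult_left_mono) auto
    then have 2: "ennreal ((\<theta>1 + \<theta>2 + \<epsilon> * (\<tau> + \<delta>) + C * \<delta>) * e) * G \<le> ennreal \<kappa> * G"
      by (intro mult_right_mono ennreal_leI) auto
    show ?thesis by (rule add_mono[OF add_mono[OF 1 order_refl] 2])
  qed
  finally have "G \<le> ennreal (1 / (1 - \<kappa>)) * ((\<integral>\<^sup>+t\<in>{-\<tau>..0}. f t \<partial>lborel) + ennreal e * (\<integral>\<^sup>+t\<in>{0..\<delta>}. g t \<partial>lborel))"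
    using G_fin \<kappa> pos by (intro ennreal_absorb) (auto simp: \<kappa>_def e_def)
  then show ?thesis unfolding G_eq w_def .
qed

subsection \<open>Broad solutions and kernels\<close>

lemma set_lborel_translate:
  fixes F :: "real \<Rightarrow> real"
  assumes "set_integrable lborel {a + k..b + k} F"
  shows "set_integrable lborel {a..b} (\<lambda>s. F (s + k))"
    and "(LBINT s:{a..b}. F (s + k)) = (LBINT s:{a + k..b + k}. F s)"
proof -
  have e: "indicator {a + k..b + k} (k + 1 * x) *\<^sub>R F (k + 1 * x) = indicator {a..b} x *\<^sub>R F (x + k)" for x
    by (auto simp: indicator_def add.commute)
  show "set_integrable lborel {a..b} (\<lambda>s. F (s + k))"
    using lborel_integrable_real_affine[OF assms[unfolded set_integrable_def], of 1 k]
    unfolding set_integrable_def e by simp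
  show "(LBINT s:{a..b}. F (s + k)) = (LBINT s:{a + k..b + k}. F s)"
    using lborel_integral_real_affine[of 1 "\<lambda>s. indicator {a + k..b + k} s *\<^sub>R F s" k]
    unfolding set_lebesgue_integral_def e by simp
qed

lemma set_lborel_reflect:
  fixes F :: "real \<Rightarrow> real"
  assumes "set_integrable lborel {k - b..k - a} F"
  shows "set_integrable lborel {a..b} (\<lambda>s. F (k - s))"
    and "(LBINT s:{a..b}. F (k - s)) = (LBINT s:{k - b..k - a}. F s)"
proof -
  have e: "indicator {k - b..k - a} (k + (-1) * x) *\<^sub>R F (k + (-1) * x) = indicator {a..b} x *\<^sub>R F (k - x)" for x
    by (auto simp: indicator_def)
  show "set_integrable lborel {a..b} (\<lambda>s. F (k - s))"
    using lborel_integrable_real_affine[OF assms[unfolded set_integrable_def], of "-1" k]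
    unfolding set_integrable_def e by simp
  show "(LBINT s:{a..b}. F (k - s)) = (LBINT s:{k - b..k - a}. F s)"
    using lborel_integral_real_affine[of "-1" "\<lambda>s. indicator {k - b..k - a} s *\<^sub>R F s" k]
    unfolding set_lebesgue_integral_def e by simp
qed

text \<open>Puts the first variable at x0 + a s. With x0 the foot of a characteristic of the state,
  kernel and state become broad solutions in the same variables (s, \<xi>), and their product can be
  formed. The label c moves by a translation, which preserves null sets.\<close>

lemma broad_solution_shift:
  assumes f: "broad_solution a b S f g" and a: "0 < a"
    and D: "\<And>s \<xi>. (s, \<xi>) \<in> D \<Longrightarrow> (x0 + a * s, \<xi>) \<in> S"
  shows "broad_solution 1 b D (\<lambda>s \<xi>. f (x0 + a * s) \<xi>) (\<lambda>s \<xi>. g (x0 + a * s) \<xi>)"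
  unfolding broad_solution_def
  using AE_lborel_affine[OF _ f[unfolded broad_solution_def], of 1 "- (b * x0 / a)", simplified]
proof eventually_elim
  case (elim c)
  show ?case
  proof (intro allI impI)
    fix s0 s1 :: real
    assume s: "s0 \<le> s1" "(1 * s0, c + b * s0) \<in> D" "(1 * s1, c + b * s1) \<in> D"
    have e: "a * (s + x0 / a) = x0 + a * s" "c - b * x0 / a + b * (s + x0 / a) = c + b * s" for s
      using a by (simp_all add: field_simps)
    have *: "set_integrable lborel {s0 + x0 / a..s1 + x0 / a} (\<lambda>s. g (a * s) (c - b * x0 / a + b * s)) \<and>
      f (a * (s1 + x0 / a)) (c - b * x0 / a + b * (s1 + x0 / a)) - f (a * (s0 + x0 / a)) (c - b * x0 / a + b * (s0 + x0 / a))
       = (LBINT s:{s0 + x0 / a..s1 + x0 / a}. g (a * s) (c - b * x0 / a + b * s))"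
      using elim[rule_format, of "s0 + x0 / a" "s1 + x0 / a"] s D[of s0] D[of s1] unfolding e by simp
    from set_lborel_translate[OF conjunct1[OF *]] conjunct2[OF *]
    show "set_integrable lborel {s0..s1} (\<lambda>s. g (x0 + a * (1 * s)) (c + b * s)) \<and>
      f (x0 + a * (1 * s1)) (c + b * s1) - f (x0 + a * (1 * s0)) (c + b * s0) = (LBINT s:{s0..s1}. g (x0 + a * (1 * s)) (c + b * s))"
      unfolding e by simp
  qed
qed

text \<open>The second component travels to the left, so the region below its characteristic grows
  backwards in time. Reversing time reduces it to the right-going case.\<close>

lemma broad_solution_reverse:
  assumes f: "broad_solution 1 b S f g"
    and D: "\<And>s \<xi>. (s, \<xi>) \<in> D \<Longrightarrow> (t1 - s, \<xi>) \<in> S"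
  shows "broad_solution 1 (- b) D (\<lambda>s \<xi>. f (t1 - s) \<xi>) (\<lambda>s \<xi>. - g (t1 - s) \<xi>)"
  unfolding broad_solution_def
  using AE_lborel_affine[OF _ f[unfolded broad_solution_def], of 1 "- (b * t1)", simplified]
proof eventually_elim
  case (elim c)
  show ?case
  proof (intro allI impI)
    fix s0 s1 :: real
    assume s: "s0 \<le> s1" "(1 * s0, c + - b * s0) \<in> D" "(1 * s1, c + - b * s1) \<in> D"
    have e: "c - b * t1 + b * (t1 - s) = c + - b * s" for s by (simp add: algebra_simps)
    have *: "set_integrable lborel {t1 - s1..t1 - s0} (\<lambda>s. g s (c - b * t1 + b * s)) \<and>
      f (t1 - s0) (c - b * t1 + b * (t1 - s0)) - f (t1 - s1) (c - b * t1 + b * (t1 - s1))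
       = (LBINT s:{t1 - s1..t1 - s0}. g s (c - b * t1 + b * s))"
      using elim[rule_format, of "t1 - s1" "t1 - s0"] s D[of s0] D[of s1] unfolding e by simp
    from set_lborel_reflect[OF conjunct1[OF *]] conjunct2[OF *]
    have "set_integrable lborel {s0..s1} (\<lambda>s. g (t1 - s) (c + - b * s))"
      and eq: "f (t1 - s0) (c + - b * s0) - f (t1 - s1) (c + - b * s1) = (LBINT s:{s0..s1}. g (t1 - s) (c + - b * s))"
      unfolding e by simp_all
    then show "set_integrable lborel {s0..s1} (\<lambda>s. - g (t1 - 1 * s) (c + - b * s)) \<and>
      f (t1 - 1 * s1) (c + - b * s1) - f (t1 - 1 * s0) (c + - b * s0) = (LBINT s:{s0..s1}. - g (t1 - 1 * s) (c + - b * s))"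
      using eq by (simp add: set_integrable_def set_lebesgue_integral_def)
  qed
qed

section \<open>Product rule along characteristics and flux balance on a trapezoid\<close>

lemma integrable_tensor:
  fixes G K :: "real \<Rightarrow> real"
  assumes G: "integrable lborel G" and K: "integrable lborel K"
  shows "integrable (lborel \<Otimes>\<^sub>M lborel) (\<lambda>(x, y). G x * K y)"
proof (rule lborel_pair.Fubini_integrable)
  have [measurable]: "G \<in> borel_measurable borel" "K \<in> borel_measurable borel" using G K by auto
  show "(\<lambda>(x, y). G x * K y) \<in> borel_measurable (lborel \<Otimes>\<^sub>M lborel)" by measurable
  show "integrable lborel (\<lambda>x. LINT y|lborel. norm (case (x, y) of (x, y) \<Rightarrow> G x * K y))"
    using G K by (simp add: abs_mult)
  show "AE x in lborel. integrable lborel (\<lambda>y. case (x, y) of (x, y) \<Rightarrow> G x * K y)"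
    using K by simp
qed

text \<open>The product rule for absolutely continuous functions, by Fubini: the product of
  increments is the integral of g(x) k(y) over the square, and its parts below and above the
  diagonal integrate to the two halves of the product rule.\<close>

lemma product_rule_set_integral:
  fixes f g h k :: "real \<Rightarrow> real"
  assumes s: "s0 \<le> s1" and g: "set_integrable lborel {s0..s1} g" and k: "set_integrable lborel {s0..s1} k"
    and f: "\<And>s. s \<in> {s0..s1} \<Longrightarrow> f s - f s0 = (LBINT r:{s0..s}. g r)"
    and h: "\<And>s. s \<in> {s0..s1} \<Longrightarrow> h s - h s0 = (LBINT r:{s0..s}. k r)"
  shows "set_integrable lborel {s0..s1} (\<lambda>s. g s * h s + f s * k s)"
    and "f s1 * h s1 - f s0 * h s0 = (LBINT s:{s0..s1}. g s * h s + f s * k s)"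
proof -
  define G where "G x = indicator {s0..s1} x * g x" for x
  define K where "K x = indicator {s0..s1} x * k x" for x
  have G: "integrable lborel G" and K: "integrable lborel K"
    using g k unfolding set_integrable_def G_def K_def by simp_all
  have [measurable]: "G \<in> borel_measurable borel" "K \<in> borel_measurable borel" using G K by auto
  note GK = integrable_tensor[OF G K]
  \<comment> \<open>The diagonal is assigned to \<open>U\<close>. This matters only on a null set,
    which is removed when \<open>V\<close> is integrated.\<close>
  define U where "U x y = (if y \<le> x then G x * K y else 0)" for x y :: real
  define V where "V x y = (if y \<le> x then 0 else G x * K y)" for x y :: real
  have U: "integrable (lborel \<Otimes>\<^sub>M lborel) (\<lambda>(x, y). U x y)"
    by (rule Bochner_Integration.integrable_bound[OF GK]) (auto simp: U_def)
  have V: "integrable (lborel \<Otimes>\<^sub>M lborel) (\<lambda>(x, y). V x y)"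
    by (rule Bochner_Integration.integrable_bound[OF GK]) (auto simp: V_def)
  have Kx: "(LINT y|lborel. U x y) = G x * (h x - h s0)" for x
  proof (cases "x \<in> {s0..s1}")
    case True
    have "(LINT y|lborel. U x y) = (LINT y|lborel. G x * (indicator {s0..x} y *\<^sub>R k y))"
      by (rule Bochner_Integration.integral_cong) (use True in \<open>auto simp: U_def K_def indicator_def\<close>)
    then show ?thesis using h[OF True] by (simp add: set_lebesgue_integral_def)
  next
    case False
    then have "U x y = 0" for y by (simp add: U_def G_def)
    then show ?thesis using False by (simp add: G_def)
  qed
  have Gy: "(LINT x|lborel. V x y) = K y * (f y - f s0)" for y
  proof (cases "y \<in> {s0..s1}")
    case True
    have "(LINT x|lborel. V x y) = (LINT x|lborel. K y * (indicator {s0..y} x *\<^sub>R g x))"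
    proof (rule integral_cong_AE)
      show "(\<lambda>x. V x y) \<in> borel_measurable lborel" unfolding V_def by measurable
      have "(\<lambda>x. K y * (indicator {s0..y} x *\<^sub>R g x)) = (\<lambda>x. K y * (indicator {..y} x * G x))"
        using True by (auto simp: fun_eq_iff G_def indicator_def)
      then show "(\<lambda>x. K y * (indicator {s0..y} x *\<^sub>R g x)) \<in> borel_measurable lborel" by simp
      show "AE x in lborel. V x y = K y * (indicator {s0..y} x *\<^sub>R g x)"
        using AE_lborel_singleton[of y]
        by eventually_elim (use True in \<open>auto simp: V_def G_def indicator_def\<close>)
    qed
    then show ?thesis using f[OF True] by (simp add: set_lebesgue_integral_def)
  next
    case False
    then have "V x y = 0" for x by (simp add: V_def K_def)
    then show ?thesis using False by (simp add: K_def)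
  qed
  have iU: "integrable lborel (\<lambda>x. G x * (h x - h s0))"
    using lborel_pair.integrable_fst'[OF U] by (simp add: Kx)
  have iV: "integrable lborel (\<lambda>y. K y * (f y - f s0))"
    using lborel_pair.integrable_snd[OF V] by (simp add: Gy)
  have e: "indicator {s0..s1} s *\<^sub>R (g s * h s + f s * k s)
    = G s * (h s - h s0) + K s * (f s - f s0) + h s0 * G s + f s0 * K s" for s
    by (simp add: G_def K_def algebra_simps)
  show "set_integrable lborel {s0..s1} (\<lambda>s. g s * h s + f s * k s)"
    unfolding set_integrable_def e using iU iV G K by simp
  have GI: "integral\<^sup>L lborel G = f s1 - f s0" and KI: "integral\<^sup>L lborel K = h s1 - h s0"
    using f[of s1] h[of s1] s by (simp_all add: set_lebesgue_integral_def G_def[abs_def] K_def[abs_def])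
  have "(LBINT s:{s0..s1}. g s * h s + f s * k s)
    = (LINT x|lborel. G x * (h x - h s0)) + (LINT y|lborel. K y * (f y - f s0))
      + h s0 * (f s1 - f s0) + f s0 * (h s1 - h s0)"
    unfolding set_lebesgue_integral_def e using iU iV G K by (simp add: GI KI)
  also have "(LINT x|lborel. G x * (h x - h s0)) + (LINT y|lborel. K y * (f y - f s0))
    = (LINT x|lborel. LINT y|lborel. U x y) + (LINT x|lborel. LINT y|lborel. V x y)"
    using lborel_pair.Fubini_integral[OF V] by (simp add: Kx Gy)
  also have "\<dots> = (LINT p|(lborel \<Otimes>\<^sub>M lborel). case_prod U p) + (LINT p|(lborel \<Otimes>\<^sub>M lborel). case_prod V p)"
    using lborel_pair.integral_fst'[OF U] lborel_pair.integral_fst'[OF V] by simp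
  also have "\<dots> = (LINT p|(lborel \<Otimes>\<^sub>M lborel). case_prod U p + case_prod V p)"
    using U V by simp
  also have "\<dots> = (LINT p|(lborel \<Otimes>\<^sub>M lborel). (\<lambda>(x, y). G x * K y) p)"
    by (rule Bochner_Integration.integral_cong) (auto simp: U_def V_def)
  also have "\<dots> = (f s1 - f s0) * (h s1 - h s0)"
    using lborel_pair.integral_fst'[OF GK] by (simp add: GI KI)
  finally show "f s1 * h s1 - f s0 * h s0 = (LBINT s:{s0..s1}. g s * h s + f s * k s)"
    by (simp add: algebra_simps)
qed

text \<open>Convexity of D keeps the whole segment between two points of a characteristic inside D,
  so that both equations hold at all intermediate times, as the product rule requires.\<close>

lemma broad_solution_mult:
  assumes f: "broad_solution 1 b D f g" and h: "broad_solution 1 b D h k" and D: "convex D"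
  shows "broad_solution 1 b D (\<lambda>s \<xi>. f s \<xi> * h s \<xi>) (\<lambda>s \<xi>. g s \<xi> * h s \<xi> + f s \<xi> * k s \<xi>)"
  unfolding broad_solution_def
  using f[unfolded broad_solution_def] h[unfolded broad_solution_def]
proof eventually_elim
  case (elim c)
  show ?case
  proof (intro allI impI)
    fix s0 s1 :: real
    assume s: "s0 \<le> s1" "(1 * s0, c + b * s0) \<in> D" "(1 * s1, c + b * s1) \<in> D"
    have mem: "(1 * r, c + b * r) \<in> D" if "r \<in> {s0..s1}" for r
    proof (cases "s0 = s1")
      case True then show ?thesis using s that by simp
    next
      case False
      define u where "u = (r - s0) / (s1 - s0)"
      have "u * (s1 - s0) = r - s0" using False by (simp add: u_def)
      then have u3: "r = (1 - u) * s0 + u * s1" by (simp add: algebra_simps)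
      have u: "0 \<le> u" "u \<le> 1" using False s that by (auto simp: u_def)
      have "(1 - u) *\<^sub>R (1 * s0, c + b * s0) + u *\<^sub>R (1 * s1, c + b * s1) \<in> D"
        using convexD_alt[OF D s(2,3)] u by simp
      then show ?thesis unfolding u3 by (simp add: algebra_simps)
    qed
    have "s1 \<in> {s0..s1}" using s by simp
    note elim1 = elim(1)[rule_format, OF _ s(2) mem] and elim2 = elim(2)[rule_format, OF _ s(2) mem]
    show "set_integrable lborel {s0..s1} (\<lambda>s. g (1 * s) (c + b * s) * h (1 * s) (c + b * s) + f (1 * s) (c + b * s) * k (1 * s) (c + b * s)) \<and>
      f (1 * s1) (c + b * s1) * h (1 * s1) (c + b * s1) - f (1 * s0) (c + b * s0) * h (1 * s0) (c + b * s0) =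
      (LBINT s:{s0..s1}. g (1 * s) (c + b * s) * h (1 * s) (c + b * s) + f (1 * s) (c + b * s) * k (1 * s) (c + b * s))"
      using product_rule_set_integral[of s0 s1 "\<lambda>s. g (1 * s) (c + b * s)" "\<lambda>s. k (1 * s) (c + b * s)"
        "\<lambda>s. f (1 * s) (c + b * s)" "\<lambda>s. h (1 * s) (c + b * s)"] elim1 elim2 s(1) \<open>s1 \<in> {s0..s1}\<close> by auto
  qed
qed

text \<open>The shear (s, c) to (s, c + b s) preserves area; integrating over all characteristics is
  integrating over the plane.\<close>

lemma shear_integral:
  fixes F :: "real \<Rightarrow> real \<Rightarrow> real"
  assumes F: "integrable (lborel \<Otimes>\<^sub>M lborel) (\<lambda>(s, \<xi>). F s \<xi>)"
  shows "(LINT c|lborel. LINT s|lborel. F s (c + b * s)) = (LINT s|lborel. LINT \<xi>|lborel. F s \<xi>)"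
proof -
  have [measurable]: "(\<lambda>(s, \<xi>). F s \<xi>) \<in> borel_measurable (borel \<Otimes>\<^sub>M borel)"
    using borel_measurable_integrable[OF F] by simp
  have e: "(LINT c|lborel. f (c + b * s)) = (LINT c|lborel. f c)" for f :: "real \<Rightarrow> real" and s
    using lborel_integral_real_affine[of 1 f "b * s"] by (simp add: add.commute)
  have "integrable (lborel \<Otimes>\<^sub>M lborel) (\<lambda>(s, c). F s (c + b * s))"
  proof (rule lborel_pair.Fubini_integrable)
    show "integrable lborel (\<lambda>s. LINT c|lborel. norm (case (s, c) of (s, c) \<Rightarrow> F s (c + b * s)))"
      using lborel_pair.integrable_fst'[OF integrable_norm[OF F]] e[of "\<lambda>c. norm (F _ c)"] by simp
    show "AE s in lborel. integrable lborel (\<lambda>c. case (s, c) of (s, c) \<Rightarrow> F s (c + b * s))"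
      using lborel_pair.AE_integrable_fst'[OF F]
    proof eventually_elim
      case (elim s)
      then show ?case using lborel_integrable_real_affine[of "F s" 1 "b * s"] by (simp add: add.commute)
    qed
  qed measurable
  from lborel_pair.Fubini_integral[OF this] show ?thesis by (simp add: e)
qed

lemma set_integrable_bounded_mult:
  fixes h a :: "real \<Rightarrow> real"
  assumes h: "set_integrable lborel S h" and [measurable]: "h \<in> borel_measurable borel" "a \<in> borel_measurable borel" "S \<in> sets borel"
    and bdd: "\<And>x. \<bar>a x\<bar> \<le> D"
  shows "set_integrable lborel S (\<lambda>x. a x * h x)"
  unfolding set_integrable_def
proof (rule Bochner_Integration.integrable_bound[OF integrable_mult_right[OF h[unfolded set_integrable_def], of D]])
  show "AE x in lborel. norm (indicator S x *\<^sub>R (a x * h x)) \<le> norm (D * (indicator S x *\<^sub>R h x))"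
  proof (rule AE_I2)
    fix x have "\<bar>a x\<bar> \<le> \<bar>D\<bar>" using bdd[of x] by linarith
    then show "norm (indicator S x *\<^sub>R (a x * h x)) \<le> norm (D * (indicator S x *\<^sub>R h x))"
      by (auto simp: indicator_def abs_mult intro: mult_right_mono)
  qed
qed measurable

definition trapezoid :: "real \<Rightarrow> real \<Rightarrow> real \<Rightarrow> (real \<times> real) set" where
  "trapezoid a x0 h = {(s, \<xi>). 0 \<le> s \<and> s \<le> h \<and> 0 \<le> \<xi> \<and> \<xi> \<le> x0 + a * s}"

lemma convex_trapezoid: "convex (trapezoid a x0 h)"
proof -
  have "trapezoid a x0 h = {z. (-1, 0) \<bullet> z \<le> 0} \<inter> {z. (1, 0) \<bullet> z \<le> h} \<inter> {z. (0, -1) \<bullet> z \<le> 0} \<inter> {z. (- a, 1) \<bullet> z \<le> x0}"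
    by (auto simp: trapezoid_def)
  then show ?thesis by (simp only: convex_Int convex_halfspace_le)
qed

text \<open>The divergence theorem for broad solutions whose characteristics are parallel to the
  slanted side, so nothing crosses that side. A characteristic enters through s = 0 or through \<xi>
  = 0 and leaves at s = h. Integrating its increment over the label c, the substitution c = - a s
  produces the factor a of the flux at \<xi> = 0.\<close>

lemma trapezoid_balance_up:
  fixes P g :: "real \<Rightarrow> real \<Rightarrow> real"
  assumes a: "0 < a" "0 \<le> x0" "0 \<le> h"
    and P: "broad_solution 1 a (trapezoid a x0 h) P g"
    and g: "integrable (lborel \<Otimes>\<^sub>M lborel) (\<lambda>(s, \<xi>). indicator (trapezoid a x0 h) (s, \<xi>) * g s \<xi>)"
    and i0: "set_integrable lborel {0..x0} (P 0)" and ih: "set_integrable lborel {0..x0 + a * h} (P h)"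
    and ib: "set_integrable lborel {0..h} (\<lambda>s. P s 0)"
  shows "(LBINT \<xi>:{0..x0 + a * h}. P h \<xi>) = (LBINT \<xi>:{0..x0}. P 0 \<xi>) + a * (LBINT s:{0..h}. P s 0)
    + (LINT s|lborel. LINT \<xi>|lborel. indicator (trapezoid a x0 h) (s, \<xi>) * g s \<xi>)"
proof -
  let ?D = "trapezoid a x0 h"
  define Qh where "Qh \<xi> = indicator {0..x0 + a * h} \<xi> *\<^sub>R P h \<xi>" for \<xi>
  define Q0 where "Q0 \<xi> = indicator {0..x0} \<xi> *\<^sub>R P 0 \<xi>" for \<xi>
  define Qb where "Qb s = indicator {0..h} s *\<^sub>R P s 0" for s
  have Q: "integrable lborel Qh" "integrable lborel Q0" "integrable lborel Qb"
    using i0 ih ib unfolding set_integrable_def Qh_def Q0_def Qb_def by simp_all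
  define E where "E c = (LINT s|lborel. indicator ?D (s, c + a * s) * g s (c + a * s))" for c
  have [measurable]: "(\<lambda>(s, \<xi>). indicator ?D (s, \<xi>) * g s \<xi>) \<in> borel_measurable (borel \<Otimes>\<^sub>M borel)"
    using borel_measurable_integrable[OF g] by simp
  have [measurable]: "E \<in> borel_measurable borel"
  proof -
    have "(\<lambda>(c, s). indicator ?D (s, c + a * s) * g s (c + a * s)) \<in> borel_measurable (borel \<Otimes>\<^sub>M borel)"
      using measurable_compose[of "\<lambda>(c, s). (s, c + a * s)" "borel \<Otimes>\<^sub>M borel" "borel \<Otimes>\<^sub>M borel"
        "\<lambda>(s, \<xi>). indicator ?D (s, \<xi>) * g s \<xi>" borel] by (simp add: case_prod_unfold)
    then have "(\<lambda>c. E c) \<in> borel_measurable borel" unfolding E_def by measurable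
    then show ?thesis .
  qed
  \<comment> \<open>The arguments are exit height, entry height and entry time of the characteristic
    with label c, in the form expected by the affine substitution rule. Labels of characteristics
    through corners are removed, since there two boundary terms would count at once.\<close>
  have AE: "AE c in lborel. E c = Qh (a * h + 1 * c) - Q0 c - Qb (0 + (- 1 / a) * c)"
    using P[unfolded broad_solution_def] AE_lborel_singleton[of 0] AE_lborel_singleton[of x0] AE_lborel_singleton[of "- a * h"]
  proof eventually_elim
    case (elim c)
    show ?case
    proof (cases "- a * h < c \<and> c < x0")
      case False
      have z: "indicator ?D (s, c + a * s) * g s (c + a * s) = 0" for s
      proof -
        have "(s, c + a * s) \<notin> ?D"
        proof
          assume "(s, c + a * s) \<in> ?D"
          then have "0 \<le> c + a * s" "c \<le> x0" "a * s \<le> a * h" using a by (auto simp: trapezoid_def)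
          then show False using False elim by auto
        qed
        then show ?thesis by simp
      qed
      have "E c = 0" unfolding E_def z by simp
      moreover have "Qh (a * h + 1 * c) = 0" "Q0 c = 0" "Qb (0 + (- 1 / a) * c) = 0"
      proof -
        have "0 \<le> a * h" using a by auto
        moreover have "c \<noteq> - (a * h)" using elim(4) by simp
        ultimately have "c < 0 \<or> x0 < c" "c < - (a * h) \<or> x0 < c"
          using False elim(2,3) by (smt (verit) mult_minus_left)+
        then show "Qh (a * h + 1 * c) = 0" "Q0 c = 0" "Qb (0 + (- 1 / a) * c) = 0"
          using a by (auto simp: Qh_def Q0_def Qb_def indicator_def field_simps)
      qed
      ultimately show ?thesis by simp
    next
      case True
      \<comment> \<open>Entry time: 0 if the characteristic starts on the base, otherwise its
        crossing of \<xi> = 0.\<close>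
      define s0 where "s0 = max 0 (- c / a)"
      have s0: "0 \<le> s0" "s0 \<le> h" using True a by (auto simp: s0_def field_simps)
      have mem: "(s, c + a * s) \<in> ?D \<longleftrightarrow> s \<in> {s0..h}" for s
        using True a by (auto simp: trapezoid_def s0_def field_simps)
      have "E c = (LBINT s:{s0..h}. g s (c + a * s))"
        unfolding E_def set_lebesgue_integral_def
        by (rule Bochner_Integration.integral_cong) (auto simp: indicator_def mem)
      also have "\<dots> = P h (c + a * h) - P s0 (c + a * s0)"
        using elim(1)[rule_format, of s0 h] s0 mem[of s0] mem[of h] by simp
      also have "P h (c + a * h) = Qh (a * h + 1 * c)"
        using True a by (simp add: Qh_def add.commute)
      also have "P s0 (c + a * s0) = Q0 c + Qb (0 + (- 1 / a) * c)"
      proof (cases "c < 0")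
        case c: True
        then show ?thesis using True a by (simp add: s0_def Q0_def Qb_def field_simps max_def)
      next
        case c: False
        then show ?thesis using True a elim by (auto simp: s0_def Q0_def Qb_def field_simps max_def indicator_def)
      qed
      finally show ?thesis by simp
    qed
  qed
  have Ih: "integrable lborel (\<lambda>c. Qh (a * h + 1 * c))" and Ib: "integrable lborel (\<lambda>c. Qb (0 + (- 1 / a) * c))"
    by - (rule lborel_integrable_real_affine, rule Q, use a in simp)+
  have "integral\<^sup>L lborel E = (LINT c|lborel. Qh (a * h + 1 * c) - Q0 c - Qb (0 + (- 1 / a) * c))"
    using Ih Ib Q(2) AE by (intro integral_cong_AE) auto
  also have "\<dots> = (LINT c|lborel. Qh (a * h + 1 * c)) - integral\<^sup>L lborel Q0 - (LINT c|lborel. Qb (0 + (- 1 / a) * c))"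
    using Ih Ib Q(2) by simp
  also have "(LINT c|lborel. Qh (a * h + 1 * c)) = integral\<^sup>L lborel Qh"
    using lborel_integral_real_affine[of 1 Qh "a * h"] by simp
  also have "(LINT c|lborel. Qb (0 + (- 1 / a) * c)) = a * integral\<^sup>L lborel Qb"
    using lborel_integral_real_affine[of "- 1 / a" Qb 0] a by simp
  finally have "integral\<^sup>L lborel E = integral\<^sup>L lborel Qh - integral\<^sup>L lborel Q0 - a * integral\<^sup>L lborel Qb" .
  moreover have "integral\<^sup>L lborel E = (LINT s|lborel. LINT \<xi>|lborel. indicator ?D (s, \<xi>) * g s \<xi>)"
    unfolding E_def by (rule shear_integral[OF g])
  ultimately show ?thesis
    unfolding set_lebesgue_integral_def Qh_def Q0_def Qb_def by linarith
qed

text \<open>Now the characteristics descend with speed m while the upper side rises with speed a, so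
  they also enter through that side, at relative speed a + m. They leave through \<xi> = 0 or at s =
  h.\<close>

lemma trapezoid_balance_down:
  fixes R g :: "real \<Rightarrow> real \<Rightarrow> real"
  assumes a: "0 < a" "0 < m" "0 \<le> x0" "0 \<le> h"
    and R: "broad_solution 1 (- m) (trapezoid a x0 h) R g"
    and g: "integrable (lborel \<Otimes>\<^sub>M lborel) (\<lambda>(s, \<xi>). indicator (trapezoid a x0 h) (s, \<xi>) * g s \<xi>)"
    and i0: "set_integrable lborel {0..x0} (R 0)" and ih: "set_integrable lborel {0..x0 + a * h} (R h)"
    and ib: "set_integrable lborel {0..h} (\<lambda>s. R s 0)"
    and it: "set_integrable lborel {0..h} (\<lambda>s. R s (x0 + a * s))"
  shows "(LBINT \<xi>:{0..x0 + a * h}. R h \<xi>) = (LBINT \<xi>:{0..x0}. R 0 \<xi>) - m * (LBINT s:{0..h}. R s 0)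
    + (a + m) * (LBINT s:{0..h}. R s (x0 + a * s))
    + (LINT s|lborel. LINT \<xi>|lborel. indicator (trapezoid a x0 h) (s, \<xi>) * g s \<xi>)"
proof -
  let ?D = "trapezoid a x0 h"
  define Qh where "Qh \<xi> = indicator {0..x0 + a * h} \<xi> *\<^sub>R R h \<xi>" for \<xi>
  define Q0 where "Q0 \<xi> = indicator {0..x0} \<xi> *\<^sub>R R 0 \<xi>" for \<xi>
  define Qb where "Qb s = indicator {0..h} s *\<^sub>R R s 0" for s
  define Qt where "Qt s = indicator {0..h} s *\<^sub>R R s (x0 + a * s)" for s
  have Q: "integrable lborel Qh" "integrable lborel Q0" "integrable lborel Qb" "integrable lborel Qt"
    using i0 ih ib it unfolding set_integrable_def Qh_def Q0_def Qb_def Qt_def by simp_all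
  define E where "E c = (LINT s|lborel. indicator ?D (s, c + (- m) * s) * g s (c + (- m) * s))" for c
  have [measurable]: "(\<lambda>(s, \<xi>). indicator ?D (s, \<xi>) * g s \<xi>) \<in> borel_measurable (borel \<Otimes>\<^sub>M borel)"
    using borel_measurable_integrable[OF g] by simp
  have [measurable]: "E \<in> borel_measurable borel"
  proof -
    have "(\<lambda>(c, s). indicator ?D (s, c + (- m) * s) * g s (c + (- m) * s)) \<in> borel_measurable (borel \<Otimes>\<^sub>M borel)"
      using measurable_compose[of "\<lambda>(c, s). (s, c + (- m) * s)" "borel \<Otimes>\<^sub>M borel" "borel \<Otimes>\<^sub>M borel"
        "\<lambda>(s, \<xi>). indicator ?D (s, \<xi>) * g s \<xi>" borel] by (simp add: case_prod_unfold)
    then have "(\<lambda>c. E c) \<in> borel_measurable borel" unfolding E_def by measurable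
    then show ?thesis .
  qed
  let ?b = "1 / m" and ?t = "1 / (a + m)"
  have AE: "AE c in lborel. E c = Qb (0 + ?b * c) + Qh (- m * h + 1 * c) - Q0 c - Qt (- x0 * ?t + ?t * c)"
    using R[unfolded broad_solution_def] AE_lborel_singleton[of 0] AE_lborel_singleton[of x0]
      AE_lborel_singleton[of "m * h"] AE_lborel_singleton[of "x0 + (a + m) * h"]
  proof eventually_elim
    case (elim c)
    have te: "- x0 * ?t + ?t * c = (c - x0) / (a + m)" by (simp add: diff_divide_distrib)
    show ?case
    proof (cases "0 < c \<and> c < x0 + (a + m) * h")
      case False
      have z: "indicator ?D (s, c + (- m) * s) * g s (c + (- m) * s) = 0" for s
      proof -
        have "(s, c + (- m) * s) \<notin> ?D"
        proof
          assume *: "(s, c + (- m) * s) \<in> ?D"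
          then have "0 \<le> s" "s \<le> h" "m * s \<le> c" "c \<le> x0 + (a + m) * s"
            by (auto simp: trapezoid_def algebra_simps)
          moreover then have "0 \<le> m * s" "(a + m) * s \<le> (a + m) * h" using a by (auto intro: mult_left_mono)
          ultimately show False using False elim by auto
        qed
        then show ?thesis by simp
      qed
      have "E c = 0" unfolding E_def z by simp
      moreover have "Qb (0 + ?b * c) = 0" "Q0 c = 0"
      proof -
        have "c < 0 \<or> x0 + (a + m) * h < c" using False elim by auto
        moreover have "0 \<le> m * h" "0 \<le> a * h" using a by auto
        ultimately have "c < 0 \<or> x0 < c \<and> m * h < c" using \<open>0 \<le> x0\<close> unfolding distrib_right by linarith
        then show "Qb (0 + ?b * c) = 0" "Q0 c = 0"
          using a by (auto simp: Q0_def Qb_def indicator_def field_simps)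
      qed
      moreover have "Qh (- m * h + 1 * c) = 0" "Qt (- x0 * ?t + ?t * c) = 0"
      proof -
        have c: "c < 0 \<or> x0 + (a + m) * h < c" using False elim by auto
        have "0 \<le> m * h" using a by auto
        then show "Qh (- m * h + 1 * c) = 0"
          using c by (auto simp: Qh_def indicator_def algebra_simps)
        show "Qt (- x0 * ?t + ?t * c) = 0"
          unfolding te using c a by (auto simp: Qt_def indicator_def field_simps)
      qed
      ultimately show ?thesis by simp
    next
      case True
      \<comment> \<open>Entry time, on the base or the slanted side; \<open>s1\<close> is the exit
        time, at \<xi> = 0 or at s = h. Each of the four boundary integrands catches one of these
        cases.\<close>
      define s0 where "s0 = max 0 ((c - x0) / (a + m))"
      define s1 where "s1 = min h (c / m)"
      have "(c - x0) / (a + m) \<le> c / m"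
      proof -
        have "(c - x0) * m \<le> c * (a + m)" using a True by (auto simp: algebra_simps intro!: add_increasing)
        then show ?thesis using a by (simp add: divide_simps)
      qed
      moreover have "(c - x0) / (a + m) \<le> h" using True a by (simp add: field_simps)
      ultimately have s01: "s0 \<le> s1" using True a by (auto simp: s0_def s1_def)
      have m1: "(c - x0) / (a + m) \<le> s \<longleftrightarrow> c + (- m) * s \<le> x0 + a * s" for s
        using a by (simp add: pos_divide_le_eq algebra_simps)
      have m2: "s \<le> c / m \<longleftrightarrow> 0 \<le> c + (- m) * s" for s
        using a by (simp add: pos_le_divide_eq mult.commute)
      have mem: "(s, c + (- m) * s) \<in> ?D \<longleftrightarrow> s \<in> {s0..s1}" for s
        using m1[of s] m2[of s] by (auto simp: trapezoid_def s0_def s1_def)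
      have "E c = (LBINT s:{s0..s1}. g s (c + (- m) * s))"
        unfolding E_def set_lebesgue_integral_def
        by (rule Bochner_Integration.integral_cong) (auto simp: indicator_def mem[simplified])
      also have "\<dots> = R s1 (c + (- m) * s1) - R s0 (c + (- m) * s0)"
        using elim(1)[rule_format, of s0 s1] s01 mem[of s0] mem[of s1] by simp
      also have "R s1 (c + (- m) * s1) = Qb (0 + ?b * c) + Qh (- m * h + 1 * c)"
      proof (cases "c < m * h")
        case c: True
        then have s1: "s1 = c / m" using a by (simp add: s1_def min_def field_simps)
        have "c + (- m) * s1 = 0" using s1 a by simp
        moreover have "c / m \<in> {0..h}" using True a c by (auto simp: field_simps)
        ultimately show ?thesis using c by (simp add: Qh_def Qb_def s1)
      next
        case c: False
        then have "s1 = h" using a by (simp add: s1_def min_def field_simps)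
        then show ?thesis using True a c elim by (auto simp: Qh_def Qb_def field_simps indicator_def)
      qed
      also have "R s0 (c + (- m) * s0) = Q0 c + Qt (- x0 * ?t + ?t * c)"
      proof (cases "c < x0")
        case c: True
        then have "(c - x0) / (a + m) < 0" using a by (simp add: divide_neg_pos)
        then have "s0 = 0" "(c - x0) / (a + m) \<notin> {0..h}" by (auto simp: s0_def)
        then show ?thesis unfolding te using True c by (simp add: Q0_def Qt_def)
      next
        case c: False
        then have "0 \<le> (c - x0) / (a + m)" using a by simp
        then have s0: "s0 = (c - x0) / (a + m)" by (simp add: s0_def)
        then have "s0 \<in> {0..h}" using s01 by (auto simp: s0_def s1_def)
        moreover have "c + (- m) * s0 = x0 + a * s0" unfolding s0 using a by (simp add: field_simps)
        moreover have "x0 < c" using c elim by auto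
        ultimately show ?thesis unfolding te s0[symmetric] by (simp add: Q0_def Qt_def)
      qed
      finally show ?thesis by simp
    qed
  qed
  have Ih: "integrable lborel (\<lambda>c. Qh (- m * h + 1 * c))" and Ib: "integrable lborel (\<lambda>c. Qb (0 + ?b * c))"
    and It: "integrable lborel (\<lambda>c. Qt (- x0 * ?t + ?t * c))"
    by - (rule lborel_integrable_real_affine, rule Q, use a in simp)+
  have "integral\<^sup>L lborel E = (LINT c|lborel. Qb (0 + ?b * c) + Qh (- m * h + 1 * c) - Q0 c - Qt (- x0 * ?t + ?t * c))"
    using Ih Ib It Q(2) AE by (intro integral_cong_AE) auto
  also have "\<dots> = (LINT c|lborel. Qb (0 + ?b * c)) + (LINT c|lborel. Qh (- m * h + 1 * c)) - integral\<^sup>L lborel Q0 - (LINT c|lborel. Qt (- x0 * ?t + ?t * c))"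
    using Ih Ib It Q(2) by simp
  also have "(LINT c|lborel. Qh (- m * h + 1 * c)) = integral\<^sup>L lborel Qh"
    using lborel_integral_real_affine[of 1 Qh "- m * h"] by simp
  also have "(LINT c|lborel. Qb (0 + ?b * c)) = m * integral\<^sup>L lborel Qb"
    using lborel_integral_real_affine[of ?b Qb 0] a by simp
  also have "(LINT c|lborel. Qt (- x0 * ?t + ?t * c)) = (a + m) * integral\<^sup>L lborel Qt"
    using lborel_integral_real_affine[of ?t Qt "- x0 * ?t"] a by simp
  finally have "integral\<^sup>L lborel E = m * integral\<^sup>L lborel Qb + integral\<^sup>L lborel Qh - integral\<^sup>L lborel Q0 - (a + m) * integral\<^sup>L lborel Qt" .
  moreover have "integral\<^sup>L lborel E = (LINT s|lborel. LINT \<xi>|lborel. indicator ?D (s, \<xi>) * g s \<xi>)"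
    unfolding E_def by (rule shear_integral[OF g])
  ultimately show ?thesis
    unfolding set_lebesgue_integral_def Qh_def Q0_def Qb_def Qt_def by linarith
qed

text \<open>Why the transform is constant along a characteristic. The source terms of k1 f1 and k2
  f2 are \<open>g\<close> and \<open>-g\<close> and cancel in the sum. The fluxes through \<xi> = 0
  cancel by \<open>bottom\<close>. What remains is the inflow of k2 f2 through the slanted side,
  which by \<open>diag\<close> is the integral of \<sigma>1 f2, and by \<open>top\<close> this is
  the increment of f1. It is stated for abstract k1, k2, f1, f2 in order to serve both
  components.\<close>

lemma backstepping_transport:
  fixes k1 k2 f1 f2 :: "real \<Rightarrow> real \<Rightarrow> real" and \<sigma>1 \<sigma>2 :: "real \<Rightarrow> real"
  defines "w s \<xi> \<equiv> ennreal ((f1 s \<xi>)\<^sup>2 + (f2 s \<xi>)\<^sup>2)"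
  assumes a: "0 < a" "0 < m" "0 \<le> x0" "0 \<le> h" "x0 + a * h \<le> 1"
    and meas[measurable]: "(\<lambda>(s, \<xi>). k1 s \<xi>) \<in> borel_measurable (borel \<Otimes>\<^sub>M borel)"
      "(\<lambda>(s, \<xi>). k2 s \<xi>) \<in> borel_measurable (borel \<Otimes>\<^sub>M borel)"
      "(\<lambda>(s, \<xi>). f1 s \<xi>) \<in> borel_measurable (borel \<Otimes>\<^sub>M borel)"
      "(\<lambda>(s, \<xi>). f2 s \<xi>) \<in> borel_measurable (borel \<Otimes>\<^sub>M borel)"
      "\<sigma>1 \<in> borel_measurable borel" "\<sigma>2 \<in> borel_measurable borel"
    and bdd: "\<And>s \<xi>. \<bar>k1 s \<xi>\<bar> \<le> M" "\<And>s \<xi>. \<bar>k2 s \<xi>\<bar> \<le> M" "\<And>\<xi>. \<bar>\<sigma>1 \<xi>\<bar> \<le> M" "\<And>\<xi>. \<bar>\<sigma>2 \<xi>\<bar> \<le> M"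
    and k1: "broad_solution 1 a (trapezoid a x0 h) k1 (\<lambda>s \<xi>. - k2 s \<xi> * \<sigma>2 \<xi>)"
    and k2: "broad_solution 1 (- m) (trapezoid a x0 h) k2 (\<lambda>s \<xi>. - k1 s \<xi> * \<sigma>1 \<xi>)"
    and f1: "broad_solution 1 a (trapezoid a x0 h) f1 (\<lambda>s \<xi>. \<sigma>1 \<xi> * f2 s \<xi>)"
    and f2: "broad_solution 1 (- m) (trapezoid a x0 h) f2 (\<lambda>s \<xi>. \<sigma>2 \<xi> * f1 s \<xi>)"
    and fin: "(\<integral>\<^sup>+s\<in>{0..h}. (\<integral>\<^sup>+\<xi>\<in>{0..1}. w s \<xi> \<partial>lborel) \<partial>lborel) < \<infinity>"
    and fin0: "(\<integral>\<^sup>+\<xi>\<in>{0..1}. w 0 \<xi> \<partial>lborel) < \<infinity>" and finh: "(\<integral>\<^sup>+\<xi>\<in>{0..1}. w h \<xi> \<partial>lborel) < \<infinity>"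
    and finb: "(\<integral>\<^sup>+s\<in>{0..h}. w s 0 \<partial>lborel) < \<infinity>"
    and bottom: "AE s in lborel. s \<in> {0..h} \<longrightarrow> a * (k1 s 0 * f1 s 0) = m * (k2 s 0 * f2 s 0)"
    and diag: "AE s in lborel. s \<in> {0..h} \<longrightarrow> (a + m) * k2 s (x0 + a * s) = \<sigma>1 (x0 + a * s)"
    and top: "set_integrable lborel {0..h} (\<lambda>s. \<sigma>1 (x0 + a * s) * f2 s (x0 + a * s))"
      "f1 h (x0 + a * h) - f1 0 x0 = (LBINT s:{0..h}. \<sigma>1 (x0 + a * s) * f2 s (x0 + a * s))"
  shows "f1 h (x0 + a * h) - (LBINT \<xi>:{0..x0 + a * h}. k1 h \<xi> * f1 h \<xi> + k2 h \<xi> * f2 h \<xi>)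
    = f1 0 x0 - (LBINT \<xi>:{0..x0}. k1 0 \<xi> * f1 0 \<xi> + k2 0 \<xi> * f2 0 \<xi>)"
proof -
  let ?D = "trapezoid a x0 h"
  have M: "0 \<le> M" using bdd(3)[of 0] by linarith
  define g where "g s \<xi> = - k2 s \<xi> * \<sigma>2 \<xi> * f1 s \<xi> + k1 s \<xi> * (\<sigma>1 \<xi> * f2 s \<xi>)" for s \<xi>
  have Dsets[measurable]: "?D \<in> sets (borel \<Otimes>\<^sub>M borel)"
  proof -
    have "{p \<in> space (borel \<Otimes>\<^sub>M borel). 0 \<le> (fst p :: real) \<and> fst p \<le> h \<and> 0 \<le> (snd p :: real) \<and> snd p \<le> x0 + a * fst p}
      \<in> sets (borel \<Otimes>\<^sub>M borel)" by measurable
    moreover have "?D = {p \<in> space (borel \<Otimes>\<^sub>M borel). 0 \<le> (fst p :: real) \<and> fst p \<le> h \<and> 0 \<le> (snd p :: real) \<and> snd p \<le> x0 + a * fst p}"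
      by (auto simp: trapezoid_def space_pair_measure)
    ultimately show ?thesis by simp
  qed
  have [measurable]: "(\<lambda>(s, \<xi>). g s \<xi>) \<in> borel_measurable (borel \<Otimes>\<^sub>M borel)"
    unfolding g_def by measurable
  have abs_le: "\<bar>r\<bar> \<le> 1 + r\<^sup>2" for r :: real
    using zero_le_power2[of "\<bar>r\<bar> - 1"] by (simp add: power2_eq_square algebra_simps)
  have lin: "ennreal \<bar>c1 * f1 s \<xi> + c2 * f2 s \<xi>\<bar> \<le> ennreal C * (2 + w s \<xi>)"
    if "\<bar>c1\<bar> \<le> C" "\<bar>c2\<bar> \<le> C" for c1 c2 C s \<xi>
  proof -
    have C: "0 \<le> C" using that(1) by linarith
    have "\<bar>c1 * f1 s \<xi> + c2 * f2 s \<xi>\<bar> \<le> \<bar>c1\<bar> * \<bar>f1 s \<xi>\<bar> + \<bar>c2\<bar> * \<bar>f2 s \<xi>\<bar>"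
      by (metis abs_mult abs_triangle_ineq)
    also have "\<dots> \<le> C * (1 + (f1 s \<xi>)\<^sup>2) + C * (1 + (f2 s \<xi>)\<^sup>2)"
      by (intro add_mono mult_mono abs_le that C) auto
    also have "\<dots> = C * (2 + ((f1 s \<xi>)\<^sup>2 + (f2 s \<xi>)\<^sup>2))" by (simp add: algebra_simps)
    finally have "ennreal \<bar>c1 * f1 s \<xi> + c2 * f2 s \<xi>\<bar> \<le> ennreal (C * (2 + ((f1 s \<xi>)\<^sup>2 + (f2 s \<xi>)\<^sup>2)))" by (rule ennreal_leI)
    then show ?thesis using C by (simp add: w_def ennreal_mult)
  qed
  \<comment> \<open>One integrability argument for all edges: (S, X) parametrizes the edge, and
    setting one coefficient to zero selects a single product. Square integrability of the state
    suffices because |r| \<le> 1 + r^2 and the kernels are bounded.\<close>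
  have int1: "set_integrable lborel {p..r} (\<lambda>z. c1 z * f1 (S z) (X z) + c2 z * f2 (S z) (X z))"
    if [measurable]: "S \<in> borel_measurable borel" "X \<in> borel_measurable borel" "c1 \<in> borel_measurable borel" "c2 \<in> borel_measurable borel"
      and c: "\<And>z. \<bar>c1 z\<bar> \<le> M" "\<And>z. \<bar>c2 z\<bar> \<le> M"
      and f: "(\<integral>\<^sup>+z\<in>{p..r}. w (S z) (X z) \<partial>lborel) < \<infinity>"
    for S X c1 c2 :: "real \<Rightarrow> real" and p r
    unfolding set_integrable_def
  proof (rule integrableI_bounded)
    have [measurable]: "(\<lambda>(s, \<xi>). w s \<xi>) \<in> borel_measurable (borel \<Otimes>\<^sub>M borel)" unfolding w_def by measurable
    have "(\<integral>\<^sup>+z. ennreal (norm (indicator {p..r} z *\<^sub>R (c1 z * f1 (S z) (X z) + c2 z * f2 (S z) (X z)))) \<partial>lborel)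
      \<le> (\<integral>\<^sup>+z. ennreal M * (2 * indicator {p..r} z + w (S z) (X z) * indicator {p..r} z) \<partial>lborel)"
    proof (rule nn_integral_mono)
      fix z show "ennreal (norm (indicator {p..r} z *\<^sub>R (c1 z * f1 (S z) (X z) + c2 z * f2 (S z) (X z))))
        \<le> ennreal M * (2 * indicator {p..r} z + w (S z) (X z) * indicator {p..r} z)"
        using lin[OF c(1)[of z] c(2)[of z], of "S z" "X z"] by (auto simp: indicator_def)
    qed
    also have "\<dots> < \<infinity>"
      using f by (simp add: nn_integral_cmult nn_integral_add ennreal_mult_less_top emeasure_lborel_Icc_eq)
    finally show "(\<integral>\<^sup>+z. ennreal (norm (indicator {p..r} z *\<^sub>R (c1 z * f1 (S z) (X z) + c2 z * f2 (S z) (X z)))) \<partial>lborel) < \<infinity>" .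
  qed measurable
  have gint: "integrable (lborel \<Otimes>\<^sub>M lborel) (\<lambda>(s, \<xi>). indicator ?D (s, \<xi>) * g s \<xi>)"
  proof (rule integrableI_bounded)
    have [measurable]: "(\<lambda>(s, \<xi>). w s \<xi>) \<in> borel_measurable (borel \<Otimes>\<^sub>M borel)" unfolding w_def by measurable
    have "(\<lambda>(s, \<xi>). ennreal (norm (indicator ?D (s, \<xi>) * g s \<xi>))) \<in> borel_measurable (lborel \<Otimes>\<^sub>M lborel)" by measurable
    from lborel.nn_integral_fst[OF this]
    have "(\<integral>\<^sup>+p. ennreal (norm (case p of (s, \<xi>) \<Rightarrow> indicator ?D (s, \<xi>) * g s \<xi>)) \<partial>(lborel \<Otimes>\<^sub>M lborel))
      = (\<integral>\<^sup>+s. \<integral>\<^sup>+\<xi>. ennreal (norm (indicator ?D (s, \<xi>) * g s \<xi>)) \<partial>lborel \<partial>lborel)"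
      by (simp add: case_prod_unfold)
    also have "\<dots> \<le> (\<integral>\<^sup>+s. ennreal (M * M) * (2 * indicator {0..h} s + (\<integral>\<^sup>+\<xi>\<in>{0..1}. w s \<xi> \<partial>lborel) * indicator {0..h} s) \<partial>lborel)"
    proof (rule nn_integral_mono)
      fix s :: real
      have "(\<integral>\<^sup>+\<xi>. ennreal (norm (indicator ?D (s, \<xi>) * g s \<xi>)) \<partial>lborel)
        \<le> (\<integral>\<^sup>+\<xi>. ennreal (M * M) * indicator {0..h} s * (2 * indicator {0..1} \<xi> + w s \<xi> * indicator {0..1} \<xi>) \<partial>lborel)"
      proof (rule nn_integral_mono)
        fix \<xi> :: real
        have g: "ennreal \<bar>g s \<xi>\<bar> \<le> ennreal (M * M) * (2 + w s \<xi>)"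
          using lin[of "- k2 s \<xi> * \<sigma>2 \<xi>" "M * M" "k1 s \<xi> * \<sigma>1 \<xi>" s \<xi>] bdd M
          by (simp add: g_def abs_mult mult_mono mult.assoc)
        have "s \<in> {0..h} \<and> \<xi> \<in> {0..1}" if "(s, \<xi>) \<in> ?D"
        proof -
          have "a * s \<le> a * h" using that a by (simp add: trapezoid_def)
          moreover have "\<xi> \<le> x0 + a * s" using that by (simp add: trapezoid_def)
          ultimately have "\<xi> \<le> 1" using a(5) by linarith
          then show ?thesis using that by (simp add: trapezoid_def)
        qed
        then show "ennreal (norm (indicator ?D (s, \<xi>) * g s \<xi>))
          \<le> ennreal (M * M) * indicator {0..h} s * (2 * indicator {0..1} \<xi> + w s \<xi> * indicator {0..1} \<xi>)"
          using g by (auto simp: indicator_def)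
      qed
      also have "\<dots> = ennreal (M * M) * indicator {0..h} s * (2 + (\<integral>\<^sup>+\<xi>\<in>{0..1}. w s \<xi> \<partial>lborel))"
        by (simp add: nn_integral_cmult nn_integral_add)
      finally show "(\<integral>\<^sup>+\<xi>. ennreal (norm (indicator ?D (s, \<xi>) * g s \<xi>)) \<partial>lborel)
        \<le> ennreal (M * M) * (2 * indicator {0..h} s + (\<integral>\<^sup>+\<xi>\<in>{0..1}. w s \<xi> \<partial>lborel) * indicator {0..h} s)"
        by (simp add: distrib_left distrib_right mult_ac)
    qed
    also have "\<dots> < \<infinity>"
      using fin by (simp add: nn_integral_cmult nn_integral_add ennreal_mult_less_top emeasure_lborel_Icc_eq)
    finally show "(\<integral>\<^sup>+p. ennreal (norm (case p of (s, \<xi>) \<Rightarrow> indicator ?D (s, \<xi>) * g s \<xi>)) \<partial>(lborel \<Otimes>\<^sub>M lborel)) < \<infinity>" .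
  qed measurable
  have sub: "set_integrable lborel {0..x} F" if "set_integrable lborel {0..1} F" "x \<le> 1" for F :: "real \<Rightarrow> real" and x
    by (rule set_integrable_subset[OF that(1)]) (use that in auto)
  have x0: "x0 \<le> 1" using a by (smt (verit) mult_nonneg_nonneg)
  have z: "\<bar>0::real\<bar> \<le> M" using M by simp
  have iP0: "set_integrable lborel {0..1} (\<lambda>\<xi>. k1 0 \<xi> * f1 0 \<xi>)"
    by (rule int1[of "\<lambda>_. 0" "\<lambda>\<xi>. \<xi>" "\<lambda>\<xi>. k1 0 \<xi>" "\<lambda>_. 0" 0 1, OF _ _ _ _ bdd(1) z fin0, unfolded mult_zero_left add_0_right]; measurable)
  have iPh: "set_integrable lborel {0..1} (\<lambda>\<xi>. k1 h \<xi> * f1 h \<xi>)"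
    by (rule int1[of "\<lambda>_. h" "\<lambda>\<xi>. \<xi>" "\<lambda>\<xi>. k1 h \<xi>" "\<lambda>_. 0" 0 1, OF _ _ _ _ bdd(1) z finh, unfolded mult_zero_left add_0_right]; measurable)
  have iR0: "set_integrable lborel {0..1} (\<lambda>\<xi>. k2 0 \<xi> * f2 0 \<xi>)"
    by (rule int1[of "\<lambda>_. 0" "\<lambda>\<xi>. \<xi>" "\<lambda>_. 0" "\<lambda>\<xi>. k2 0 \<xi>" 0 1, OF _ _ _ _ z bdd(2) fin0, unfolded mult_zero_left add_0_left]; measurable)
  have iRh: "set_integrable lborel {0..1} (\<lambda>\<xi>. k2 h \<xi> * f2 h \<xi>)"
    by (rule int1[of "\<lambda>_. h" "\<lambda>\<xi>. \<xi>" "\<lambda>_. 0" "\<lambda>\<xi>. k2 h \<xi>" 0 1, OF _ _ _ _ z bdd(2) finh, unfolded mult_zero_left add_0_left]; measurable)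
  have iPb: "set_integrable lborel {0..h} (\<lambda>s. k1 s 0 * f1 s 0)"
    by (rule int1[of "\<lambda>s. s" "\<lambda>_. 0" "\<lambda>s. k1 s 0" "\<lambda>_. 0" 0 h, OF _ _ _ _ bdd(1) z finb, unfolded mult_zero_left add_0_right]; measurable)
  have iRb: "set_integrable lborel {0..h} (\<lambda>s. k2 s 0 * f2 s 0)"
    by (rule int1[of "\<lambda>s. s" "\<lambda>_. 0" "\<lambda>_. 0" "\<lambda>s. k2 s 0" 0 h, OF _ _ _ _ z bdd(2) finb, unfolded mult_zero_left add_0_left]; measurable)
  \<comment> \<open>The kernel value on the diagonal is 1 / (a + m) times \<sigma>1; the denominator
    cancels the relative speed with which the slanted side is crossed.\<close>
  have top_eq: "AE s in lborel. indicator {0..h} s *\<^sub>R (k2 s (x0 + a * s) * f2 s (x0 + a * s))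
      = (1 / (a + m)) * (indicator {0..h} s *\<^sub>R (\<sigma>1 (x0 + a * s) * f2 s (x0 + a * s)))"
    using diag
  proof eventually_elim
    case (elim s)
    show ?case
    proof (cases "s \<in> {0..h}")
      case True
      with elim have "(a + m) * k2 s (x0 + a * s) = \<sigma>1 (x0 + a * s)" by simp
      then have "k2 s (x0 + a * s) = 1 / (a + m) * \<sigma>1 (x0 + a * s)" using a by (simp add: field_simps)
      then show ?thesis by simp
    qed simp
  qed
  have it: "set_integrable lborel {0..h} (\<lambda>s. k2 s (x0 + a * s) * f2 s (x0 + a * s))"
    and It: "(a + m) * (LBINT s:{0..h}. k2 s (x0 + a * s) * f2 s (x0 + a * s)) = f1 h (x0 + a * h) - f1 0 x0"
  proof -
    have m1: "(\<lambda>s. indicator {0..h} s *\<^sub>R (k2 s (x0 + a * s) * f2 s (x0 + a * s))) \<in> borel_measurable lborel" by measurable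
    have m2: "(\<lambda>s. (1 / (a + m)) * (indicator {0..h} s *\<^sub>R (\<sigma>1 (x0 + a * s) * f2 s (x0 + a * s)))) \<in> borel_measurable lborel" by measurable
    show "set_integrable lborel {0..h} (\<lambda>s. k2 s (x0 + a * s) * f2 s (x0 + a * s))"
      using top(1) integrable_cong_AE[OF m1 m2 top_eq] unfolding set_integrable_def by simp
    have "(LBINT s:{0..h}. k2 s (x0 + a * s) * f2 s (x0 + a * s))
      = (LINT s|lborel. (1 / (a + m)) * (indicator {0..h} s *\<^sub>R (\<sigma>1 (x0 + a * s) * f2 s (x0 + a * s))))"
      unfolding set_lebesgue_integral_def by (rule integral_cong_AE[OF m1 m2 top_eq])
    also have "\<dots> = (1 / (a + m)) * (f1 h (x0 + a * h) - f1 0 x0)"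
      unfolding top(2) set_lebesgue_integral_def by (rule integral_mult_right_zero)
    finally show "(a + m) * (LBINT s:{0..h}. k2 s (x0 + a * s) * f2 s (x0 + a * s)) = f1 h (x0 + a * h) - f1 0 x0"
      using a by simp
  qed
  have bot: "a * (LBINT s:{0..h}. k1 s 0 * f1 s 0) = m * (LBINT s:{0..h}. k2 s 0 * f2 s 0)"
  proof -
    have "(LINT s|lborel. a * (indicator {0..h} s *\<^sub>R (k1 s 0 * f1 s 0))) = (LINT s|lborel. m * (indicator {0..h} s *\<^sub>R (k2 s 0 * f2 s 0)))"
    proof (rule integral_cong_AE)
      show "AE s in lborel. a * (indicator {0..h} s *\<^sub>R (k1 s 0 * f1 s 0)) = m * (indicator {0..h} s *\<^sub>R (k2 s 0 * f2 s 0))"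
        using bottom by eventually_elim (auto simp: indicator_def)
    qed measurable
    then show ?thesis by (simp add: set_lebesgue_integral_def)
  qed
  have bP: "broad_solution 1 a ?D (\<lambda>s \<xi>. k1 s \<xi> * f1 s \<xi>) g"
    using broad_solution_mult[OF k1 f1 convex_trapezoid] unfolding g_def .
  have "(\<lambda>s \<xi>. - k1 s \<xi> * \<sigma>1 \<xi> * f2 s \<xi> + k2 s \<xi> * (\<sigma>2 \<xi> * f1 s \<xi>)) = (\<lambda>s \<xi>. - g s \<xi>)"
    by (auto simp: g_def fun_eq_iff)
  then have bR: "broad_solution 1 (- m) ?D (\<lambda>s \<xi>. k2 s \<xi> * f2 s \<xi>) (\<lambda>s \<xi>. - g s \<xi>)"
    using broad_solution_mult[OF k2 f2 convex_trapezoid] by simp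
  have gint': "integrable (lborel \<Otimes>\<^sub>M lborel) (\<lambda>(s, \<xi>). indicator ?D (s, \<xi>) * - g s \<xi>)"
    using gint by (auto simp: case_prod_unfold)
  note eP = trapezoid_balance_up[OF a(1,3,4) bP gint sub[OF iP0 x0] sub[OF iPh a(5)] iPb]
  note eR = trapezoid_balance_down[OF a(1-4) bR gint' sub[OF iR0 x0] sub[OF iRh a(5)] iRb it]
  have "(LBINT \<xi>:{0..x0 + a * h}. k1 h \<xi> * f1 h \<xi> + k2 h \<xi> * f2 h \<xi>)
    = (LBINT \<xi>:{0..x0}. k1 0 \<xi> * f1 0 \<xi> + k2 0 \<xi> * f2 0 \<xi>) + (f1 h (x0 + a * h) - f1 0 x0)"
    using eP eR bot It
    by (simp add: set_integral_add sub[OF iPh a(5)] sub[OF iRh a(5)] sub[OF iP0 x0] sub[OF iR0 x0])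
  then show ?thesis by simp
qed

subsection \<open>The Volterra transformation\<close>

text \<open>One Volterra transform for both components: the first kernel goes with the function
  being transformed. Thus \<alpha> is \<open>bt Kuu Kuv u v\<close>, whereas \<beta> is
  \<open>bt Kvv Kvu v u\<close> with the arguments in reversed order.\<close>

definition bt :: "(real \<Rightarrow> real \<Rightarrow> real) \<Rightarrow> (real \<Rightarrow> real \<Rightarrow> real) \<Rightarrow> (real \<Rightarrow> real) \<Rightarrow> (real \<Rightarrow> real) \<Rightarrow> real \<Rightarrow> real" where
  "bt K L f g x = f x - (LBINT \<xi>:{0..x}. K x \<xi> * f \<xi> + L x \<xi> * g \<xi>)"

lemma integral_Icc_abs_le:
  fixes f g a b :: "real \<Rightarrow> real"
  assumes [measurable]: "f \<in> borel_measurable borel" "g \<in> borel_measurable borel"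
    and bdd: "\<And>\<xi>. \<bar>a \<xi>\<bar> \<le> M" "\<And>\<xi>. \<bar>b \<xi>\<bar> \<le> M"
  shows "ennreal \<bar>LBINT \<xi>:{p..r}. a \<xi> * f \<xi> + b \<xi> * g \<xi>\<bar>
    \<le> ennreal M * (\<integral>\<^sup>+\<xi>\<in>{p..r}. ennreal (\<bar>f \<xi>\<bar> + \<bar>g \<xi>\<bar>) \<partial>lborel)"
proof -
  have M: "0 \<le> M" using bdd(1)[of 0] by linarith
  let ?F = "\<lambda>\<xi>. indicator {p..r} \<xi> *\<^sub>R (a \<xi> * f \<xi> + b \<xi> * g \<xi>)"
  have "ennreal \<bar>LBINT \<xi>:{p..r}. a \<xi> * f \<xi> + b \<xi> * g \<xi>\<bar> \<le> (\<integral>\<^sup>+\<xi>. ennreal (norm (?F \<xi>)) \<partial>lborel)"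
    unfolding set_lebesgue_integral_def
    using integral_norm_bound_ennreal[of lborel ?F]
    by (cases "integrable lborel ?F") (auto simp: not_integrable_integral_eq)
  also have "\<dots> \<le> (\<integral>\<^sup>+\<xi>. ennreal M * (ennreal (\<bar>f \<xi>\<bar> + \<bar>g \<xi>\<bar>) * indicator {p..r} \<xi>) \<partial>lborel)"
  proof (rule nn_integral_mono)
    fix \<xi>
    have "\<bar>a \<xi> * f \<xi> + b \<xi> * g \<xi>\<bar> \<le> \<bar>a \<xi>\<bar> * \<bar>f \<xi>\<bar> + \<bar>b \<xi>\<bar> * \<bar>g \<xi>\<bar>"
      by (metis abs_mult abs_triangle_ineq)
    also have "\<dots> \<le> M * \<bar>f \<xi>\<bar> + M * \<bar>g \<xi>\<bar>"
      by (intro add_mono mult_right_mono bdd) auto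
    finally have "\<bar>a \<xi> * f \<xi> + b \<xi> * g \<xi>\<bar> \<le> M * (\<bar>f \<xi>\<bar> + \<bar>g \<xi>\<bar>)" by (simp add: distrib_left)
    then have "ennreal \<bar>a \<xi> * f \<xi> + b \<xi> * g \<xi>\<bar> \<le> ennreal M * ennreal (\<bar>f \<xi>\<bar> + \<bar>g \<xi>\<bar>)"
      using M by (subst ennreal_mult[symmetric]) (auto intro: ennreal_leI)
    then show "ennreal (norm (?F \<xi>)) \<le> ennreal M * (ennreal (\<bar>f \<xi>\<bar> + \<bar>g \<xi>\<bar>) * indicator {p..r} \<xi>)"
      by (auto simp: indicator_def)
  qed
  also have "\<dots> = ennreal M * (\<integral>\<^sup>+\<xi>\<in>{p..r}. ennreal (\<bar>f \<xi>\<bar> + \<bar>g \<xi>\<bar>) \<partial>lborel)"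
    by (rule nn_integral_cmult) measurable
  finally show ?thesis .
qed

text \<open>The x-dependent domain of integration is rewritten as a conditional factor in order to
  make joint measurability visible.\<close>

lemma bt_measurable:
  assumes [measurable]: "(\<lambda>(x, \<xi>). K x \<xi>) \<in> borel_measurable (borel \<Otimes>\<^sub>M borel)" "(\<lambda>(x, \<xi>). L x \<xi>) \<in> borel_measurable (borel \<Otimes>\<^sub>M borel)"
    "(\<lambda>(t, x). f t x) \<in> borel_measurable (borel \<Otimes>\<^sub>M borel)" "(\<lambda>(t, x). g t x) \<in> borel_measurable (borel \<Otimes>\<^sub>M borel)"
  shows "(\<lambda>(t::real, x). bt K L (f t) (g t) x) \<in> borel_measurable (borel \<Otimes>\<^sub>M borel)"
proof -
  have "bt K L (f t) (g t) x = f t x - (LINT \<xi>|lborel. (if 0 \<le> \<xi> \<and> \<xi> \<le> x then 1 else 0) * (K x \<xi> * f t \<xi> + L x \<xi> * g t \<xi>))" for t x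
    unfolding bt_def set_lebesgue_integral_def
    by (intro arg_cong2[where f="(-)"] refl Bochner_Integration.integral_cong) (auto simp: indicator_def)
  then show ?thesis by simp
qed

lemma bt_measurable1:
  assumes [measurable]: "(\<lambda>(x, \<xi>). K x \<xi>) \<in> borel_measurable (borel \<Otimes>\<^sub>M borel)" "(\<lambda>(x, \<xi>). L x \<xi>) \<in> borel_measurable (borel \<Otimes>\<^sub>M borel)"
    "f \<in> borel_measurable borel" "g \<in> borel_measurable borel"
  shows "bt K L f g \<in> borel_measurable borel"
proof -
  have "bt K L f g x = f x - (LINT \<xi>|lborel. (if 0 \<le> \<xi> \<and> \<xi> \<le> x then 1 else 0) * (K x \<xi> * f \<xi> + L x \<xi> * g \<xi>))" for x
    unfolding bt_def set_lebesgue_integral_def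
    by (intro arg_cong2[where f="(-)"] refl Bochner_Integration.integral_cong) (auto simp: indicator_def)
  then have "bt K L f g = (\<lambda>x. f x - (LINT \<xi>|lborel. (if 0 \<le> \<xi> \<and> \<xi> \<le> x then 1 else 0) * (K x \<xi> * f \<xi> + L x \<xi> * g \<xi>)))"
    by auto
  then show ?thesis by simp
qed

lemma add_square_le: "((a::real) + b)\<^sup>2 \<le> 2 * (a\<^sup>2 + b\<^sup>2)"
  using zero_le_power2[of "a - b"] by (simp add: power2_eq_square algebra_simps)

text \<open>Norm equivalence of the state and its transform without constructing inverse kernels:
  the lower bound is Gronwall applied to (|f| + |g|)^2, the upper bound Cauchy-Schwarz. Gronwall
  with L = 8 M^2 gives 2 exp(16 M^2); two squares of sums contribute the remaining factor 4.\<close>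

lemma bt_gronwall:
  fixes f g :: "real \<Rightarrow> real"
  assumes [measurable]: "f \<in> borel_measurable borel" "g \<in> borel_measurable borel"
      "(\<lambda>(x, \<xi>). K1 x \<xi>) \<in> borel_measurable (borel \<Otimes>\<^sub>M borel)" "(\<lambda>(x, \<xi>). K2 x \<xi>) \<in> borel_measurable (borel \<Otimes>\<^sub>M borel)"
      "(\<lambda>(x, \<xi>). K3 x \<xi>) \<in> borel_measurable (borel \<Otimes>\<^sub>M borel)" "(\<lambda>(x, \<xi>). K4 x \<xi>) \<in> borel_measurable (borel \<Otimes>\<^sub>M borel)"
    and M: "0 < M" "\<And>x \<xi>. \<bar>K1 x \<xi>\<bar> \<le> M" "\<And>x \<xi>. \<bar>K2 x \<xi>\<bar> \<le> M" "\<And>x \<xi>. \<bar>K3 x \<xi>\<bar> \<le> M" "\<And>x \<xi>. \<bar>K4 x \<xi>\<bar> \<le> M"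
    and fin: "(\<integral>\<^sup>+x\<in>{0..1}. ennreal ((f x)\<^sup>2 + (g x)\<^sup>2) \<partial>lborel) < \<infinity>"
  shows "(\<integral>\<^sup>+x\<in>{0..1}. ennreal ((f x)\<^sup>2 + (g x)\<^sup>2) \<partial>lborel)
      \<le> ennreal (8 * exp (16 * M\<^sup>2)) * (\<integral>\<^sup>+x\<in>{0..1}. ennreal ((bt K1 K2 f g x)\<^sup>2 + (bt K3 K4 g f x)\<^sup>2) \<partial>lborel)" (is ?lower)
    and "(\<integral>\<^sup>+x\<in>{0..1}. ennreal ((bt K1 K2 f g x)\<^sup>2 + (bt K3 K4 g f x)\<^sup>2) \<partial>lborel)
      \<le> ennreal (2 + 8 * M\<^sup>2) * (\<integral>\<^sup>+x\<in>{0..1}. ennreal ((f x)\<^sup>2 + (g x)\<^sup>2) \<partial>lborel)" (is ?upper)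
proof -
  define A where "A = bt K1 K2 f g"
  define B where "B = bt K3 K4 g f"
  have [measurable]: "A \<in> borel_measurable borel" "B \<in> borel_measurable borel"
    unfolding A_def B_def by (auto intro!: bt_measurable1)
  define w where "w x = ennreal ((\<bar>f x\<bar> + \<bar>g x\<bar>)\<^sup>2)" for x
  define N where "N = (\<integral>\<^sup>+x\<in>{0..1}. ennreal ((f x)\<^sup>2 + (g x)\<^sup>2) \<partial>lborel)"
  have [measurable]: "w \<in> borel_measurable borel" unfolding w_def by measurable
  have w_le: "w x \<le> 2 * ennreal ((f x)\<^sup>2 + (g x)\<^sup>2)" for x
    using ennreal_leI[OF add_square_le[of "\<bar>f x\<bar>" "\<bar>g x\<bar>"]] by (simp add: w_def ennreal_mult)
  have le_w: "ennreal ((f x)\<^sup>2 + (g x)\<^sup>2) \<le> w x" for x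
    unfolding w_def by (intro ennreal_leI) (simp add: power2_sum)
  define I where "I x = (\<integral>\<^sup>+\<xi>\<in>{0..x}. ennreal (\<bar>f \<xi>\<bar> + \<bar>g \<xi>\<bar>) \<partial>lborel)" for x
  have n4: "2 * ennreal (2 * z) = 4 * ennreal z" if "0 \<le> z" for z
    using that by (simp add: ennreal_mult mult.assoc[symmetric])
  have I2: "(I x)\<^sup>2 \<le> (\<integral>\<^sup>+\<xi>\<in>{0..x}. w \<xi> \<partial>lborel)" if "x \<in> {0..1}" for x
  proof -
    have "(I x)\<^sup>2 \<le> ennreal (x - 0) * (\<integral>\<^sup>+\<xi>\<in>{0..x}. (ennreal (\<bar>f \<xi>\<bar> + \<bar>g \<xi>\<bar>))\<^sup>2 \<partial>lborel)"
      unfolding I_def using that by (intro nn_integral_Icc_power2_le) auto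
    also have "\<dots> \<le> 1 * (\<integral>\<^sup>+\<xi>\<in>{0..x}. w \<xi> \<partial>lborel)"
      using that by (intro mult_mono) (auto simp: w_def ennreal_power simp del: ennreal_plus)
    finally show ?thesis by simp
  qed
  have dA: "ennreal \<bar>f x - A x\<bar> \<le> ennreal M * I x" for x
    using integral_Icc_abs_le[of f g "\<lambda>\<xi>. K1 x \<xi>" M "\<lambda>\<xi>. K2 x \<xi>" 0 x] M by (simp add: A_def bt_def I_def)
  have dB: "ennreal \<bar>g x - B x\<bar> \<le> ennreal M * I x" for x
    using integral_Icc_abs_le[of g f "\<lambda>\<xi>. K3 x \<xi>" M "\<lambda>\<xi>. K4 x \<xi>" 0 x] M
    by (simp add: B_def bt_def I_def add.commute)
  have sq: "(ennreal (2 * M) * I x)\<^sup>2 = ennreal (4 * M\<^sup>2) * (I x)\<^sup>2" for x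
    using M by (simp add: power_mult_distrib ennreal_power)
  have MI: "ennreal M * I x + ennreal M * I x = ennreal (2 * M) * I x" for x
    using M(1) by (simp flip: distrib_right ennreal_plus)
  \<comment> \<open>Both components differ from their transforms by at most M times the same
    integral \<open>I x\<close>, together 2 M; squaring a two-term sum doubles (2 M)^2 to 8
    M^2.\<close>
  have pt: "w x \<le> 2 * ennreal ((\<bar>A x\<bar> + \<bar>B x\<bar>)\<^sup>2) + ennreal (8 * M\<^sup>2) * (\<integral>\<^sup>+\<xi>\<in>{0..x}. w \<xi> \<partial>lborel)"
    if "x \<in> {0..1}" for x
  proof -
    have "ennreal (\<bar>f x\<bar> + \<bar>g x\<bar>) \<le> ennreal ((\<bar>A x\<bar> + \<bar>B x\<bar>) + (\<bar>f x - A x\<bar> + \<bar>g x - B x\<bar>))"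
      by (intro ennreal_leI) linarith
    also have "\<dots> = ennreal (\<bar>A x\<bar> + \<bar>B x\<bar>) + (ennreal \<bar>f x - A x\<bar> + ennreal \<bar>g x - B x\<bar>)" by simp
    also have "\<dots> \<le> ennreal (\<bar>A x\<bar> + \<bar>B x\<bar>) + ennreal (2 * M) * I x"
      using add_mono[OF dA[of x] dB[of x]] by (simp only: MI add_left_mono)
    finally have "(ennreal (\<bar>f x\<bar> + \<bar>g x\<bar>))\<^sup>2 \<le> (ennreal (\<bar>A x\<bar> + \<bar>B x\<bar>) + ennreal (2 * M) * I x)\<^sup>2"
      by (intro power_mono) auto
    also have "\<dots> \<le> 2 * (ennreal (\<bar>A x\<bar> + \<bar>B x\<bar>))\<^sup>2 + 2 * (ennreal (2 * M) * I x)\<^sup>2"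
      by (rule ennreal_power2_add_le)
    also have "2 * (ennreal (2 * M) * I x)\<^sup>2 = ennreal (8 * M\<^sup>2) * (I x)\<^sup>2"
      unfolding sq using ennreal_mult[of 2 "4 * M\<^sup>2"] M(1) by (simp add: mult.assoc[symmetric])
    also have "\<dots> \<le> ennreal (8 * M\<^sup>2) * (\<integral>\<^sup>+\<xi>\<in>{0..x}. w \<xi> \<partial>lborel)"
      by (intro mult_left_mono I2 that) auto
    finally show ?thesis by (simp add: w_def ennreal_power add_left_mono del: ennreal_plus)
  qed
  have wfin: "(\<integral>\<^sup>+x\<in>{0..1}. w x \<partial>lborel) \<le> 2 * N"
  proof -
    have "(\<integral>\<^sup>+x\<in>{0..1}. w x \<partial>lborel) \<le> (\<integral>\<^sup>+x. 2 * (ennreal ((f x)\<^sup>2 + (g x)\<^sup>2) * indicator {0..1} x) \<partial>lborel)"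
      by (intro nn_integral_mono) (use w_le in \<open>auto simp: indicator_def\<close>)
    then show ?thesis by (simp add: N_def nn_integral_cmult)
  qed
  have "N \<le> (\<integral>\<^sup>+x\<in>{0..1}. w x \<partial>lborel)"
    unfolding N_def by (intro nn_integral_mono mult_right_mono le_w) auto
  also have "\<dots> \<le> ennreal (2 * exp (2 * (8 * M\<^sup>2))) * (\<integral>\<^sup>+x\<in>{0..1}. 2 * ennreal ((\<bar>A x\<bar> + \<bar>B x\<bar>)\<^sup>2) \<partial>lborel)"
  proof (rule gronwall_nn_integral)
    show "(\<integral>\<^sup>+x\<in>{0..1}. w x \<partial>lborel) < \<infinity>"
      by (rule le_less_trans[OF wfin]) (use fin in \<open>simp add: N_def ennreal_mult_less_top\<close>)
  qed (use M pt in auto)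
  also have "(\<integral>\<^sup>+x\<in>{0..1}. 2 * ennreal ((\<bar>A x\<bar> + \<bar>B x\<bar>)\<^sup>2) \<partial>lborel) \<le> (\<integral>\<^sup>+x. 4 * (ennreal ((A x)\<^sup>2 + (B x)\<^sup>2) * indicator {0..1} x) \<partial>lborel)"
  proof (intro nn_integral_mono)
    fix x
    have "2 * ennreal ((\<bar>A x\<bar> + \<bar>B x\<bar>)\<^sup>2) \<le> 2 * ennreal (2 * ((A x)\<^sup>2 + (B x)\<^sup>2))"
      using add_square_le[of "\<bar>A x\<bar>" "\<bar>B x\<bar>"] by (intro mult_left_mono ennreal_leI) auto
    also have "\<dots> = 4 * ennreal ((A x)\<^sup>2 + (B x)\<^sup>2)" by (rule n4) simp
    finally show "2 * ennreal ((\<bar>A x\<bar> + \<bar>B x\<bar>)\<^sup>2) * indicator {0..1} x \<le> 4 * (ennreal ((A x)\<^sup>2 + (B x)\<^sup>2) * indicator {0..1} x)"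
      by (auto simp: indicator_def)
  qed
  also have "\<dots> = 4 * (\<integral>\<^sup>+x\<in>{0..1}. ennreal ((A x)\<^sup>2 + (B x)\<^sup>2) \<partial>lborel)" by (rule nn_integral_cmult) measurable
  finally have "N \<le> ennreal (2 * exp (2 * (8 * M\<^sup>2))) * (4 * (\<integral>\<^sup>+x\<in>{0..1}. ennreal ((A x)\<^sup>2 + (B x)\<^sup>2) \<partial>lborel))"
    by (simp add: mult_left_mono)
  also have "\<dots> = ennreal (8 * exp (16 * M\<^sup>2)) * (\<integral>\<^sup>+x\<in>{0..1}. ennreal ((A x)\<^sup>2 + (B x)\<^sup>2) \<partial>lborel)"
  proof -
    have "ennreal (2 * exp (2 * (8 * M\<^sup>2))) * 4 = ennreal (8 * exp (16 * M\<^sup>2))"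
      using ennreal_mult[of "2 * exp (2 * (8 * M\<^sup>2))" 4] by (simp add: mult.commute)
    then show ?thesis by (simp only: mult.assoc[symmetric])
  qed
  finally show ?lower by (simp add: N_def A_def B_def)
  have I1: "(I x)\<^sup>2 \<le> 2 * N" if "x \<in> {0..1}" for x
  proof -
    have "(\<integral>\<^sup>+\<xi>\<in>{0..x}. w \<xi> \<partial>lborel) \<le> (\<integral>\<^sup>+\<xi>\<in>{0..1}. w \<xi> \<partial>lborel)"
      using that by (intro nn_integral_mono) (auto simp: indicator_def)
    then show ?thesis using I2[OF that] wfin by (meson order_trans)
  qed
  have sqb: "ennreal (p\<^sup>2) \<le> 2 * ennreal (r\<^sup>2) + ennreal (4 * M\<^sup>2) * N"
    if "ennreal \<bar>r - p\<bar> \<le> ennreal M * I x" "x \<in> {0..1}" for p r x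
  proof -
    have "ennreal (p\<^sup>2) = (ennreal \<bar>p\<bar>)\<^sup>2" by (simp add: ennreal_power)
    also have "\<dots> \<le> (ennreal \<bar>r\<bar> + ennreal M * I x)\<^sup>2"
    proof (rule power_mono)
      have "ennreal \<bar>p\<bar> \<le> ennreal (\<bar>r\<bar> + \<bar>r - p\<bar>)" by (intro ennreal_leI) linarith
      also have "\<dots> = ennreal \<bar>r\<bar> + ennreal \<bar>r - p\<bar>" by simp
      finally show "ennreal \<bar>p\<bar> \<le> ennreal \<bar>r\<bar> + ennreal M * I x" using that(1) by (meson add_left_mono order_trans)
    qed simp
    also have "\<dots> \<le> 2 * (ennreal \<bar>r\<bar>)\<^sup>2 + 2 * (ennreal M * I x)\<^sup>2" by (rule ennreal_power2_add_le)
    also have "2 * (ennreal M * I x)\<^sup>2 = 2 * ennreal (M\<^sup>2) * (I x)\<^sup>2"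
      using M(1) by (simp add: power_mult_distrib ennreal_power mult.assoc)
    also have "\<dots> \<le> 2 * ennreal (M\<^sup>2) * (2 * N)" by (intro mult_left_mono I1 that) auto
    also have "\<dots> = ennreal (4 * M\<^sup>2) * N"
      using M(1) by (simp add: ennreal_mult mult_ac)
    finally show ?thesis by (simp add: ennreal_power add_left_mono)
  qed
  have "(\<integral>\<^sup>+x\<in>{0..1}. ennreal ((A x)\<^sup>2 + (B x)\<^sup>2) \<partial>lborel)
    \<le> (\<integral>\<^sup>+x. 2 * (ennreal ((f x)\<^sup>2 + (g x)\<^sup>2) * indicator {0..1} x) + ennreal (8 * M\<^sup>2) * N * indicator {0..1} x \<partial>lborel)"
  proof (intro nn_integral_mono)
    fix x
    show "ennreal ((A x)\<^sup>2 + (B x)\<^sup>2) * indicator {0..1} x \<le> 2 * (ennreal ((f x)\<^sup>2 + (g x)\<^sup>2) * indicator {0..1} x) + ennreal (8 * M\<^sup>2) * N * indicator {0..1} x"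
    proof (cases "x \<in> {0..1}")
      case True
      have e: "ennreal (8 * M\<^sup>2) = ennreal (4 * M\<^sup>2) + ennreal (4 * M\<^sup>2)" by (simp flip: ennreal_plus)
      show ?thesis using add_mono[OF sqb[OF dA True] sqb[OF dB True]] True
        by (simp add: e distrib_left distrib_right add_ac)
    qed simp
  qed
  also have "\<dots> = 2 * N + ennreal (8 * M\<^sup>2) * N" by (simp add: nn_integral_add nn_integral_cmult N_def)
  also have "\<dots> = ennreal (2 + 8 * M\<^sup>2) * N" by (simp add: distrib_right)
  finally show ?upper by (simp add: N_def A_def B_def)
qed

section \<open>The adjoint of the Volterra transformation\<close>

lemma volterra_fubini:
  fixes f \<kappa> :: "real \<Rightarrow> real" and K :: "real \<Rightarrow> real \<Rightarrow> real"
  assumes [measurable]: "(\<lambda>(x, \<xi>). K x \<xi>) \<in> borel_measurable (borel \<Otimes>\<^sub>M borel)" "\<kappa> \<in> borel_measurable borel"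
    and bdd: "\<And>x \<xi>. \<bar>K x \<xi>\<bar> \<le> M" "\<And>x. \<bar>\<kappa> x\<bar> \<le> C" and f: "set_integrable lborel {0..1} f"
  shows "set_integrable lborel {0..1} (\<lambda>x. \<kappa> x * (LBINT \<xi>:{0..x}. K x \<xi> * f \<xi>))"
    and "(LBINT x:{0..1}. \<kappa> x * (LBINT \<xi>:{0..x}. K x \<xi> * f \<xi>)) = (LBINT \<xi>:{0..1}. f \<xi> * (LBINT x:{\<xi>..1}. K x \<xi> * \<kappa> x))"
proof -
  define F where "F \<xi> = indicator {0..1} \<xi> * f \<xi>" for \<xi>
  have F: "integrable lborel F" using f unfolding set_integrable_def F_def by simp
  have [measurable]: "F \<in> borel_measurable borel" using F by auto
  define H where "H x \<xi> = (if \<xi> \<le> x then indicator {0..1} x * \<kappa> x * K x \<xi> * F \<xi> else 0)" for x \<xi>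
  have "integrable lborel (indicator {0..1::real} :: real \<Rightarrow> real)" by (simp add: integrable_indicator_iff emeasure_lborel_Icc_eq)
  note T = integrable_tensor[OF this integrable_norm[OF F]]
  have M: "0 \<le> M" "0 \<le> C" using bdd(1)[of 0 0] bdd(2)[of 0] by linarith+
  have H: "integrable (lborel \<Otimes>\<^sub>M lborel) (\<lambda>(x, \<xi>). H x \<xi>)"
  proof (rule Bochner_Integration.integrable_bound[OF integrable_mult_right[OF T, of "C * M"]])
    show "AE p in lborel \<Otimes>\<^sub>M lborel. norm (case p of (x, \<xi>) \<Rightarrow> H x \<xi>) \<le> norm (C * M * (case p of (x, \<xi>) \<Rightarrow> indicator {0..1} x * norm (F \<xi>)))"
    proof (rule AE_I2, clarsimp simp: H_def abs_mult)
      fix x \<xi> :: real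
      have "\<bar>\<kappa> x\<bar> * \<bar>K x \<xi>\<bar> \<le> \<bar>C\<bar> * \<bar>M\<bar>" using bdd(1)[of x \<xi>] bdd(2)[of x] M by (intro mult_mono) auto
      then show "indicator {0..1} x * \<bar>\<kappa> x\<bar> * \<bar>K x \<xi>\<bar> * \<bar>F \<xi>\<bar> \<le> \<bar>C\<bar> * \<bar>M\<bar> * (indicator {0..1} x * \<bar>F \<xi>\<bar>)"
        by (auto simp: indicator_def intro: mult_right_mono)
    qed
  qed (simp add: H_def)
  have 1: "(LINT \<xi>|lborel. H x \<xi>) = indicator {0..1} x *\<^sub>R (\<kappa> x * (LBINT \<xi>:{0..x}. K x \<xi> * f \<xi>))" for x
  proof -
    have "(LINT \<xi>|lborel. H x \<xi>) = (LINT \<xi>|lborel. indicator {0..1} x * \<kappa> x * (indicator {0..x} \<xi> *\<^sub>R (K x \<xi> * f \<xi>)))"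
      by (rule Bochner_Integration.integral_cong) (auto simp: H_def F_def indicator_def)
    then show ?thesis by (simp add: set_lebesgue_integral_def)
  qed
  have 2: "(LINT x|lborel. H x \<xi>) = indicator {0..1} \<xi> *\<^sub>R (f \<xi> * (LBINT x:{\<xi>..1}. K x \<xi> * \<kappa> x))" for \<xi>
  proof -
    have "(LINT x|lborel. H x \<xi>) = (LINT x|lborel. F \<xi> * (indicator {\<xi>..1} x *\<^sub>R (K x \<xi> * \<kappa> x)))"
      by (rule Bochner_Integration.integral_cong) (auto simp: H_def F_def indicator_def)
    then show ?thesis by (simp add: set_lebesgue_integral_def F_def)
  qed
  show "set_integrable lborel {0..1} (\<lambda>x. \<kappa> x * (LBINT \<xi>:{0..x}. K x \<xi> * f \<xi>))"
    using lborel_pair.integrable_fst'[OF H] unfolding set_integrable_def 1[symmetric] by simp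
  have "(LINT x|lborel. LINT \<xi>|lborel. H x \<xi>) = (LINT \<xi>|lborel. LINT x|lborel. H x \<xi>)"
    using lborel_pair.Fubini_integral[OF H] by simp
  then show "(LBINT x:{0..1}. \<kappa> x * (LBINT \<xi>:{0..x}. K x \<xi> * f \<xi>)) = (LBINT \<xi>:{0..1}. f \<xi> * (LBINT x:{\<xi>..1}. K x \<xi> * \<kappa> x))"
    by (simp only: 1 2 set_lebesgue_integral_def[of lborel "{0..1::real}"])
qed

text \<open>The adjoint system is again of Volterra type, but integrates from \<xi> up to 1. It is
  solved by the Neumann series, with B exp(2 M (1 - \<xi>)) as a bound for all iterates.\<close>

lemma adjoint_volterra:
  fixes K11 K12 K21 K22 :: "real \<Rightarrow> real \<Rightarrow> real" and k1 k2 :: "real \<Rightarrow> real"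
  assumes meas[measurable]: "(\<lambda>(x, \<xi>). K11 x \<xi>) \<in> borel_measurable (borel \<Otimes>\<^sub>M borel)" "(\<lambda>(x, \<xi>). K12 x \<xi>) \<in> borel_measurable (borel \<Otimes>\<^sub>M borel)"
      "(\<lambda>(x, \<xi>). K21 x \<xi>) \<in> borel_measurable (borel \<Otimes>\<^sub>M borel)" "(\<lambda>(x, \<xi>). K22 x \<xi>) \<in> borel_measurable (borel \<Otimes>\<^sub>M borel)"
      "k1 \<in> borel_measurable borel" "k2 \<in> borel_measurable borel"
    and M: "0 < M" "\<And>x \<xi>. \<bar>K11 x \<xi>\<bar> \<le> M" "\<And>x \<xi>. \<bar>K12 x \<xi>\<bar> \<le> M" "\<And>x \<xi>. \<bar>K21 x \<xi>\<bar> \<le> M" "\<And>x \<xi>. \<bar>K22 x \<xi>\<bar> \<le> M"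
      "\<And>x. \<bar>k1 x\<bar> \<le> B" "\<And>x. \<bar>k2 x\<bar> \<le> B"
  obtains \<kappa>1 \<kappa>2 C where "\<kappa>1 \<in> borel_measurable borel" "\<kappa>2 \<in> borel_measurable borel"
    "\<And>x. \<bar>\<kappa>1 x\<bar> \<le> C" "\<And>x. \<bar>\<kappa>2 x\<bar> \<le> C"
    "\<And>\<xi>. \<xi> \<in> {0..1} \<Longrightarrow> \<kappa>1 \<xi> = k1 \<xi> + (LBINT x:{\<xi>..1}. K11 x \<xi> * \<kappa>1 x) + (LBINT x:{\<xi>..1}. K21 x \<xi> * \<kappa>2 x)"
    "\<And>\<xi>. \<xi> \<in> {0..1} \<Longrightarrow> \<kappa>2 \<xi> = k2 \<xi> + (LBINT x:{\<xi>..1}. K12 x \<xi> * \<kappa>1 x) + (LBINT x:{\<xi>..1}. K22 x \<xi> * \<kappa>2 x)"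
proof -
  \<comment> \<open>Data and coefficients are cut off outside [0,1], so the solution is bounded on
    the whole line and not just on the interval.\<close>
  define d :: "nat \<Rightarrow> real \<Rightarrow> real" where "d i \<xi> = indicator {0..1} \<xi> * (if i = 0 then k1 \<xi> else k2 \<xi>)" for i \<xi>
  \<comment> \<open>The transposed matrix of kernels: row 0 uses K11 and K21, row 1 uses K12 and
    K22.\<close>
  define KK :: "nat \<Rightarrow> nat \<Rightarrow> real \<Rightarrow> real \<Rightarrow> real" where
    "KK i j = (if i = 0 then (if j = 0 then K11 else K21) else (if j = 0 then K12 else K22))" for i j
  define c :: "nat \<Rightarrow> nat \<Rightarrow> real \<Rightarrow> real \<Rightarrow> real" where
    "c i j \<xi> y = (if 0 \<le> \<xi> \<and> \<xi> \<le> y \<and> y \<le> 1 then KK i j y \<xi> else 0)" for i j \<xi> y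
  have [measurable]: "(\<lambda>(x, \<xi>). KK i j x \<xi>) \<in> borel_measurable (borel \<Otimes>\<^sub>M borel)" for i j
    using meas by (simp add: KK_def)
  interpret P: picard borel 2 d c "\<lambda>i j. j" "\<lambda>i j \<xi> y. y"
  proof
    show "d i \<in> borel_measurable borel" for i
      unfolding d_def[abs_def] by (cases "i = 0") auto
    show "(\<lambda>(z, y). c i j z y) \<in> borel_measurable (borel \<Otimes>\<^sub>M borel)" for i j
      unfolding c_def by measurable
  qed auto
  have B: "0 \<le> B" using M(6)[of 0] by linarith
  have KKM: "\<bar>KK i j x \<xi>\<bar> \<le> M" for i j x \<xi> using M by (simp add: KK_def)
  have cint: "(\<integral>\<^sup>+y. ennreal (M * (B * exp (2 * M * (1 - y)))) * indicator {\<xi>..1} y \<partial>lborel) = ennreal (B / 2 * (exp (2 * M * (1 - \<xi>)) - 1))"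
    if "\<xi> \<in> {0..1}" for \<xi>
  proof -
    have "(\<integral>\<^sup>+y. ennreal (M * (B * exp (2 * M * (1 - y)))) * indicator {\<xi>..1} y \<partial>lborel)
      = ennreal ((- B / 2 * exp (2 * M * (1 - 1))) - (- B / 2 * exp (2 * M * (1 - \<xi>))))"
    proof (rule nn_integral_FTC_Icc)
      show "((\<lambda>y. - B / 2 * exp (2 * M * (1 - y))) has_real_derivative M * (B * exp (2 * M * (1 - x)))) (at x)" for x
        by (auto intro!: derivative_eq_intros)
    qed (use B M that in auto)
    also have "(- B / 2 * exp (2 * M * (1 - 1))) - (- B / 2 * exp (2 * M * (1 - \<xi>))) = B / 2 * (exp (2 * M * (1 - \<xi>)) - 1)"
      by (simp add: algebra_simps)
    finally show ?thesis .
  qed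
  \<comment> \<open>The exponential reproduces itself: each of the two terms integrates to (B/2)
    (exp(2 M (1 - \<xi>)) - 1), and B plus twice this is B exp(2 M (1 - \<xi>)).\<close>
  have S_le: "P.S n i \<xi> \<le> (if \<xi> \<in> {0..1} then ennreal (B * exp (2 * M * (1 - \<xi>))) else 0)" for n i \<xi>
  proof (induction n arbitrary: i \<xi>)
    case (Suc n)
    show ?case
    proof (cases "\<xi> \<in> {0..1}")
      case False
      then have "d i \<xi> = 0" "c i j \<xi> y = 0" for j y by (auto simp: d_def c_def)
      then have "P.S (Suc n) i \<xi> = 0" by (simp add: picard_op_def)
      then show ?thesis by simp
    next
      case True
      have t: "(\<integral>\<^sup>+y. ennreal \<bar>c i j \<xi> y\<bar> * P.S n j y \<partial>lborel) \<le> ennreal (B / 2 * (exp (2 * M * (1 - \<xi>)) - 1))" for j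
      proof -
        have "(\<integral>\<^sup>+y. ennreal \<bar>c i j \<xi> y\<bar> * P.S n j y \<partial>lborel)
          \<le> (\<integral>\<^sup>+y. ennreal (M * (B * exp (2 * M * (1 - y)))) * indicator {\<xi>..1} y \<partial>lborel)"
        proof (rule nn_integral_mono)
          fix y
          show "ennreal \<bar>c i j \<xi> y\<bar> * P.S n j y \<le> ennreal (M * (B * exp (2 * M * (1 - y)))) * indicator {\<xi>..1} y"
          proof (cases "\<xi> \<le> y \<and> y \<le> 1")
            case y: True
            have "y \<in> {0..1}" using y True by auto
            then have "P.S n j y \<le> ennreal (B * exp (2 * M * (1 - y)))" using Suc[of j y] by simp
            then have "ennreal \<bar>c i j \<xi> y\<bar> * P.S n j y \<le> ennreal M * ennreal (B * exp (2 * M * (1 - y)))"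
              using y True KKM by (intro mult_mono ennreal_leI) (auto simp: c_def)
            then show ?thesis using y B M by (simp add: ennreal_mult)
          qed (auto simp: c_def)
        qed
        then show ?thesis using cint[OF True] by simp
      qed
      have "P.S (Suc n) i \<xi> \<le> ennreal B + (ennreal (B / 2 * (exp (2 * M * (1 - \<xi>)) - 1)) + ennreal (B / 2 * (exp (2 * M * (1 - \<xi>)) - 1)))"
        unfolding P.S.simps picard_op_def
        using add_mono[OF t[of 0] t[of 1]] M B by (intro add_mono) (auto simp: d_def numeral_2_eq_2 indicator_def intro!: ennreal_leI)
      also have "\<dots> = ennreal (B + (B / 2 * (exp (2 * M * (1 - \<xi>)) - 1) + B / 2 * (exp (2 * M * (1 - \<xi>)) - 1)))"
        using B M True by (simp flip: ennreal_plus)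
      also have "B + (B / 2 * (exp (2 * M * (1 - \<xi>)) - 1) + B / 2 * (exp (2 * M * (1 - \<xi>)) - 1)) = B * exp (2 * M * (1 - \<xi>))"
        by (simp add: algebra_simps)
      finally show ?thesis using True by simp
    qed
  qed simp
  define C where "C = B * exp (2 * M)"
  have maj: "P.majorant i \<xi> \<le> ennreal C" for i \<xi>
    unfolding P.majorant_def
  proof (rule SUP_least)
    fix n
    have "P.S n i \<xi> \<le> (if \<xi> \<in> {0..1} then ennreal (B * exp (2 * M * (1 - \<xi>))) else 0)" by (rule S_le)
    also have "\<dots> \<le> ennreal C"
      unfolding C_def using B M by (auto intro!: ennreal_leI mult_left_mono)
    finally show "P.S n i \<xi> \<le> ennreal C" .
  qed
  have C: "0 \<le> C" using B by (simp add: C_def)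
  show thesis
  proof (rule that[of "P.sol 0" "P.sol 1" C])
    show "\<bar>P.sol 0 x\<bar> \<le> C" "\<bar>P.sol 1 x\<bar> \<le> C" for x
      using order_trans[OF P.sol_le_majorant maj] C by (auto simp: ennreal_le_iff)
    have eq: "P.sol i \<xi> = d i \<xi> + (LINT y|lborel. c i 0 \<xi> y * P.sol 0 y) + (LINT y|lborel. c i 1 \<xi> y * P.sol 1 y)" for i \<xi>
    proof -
      have "P.majorant i \<xi> < \<infinity>" using maj[of i \<xi>] by (rule le_less_trans) simp
      from P.sol_equation(2)[OF this] show ?thesis by (simp add: numeral_2_eq_2)
    qed
    have ce: "(LINT y|lborel. c i j \<xi> y * f y) = (LBINT y:{\<xi>..1}. KK i j y \<xi> * f y)" if "\<xi> \<in> {0..1}" for i j \<xi> and f :: "real \<Rightarrow> real"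
      unfolding set_lebesgue_integral_def
      by (rule Bochner_Integration.integral_cong) (use that in \<open>auto simp: c_def indicator_def\<close>)
    fix \<xi> :: real assume \<xi>: "\<xi> \<in> {0..1}"
    show "P.sol 0 \<xi> = k1 \<xi> + (LBINT x:{\<xi>..1}. K11 x \<xi> * P.sol 0 x) + (LBINT x:{\<xi>..1}. K21 x \<xi> * P.sol 1 x)"
      using eq[of 0 \<xi>] \<xi> unfolding ce[OF \<xi>] by (simp add: d_def KK_def)
    show "P.sol 1 \<xi> = k2 \<xi> + (LBINT x:{\<xi>..1}. K12 x \<xi> * P.sol 0 x) + (LBINT x:{\<xi>..1}. K22 x \<xi> * P.sol 1 x)"
      using eq[of 1 \<xi>] \<xi> unfolding ce[OF \<xi>] by (simp add: d_def KK_def)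
  qed (rule P.sol_meas)+
qed

text \<open>Moving the Volterra operators from the state to \<kappa>1, \<kappa>2 leaves exactly k1
  and k2, by the adjoint system. A functional of the state thereby becomes a functional of the
  transformed state, whose evolution is pure transport.\<close>

lemma bt_duality:
  fixes K11 K12 K21 K22 :: "real \<Rightarrow> real \<Rightarrow> real" and k1 k2 :: "real \<Rightarrow> real"
  assumes meas[measurable]: "(\<lambda>(x, \<xi>). K11 x \<xi>) \<in> borel_measurable (borel \<Otimes>\<^sub>M borel)" "(\<lambda>(x, \<xi>). K12 x \<xi>) \<in> borel_measurable (borel \<Otimes>\<^sub>M borel)"
      "(\<lambda>(x, \<xi>). K21 x \<xi>) \<in> borel_measurable (borel \<Otimes>\<^sub>M borel)" "(\<lambda>(x, \<xi>). K22 x \<xi>) \<in> borel_measurable (borel \<Otimes>\<^sub>M borel)"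
      "k1 \<in> borel_measurable borel" "k2 \<in> borel_measurable borel"
    and M: "0 < M" "\<And>x \<xi>. \<bar>K11 x \<xi>\<bar> \<le> M" "\<And>x \<xi>. \<bar>K12 x \<xi>\<bar> \<le> M" "\<And>x \<xi>. \<bar>K21 x \<xi>\<bar> \<le> M" "\<And>x \<xi>. \<bar>K22 x \<xi>\<bar> \<le> M"
      "\<And>x. \<bar>k1 x\<bar> \<le> B" "\<And>x. \<bar>k2 x\<bar> \<le> B"
  obtains \<kappa>1 \<kappa>2 C where "\<kappa>1 \<in> borel_measurable borel" "\<kappa>2 \<in> borel_measurable borel"
    "\<And>x. \<bar>\<kappa>1 x\<bar> \<le> C" "\<And>x. \<bar>\<kappa>2 x\<bar> \<le> C"
    "\<And>f g. set_integrable lborel {0..1} f \<Longrightarrow> set_integrable lborel {0..1} g \<Longrightarrow> f \<in> borel_measurable borel \<Longrightarrow> g \<in> borel_measurable borel \<Longrightarrow>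
      (LBINT \<xi>:{0..1}. k1 \<xi> * f \<xi> + k2 \<xi> * g \<xi>) = (LBINT x:{0..1}. \<kappa>1 x * bt K11 K12 f g x + \<kappa>2 x * bt K22 K21 g f x)"
proof -
  obtain \<kappa>1 \<kappa>2 C where \<kappa>[measurable]: "\<kappa>1 \<in> borel_measurable borel" "\<kappa>2 \<in> borel_measurable borel"
    and C: "\<And>x. \<bar>\<kappa>1 x\<bar> \<le> C" "\<And>x. \<bar>\<kappa>2 x\<bar> \<le> C"
    and eq: "\<And>\<xi>. \<xi> \<in> {0..1} \<Longrightarrow> \<kappa>1 \<xi> = k1 \<xi> + (LBINT x:{\<xi>..1}. K11 x \<xi> * \<kappa>1 x) + (LBINT x:{\<xi>..1}. K21 x \<xi> * \<kappa>2 x)"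
    "\<And>\<xi>. \<xi> \<in> {0..1} \<Longrightarrow> \<kappa>2 \<xi> = k2 \<xi> + (LBINT x:{\<xi>..1}. K12 x \<xi> * \<kappa>1 x) + (LBINT x:{\<xi>..1}. K22 x \<xi> * \<kappa>2 x)"
    by (rule adjoint_volterra[OF meas M]) blast
  show thesis
  proof (rule that[OF \<kappa> C])
    fix f g :: "real \<Rightarrow> real"
    assume f: "set_integrable lborel {0..1} f" and g: "set_integrable lborel {0..1} g"
      and [measurable]: "f \<in> borel_measurable borel" "g \<in> borel_measurable borel"
    have bint: "set_integrable lborel {p..r} (\<lambda>x. a x * h x)" if "set_integrable lborel {0..1} h" "{p..r} \<subseteq> {0..1}"
      "\<And>x. \<bar>a x\<bar> \<le> D" "h \<in> borel_measurable borel" "a \<in> borel_measurable borel" for p r D and a h :: "real \<Rightarrow> real"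
      by (rule set_integrable_bounded_mult[OF set_integrable_subset[OF that(1) _ that(2)] that(4,5) _ that(3)]) simp_all
    note V11 = volterra_fubini[OF meas(1) \<kappa>(1) M(2) C(1) f] and V12 = volterra_fubini[OF meas(2) \<kappa>(1) M(3) C(1) g]
      and V21 = volterra_fubini[OF meas(3) \<kappa>(2) M(4) C(2) f] and V22 = volterra_fubini[OF meas(4) \<kappa>(2) M(5) C(2) g]
    have split: "\<kappa>1 x * bt K11 K12 f g x + \<kappa>2 x * bt K22 K21 g f x
      = (\<kappa>1 x * f x + \<kappa>2 x * g x) - ((\<kappa>1 x * (LBINT \<xi>:{0..x}. K11 x \<xi> * f \<xi>) + \<kappa>1 x * (LBINT \<xi>:{0..x}. K12 x \<xi> * g \<xi>))
        + (\<kappa>2 x * (LBINT \<xi>:{0..x}. K21 x \<xi> * f \<xi>) + \<kappa>2 x * (LBINT \<xi>:{0..x}. K22 x \<xi> * g \<xi>)))"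
      if "x \<in> {0..1}" for x
    proof -
      have s: "{0..x} \<subseteq> {0..1}" using that by auto
      have i: "set_integrable lborel {0..x} (\<lambda>\<xi>. K11 x \<xi> * f \<xi>)" "set_integrable lborel {0..x} (\<lambda>\<xi>. K12 x \<xi> * g \<xi>)"
        "set_integrable lborel {0..x} (\<lambda>\<xi>. K21 x \<xi> * f \<xi>)" "set_integrable lborel {0..x} (\<lambda>\<xi>. K22 x \<xi> * g \<xi>)"
        by (rule bint[OF _ s, where D = M]; use f g M in measurable)+
      show ?thesis unfolding bt_def set_integral_add(2)[OF i(1,2)] set_integral_add(2)[OF i(4,3)]
        by (simp add: algebra_simps)
    qed
    have i\<kappa>: "set_integrable lborel {0..1} (\<lambda>x. \<kappa>1 x * f x)" "set_integrable lborel {0..1} (\<lambda>x. \<kappa>2 x * g x)"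
      by (rule bint[OF _ order_refl, where D = C]; use f g C in measurable)+
    have ik: "set_integrable lborel {0..1} (\<lambda>x. k1 x * f x)" "set_integrable lborel {0..1} (\<lambda>x. k2 x * g x)"
      by (rule bint[OF _ order_refl, where D = B]; use f g M in measurable)+
    have "(LBINT x:{0..1}. \<kappa>1 x * bt K11 K12 f g x + \<kappa>2 x * bt K22 K21 g f x)
      = (LBINT x:{0..1}. (\<kappa>1 x * f x + \<kappa>2 x * g x) - ((\<kappa>1 x * (LBINT \<xi>:{0..x}. K11 x \<xi> * f \<xi>) + \<kappa>1 x * (LBINT \<xi>:{0..x}. K12 x \<xi> * g \<xi>))
        + (\<kappa>2 x * (LBINT \<xi>:{0..x}. K21 x \<xi> * f \<xi>) + \<kappa>2 x * (LBINT \<xi>:{0..x}. K22 x \<xi> * g \<xi>))))"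
      by (rule set_lebesgue_integral_cong) (use split in auto)
    also have "\<dots> = ((LBINT x:{0..1}. \<kappa>1 x * f x) + (LBINT x:{0..1}. \<kappa>2 x * g x))
       - (((LBINT \<xi>:{0..1}. f \<xi> * (LBINT x:{\<xi>..1}. K11 x \<xi> * \<kappa>1 x)) + (LBINT \<xi>:{0..1}. g \<xi> * (LBINT x:{\<xi>..1}. K12 x \<xi> * \<kappa>1 x)))
        + ((LBINT \<xi>:{0..1}. f \<xi> * (LBINT x:{\<xi>..1}. K21 x \<xi> * \<kappa>2 x)) + (LBINT \<xi>:{0..1}. g \<xi> * (LBINT x:{\<xi>..1}. K22 x \<xi> * \<kappa>2 x))))"
      unfolding V11(2)[symmetric] V12(2)[symmetric] V21(2)[symmetric] V22(2)[symmetric]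
      by (simp only: set_integral_add set_integral_diff i\<kappa> V11(1) V12(1) V21(1) V22(1))
    finally have L: "(LBINT x:{0..1}. \<kappa>1 x * bt K11 K12 f g x + \<kappa>2 x * bt K22 K21 g f x) = \<dots>" .
    \<comment> \<open>The adjoint equation tested against a function j. The Volterra terms
      \<open>p\<close> and \<open>r\<close> are bounded only for arguments in [0,1], hence the
      cut-off inside.\<close>
    have e: "(LBINT x:{0..1}. h x * j x) = (LBINT x:{0..1}. kk x * j x) + ((LBINT x:{0..1}. j x * p x) + (LBINT x:{0..1}. j x * r x))"
      if "\<And>x. x \<in> {0..1} \<Longrightarrow> h x = kk x + p x + r x" and ij: "set_integrable lborel {0..1} j" "j \<in> borel_measurable borel"
        and p: "p \<in> borel_measurable borel" "\<And>x. x \<in> {0..1} \<Longrightarrow> \<bar>p x\<bar> \<le> D" and r: "r \<in> borel_measurable borel" "\<And>x. x \<in> {0..1} \<Longrightarrow> \<bar>r x\<bar> \<le> D"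
        and kk: "set_integrable lborel {0..1} (\<lambda>x. kk x * j x)"
      for h j kk p r :: "real \<Rightarrow> real" and D
    proof -
      have D: "0 \<le> D" using p(2)[of 0] by simp
      have 1: "set_integrable lborel {0..1} (\<lambda>x. j x * (indicator {0..1} x * p x))" "set_integrable lborel {0..1} (\<lambda>x. j x * (indicator {0..1} x * r x))"
        unfolding mult.commute[of "j _"]
        by (rule bint[OF ij(1) order_refl, where D = D]; use ij p r D in \<open>auto simp: indicator_def\<close>)+
      have 2: "(LBINT x:{0..1}. h x * j x) = (LBINT x:{0..1}. kk x * j x + (j x * (indicator {0..1} x * p x) + j x * (indicator {0..1} x * r x)))"
        by (rule set_lebesgue_integral_cong) (use that in \<open>auto simp: algebra_simps\<close>)
      have 3: "(LBINT x:{0..1}. j x * (indicator {0..1} x * p x)) = (LBINT x:{0..1}. j x * p x)" "(LBINT x:{0..1}. j x * (indicator {0..1} x * r x)) = (LBINT x:{0..1}. j x * r x)"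
        by (rule set_lebesgue_integral_cong; auto)+
      show ?thesis unfolding 2 using kk 1 by (simp only: set_integral_add 3)
    qed
    have vm: "(\<lambda>\<xi>. LBINT x:{\<xi>..1}. K x \<xi> * \<kappa> x) \<in> borel_measurable borel"
      if [measurable]: "(\<lambda>(x, \<xi>). K x \<xi>) \<in> borel_measurable (borel \<Otimes>\<^sub>M borel)" "\<kappa> \<in> borel_measurable borel" for K :: "real \<Rightarrow> real \<Rightarrow> real" and \<kappa>
    proof -
      have "(LBINT x:{\<xi>..1}. K x \<xi> * \<kappa> x) = (LINT x|lborel. (if \<xi> \<le> x \<and> x \<le> 1 then K x \<xi> * \<kappa> x else 0))" for \<xi>
        unfolding set_lebesgue_integral_def by (rule Bochner_Integration.integral_cong) (auto simp: indicator_def)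
      then show ?thesis by simp
    qed
    have vb: "\<bar>LBINT x:{\<xi>..1}. K x \<xi> * \<kappa> x\<bar> \<le> M * C" if "\<xi> \<in> {0..1}" "\<And>x. \<bar>\<kappa> x\<bar> \<le> C" "\<And>x. \<bar>K x \<xi>\<bar> \<le> M" "(\<lambda>(x, \<xi>). K x \<xi>) \<in> borel_measurable (borel \<Otimes>\<^sub>M borel)" "\<kappa> \<in> borel_measurable borel" 
      for K :: "real \<Rightarrow> real \<Rightarrow> real" and \<kappa> \<xi>
    proof -
      note [measurable] = that(4,5)
      have "ennreal \<bar>LBINT x:{\<xi>..1}. K x \<xi> * \<kappa> x + 0 * 0\<bar> \<le> ennreal M * (\<integral>\<^sup>+x\<in>{\<xi>..1}. ennreal (\<bar>\<kappa> x\<bar> + \<bar>0\<bar>) \<partial>lborel)"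
        using that M(1) by (intro integral_Icc_abs_le) auto
      also have "\<dots> \<le> ennreal M * (\<integral>\<^sup>+x\<in>{\<xi>..1}. ennreal C \<partial>lborel)"
        using that by (intro mult_left_mono nn_integral_mono mult_right_mono ennreal_leI) auto
      also have "\<dots> \<le> ennreal M * (ennreal C * 1)"
        using that(1) by (intro mult_left_mono) (auto simp: nn_integral_cmult intro!: mult_left_mono[of _ 1 "ennreal C", simplified])
      also have "\<dots> = ennreal (M * C)" using M(1) that(2)[of 0] by (simp add: ennreal_mult)
      finally show ?thesis using M(1) that(2)[of 0] by (simp add: ennreal_le_iff)
    qed
    have "(LBINT x:{0..1}. \<kappa>1 x * f x) = (LBINT x:{0..1}. k1 x * f x)
      + ((LBINT \<xi>:{0..1}. f \<xi> * (LBINT x:{\<xi>..1}. K11 x \<xi> * \<kappa>1 x)) + (LBINT \<xi>:{0..1}. f \<xi> * (LBINT x:{\<xi>..1}. K21 x \<xi> * \<kappa>2 x)))"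
      by (rule e[where D = "M * C"]) (use eq f ik C M in \<open>auto intro!: vm vb meas \<kappa>\<close>)
    moreover have "(LBINT x:{0..1}. \<kappa>2 x * g x) = (LBINT x:{0..1}. k2 x * g x)
      + ((LBINT \<xi>:{0..1}. g \<xi> * (LBINT x:{\<xi>..1}. K12 x \<xi> * \<kappa>1 x)) + (LBINT \<xi>:{0..1}. g \<xi> * (LBINT x:{\<xi>..1}. K22 x \<xi> * \<kappa>2 x)))"
      by (rule e[where D = "M * C"]) (use eq g ik C M in \<open>auto intro!: vm vb meas \<kappa>\<close>)
    moreover have "(LBINT \<xi>:{0..1}. k1 \<xi> * f \<xi> + k2 \<xi> * g \<xi>) = (LBINT x:{0..1}. k1 x * f x) + (LBINT x:{0..1}. k2 x * g x)"
      using ik by (rule set_integral_add(2))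
    ultimately show "(LBINT \<xi>:{0..1}. k1 \<xi> * f \<xi> + k2 \<xi> * g \<xi>) = (LBINT x:{0..1}. \<kappa>1 x * bt K11 K12 f g x + \<kappa>2 x * bt K22 K21 g f x)"
      unfolding L by linarith
  qed
qed

lemma nn_integral_L2_on:
  assumes "L2_on S f"
  shows "(\<integral>\<^sup>+x\<in>S. ennreal ((f x)\<^sup>2) \<partial>lborel) = ennreal ((L2norm_on S f)\<^sup>2)"
proof -
  have i: "integrable lborel (\<lambda>x. indicator S x *\<^sub>R (f x)\<^sup>2)"
    using assms by (simp add: L2_on_def set_integrable_def)
  have "(\<integral>\<^sup>+x\<in>S. ennreal ((f x)\<^sup>2) \<partial>lborel) = (\<integral>\<^sup>+x. ennreal (indicator S x *\<^sub>R (f x)\<^sup>2) \<partial>lborel)"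
    by (rule nn_integral_cong) (auto simp: indicator_def)
  also have "\<dots> = ennreal (LBINT x:S. (f x)\<^sup>2)"
    unfolding set_lebesgue_integral_def by (rule nn_integral_eq_integral[OF i]) auto
  also have "(LBINT x:S. (f x)\<^sup>2) = (L2norm_on S f)\<^sup>2"
    unfolding L2norm_on_def set_lebesgue_integral_def
    by (subst real_sqrt_pow2) (auto intro!: integral_nonneg_AE)
  finally show ?thesis .
qed

lemma L2_onI:
  fixes f :: "'a::euclidean_space \<Rightarrow> real"
  assumes [measurable]: "f \<in> borel_measurable borel" "S \<in> sets borel"
    and fin: "(\<integral>\<^sup>+x\<in>S. ennreal ((f x)\<^sup>2) \<partial>lborel) < \<infinity>"
  shows "L2_on S f"
  unfolding L2_on_def set_integrable_def set_borel_measurable_def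
proof
  show "integrable lborel (\<lambda>x. indicator S x *\<^sub>R (f x)\<^sup>2)"
  proof (rule integrableI_bounded)
    have "(\<integral>\<^sup>+x. ennreal (norm (indicator S x *\<^sub>R (f x)\<^sup>2)) \<partial>lborel) = (\<integral>\<^sup>+x\<in>S. ennreal ((f x)\<^sup>2) \<partial>lborel)"
      by (rule nn_integral_cong) (auto simp: indicator_def)
    then show "(\<integral>\<^sup>+x. ennreal (norm (indicator S x *\<^sub>R (f x)\<^sup>2)) \<partial>lborel) < \<infinity>" using fin by simp
  qed measurable
qed measurable

lemma L2_on_integrable:
  fixes g :: "real \<Rightarrow> real"
  assumes g: "L2_on {0..1} g" and [measurable]: "g \<in> borel_measurable borel"
  shows "set_integrable lborel {0..1} g"
  unfolding set_integrable_def
proof (rule Bochner_Integration.integrable_bound)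
  have "set_integrable lborel {0..1} (\<lambda>x. 1 + (g x)\<^sup>2)"
    using g unfolding L2_on_def by (intro set_integral_add) (auto simp: set_integrable_def)
  then show "integrable lborel (\<lambda>x. indicator {0..1} x *\<^sub>R (1 + (g x)\<^sup>2))" by (simp add: set_integrable_def)
  have "\<bar>g x\<bar> \<le> \<bar>1 + (g x)\<^sup>2\<bar>" for x
    using zero_le_power2[of "\<bar>g x\<bar> - 1"] by (simp add: power2_eq_square algebra_simps)
  then show "AE x in lborel. norm (indicator {0..1} x *\<^sub>R g x) \<le> norm (indicator {0..1} x *\<^sub>R (1 + (g x)\<^sup>2))"
    by (simp add: indicator_def)
qed measurable

lemma nn_integral_Icc_shift:
  fixes F :: "real \<Rightarrow> ennreal"
  assumes [measurable]: "F \<in> borel_measurable borel"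
  shows "(\<integral>\<^sup>+s\<in>{a..b}. F (k + s) \<partial>lborel) = (\<integral>\<^sup>+t\<in>{k + a..k + b}. F t \<partial>lborel)"
proof -
  have "(\<integral>\<^sup>+t\<in>{k + a..k + b}. F t \<partial>lborel) = (\<integral>\<^sup>+s. F (k + 1 * s) * indicator {k + a..k + b} (k + 1 * s) \<partial>lborel)"
    using nn_integral_real_affine[of "\<lambda>t. F t * indicator {k + a..k + b} t" 1 k] by simp
  also have "\<dots> = (\<integral>\<^sup>+s\<in>{a..b}. F (k + s) \<partial>lborel)"
    by (rule nn_integral_cong) (auto simp: indicator_def)
  finally show ?thesis by simp
qed

lemma nn_integral_Icc_reflect:
  fixes F :: "real \<Rightarrow> ennreal"
  assumes [measurable]: "F \<in> borel_measurable borel"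
  shows "(\<integral>\<^sup>+s\<in>{a..b}. F (k - s) \<partial>lborel) = (\<integral>\<^sup>+t\<in>{k - b..k - a}. F t \<partial>lborel)"
proof -
  have "(\<integral>\<^sup>+t\<in>{k - b..k - a}. F t \<partial>lborel) = (\<integral>\<^sup>+s. F (k + (-1) * s) * indicator {k - b..k - a} (k + (-1) * s) \<partial>lborel)"
    using nn_integral_real_affine[of "\<lambda>t. F t * indicator {k - b..k - a} t" "-1" k] by simp
  also have "\<dots> = (\<integral>\<^sup>+s\<in>{a..b}. F (k - s) \<partial>lborel)"
    by (rule nn_integral_cong) (auto simp: indicator_def)
  finally show ?thesis by simp
qed

subsection \<open>Transport of the transformed state\<close>

text \<open>Measurability and the common bound M hold on the whole line or plane here. For given
  data this is achieved by setting the coefficients and kernels to zero outside their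
  domains.\<close>

locale backstep =
  fixes lam mu q M :: real and \<sigma>pm \<sigma>mp :: "real \<Rightarrow> real"
    and Kuu Kuv Kvu Kvv :: "real \<Rightarrow> real \<Rightarrow> real"
  assumes lam: "0 < lam" and mu: "0 < mu" and q: "q \<noteq> 0" and M: "0 < M"
    and meas[measurable]: "\<sigma>pm \<in> borel_measurable borel" "\<sigma>mp \<in> borel_measurable borel"
      "(\<lambda>(x, \<xi>). Kuu x \<xi>) \<in> borel_measurable (borel \<Otimes>\<^sub>M borel)" "(\<lambda>(x, \<xi>). Kuv x \<xi>) \<in> borel_measurable (borel \<Otimes>\<^sub>M borel)"
      "(\<lambda>(x, \<xi>). Kvu x \<xi>) \<in> borel_measurable (borel \<Otimes>\<^sub>M borel)" "(\<lambda>(x, \<xi>). Kvv x \<xi>) \<in> borel_measurable (borel \<Otimes>\<^sub>M borel)"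
    and bdd: "\<And>x. \<bar>\<sigma>pm x\<bar> \<le> M" "\<And>x. \<bar>\<sigma>mp x\<bar> \<le> M" "\<And>x \<xi>. \<bar>Kuu x \<xi>\<bar> \<le> M" "\<And>x \<xi>. \<bar>Kuv x \<xi>\<bar> \<le> M"
      "\<And>x \<xi>. \<bar>Kvu x \<xi>\<bar> \<le> M" "\<And>x \<xi>. \<bar>Kvv x \<xi>\<bar> \<le> M"
    and kernels: "backstepping_kernels lam mu q \<sigma>pm \<sigma>mp Kuu Kuv Kvu Kvv"
begin

abbreviation "A \<equiv> bt Kuu Kuv"
abbreviation "B \<equiv> bt Kvv Kvu"

lemma lam0: "lam \<noteq> 0" and mu0: "mu \<noteq> 0"
  using lam mu by auto

lemma kernel_bc:
  "AE x in lborel. x \<in> {0..1} \<longrightarrow> (lam + mu) * Kvu x x = - \<sigma>mp x \<and> mu * Kvv x 0 = lam * q * Kvu x 0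
    \<and> (lam + mu) * Kuv x x = \<sigma>pm x \<and> mu * Kuv x 0 = lam * q * Kuu x 0"
proof -
  have "AE x in lborel. x \<in> {0..1} \<longrightarrow> Kvu x x = - \<sigma>mp x / (lam + mu) \<and> Kvv x 0 = lam * q / mu * Kvu x 0 \<and>
      Kuv x x = \<sigma>pm x / (lam + mu) \<and> Kuv x 0 = lam * q / mu * Kuu x 0"
    using kernels unfolding backstepping_kernels_def by blast
  then show ?thesis
    by eventually_elim (use lam mu in \<open>auto simp: field_simps\<close>)
qed

end

locale plant = backstep +
  fixes \<rho> :: real and u0 v0 U :: "real \<Rightarrow> real" and u v :: "real \<Rightarrow> real \<Rightarrow> real"
  assumes sol: "plant_solution lam mu q \<rho> \<sigma>pm \<sigma>mp u0 v0 U u v"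
    and uv_meas[measurable]: "(\<lambda>(t, x). u t x) \<in> borel_measurable (borel \<Otimes>\<^sub>M borel)"
      "(\<lambda>(t, x). v t x) \<in> borel_measurable (borel \<Otimes>\<^sub>M borel)"
begin

definition "w t x = ennreal ((u t x)\<^sup>2 + (v t x)\<^sup>2)"

lemma w_meas[measurable]: "(\<lambda>(t, x). w t x) \<in> borel_measurable (borel \<Otimes>\<^sub>M borel)"
  unfolding w_def by measurable

lemma w_state:
  assumes "0 \<le> t"
  shows "(\<integral>\<^sup>+x\<in>{0..1}. w t x \<partial>lborel) = ennreal ((state_norm (u t) (v t))\<^sup>2)"
proof -
  have L: "L2_on {0..1} (u t)" "L2_on {0..1} (v t)" using sol assms unfolding plant_solution_def by auto
  have "(\<integral>\<^sup>+x\<in>{0..1}. w t x \<partial>lborel) = (\<integral>\<^sup>+x. ennreal ((u t x)\<^sup>2) * indicator {0..1} x + ennreal ((v t x)\<^sup>2) * indicator {0..1} x \<partial>lborel)"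
    by (rule nn_integral_cong) (auto simp: indicator_def w_def)
  also have "\<dots> = ennreal ((L2norm_on {0..1} (u t))\<^sup>2) + ennreal ((L2norm_on {0..1} (v t))\<^sup>2)"
    by (simp add: nn_integral_add nn_integral_L2_on[OF L(1)] nn_integral_L2_on[OF L(2)])
  finally show ?thesis by (simp add: state_norm_def)
qed

lemma w_state_finite: "0 \<le> t \<Longrightarrow> (\<integral>\<^sup>+x\<in>{0..1}. w t x \<partial>lborel) < \<infinity>"
  by (simp add: w_state)

lemma w_strip_finite: "(\<integral>\<^sup>+t\<in>{0..T}. (\<integral>\<^sup>+x\<in>{0..1}. w t x \<partial>lborel) \<partial>lborel) < \<infinity>"
proof -
  define T' where "T' = max T 1"
  let ?S = "{0..T'} \<times> {0..1::real}"
  have L: "L2_on ?S (\<lambda>(t, x). u t x)" "L2_on ?S (\<lambda>(t, x). v t x)"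
    using sol unfolding plant_solution_def T'_def by auto
  have one: "(\<integral>\<^sup>+t\<in>{0..T'}. (\<integral>\<^sup>+x\<in>{0..1}. ennreal ((f t x)\<^sup>2) \<partial>lborel) \<partial>lborel) < \<infinity>"
    if L: "L2_on ?S (\<lambda>(t, x). f t x)" and [measurable]: "(\<lambda>(t, x). f t x) \<in> borel_measurable (borel \<Otimes>\<^sub>M borel)" for f
  proof -
    have "(\<integral>\<^sup>+t\<in>{0..T'}. (\<integral>\<^sup>+x\<in>{0..1}. ennreal ((f t x)\<^sup>2) \<partial>lborel) \<partial>lborel)
      = (\<integral>\<^sup>+t. \<integral>\<^sup>+x. ennreal ((f t x)\<^sup>2) * (indicator {0..T'} t * indicator {0..1} x) \<partial>lborel \<partial>lborel)"
      by (intro nn_integral_cong) (subst nn_integral_multc[symmetric], measurable, simp add: mult_ac)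
    also have "\<dots> = (\<integral>\<^sup>+p. (case p of (t, x) \<Rightarrow> ennreal ((f t x)\<^sup>2) * (indicator {0..T'} t * indicator {0..1} x)) \<partial>(lborel \<Otimes>\<^sub>M lborel))"
      using lborel.nn_integral_fst[of "\<lambda>(t, x). ennreal ((f t x)\<^sup>2) * (indicator {0..T'} t * indicator {0..1} x)" lborel] by simp
    also have "\<dots> = (\<integral>\<^sup>+p\<in>?S. ennreal (((\<lambda>(t, x). f t x) p)\<^sup>2) \<partial>lborel)"
      unfolding lborel_prod by (rule nn_integral_cong) (auto simp: indicator_def)
    also have "\<dots> < \<infinity>" using nn_integral_L2_on[OF L] by simp
    finally show ?thesis .
  qed
  have "(\<integral>\<^sup>+t\<in>{0..T}. (\<integral>\<^sup>+x\<in>{0..1}. w t x \<partial>lborel) \<partial>lborel) \<le> (\<integral>\<^sup>+t\<in>{0..T'}. (\<integral>\<^sup>+x\<in>{0..1}. w t x \<partial>lborel) \<partial>lborel)"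
    by (intro nn_integral_mono) (auto simp: indicator_def T'_def)
  also have "\<dots> = (\<integral>\<^sup>+t. (\<integral>\<^sup>+x\<in>{0..1}. ennreal ((u t x)\<^sup>2) \<partial>lborel) * indicator {0..T'} t + (\<integral>\<^sup>+x\<in>{0..1}. ennreal ((v t x)\<^sup>2) \<partial>lborel) * indicator {0..T'} t \<partial>lborel)"
    by (intro nn_integral_cong) (simp add: w_def distrib_right nn_integral_add)
  also have "\<dots> = (\<integral>\<^sup>+t\<in>{0..T'}. (\<integral>\<^sup>+x\<in>{0..1}. ennreal ((u t x)\<^sup>2) \<partial>lborel) \<partial>lborel) + (\<integral>\<^sup>+t\<in>{0..T'}. (\<integral>\<^sup>+x\<in>{0..1}. ennreal ((v t x)\<^sup>2) \<partial>lborel) \<partial>lborel)"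
    by (rule nn_integral_add) measurable
  also have "\<dots> < \<infinity>" using one[OF L(1)] one[OF L(2)] by simp
  finally show ?thesis .
qed

lemma bc0: "AE t in lborel. 0 < t \<longrightarrow> u t 0 = q * v t 0"
  and bc1: "AE t in lborel. 0 < t \<longrightarrow> v t 1 = \<rho> * u t 1 + U t"
  using sol unfolding plant_solution_def by (auto elim: eventually_mono)

lemma v0_finite: "(\<integral>\<^sup>+t\<in>{0..T}. ennreal ((v t 0)\<^sup>2) \<partial>lborel) < \<infinity>"
proof -
  have L: "L2_on {0..max T 1} (\<lambda>t. v t 0)" using sol unfolding plant_solution_def by auto
  have "(\<integral>\<^sup>+t\<in>{0..T}. ennreal ((v t 0)\<^sup>2) \<partial>lborel) \<le> (\<integral>\<^sup>+t\<in>{0..max T 1}. ennreal ((v t 0)\<^sup>2) \<partial>lborel)"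
    by (intro nn_integral_mono) (auto simp: indicator_def)
  also have "\<dots> < \<infinity>" using nn_integral_L2_on[OF L] by simp
  finally show ?thesis .
qed

text \<open>The solution concept controls only the outgoing trace of v at x = 0; the reflection
  condition transfers this to u.\<close>

lemma w0_finite: "(\<integral>\<^sup>+t\<in>{0..T}. w t 0 \<partial>lborel) < \<infinity>"
proof -
  have "(\<integral>\<^sup>+t\<in>{0..T}. w t 0 \<partial>lborel) \<le> (\<integral>\<^sup>+t. ennreal (q\<^sup>2 + 1) * (ennreal ((v t 0)\<^sup>2) * indicator {0..T} t) \<partial>lborel)"
  proof (rule nn_integral_mono_AE)
    show "AE t in lborel. w t 0 * indicator {0..T} t \<le> ennreal (q\<^sup>2 + 1) * (ennreal ((v t 0)\<^sup>2) * indicator {0..T} t)"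
      using bc0 AE_lborel_singleton[of 0]
    proof eventually_elim
      case (elim t)
      show ?case
      proof (cases "t \<in> {0..T}")
        case True
        then have "u t 0 = q * v t 0" using elim by auto
        then have "w t 0 = ennreal ((q\<^sup>2 + 1) * (v t 0)\<^sup>2)" by (simp only: w_def) (simp add: power_mult_distrib algebra_simps)
        then show ?thesis using True by (simp add: ennreal_mult del: ennreal_plus)
      qed simp
    qed
  qed
  also have "\<dots> < \<infinity>" using v0_finite by (simp add: nn_integral_cmult ennreal_mult_less_top)
  finally show ?thesis .
qed

lemma strip_subset_finite:
  assumes "0 \<le> a"
  shows "(\<integral>\<^sup>+t\<in>{a..b}. (\<integral>\<^sup>+x\<in>{0..1}. w t x \<partial>lborel) \<partial>lborel) < \<infinity>" "(\<integral>\<^sup>+t\<in>{a..b}. w t 0 \<partial>lborel) < \<infinity>"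
proof -
  have "(\<integral>\<^sup>+t\<in>{a..b}. F t \<partial>lborel) \<le> (\<integral>\<^sup>+t\<in>{0..b}. F t \<partial>lborel)" for F :: "real \<Rightarrow> ennreal"
    using assms by (intro nn_integral_mono) (auto simp: indicator_def)
  then show "(\<integral>\<^sup>+t\<in>{a..b}. (\<integral>\<^sup>+x\<in>{0..1}. w t x \<partial>lborel) \<partial>lborel) < \<infinity>" "(\<integral>\<^sup>+t\<in>{a..b}. w t 0 \<partial>lborel) < \<infinity>"
    using w_strip_finite[of b] w0_finite[of b] by (meson le_less_trans)+
qed

text \<open>The only exceptional labels c are those where the equation of u fails on its own
  characteristic. The other exceptional sets belong to families of lines crossing the region below
  that characteristic, and are null within it for every single c.\<close>

lemma alpha_const:
  "AE c in lborel. \<forall>t0 t1. 0 \<le> t0 \<longrightarrow> t0 \<le> t1 \<longrightarrow> 0 \<le> c + lam * t0 \<longrightarrow> c + lam * t1 \<le> 1 \<longrightarrow>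
    A (u t1) (v t1) (c + lam * t1) = A (u t0) (v t0) (c + lam * t0)"
proof -
  have bu: "broad_solution 1 lam ({0..} \<times> {0..1}) u (\<lambda>t x. \<sigma>pm x * v t x)"
    and bv: "broad_solution 1 (- mu) ({0..} \<times> {0..1}) v (\<lambda>t x. \<sigma>mp x * u t x)"
    using sol unfolding plant_solution_def by auto
  have kuu: "broad_solution lam lam triangle Kuu (\<lambda>x \<xi>. - Kuv x \<xi> * \<sigma>mp \<xi>)"
    and kuv: "broad_solution lam (- mu) triangle Kuv (\<lambda>x \<xi>. - Kuu x \<xi> * \<sigma>pm \<xi>)"
    using kernels unfolding backstepping_kernels_def by auto
  show ?thesis
    using bu[unfolded broad_solution_def]
  proof eventually_elim
    case (elim c)
    show ?case
    proof (intro allI impI)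
      fix t0 t1 :: real
      assume t: "0 \<le> t0" "t0 \<le> t1" "0 \<le> c + lam * t0" "c + lam * t1 \<le> 1"
      define x0 where "x0 = c + lam * t0"
      define h where "h = t1 - t0"
      have xh: "x0 + lam * h = c + lam * t1" "x0 + lam * s = c + lam * (t0 + s)" "t0 + h = t1" for s
        by (simp_all add: x0_def h_def algebra_simps)
      have D: "0 \<le> s \<and> s \<le> h \<and> 0 \<le> \<xi> \<and> \<xi> \<le> 1 \<and> \<xi> \<le> x0 + lam * s \<and> x0 + lam * s \<le> 1" if "(s, \<xi>) \<in> trapezoid lam x0 h" for s \<xi>
      proof -
        have s: "0 \<le> s" "s \<le> h" "0 \<le> \<xi>" "\<xi> \<le> x0 + lam * s" using that by (auto simp: trapezoid_def)
        have "lam * s \<le> lam * h" using s lam by simp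
        then show ?thesis using s t(4) xh(1) by linarith
      qed
      have xs: "x0 + lam * s \<in> {0..1}" if "s \<in> {0..h}" for s
      proof -
        have "0 \<le> lam * s" "lam * s \<le> lam * h" using that lam by auto
        then show ?thesis using t(3,4) xh(1) x0_def by auto
      qed
      have sh1: "(\<integral>\<^sup>+s\<in>{0..h}. (\<integral>\<^sup>+\<xi>\<in>{0..1}. w (t0 + s) \<xi> \<partial>lborel) \<partial>lborel) = (\<integral>\<^sup>+t\<in>{t0 + 0..t0 + h}. (\<integral>\<^sup>+\<xi>\<in>{0..1}. w t \<xi> \<partial>lborel) \<partial>lborel)"
        by (rule nn_integral_Icc_shift) measurable
      have sh2: "(\<integral>\<^sup>+s\<in>{0..h}. w (t0 + s) 0 \<partial>lborel) = (\<integral>\<^sup>+t\<in>{t0 + 0..t0 + h}. w t 0 \<partial>lborel)"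
        by (rule nn_integral_Icc_shift) measurable
      have "A (u (t0 + h)) (v (t0 + h)) (x0 + lam * h) = A (u t0) (v t0) x0"
        unfolding bt_def
      proof (rule backstepping_transport[where a = lam and m = mu and h = h and M = M
          and ?k1.0 = "\<lambda>s. Kuu (x0 + lam * s)" and ?k2.0 = "\<lambda>s. Kuv (x0 + lam * s)"
          and ?f1.0 = "\<lambda>s. u (t0 + s)" and ?f2.0 = "\<lambda>s. v (t0 + s)" and ?\<sigma>1.0 = \<sigma>pm and ?\<sigma>2.0 = \<sigma>mp, simplified])
        show "broad_solution 1 lam (trapezoid lam x0 h) (\<lambda>s. Kuu (x0 + lam * s)) (\<lambda>s \<xi>. - (Kuv (x0 + lam * s) \<xi> * \<sigma>mp \<xi>))"
          using broad_solution_shift[OF kuu lam, of "trapezoid lam x0 h" x0] D by (auto simp: triangle_def)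
        show "broad_solution 1 (- mu) (trapezoid lam x0 h) (\<lambda>s. Kuv (x0 + lam * s)) (\<lambda>s \<xi>. - (Kuu (x0 + lam * s) \<xi> * \<sigma>pm \<xi>))"
          using broad_solution_shift[OF kuv lam, of "trapezoid lam x0 h" x0] D by (auto simp: triangle_def)
        show "broad_solution 1 lam (trapezoid lam x0 h) (\<lambda>s. u (t0 + s)) (\<lambda>s \<xi>. \<sigma>pm \<xi> * v (t0 + s) \<xi>)"
          using broad_solution_shift[OF bu zero_less_one, of "trapezoid lam x0 h" t0] D t by force
        show "broad_solution 1 (- mu) (trapezoid lam x0 h) (\<lambda>s. v (t0 + s)) (\<lambda>s \<xi>. \<sigma>mp \<xi> * u (t0 + s) \<xi>)"
          using broad_solution_shift[OF bv zero_less_one, of "trapezoid lam x0 h" t0] D t by force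
        show "(\<integral>\<^sup>+s\<in>{0..h}. (\<integral>\<^sup>+\<xi>\<in>{0..1}. (ennreal ((u (t0 + s) \<xi>)\<^sup>2) + ennreal ((v (t0 + s) \<xi>)\<^sup>2)) \<partial>lborel) \<partial>lborel) < top"
          using sh1 strip_subset_finite(1)[OF t(1), of t1]
          by (simp add: w_def xh)
        show "(\<integral>\<^sup>+s\<in>{0..h}. (ennreal ((u (t0 + s) 0)\<^sup>2) + ennreal ((v (t0 + s) 0)\<^sup>2)) \<partial>lborel) < top"
          using sh2 strip_subset_finite(2)[OF t(1), of t1]
          by (simp add: w_def xh)
        show "(\<integral>\<^sup>+\<xi>\<in>{0..1}. (ennreal ((u t0 \<xi>)\<^sup>2) + ennreal ((v t0 \<xi>)\<^sup>2)) \<partial>lborel) < top"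
          using w_state_finite[OF t(1)] by (simp add: w_def)
        show "(\<integral>\<^sup>+\<xi>\<in>{0..1}. (ennreal ((u (t0 + h) \<xi>)\<^sup>2) + ennreal ((v (t0 + h) \<xi>)\<^sup>2)) \<partial>lborel) < top"
          using w_state_finite[of t1] t by (simp add: w_def xh)
        \<comment> \<open>With u = q v, the kernel condition mu Kuv(x,0) = lam q Kuu(x,0) makes the
          two bottom fluxes equal. Time 0 is removed because the boundary condition of the plant is
          stated for positive times.\<close>
        show "AE s in lborel. 0 \<le> s \<and> s \<le> h \<longrightarrow> lam * (Kuu (x0 + lam * s) 0 * u (t0 + s) 0) = mu * (Kuv (x0 + lam * s) 0 * v (t0 + s) 0)"
          using AE_lborel_affine[OF lam0 kernel_bc, of x0] AE_lborel_affine[OF one_neq_zero bc0, of t0] AE_lborel_singleton[of "- t0"]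
        proof eventually_elim
          case (elim s)
          show ?case
          proof
            assume s: "0 \<le> s \<and> s \<le> h"
            then have "0 < t0 + 1 * s" using elim(3) t by auto
            then have e1: "u (t0 + s) 0 = q * v (t0 + s) 0" using elim(2) by simp
            have "x0 + lam * s \<in> {0..1}" using xs s by simp
            then have e2: "mu * Kuv (x0 + lam * s) 0 = lam * q * Kuu (x0 + lam * s) 0" using elim(1) by simp
            from e1 e2 show "lam * (Kuu (x0 + lam * s) 0 * u (t0 + s) 0) = mu * (Kuv (x0 + lam * s) 0 * v (t0 + s) 0)"
              by algebra
          qed
        qed
        show "AE s in lborel. 0 \<le> s \<and> s \<le> h \<longrightarrow> (lam + mu) * Kuv (x0 + lam * s) (x0 + lam * s) = \<sigma>pm (x0 + lam * s)"
          using AE_lborel_affine[OF lam0 kernel_bc, of x0]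
          by eventually_elim (use xs in auto)
        have *: "set_integrable lborel {t0..t1} (\<lambda>s. \<sigma>pm (c + lam * s) * v s (c + lam * s)) \<and>
          u t1 (c + lam * t1) - u t0 (c + lam * t0) = (LBINT s:{t0..t1}. \<sigma>pm (c + lam * s) * v s (c + lam * s))"
        proof -
          have "lam * t0 \<le> lam * t1" using t lam by simp
          then show ?thesis using elim[rule_format, of t0 t1] t by auto
        qed
        have **: "set_integrable lborel {0 + t0..h + t0} (\<lambda>s. \<sigma>pm (c + lam * s) * v s (c + lam * s))"
          using * by (simp add: h_def)
        show "set_integrable lborel {0..h} (\<lambda>s. \<sigma>pm (x0 + lam * s) * v (t0 + s) (x0 + lam * s))"
          using set_lborel_translate(1)[OF **] unfolding xh(2) by (simp add: add.commute)
        show "u (t0 + h) (x0 + lam * h) - u t0 x0 = (LBINT s:{0..h}. \<sigma>pm (x0 + lam * s) * v (t0 + s) (x0 + lam * s))"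
          using set_lborel_translate(2)[OF **] * unfolding xh by (simp add: add.commute x0_def h_def)
        show "x0 + lam * h \<le> 1" using t(4) xh(1) by simp
        show "0 \<le> x0" "0 \<le> h" using t by (simp_all add: x0_def h_def)
      qed (use lam mu bdd in simp_all)
      then show "A (u t1) (v t1) (c + lam * t1) = A (u t0) (v t0) (c + lam * t0)"
        unfolding xh(1,3) by (simp add: x0_def)
    qed
  qed
qed

text \<open>Backwards in time v moves to the right with speed mu and all sources change sign. The
  transport lemma then applies with k1 = Kvv, k2 = Kvu and with -\<sigma>mp, -\<sigma>pm as
  coefficients.\<close>

lemma beta_const:
  "AE c in lborel. \<forall>t0 t1. 0 \<le> t0 \<longrightarrow> t0 \<le> t1 \<longrightarrow> c - mu * t0 \<le> 1 \<longrightarrow> 0 \<le> c - mu * t1 \<longrightarrow>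
    B (v t1) (u t1) (c - mu * t1) = B (v t0) (u t0) (c - mu * t0)"
proof -
  have bu: "broad_solution 1 lam ({0..} \<times> {0..1}) u (\<lambda>t x. \<sigma>pm x * v t x)"
    and bv: "broad_solution 1 (- mu) ({0..} \<times> {0..1}) v (\<lambda>t x. \<sigma>mp x * u t x)"
    using sol unfolding plant_solution_def by auto
  have kvu: "broad_solution mu (- lam) triangle Kvu (\<lambda>x \<xi>. Kvv x \<xi> * \<sigma>mp \<xi>)"
    and kvv: "broad_solution mu mu triangle Kvv (\<lambda>x \<xi>. Kvu x \<xi> * \<sigma>pm \<xi>)"
    using kernels unfolding backstepping_kernels_def by auto
  show ?thesis
    using bv[unfolded broad_solution_def]
  proof eventually_elim
    case (elim c)
    show ?case
    proof (intro allI impI)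
      fix t0 t1 :: real
      assume t: "0 \<le> t0" "t0 \<le> t1" "c - mu * t0 \<le> 1" "0 \<le> c - mu * t1"
      define x0 where "x0 = c - mu * t1"
      define h where "h = t1 - t0"
      have xh: "x0 + mu * h = c - mu * t0" "x0 + mu * s = c - mu * (t1 - s)" "t1 - h = t0" for s
        by (simp_all add: x0_def h_def algebra_simps)
      have D: "0 \<le> s \<and> s \<le> h \<and> 0 \<le> \<xi> \<and> \<xi> \<le> 1 \<and> \<xi> \<le> x0 + mu * s \<and> x0 + mu * s \<le> 1" if "(s, \<xi>) \<in> trapezoid mu x0 h" for s \<xi>
      proof -
        have s: "0 \<le> s" "s \<le> h" "0 \<le> \<xi>" "\<xi> \<le> x0 + mu * s" using that by (auto simp: trapezoid_def)
        have "mu * s \<le> mu * h" using s mu by simp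
        then show ?thesis using s t(3) xh(1) by linarith
      qed
      have xs: "x0 + mu * s \<in> {0..1}" if "s \<in> {0..h}" for s
      proof -
        have "0 \<le> mu * s" "mu * s \<le> mu * h" using that mu by auto
        then show ?thesis using t(3,4) xh(1) x0_def by auto
      qed
      have t1: "0 \<le> t1" using t by simp
      have sh1: "(\<integral>\<^sup>+s\<in>{0..h}. (\<integral>\<^sup>+\<xi>\<in>{0..1}. w (t1 - s) \<xi> \<partial>lborel) \<partial>lborel) = (\<integral>\<^sup>+t\<in>{t1 - h..t1 - 0}. (\<integral>\<^sup>+\<xi>\<in>{0..1}. w t \<xi> \<partial>lborel) \<partial>lborel)"
        by (rule nn_integral_Icc_reflect) measurable
      have sh2: "(\<integral>\<^sup>+s\<in>{0..h}. w (t1 - s) 0 \<partial>lborel) = (\<integral>\<^sup>+t\<in>{t1 - h..t1 - 0}. w t 0 \<partial>lborel)"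
        by (rule nn_integral_Icc_reflect) measurable
      have "B (v (t1 - h)) (u (t1 - h)) (x0 + mu * h) = B (v t1) (u t1) x0"
        unfolding bt_def
      proof (rule backstepping_transport[where a = mu and m = lam and h = h and M = M
          and ?k1.0 = "\<lambda>s. Kvv (x0 + mu * s)" and ?k2.0 = "\<lambda>s. Kvu (x0 + mu * s)"
          and ?f1.0 = "\<lambda>s. v (t1 - s)" and ?f2.0 = "\<lambda>s. u (t1 - s)" and ?\<sigma>1.0 = "\<lambda>x. - \<sigma>mp x" and ?\<sigma>2.0 = "\<lambda>x. - \<sigma>pm x", simplified])
        show "broad_solution 1 mu (trapezoid mu x0 h) (\<lambda>s. Kvv (x0 + mu * s)) (\<lambda>s \<xi>. Kvu (x0 + mu * s) \<xi> * \<sigma>pm \<xi>)"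
          using broad_solution_shift[OF kvv mu, of "trapezoid mu x0 h" x0] D by (auto simp: triangle_def)
        show "broad_solution 1 (- lam) (trapezoid mu x0 h) (\<lambda>s. Kvu (x0 + mu * s)) (\<lambda>s \<xi>. Kvv (x0 + mu * s) \<xi> * \<sigma>mp \<xi>)"
          using broad_solution_shift[OF kvu mu, of "trapezoid mu x0 h" x0] D by (auto simp: triangle_def)
        have S: "(t1 - s, \<xi>) \<in> {0..} \<times> {0..1}" if "(s, \<xi>) \<in> trapezoid mu x0 h" for s \<xi>
          using D[OF that] t by (auto simp: h_def)
        show "broad_solution 1 mu (trapezoid mu x0 h) (\<lambda>s. v (t1 - s)) (\<lambda>s \<xi>. - (\<sigma>mp \<xi> * u (t1 - s) \<xi>))"
          using broad_solution_reverse[OF bv, of "trapezoid mu x0 h" t1] S by simp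
        show "broad_solution 1 (- lam) (trapezoid mu x0 h) (\<lambda>s. u (t1 - s)) (\<lambda>s \<xi>. - (\<sigma>pm \<xi> * v (t1 - s) \<xi>))"
          using broad_solution_reverse[OF bu, of "trapezoid mu x0 h" t1] S by simp
        show "(\<integral>\<^sup>+s\<in>{0..h}. (\<integral>\<^sup>+\<xi>\<in>{0..1}. (ennreal ((v (t1 - s) \<xi>)\<^sup>2) + ennreal ((u (t1 - s) \<xi>)\<^sup>2)) \<partial>lborel) \<partial>lborel) < top"
          using sh1 strip_subset_finite(1)[OF t(1), of t1]
          by (simp add: w_def xh add.commute)
        show "(\<integral>\<^sup>+s\<in>{0..h}. (ennreal ((v (t1 - s) 0)\<^sup>2) + ennreal ((u (t1 - s) 0)\<^sup>2)) \<partial>lborel) < top"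
          using sh2 strip_subset_finite(2)[OF t(1), of t1]
          by (simp add: w_def xh add.commute)
        show "(\<integral>\<^sup>+\<xi>\<in>{0..1}. (ennreal ((v t1 \<xi>)\<^sup>2) + ennreal ((u t1 \<xi>)\<^sup>2)) \<partial>lborel) < top"
          using w_state_finite[OF t1] by (simp add: w_def add.commute)
        show "(\<integral>\<^sup>+\<xi>\<in>{0..1}. (ennreal ((v (t1 - h) \<xi>)\<^sup>2) + ennreal ((u (t1 - h) \<xi>)\<^sup>2)) \<partial>lborel) < top"
          using w_state_finite[of t0] t by (simp add: w_def xh add.commute)
        show "AE s in lborel. 0 \<le> s \<and> s \<le> h \<longrightarrow> mu * (Kvv (x0 + mu * s) 0 * v (t1 - s) 0) = lam * (Kvu (x0 + mu * s) 0 * u (t1 - s) 0)"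
          using AE_lborel_affine[OF mu0 kernel_bc, of x0] AE_lborel_affine[OF neg_one_neq_zero bc0, of t1] AE_lborel_singleton[of t1]
        proof eventually_elim
          case (elim s)
          show ?case
          proof
            assume s: "0 \<le> s \<and> s \<le> h"
            then have "0 < t1 + (- 1) * s" using elim(3) t by (auto simp: h_def)
            then have e1: "u (t1 - s) 0 = q * v (t1 - s) 0" using elim(2) by simp
            have "x0 + mu * s \<in> {0..1}" using xs s by simp
            then have e2: "mu * Kvv (x0 + mu * s) 0 = lam * q * Kvu (x0 + mu * s) 0" using elim(1) by simp
            from e1 e2 show "mu * (Kvv (x0 + mu * s) 0 * v (t1 - s) 0) = lam * (Kvu (x0 + mu * s) 0 * u (t1 - s) 0)"
              by algebra
          qed
        qed
        show "AE s in lborel. 0 \<le> s \<and> s \<le> h \<longrightarrow> (mu + lam) * Kvu (x0 + mu * s) (x0 + mu * s) = - \<sigma>mp (x0 + mu * s)"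
          using AE_lborel_affine[OF mu0 kernel_bc, of x0]
          by eventually_elim (use xs in \<open>auto simp: add.commute\<close>)
        have *: "set_integrable lborel {t0..t1} (\<lambda>s. \<sigma>mp (c - mu * s) * u s (c - mu * s)) \<and>
          v t1 (c - mu * t1) - v t0 (c - mu * t0) = (LBINT s:{t0..t1}. \<sigma>mp (c - mu * s) * u s (c - mu * s))"
        proof -
          have "mu * t0 \<le> mu * t1" using t mu by simp
          then show ?thesis using elim[rule_format, of t0 t1] t by auto
        qed
        have **: "set_integrable lborel {t1 - h..t1 - 0} (\<lambda>s. \<sigma>mp (c - mu * s) * u s (c - mu * s))"
          using * by (simp add: h_def)
        have i: "set_integrable lborel {0..h} (\<lambda>s. \<sigma>mp (x0 + mu * s) * u (t1 - s) (x0 + mu * s))"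
          and e: "(LBINT s:{0..h}. \<sigma>mp (x0 + mu * s) * u (t1 - s) (x0 + mu * s)) = v t1 (c - mu * t1) - v t0 (c - mu * t0)"
          using set_lborel_reflect[OF **] * unfolding xh(2) by (simp_all add: h_def)
        show "set_integrable lborel {0..h} (\<lambda>s. - (\<sigma>mp (x0 + mu * s) * u (t1 - s) (x0 + mu * s)))"
          using i by (simp add: set_integrable_def)
        show "v (t1 - h) (x0 + mu * h) - v t1 x0 = (LBINT s:{0..h}. - (\<sigma>mp (x0 + mu * s) * u (t1 - s) (x0 + mu * s)))"
        proof -
          have neg: "(LBINT s:{0..h}. - (\<sigma>mp (x0 + mu * s) * u (t1 - s) (x0 + mu * s))) = - (LBINT s:{0..h}. \<sigma>mp (x0 + mu * s) * u (t1 - s) (x0 + mu * s))"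
            by (simp add: set_lebesgue_integral_def)
          show ?thesis unfolding neg e xh(1,3) by (simp add: x0_def)
        qed
        show "x0 + mu * h \<le> 1" using t(3) xh(1) by simp
        show "0 \<le> x0" "0 \<le> h" using t by (simp_all add: x0_def h_def)
      qed (use lam mu bdd in simp_all)
      then show "B (v t1) (u t1) (c - mu * t1) = B (v t0) (u t0) (c - mu * t0)"
        unfolding xh(1,3) by (simp add: x0_def)
    qed
  qed
qed

end

section \<open>The state expressed by the boundary trace\<close>

lemma bt_0: "bt K L f g 0 = f 0"
proof -
  have "(LBINT \<xi>:{0..0}. K 0 \<xi> * f \<xi> + L 0 \<xi> * g \<xi>) = 0"
    unfolding set_lebesgue_integral_def
    by (rule integral_eq_zero_AE) (use AE_lborel_singleton[of 0] in \<open>eventually_elim, auto simp: indicator_def\<close>)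
  then show ?thesis by (simp add: bt_def)
qed

lemma nn_integral_unit_affine:
  fixes F :: "real \<Rightarrow> ennreal"
  assumes [measurable]: "F \<in> borel_measurable borel" and c: "c \<noteq> 0"
  shows "(\<integral>\<^sup>+x\<in>{0..1}. F (k + c * x) \<partial>lborel) = ennreal (1 / \<bar>c\<bar>) * (\<integral>\<^sup>+r\<in>{min k (k + c)..max k (k + c)}. F r \<partial>lborel)"
proof -
  have m: "k + c * x \<in> {min k (k + c)..max k (k + c)} \<longleftrightarrow> x \<in> {0..1}" for x
  proof (cases "0 < c")
    case True
    then have "0 \<le> c * x \<longleftrightarrow> 0 \<le> x" "c * x \<le> c \<longleftrightarrow> x \<le> 1"
      by (simp_all add: zero_le_mult_iff mult_le_cancel_left2)
    then show ?thesis using True by (auto simp: min_def max_def)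
  next
    case False
    then have "c < 0" using c by simp
    then have "c * x \<le> 0 \<longleftrightarrow> 0 \<le> x" "c \<le> c * x \<longleftrightarrow> x \<le> 1"
      by (simp_all add: mult_le_0_iff mult_le_cancel_left1)
    then show ?thesis using \<open>c < 0\<close> by (auto simp: min_def max_def)
  qed
  have "(\<integral>\<^sup>+r\<in>{min k (k + c)..max k (k + c)}. F r \<partial>lborel)
    = ennreal \<bar>c\<bar> * (\<integral>\<^sup>+x. F (k + c * x) * indicator {min k (k + c)..max k (k + c)} (k + c * x) \<partial>lborel)"
    by (rule nn_integral_real_affine[OF _ c]) measurable
  also have "(\<integral>\<^sup>+x. F (k + c * x) * indicator {min k (k + c)..max k (k + c)} (k + c * x) \<partial>lborel) = (\<integral>\<^sup>+x\<in>{0..1}. F (k + c * x) \<partial>lborel)"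
    by (rule nn_integral_cong) (simp only: indicator_def m)
  finally have *: "(\<integral>\<^sup>+r\<in>{min k (k + c)..max k (k + c)}. F r \<partial>lborel) = ennreal \<bar>c\<bar> * (\<integral>\<^sup>+x\<in>{0..1}. F (k + c * x) \<partial>lborel)" .
  have "ennreal (1 / \<bar>c\<bar>) * ennreal \<bar>c\<bar> = 1" using c by (simp flip: ennreal_mult)
  then show ?thesis unfolding * by (simp add: mult.assoc[symmetric])
qed

lemma set_nn_integral_mono_set:
  "S \<subseteq> T \<Longrightarrow> (\<integral>\<^sup>+x\<in>S. F x \<partial>N) \<le> (\<integral>\<^sup>+x\<in>T. F x \<partial>N)"
  by (intro nn_integral_mono mult_left_mono) (auto simp: indicator_def)

context backstep
begin

definition tau :: real where "tau = 1 / lam + 1 / mu"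

lemma tau_pos: "0 < tau" using lam mu by (simp add: tau_def add_pos_pos)

text \<open>The kernel of the functional $\int \kappa_1\alpha + \kappa_2\beta$ as a convolution with the boundary trace of \<open>\<beta>\<close>.\<close>
definition delay_kernel :: "(real \<Rightarrow> real) \<Rightarrow> (real \<Rightarrow> real) \<Rightarrow> real \<Rightarrow> real" where
  "delay_kernel \<kappa>1 \<kappa>2 r = indicator {1 / mu..tau} r * (q * lam * \<kappa>1 (lam * (r - 1 / mu))) + indicator {0..1 / mu} r * (mu * \<kappa>2 (1 - mu * r))"

end

context plant
begin

text \<open>The trace of $\beta$ at $x = 1$, continued to negative times so that transport from $x = 1$
  with reflection at $x = 0$ also reproduces the initial data.\<close>

definition bb :: "real \<Rightarrow> real" where
  "bb r = (if 0 \<le> r then B (v r) (u r) 1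
    else if - (1 / mu) \<le> r then B (v 0) (u 0) (1 + mu * r)
    else if - tau \<le> r then A (u 0) (v 0) (- lam * (r + 1 / mu)) / q else 0)"

lemma A_meas[measurable]: "(\<lambda>(t, x). A (u t) (v t) x) \<in> borel_measurable (borel \<Otimes>\<^sub>M borel)"
  and B_meas[measurable]: "(\<lambda>(t, x). B (v t) (u t) x) \<in> borel_measurable (borel \<Otimes>\<^sub>M borel)"
  by (intro bt_measurable; measurable)+

lemma bb_meas[measurable]: "bb \<in> borel_measurable borel"
proof -
  have "(\<lambda>r. bb r) \<in> borel_measurable borel" unfolding bb_def by measurable
  then show ?thesis .
qed

lemma bb_0: "r < - tau \<Longrightarrow> bb r = 0"
  using lam mu by (auto simp: bb_def tau_def add_nonneg_nonneg) (smt (verit) divide_pos_pos)+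

text \<open>(c - 1) / mu is the time at which the characteristic x + mu t = c meets x = 1. If it is
  negative, the characteristic starts inside the domain, and the continuation of \<open>bb\<close>
  holds the initial value found there.\<close>

lemma beta_rep:
  "AE c in lborel. \<forall>t\<ge>0. c - mu * t \<in> {0..1} \<longrightarrow> B (v t) (u t) (c - mu * t) = bb ((c - 1) / mu)"
  using beta_const
proof eventually_elim
  case (elim c)
  show ?case
  proof (intro allI impI)
    fix t :: real assume t: "0 \<le> t" "c - mu * t \<in> {0..1}"
    show "B (v t) (u t) (c - mu * t) = bb ((c - 1) / mu)"
    proof (cases "1 \<le> c")
      case True
      have "(c - 1) / mu \<le> t" using t mu by (auto simp: field_simps)
      moreover have "c - mu * ((c - 1) / mu) = 1" using mu by simp
      moreover have "0 \<le> (c - 1) / mu" using True mu by simp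
      ultimately show ?thesis using elim[rule_format, of "(c - 1) / mu" t] t by (simp add: bb_def)
    next
      case False
      then have "(c - 1) / mu < 0" using mu by (simp add: divide_neg_pos)
      moreover have "0 \<le> c" using t mu mult_nonneg_nonneg[of mu t] by (auto simp del: mult_nonneg_nonneg)
      then have "- (1 / mu) \<le> (c - 1) / mu" using mu by (simp add: field_simps)
      moreover have "1 + mu * ((c - 1) / mu) = c" using mu by simp
      ultimately show ?thesis using elim[rule_format, of 0 t] t False by (simp add: bb_def)
    qed
  qed
qed

text \<open>At x = 0 the Volterra integral is empty, so v and \<beta> agree there.\<close>

lemma v_trace: "AE t in lborel. 0 < t \<longrightarrow> v t 0 = bb (t - 1 / mu)"
  using AE_lborel_affine[OF mu0 beta_rep, of 0]
proof eventually_elim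
  case (elim t)
  show ?case using elim[rule_format, of t] mu by (auto simp: bt_0 diff_divide_distrib)
qed

text \<open>For c < 0 the characteristic x - lam t = c left x = 0 at time -c / lam, where \<alpha> =
  u = q v = q \<beta>. For c > 0 it carries initial data, and the division by q in the last branch
  of \<open>bb\<close> makes the same formula valid.\<close>

lemma alpha_rep:
  "AE c in lborel. \<forall>t\<ge>0. c + lam * t \<in> {0..1} \<longrightarrow> A (u t) (v t) (c + lam * t) = q * bb (- c / lam - 1 / mu)"
proof -
  have c: "- 1 / lam \<noteq> 0" using lam by simp
  show ?thesis
    using alpha_const AE_lborel_affine[OF c v_trace, of 0] AE_lborel_affine[OF c bc0, of 0] AE_lborel_singleton[of 0]
  proof eventually_elim
    case (elim c)
    show ?case
    proof (intro allI impI)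
      fix t :: real assume t: "0 \<le> t" "c + lam * t \<in> {0..1}"
      show "A (u t) (v t) (c + lam * t) = q * bb (- c / lam - 1 / mu)"
      proof (cases "c < 0")
        case True
        define t0 where "t0 = - c / lam"
        have t0: "0 < t0" "t0 \<le> t" "c + lam * t0 = 0" using True t lam by (auto simp: t0_def field_simps)
        have "u t0 0 = q * v t0 0" "v t0 0 = bb (t0 - 1 / mu)" using elim(2,3) t0(1) by (auto simp: t0_def)
        then show ?thesis using elim(1)[rule_format, of t0 t] t0 t by (simp add: bt_0) (simp add: t0_def)
      next
        case False
        then have c: "0 < c" using elim(4) by simp
        have "c \<le> 1" using t mult_nonneg_nonneg[of lam t] lam by (auto simp del: mult_nonneg_nonneg)
        have r1: "\<not> 0 \<le> - c / lam - 1 / mu" and r2: "\<not> - (1 / mu) \<le> - c / lam - 1 / mu"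
          using c lam mu by (auto simp: not_le add_pos_pos intro: less_trans[of _ 0])
        have r3: "- tau \<le> - c / lam - 1 / mu" and r4: "- lam * (- c / lam - 1 / mu + 1 / mu) = c"
          using \<open>c \<le> 1\<close> lam mu by (auto simp: tau_def field_simps)
        have "bb (- c / lam - 1 / mu) = A (u 0) (v 0) c / q"
          by (simp only: bb_def if_not_P[OF r1] if_not_P[OF r2] if_P[OF r3] r4)
        then show ?thesis using elim(1)[rule_format, of 0 t] t c q by simp
      qed
    qed
  qed
qed

text \<open>At a fixed time the label is a translate of x, so a null set of labels is a null set of
  positions. The representation therefore holds at every t \<ge> 0.\<close>

lemma beta_at:
  assumes "0 \<le> t" shows "AE x in lborel. x \<in> {0..1} \<longrightarrow> B (v t) (u t) x = bb ((t - 1 / mu) + (1 / mu) * x)"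
  using AE_lborel_affine[OF one_neq_zero beta_rep, of "mu * t"]
proof eventually_elim
  case (elim x)
  have "(mu * t + 1 * x - 1) / mu = (t - 1 / mu) + (1 / mu) * x" using mu by (simp add: field_simps)
  then show ?case using elim[rule_format, OF assms] by simp
qed

lemma alpha_at:
  assumes "0 \<le> t" shows "AE x in lborel. x \<in> {0..1} \<longrightarrow> A (u t) (v t) x = q * bb ((t - 1 / mu) + (- 1 / lam) * x)"
  using AE_lborel_affine[OF one_neq_zero alpha_rep, of "- lam * t"]
proof eventually_elim
  case (elim x)
  have e: "- (- lam * t + 1 * x) / lam - 1 / mu = (t - 1 / mu) + (- 1 / lam) * x" using lam by (simp add: field_simps)
  show ?case using elim[rule_format, OF assms] unfolding e[symmetric] by simp
qed

lemma alpha_1: "AE t in lborel. 0 < t \<longrightarrow> A (u t) (v t) 1 = q * bb (t - tau)"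
proof -
  have "- lam \<noteq> 0" using lam by simp
  from AE_lborel_affine[OF this alpha_rep, of 1] show ?thesis
  proof eventually_elim
    case (elim t)
    have "- (1 + - lam * t) / lam - 1 / mu = t - tau" using lam by (simp add: tau_def field_simps)
    then show ?case using elim[rule_format, of t] by simp
  qed
qed

definition f :: "real \<Rightarrow> ennreal" where "f r = ennreal ((bb r)\<^sup>2)"

lemma f_meas[measurable]: "f \<in> borel_measurable borel"
proof -
  have "(\<lambda>r. f r) \<in> borel_measurable borel" unfolding f_def by measurable
  then show ?thesis .
qed

text \<open>After Gronwall, \<alpha> occupies the part [t - tau, t - 1/mu] of the trace and \<beta>
  the part [t - 1/mu, t]. The factors lam and mu are the Jacobians, and q^2 comes from the
  reflection.\<close>

lemma state_le:
  assumes t: "0 \<le> t"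
  shows "(\<integral>\<^sup>+x\<in>{0..1}. w t x \<partial>lborel) \<le> ennreal (8 * exp (16 * M\<^sup>2) * (q\<^sup>2 * lam + mu)) * (\<integral>\<^sup>+s\<in>{t - tau..t}. f s \<partial>lborel)"
proof -
  let ?J = "\<integral>\<^sup>+s\<in>{t - tau..t}. f s \<partial>lborel"
  have sect[measurable]: "u t \<in> borel_measurable borel" "v t \<in> borel_measurable borel"
    using measurable_compose_Pair1[OF _ uv_meas(1), of t] measurable_compose_Pair1[OF _ uv_meas(2), of t] by simp_all
  have "(\<integral>\<^sup>+x\<in>{0..1}. w t x \<partial>lborel) \<le> ennreal (8 * exp (16 * M\<^sup>2)) * (\<integral>\<^sup>+x\<in>{0..1}. ennreal ((A (u t) (v t) x)\<^sup>2 + (B (v t) (u t) x)\<^sup>2) \<partial>lborel)"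
    unfolding w_def using w_state_finite[OF t] by (intro bt_gronwall(1) meas bdd M sect) (simp add: w_def)
  also have "(\<integral>\<^sup>+x\<in>{0..1}. ennreal ((A (u t) (v t) x)\<^sup>2 + (B (v t) (u t) x)\<^sup>2) \<partial>lborel)
    = (\<integral>\<^sup>+x. ennreal (q\<^sup>2) * (f ((t - 1 / mu) + (- 1 / lam) * x) * indicator {0..1} x) + f ((t - 1 / mu) + (1 / mu) * x) * indicator {0..1} x \<partial>lborel)"
  proof (rule nn_integral_cong_AE)
    show "AE x in lborel. ennreal ((A (u t) (v t) x)\<^sup>2 + (B (v t) (u t) x)\<^sup>2) * indicator {0..1} x =
      ennreal (q\<^sup>2) * (f ((t - 1 / mu) + (- 1 / lam) * x) * indicator {0..1} x) + f ((t - 1 / mu) + (1 / mu) * x) * indicator {0..1} x"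
      using alpha_at[OF t] beta_at[OF t]
    proof eventually_elim
      case (elim x)
      show ?case
      proof (cases "x \<in> {0..1}")
        case True
        with elim show ?thesis by (simp add: f_def power_mult_distrib ennreal_mult)
      qed simp
    qed
  qed
  also have "\<dots> = ennreal (q\<^sup>2) * (\<integral>\<^sup>+x\<in>{0..1}. f ((t - 1 / mu) + (- 1 / lam) * x) \<partial>lborel) + (\<integral>\<^sup>+x\<in>{0..1}. f ((t - 1 / mu) + (1 / mu) * x) \<partial>lborel)"
    by (simp add: nn_integral_add nn_integral_cmult)
  also have "\<dots> \<le> ennreal (q\<^sup>2) * (ennreal lam * ?J) + ennreal mu * ?J"
  proof (intro add_mono mult_left_mono)
    have "min (t - 1 / mu) (t - 1 / mu + - 1 / lam) = t - tau" "max (t - 1 / mu) (t - 1 / mu + - 1 / lam) \<le> t"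
      using lam mu by (auto simp: tau_def min_def max_def)
    then have "(\<integral>\<^sup>+r\<in>{min (t - 1 / mu) (t - 1 / mu + - 1 / lam)..max (t - 1 / mu) (t - 1 / mu + - 1 / lam)}. f r \<partial>lborel) \<le> ?J"
      by (intro set_nn_integral_mono_set) auto
    then have "ennreal (1 / \<bar>- 1 / lam\<bar>) * (\<integral>\<^sup>+r\<in>{min (t - 1 / mu) (t - 1 / mu + - 1 / lam)..max (t - 1 / mu) (t - 1 / mu + - 1 / lam)}. f r \<partial>lborel) \<le> ennreal lam * ?J"
      using lam by (intro mult_mono) auto
    then show "(\<integral>\<^sup>+x\<in>{0..1}. f ((t - 1 / mu) + (- 1 / lam) * x) \<partial>lborel) \<le> ennreal lam * ?J"
      using lam by (subst nn_integral_unit_affine) auto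
    have "min (t - 1 / mu) (t - 1 / mu + 1 / mu) \<ge> t - tau" "max (t - 1 / mu) (t - 1 / mu + 1 / mu) = t"
      using lam mu by (auto simp: tau_def min_def max_def)
    then have "(\<integral>\<^sup>+r\<in>{min (t - 1 / mu) (t - 1 / mu + 1 / mu)..max (t - 1 / mu) (t - 1 / mu + 1 / mu)}. f r \<partial>lborel) \<le> ?J"
      by (intro set_nn_integral_mono_set) auto
    then have "ennreal (1 / \<bar>1 / mu\<bar>) * (\<integral>\<^sup>+r\<in>{min (t - 1 / mu) (t - 1 / mu + 1 / mu)..max (t - 1 / mu) (t - 1 / mu + 1 / mu)}. f r \<partial>lborel) \<le> ennreal mu * ?J"
      using mu by (intro mult_mono) auto
    then show "(\<integral>\<^sup>+x\<in>{0..1}. f ((t - 1 / mu) + (1 / mu) * x) \<partial>lborel) \<le> ennreal mu * ?J"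
      using mu by (subst nn_integral_unit_affine) auto
  qed auto
  also have "\<dots> = ennreal (q\<^sup>2 * lam + mu) * ?J"
    using lam mu by (simp add: ennreal_mult distrib_right mult.assoc)
  finally show ?thesis
    using lam mu by (simp add: ennreal_mult mult.assoc mult_left_mono)
qed

text \<open>The reverse comparison at time 0: the continued trace on [-tau, 0] is a rearrangement of
  \<beta>(0,x) and \<alpha>(0,x) / q, with Jacobians 1/mu and 1/lam.\<close>

lemma f_init_le:
  "(\<integral>\<^sup>+s\<in>{- tau..0}. f s \<partial>lborel) \<le> ennreal ((1 / mu + 1 / (lam * q\<^sup>2)) * (2 + 8 * M\<^sup>2)) * (\<integral>\<^sup>+x\<in>{0..1}. w 0 x \<partial>lborel)"
proof -
  let ?a = "\<lambda>x. ennreal ((A (u 0) (v 0) x)\<^sup>2)" and ?b = "\<lambda>x. ennreal ((B (v 0) (u 0) x)\<^sup>2)"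
  let ?W = "\<integral>\<^sup>+x\<in>{0..1}. ennreal ((A (u 0) (v 0) x)\<^sup>2 + (B (v 0) (u 0) x)\<^sup>2) \<partial>lborel"
  have sect[measurable]: "u 0 \<in> borel_measurable borel" "v 0 \<in> borel_measurable borel"
    using measurable_compose_Pair1[OF _ uv_meas(1), of 0] measurable_compose_Pair1[OF _ uv_meas(2), of 0] by simp_all
  have [measurable]: "A (u 0) (v 0) \<in> borel_measurable borel" "B (v 0) (u 0) \<in> borel_measurable borel"
    by (intro bt_measurable1 meas sect)+
  have "(\<integral>\<^sup>+s\<in>{- tau..0}. f s \<partial>lborel) \<le> (\<integral>\<^sup>+s. ennreal (1 / q\<^sup>2) * (?a (- lam / mu + - lam * s) * indicator {0..1} (- lam / mu + - lam * s))
      + ?b (1 + mu * s) * indicator {0..1} (1 + mu * s) \<partial>lborel)"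
  proof (rule nn_integral_mono_AE)
    show "AE s in lborel. f s * indicator {- tau..0} s \<le> ennreal (1 / q\<^sup>2) * (?a (- lam / mu + - lam * s) * indicator {0..1} (- lam / mu + - lam * s))
      + ?b (1 + mu * s) * indicator {0..1} (1 + mu * s)"
      using AE_lborel_singleton[of 0]
    proof eventually_elim
      case (elim s)
      show ?case
      proof (cases "s \<in> {- tau..0}")
        case True
        then have s: "- tau \<le> s" "s < 0" using elim by auto
        show ?thesis
        proof (cases "- (1 / mu) \<le> s")
          case True
          then have "1 + mu * s \<in> {0..1}" using s mu by (auto simp: field_simps mult_le_0_iff)
          moreover have "f s = ?b (1 + mu * s)" using True s by (simp add: f_def bb_def)
          ultimately show ?thesis by (simp add: add_increasing indicator_def)
        next
          case False
          have e: "- lam / mu + - lam * s = - lam * (s + 1 / mu)" by (simp add: algebra_simps)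
          have "0 \<le> - lam * (s + 1 / mu)" using False lam by (auto simp: mult_le_0_iff)
          moreover have "- lam * (s + 1 / mu) \<le> - lam * (- (1 / lam))" using s lam by (intro mult_left_mono_neg) (auto simp: tau_def)
          ultimately have "- lam / mu + - lam * s \<in> {0..1}" unfolding e using lam by simp
          moreover have "f s = ennreal (1 / q\<^sup>2) * ?a (- lam / mu + - lam * s)"
            unfolding e using False s by (simp add: f_def bb_def power_divide ennreal_mult[symmetric])
          ultimately show ?thesis by (simp add: add_increasing2 indicator_def)
        qed
      qed simp
    qed
  qed
  also have "\<dots> = ennreal (1 / q\<^sup>2) * (\<integral>\<^sup>+s. ?a (- lam / mu + - lam * s) * indicator {0..1} (- lam / mu + - lam * s) \<partial>lborel)
      + (\<integral>\<^sup>+s. ?b (1 + mu * s) * indicator {0..1} (1 + mu * s) \<partial>lborel)"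
    by (subst nn_integral_add; (subst nn_integral_cmult)?) measurable
  also have "(\<integral>\<^sup>+s. ?a (- lam / mu + - lam * s) * indicator {0..1} (- lam / mu + - lam * s) \<partial>lborel) = ennreal (1 / lam) * (\<integral>\<^sup>+x\<in>{0..1}. ?a x \<partial>lborel)"
  proof -
    have "(\<integral>\<^sup>+x\<in>{0..1}. ?a x \<partial>lborel) = ennreal \<bar>- lam\<bar> * (\<integral>\<^sup>+s. ?a (- lam / mu + - lam * s) * indicator {0..1} (- lam / mu + - lam * s) \<partial>lborel)"
      using lam by (intro nn_integral_real_affine) auto
    moreover have "ennreal (1 / lam) * ennreal \<bar>- lam\<bar> = 1" using lam by (simp flip: ennreal_mult)
    ultimately show ?thesis by (simp add: mult.assoc[symmetric])
  qed
  also have "(\<integral>\<^sup>+s. ?b (1 + mu * s) * indicator {0..1} (1 + mu * s) \<partial>lborel) = ennreal (1 / mu) * (\<integral>\<^sup>+x\<in>{0..1}. ?b x \<partial>lborel)"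
  proof -
    have "(\<integral>\<^sup>+x\<in>{0..1}. ?b x \<partial>lborel) = ennreal \<bar>mu\<bar> * (\<integral>\<^sup>+s. ?b (1 + mu * s) * indicator {0..1} (1 + mu * s) \<partial>lborel)"
      using mu by (intro nn_integral_real_affine) auto
    moreover have "ennreal (1 / mu) * ennreal \<bar>mu\<bar> = 1" using mu by (simp flip: ennreal_mult)
    ultimately show ?thesis by (simp add: mult.assoc[symmetric])
  qed
  also have "ennreal (1 / q\<^sup>2) * (ennreal (1 / lam) * (\<integral>\<^sup>+x\<in>{0..1}. ?a x \<partial>lborel)) + ennreal (1 / mu) * (\<integral>\<^sup>+x\<in>{0..1}. ?b x \<partial>lborel)
     \<le> ennreal (1 / q\<^sup>2) * (ennreal (1 / lam) * ?W) + ennreal (1 / mu) * ?W"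
    by (intro add_mono mult_left_mono nn_integral_mono mult_right_mono ennreal_leI) auto
  also have "\<dots> = ennreal (1 / mu + 1 / (lam * q\<^sup>2)) * ?W"
  proof -
    have "ennreal (1 / q\<^sup>2) * ennreal (1 / lam) = ennreal (1 / (lam * q\<^sup>2))"
      using lam by (simp add: ennreal_mult[symmetric] mult.commute)
    then show ?thesis using lam mu by (simp add: mult.assoc[symmetric] distrib_right add.commute)
  qed
  also have "\<dots> \<le> ennreal (1 / mu + 1 / (lam * q\<^sup>2)) * (ennreal (2 + 8 * M\<^sup>2) * (\<integral>\<^sup>+x\<in>{0..1}. w 0 x \<partial>lborel))"
    unfolding w_def using w_state_finite[of 0] by (intro mult_left_mono bt_gronwall(2) meas bdd M sect) (auto simp: w_def)
  also have "\<dots> = ennreal ((1 / mu + 1 / (lam * q\<^sup>2)) * (2 + 8 * M\<^sup>2)) * (\<integral>\<^sup>+x\<in>{0..1}. w 0 x \<partial>lborel)"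
    using lam mu by (simp add: ennreal_mult mult.assoc del: ennreal_plus)
  finally show ?thesis .
qed

text \<open>For s \<ge> 0, bb(s) = v(s + 1/mu, 0) almost everywhere. The square-integrable trace of
  v at x = 0 thus controls the trace of \<beta> at x = 1, for which the solution concept gives no
  direct bound.\<close>

lemma f_finite: "(\<integral>\<^sup>+s\<in>{- tau..T}. f s \<partial>lborel) < \<infinity>"
proof -
  have 1: "(\<integral>\<^sup>+s\<in>{- tau..0}. f s \<partial>lborel) < \<infinity>"
    by (rule le_less_trans[OF f_init_le]) (use w_state_finite[of 0] in \<open>simp add: ennreal_mult_less_top\<close>)
  let ?V = "\<lambda>t. ennreal ((v t 0)\<^sup>2)"
  have "(\<integral>\<^sup>+s\<in>{- tau..T}. f s \<partial>lborel) \<le> (\<integral>\<^sup>+s. f s * indicator {- tau..0} s + ?V (1 / mu + s) * indicator {0..T} s \<partial>lborel)"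
  proof (rule nn_integral_mono_AE)
    show "AE s in lborel. f s * indicator {- tau..T} s \<le> f s * indicator {- tau..0} s + ?V (1 / mu + s) * indicator {0..T} s"
      using AE_lborel_affine[OF one_neq_zero v_trace, of "1 / mu"]
    proof eventually_elim
      case (elim s)
      have "0 \<le> s \<Longrightarrow> f s = ?V (1 / mu + s)"
      proof -
        assume "0 \<le> s"
        then have "0 < 1 / mu + s" using mu by (simp add: add_pos_nonneg)
        then show ?thesis using elim by (simp add: f_def)
      qed
      then show ?case by (auto simp: indicator_def)
    qed
  qed
  also have "\<dots> = (\<integral>\<^sup>+s\<in>{- tau..0}. f s \<partial>lborel) + (\<integral>\<^sup>+s\<in>{0..T}. ?V (1 / mu + s) \<partial>lborel)"
    by (rule nn_integral_add) measurable
  also have "(\<integral>\<^sup>+s\<in>{0..T}. ?V (1 / mu + s) \<partial>lborel) = (\<integral>\<^sup>+t\<in>{1 / mu + 0..1 / mu + T}. ?V t \<partial>lborel)"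
    by (rule nn_integral_Icc_shift) measurable
  also have "\<dots> \<le> (\<integral>\<^sup>+t\<in>{0..1 / mu + T}. ?V t \<partial>lborel)"
  proof (rule set_nn_integral_mono_set)
    have "0 \<le> 1 / mu" using mu by simp
    then show "{1 / mu + 0..1 / mu + T} \<subseteq> {0..1 / mu + T}" by (intro subsetI, unfold atLeastAtMost_iff) linarith
  qed
  finally show ?thesis using 1 v0_finite[of "1 / mu + T"] by (auto simp: less_top[symmetric] top_unique)
qed

end

text \<open>Cauchy-Schwarz with weights r1, r2, k. If r1 + r2 + k \<le> 1, the squares keep the
  coefficients r1 and r2 themselves, so that r1 + r2 < 1 is still available in the L2 estimate. A
  cruder splitting would shrink the admissible range of K.\<close>

lemma weighted_square_le:
  fixes r1 r2 k :: real
  assumes "0 \<le> r1" "0 \<le> r2" "0 < k" "\<bar>a\<bar> = r1" "\<bar>b\<bar> = r2"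
  shows "(a * x + b * y + z)\<^sup>2 \<le> (r1 + r2 + k) * (r1 * x\<^sup>2 + r2 * y\<^sup>2 + z\<^sup>2 / k)"
proof -
  define X Y W where "X = \<bar>x\<bar>" "Y = \<bar>y\<bar>" "W = \<bar>z\<bar> / k"
  have "\<bar>a * x + b * y + z\<bar> \<le> \<bar>r1 * X + r2 * Y + k * W\<bar>"
  proof -
    have "\<bar>a * x + b * y + z\<bar> \<le> r1 * X + r2 * Y + k * W"
      using abs_triangle_ineq[of "a * x + b * y" z] abs_triangle_ineq[of "a * x" "b * y"] assms
      by (simp add: X_Y_W_def abs_mult)
    then show ?thesis by linarith
  qed
  then have "(a * x + b * y + z)\<^sup>2 \<le> (r1 * X + r2 * Y + k * W)\<^sup>2" by (simp only: abs_le_square_iff)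
  \<comment> \<open>The defect in the weighted inequality, written explicitly as a sum of squares of
    differences.\<close>
  also have "\<dots> = (r1 + r2 + k) * (r1 * X\<^sup>2 + r2 * Y\<^sup>2 + k * W\<^sup>2)
      - (r1 * r2 * (X - Y)\<^sup>2 + r1 * k * (X - W)\<^sup>2 + r2 * k * (Y - W)\<^sup>2)"
    by (simp add: power2_eq_square algebra_simps)
  also have "\<dots> \<le> (r1 + r2 + k) * (r1 * X\<^sup>2 + r2 * Y\<^sup>2 + k * W\<^sup>2)"
  proof -
    have "0 \<le> r1 * r2 * (X - Y)\<^sup>2" "0 \<le> r1 * k * (X - W)\<^sup>2" "0 \<le> r2 * k * (Y - W)\<^sup>2"
      using assms by simp_all
    then show ?thesis by linarith
  qed
  also have "k * W\<^sup>2 = z\<^sup>2 / k" using assms by (simp add: X_Y_W_def power2_eq_square)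
  finally show ?thesis by (simp add: X_Y_W_def)
qed

section \<open>Convolution with the delay kernel\<close>

context backstep
begin

lemma delay_kernel_meas[measurable]:
  "\<kappa>1 \<in> borel_measurable borel \<Longrightarrow> \<kappa>2 \<in> borel_measurable borel \<Longrightarrow> delay_kernel \<kappa>1 \<kappa>2 \<in> borel_measurable borel"
proof -
  assume [measurable]: "\<kappa>1 \<in> borel_measurable borel" "\<kappa>2 \<in> borel_measurable borel"
  have "(\<lambda>r. delay_kernel \<kappa>1 \<kappa>2 r) \<in> borel_measurable borel" unfolding delay_kernel_def by measurable
  then show "delay_kernel \<kappa>1 \<kappa>2 \<in> borel_measurable borel" .
qed

lemma delay_kernel_supp: "r \<notin> {0..tau} \<Longrightarrow> delay_kernel \<kappa>1 \<kappa>2 r = 0"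
proof -
  assume r: "r \<notin> {0..tau}"
  have "0 \<le> 1 / mu" "1 / mu \<le> tau" using lam mu by (simp_all add: tau_def)
  then have "r \<notin> {1 / mu..tau}" "r \<notin> {0..1 / mu}" using r unfolding atLeastAtMost_iff by linarith+
  then show "delay_kernel \<kappa>1 \<kappa>2 r = 0" by (simp add: delay_kernel_def)
qed

lemma delay_kernel_bdd:
  assumes "\<And>x. \<bar>\<kappa>1 x\<bar> \<le> C" "\<And>x. \<bar>\<kappa>2 x\<bar> \<le> C"
  shows "\<bar>delay_kernel \<kappa>1 \<kappa>2 r\<bar> \<le> \<bar>q * lam\<bar> * C + mu * C"
proof -
  have C: "0 \<le> C" using assms(1)[of 0] by linarith
  have "\<bar>delay_kernel \<kappa>1 \<kappa>2 r\<bar> \<le> \<bar>indicator {1 / mu..tau} r * (q * lam * \<kappa>1 (lam * (r - 1 / mu)))\<bar> + \<bar>indicator {0..1 / mu} r * (mu * \<kappa>2 (1 - mu * r))\<bar>"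
    unfolding delay_kernel_def by (rule abs_triangle_ineq)
  also have "\<dots> \<le> \<bar>q * lam\<bar> * C + mu * C"
    using assms mu C by (intro add_mono) (auto simp: indicator_def abs_mult intro!: mult_left_mono)
  finally show ?thesis .
qed

end

context plant
begin

lemma f_finite': "(\<integral>\<^sup>+s\<in>{a..b}. f s \<partial>lborel) < \<infinity>"
proof -
  have "(\<integral>\<^sup>+s\<in>{a..b}. f s \<partial>lborel) \<le> (\<integral>\<^sup>+s\<in>{- tau..b}. f s \<partial>lborel)"
    by (rule nn_integral_mono) (auto simp: indicator_def f_def bb_0)
  then show ?thesis using f_finite by (rule le_less_trans)
qed

text \<open>The support of h confines Cauchy-Schwarz to the window [t - c, t], so that the bound
  stays local in time.\<close>

lemma convolution_power2_le:
  assumes [measurable]: "h \<in> borel_measurable borel" and supp: "\<And>r. r \<notin> {0..c} \<Longrightarrow> h r = 0"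
  shows "ennreal ((LINT r|lborel. h r * bb (t - r))\<^sup>2) \<le> (\<integral>\<^sup>+r. ennreal ((h r)\<^sup>2) \<partial>lborel) * (\<integral>\<^sup>+s\<in>{t - c..t}. f s \<partial>lborel)"
proof -
  let ?F = "\<lambda>r. h r * bb (t - r)"
  have "ennreal \<bar>LINT r|lborel. ?F r\<bar> \<le> (\<integral>\<^sup>+r. ennreal (norm (?F r)) \<partial>lborel)"
    using integral_norm_bound_ennreal[of lborel ?F]
    by (cases "integrable lborel ?F") (auto simp: not_integrable_integral_eq)
  also have "\<dots> = (\<integral>\<^sup>+r. ennreal \<bar>h r\<bar> * (ennreal \<bar>bb (t - r)\<bar> * indicator {0..c} r) \<partial>lborel)"
    by (rule nn_integral_cong) (use supp in \<open>auto simp: abs_mult ennreal_mult indicator_def\<close>)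
  finally have "(ennreal \<bar>LINT r|lborel. ?F r\<bar>)\<^sup>2 \<le> (\<integral>\<^sup>+r. ennreal \<bar>h r\<bar> * (ennreal \<bar>bb (t - r)\<bar> * indicator {0..c} r) \<partial>lborel)\<^sup>2"
    by (intro power_mono) auto
  also have "\<dots> \<le> (\<integral>\<^sup>+r. (ennreal \<bar>h r\<bar>)\<^sup>2 \<partial>lborel) * (\<integral>\<^sup>+r. (ennreal \<bar>bb (t - r)\<bar> * indicator {0..c} r)\<^sup>2 \<partial>lborel)"
    by (rule Cauchy_Schwarz_nn_integral) measurable
  also have "(\<integral>\<^sup>+r. (ennreal \<bar>bb (t - r)\<bar> * indicator {0..c} r)\<^sup>2 \<partial>lborel) = (\<integral>\<^sup>+r\<in>{0..c}. f (t - r) \<partial>lborel)"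
    by (rule nn_integral_cong) (auto simp: indicator_def f_def ennreal_power)
  also have "\<dots> = (\<integral>\<^sup>+s\<in>{t - c..t - 0}. f s \<partial>lborel)" by (rule nn_integral_Icc_reflect) measurable
  finally show ?thesis by (simp add: ennreal_power)
qed

lemma convolution_integrable:
  assumes [measurable]: "h \<in> borel_measurable borel" and supp: "\<And>r. r \<notin> {0..c} \<Longrightarrow> h r = 0" and bdd: "\<And>r. \<bar>h r\<bar> \<le> C"
  shows "integrable lborel (\<lambda>r. h r * bb (t - r))"
proof (rule integrableI_bounded)
  have C: "0 \<le> C" using bdd[of 0] by linarith
  have "(\<integral>\<^sup>+r. ennreal (norm (h r * bb (t - r))) \<partial>lborel) \<le> (\<integral>\<^sup>+r. ennreal C * (indicator {0..c} r + f (t - r) * indicator {0..c} r) \<partial>lborel)"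
  proof (rule nn_integral_mono)
    fix r
    show "ennreal (norm (h r * bb (t - r))) \<le> ennreal C * (indicator {0..c} r + f (t - r) * indicator {0..c} r)"
    proof (cases "r \<in> {0..c}")
      case True
      have "\<bar>bb (t - r)\<bar> \<le> 1 + (bb (t - r))\<^sup>2"
        using zero_le_power2[of "\<bar>bb (t - r)\<bar> - 1"] by (simp add: power2_eq_square algebra_simps)
      then have "\<bar>h r\<bar> * \<bar>bb (t - r)\<bar> \<le> C * (1 + (bb (t - r))\<^sup>2)" using bdd C by (intro mult_mono) auto
      then have "ennreal (norm (h r * bb (t - r))) \<le> ennreal (C * (1 + (bb (t - r))\<^sup>2))"
        by (intro ennreal_leI) (simp add: abs_mult)
      then show ?thesis using True C by (simp add: f_def ennreal_mult)
    qed (simp add: supp)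
  qed
  also have "\<dots> = ennreal C * ((\<integral>\<^sup>+r. indicator {0..c} r \<partial>lborel) + (\<integral>\<^sup>+r\<in>{0..c}. f (t - r) \<partial>lborel))"
    by (simp add: nn_integral_cmult nn_integral_add)
  also have "(\<integral>\<^sup>+r\<in>{0..c}. f (t - r) \<partial>lborel) = (\<integral>\<^sup>+s\<in>{t - c..t - 0}. f s \<partial>lborel)" by (rule nn_integral_Icc_reflect) measurable
  also have "ennreal C * ((\<integral>\<^sup>+r. indicator {0..c} r \<partial>lborel) + (\<integral>\<^sup>+s\<in>{t - c..t - 0}. f s \<partial>lborel)) < \<infinity>"
    using f_finite'[of "t - c" "t - 0"] by (simp add: ennreal_mult_less_top emeasure_lborel_Icc_eq)
  finally show "(\<integral>\<^sup>+r. ennreal (norm (h r * bb (t - r))) \<partial>lborel) < \<infinity>" .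
qed measurable

lemma sect_meas[measurable]: "u t \<in> borel_measurable borel" "v t \<in> borel_measurable borel"
  using measurable_compose_Pair1[OF _ uv_meas(1), of t] measurable_compose_Pair1[OF _ uv_meas(2), of t] by simp_all

lemma uv_integrable:
  assumes t: "0 \<le> t"
  shows "set_integrable lborel {0..1} (u t)" "set_integrable lborel {0..1} (v t)"
  by (rule L2_on_integrable; use sol t in \<open>simp add: plant_solution_def\<close>)+

text \<open>The lag r of the trace seen at position x is 1/mu + x/lam in \<alpha> and (1 - x)/mu in
  \<beta>. Changing variables from x to r produces the two pieces of the kernel, with the Jacobians
  lam and mu.\<close>

lemma functional_rep:
  assumes [measurable]: "\<kappa>1 \<in> borel_measurable borel" "\<kappa>2 \<in> borel_measurable borel"
    and C: "\<And>x. \<bar>\<kappa>1 x\<bar> \<le> C" "\<And>x. \<bar>\<kappa>2 x\<bar> \<le> C" and t: "0 \<le> t"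
  shows "(LBINT x:{0..1}. \<kappa>1 x * A (u t) (v t) x + \<kappa>2 x * B (v t) (u t) x) = (LINT r|lborel. delay_kernel \<kappa>1 \<kappa>2 r * bb (t - r))"
proof -
  define h1 where "h1 r = indicator {1 / mu..tau} r * (q * lam * \<kappa>1 (lam * (r - 1 / mu)))" for r
  define h2 where "h2 r = indicator {0..1 / mu} r * (mu * \<kappa>2 (1 - mu * r))" for r
  have [measurable]: "h1 \<in> borel_measurable borel" "h2 \<in> borel_measurable borel"
    unfolding h1_def[abs_def] h2_def[abs_def] by measurable
  have N: "delay_kernel \<kappa>1 \<kappa>2 r = h1 r + h2 r" for r by (simp add: delay_kernel_def h1_def h2_def)
  have mt: "0 \<le> 1 / mu" "1 / mu \<le> tau" using lam mu by (simp_all add: tau_def)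
  have C0: "0 \<le> C" using C(1)[of 0] by linarith
  have i1: "integrable lborel (\<lambda>r. h1 r * bb (t - r))"
  proof (rule convolution_integrable[where c = tau and C = "\<bar>q * lam\<bar> * C"])
    show "\<bar>h1 r\<bar> \<le> \<bar>q * lam\<bar> * C" for r using C C0 by (auto simp: h1_def indicator_def abs_mult intro!: mult_left_mono)
    show "h1 r = 0" if "r \<notin> {0..tau}" for r
    proof -
      have "r \<notin> {1 / mu..tau}" using that mt unfolding atLeastAtMost_iff by linarith
      then show ?thesis by (simp add: h1_def)
    qed
  qed measurable
  have i2: "integrable lborel (\<lambda>r. h2 r * bb (t - r))"
  proof (rule convolution_integrable[where c = "1 / mu" and C = "\<bar>mu\<bar> * C"])
    show "\<bar>h2 r\<bar> \<le> \<bar>mu\<bar> * C" for r using C C0 by (auto simp: h2_def indicator_def abs_mult intro!: mult_left_mono)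
    show "h2 r = 0" if "r \<notin> {0..1 / mu}" for r using that by (simp add: h2_def)
  qed measurable
  define G1 where "G1 x = indicator {0..1} x * (\<kappa>1 x * (q * bb ((t - 1 / mu) + (- 1 / lam) * x)))" for x
  define G2 where "G2 x = indicator {0..1} x * (\<kappa>2 x * bb ((t - 1 / mu) + (1 / mu) * x))" for x
  have [measurable]: "G1 \<in> borel_measurable borel" "G2 \<in> borel_measurable borel"
    unfolding G1_def[abs_def] G2_def[abs_def] by measurable
  have e1: "lam * G1 (- lam / mu + lam * r) = h1 r * bb (t - r)" for r
  proof -
    have x: "- lam / mu + lam * r = lam * (r - 1 / mu)" by (simp add: algebra_simps)
    have "lam * (r - 1 / mu) \<in> {0..1} \<longleftrightarrow> r \<in> {1 / mu..tau}"
    proof -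
      have "lam * (r - 1 / mu) \<le> 1 \<longleftrightarrow> r - 1 / mu \<le> 1 / lam" using lam by (simp add: pos_le_divide_eq mult.commute)
      moreover have "0 \<le> lam * (r - 1 / mu) \<longleftrightarrow> 0 \<le> r - 1 / mu" using lam by (simp add: zero_le_mult_iff)
      ultimately show ?thesis by (auto simp: tau_def)
    qed
    moreover have "(t - 1 / mu) + (- 1 / lam) * (lam * (r - 1 / mu)) = t - r" using lam by simp
    ultimately show ?thesis unfolding x G1_def h1_def by (simp add: indicator_def)
  qed
  have e2: "mu * G2 (1 + (- mu) * r) = h2 r * bb (t - r)" for r
  proof -
    have m: "1 + (- mu) * r \<in> {0..1} \<longleftrightarrow> r \<in> {0..1 / mu}"
      using mu by (auto simp: pos_le_divide_eq mult.commute zero_le_mult_iff)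
    have k: "(t - 1 / mu) + (1 / mu) * (1 + (- mu) * r) = t - r" using mu by (simp add: field_simps)
    show ?thesis unfolding G2_def h2_def k indicator_def m by simp
  qed
  have g1: "integrable lborel (\<lambda>r. G1 (- lam / mu + lam * r))" and g2: "integrable lborel (\<lambda>r. G2 (1 + (- mu) * r))"
    using integrable_mult_right[OF i1, of "1 / lam"] integrable_mult_right[OF i2, of "1 / mu"] lam mu
    unfolding e1[symmetric] e2[symmetric] by simp_all
  have G: "integrable lborel G1" "integrable lborel G2"
    using g1 g2 lborel_integrable_real_affine_iff[of lam G1 "- lam / mu"] lborel_integrable_real_affine_iff[of "- mu" G2 1] lam mu by simp_all
  have "(LBINT x:{0..1}. \<kappa>1 x * A (u t) (v t) x + \<kappa>2 x * B (v t) (u t) x) = (LINT x|lborel. G1 x + G2 x)"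
    unfolding set_lebesgue_integral_def
  proof (rule integral_cong_AE)
    have [measurable]: "A (u t) (v t) \<in> borel_measurable borel" "B (v t) (u t) \<in> borel_measurable borel"
      by (intro bt_measurable1 meas sect_meas)+
    show "(\<lambda>x. indicator {0..1} x *\<^sub>R (\<kappa>1 x * A (u t) (v t) x + \<kappa>2 x * B (v t) (u t) x)) \<in> borel_measurable lborel" by measurable
    show "AE x in lborel. indicator {0..1} x *\<^sub>R (\<kappa>1 x * A (u t) (v t) x + \<kappa>2 x * B (v t) (u t) x) = G1 x + G2 x"
      using alpha_at[OF t] beta_at[OF t] by eventually_elim (auto simp: G1_def G2_def indicator_def)
  qed measurable
  also have "\<dots> = integral\<^sup>L lborel G1 + integral\<^sup>L lborel G2" using G by simp
  also have "integral\<^sup>L lborel G1 = (LINT r|lborel. h1 r * bb (t - r))"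
    using lborel_integral_real_affine[of lam G1 "- lam / mu"] lam by (simp flip: e1)
  also have "integral\<^sup>L lborel G2 = (LINT r|lborel. h2 r * bb (t - r))"
    using lborel_integral_real_affine[of "- mu" G2 1] mu by (simp flip: e2)
  also have "(LINT r|lborel. h1 r * bb (t - r)) + (LINT r|lborel. h2 r * bb (t - r)) = (LINT r|lborel. delay_kernel \<kappa>1 \<kappa>2 r * bb (t - r))"
    unfolding N distrib_right using i1 i2 by simp
  finally show ?thesis .
qed

end

context backstep
begin

definition kf :: "real \<Rightarrow> real \<Rightarrow> real" where "kf \<rho> \<xi> = \<rho> * Kuu 1 \<xi> - Kvu 1 \<xi>"
definition kg :: "real \<Rightarrow> real \<Rightarrow> real" where "kg \<rho> \<xi> = \<rho> * Kuv 1 \<xi> - Kvv 1 \<xi>"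

lemma K1_meas[measurable]:
  "Kuu 1 \<in> borel_measurable borel" "Kuv 1 \<in> borel_measurable borel" "Kvu 1 \<in> borel_measurable borel" "Kvv 1 \<in> borel_measurable borel"
  using measurable_compose_Pair1[OF _ meas(3), of 1] measurable_compose_Pair1[OF _ meas(4), of 1]
    measurable_compose_Pair1[OF _ meas(5), of 1] measurable_compose_Pair1[OF _ meas(6), of 1] by simp_all

lemma kfg_meas[measurable]: "kf \<rho> \<in> borel_measurable borel" "kg \<rho> \<in> borel_measurable borel"
  unfolding kf_def[abs_def] kg_def[abs_def] by measurable

lemma kfg_bdd: "\<bar>kf \<rho> x\<bar> \<le> \<bar>\<rho>\<bar> * M + M" "\<bar>kg \<rho> x\<bar> \<le> \<bar>\<rho>\<bar> * M + M"
proof -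
  have "\<bar>\<rho> * a - b\<bar> \<le> \<bar>\<rho>\<bar> * M + M" if "\<bar>a\<bar> \<le> M" "\<bar>b\<bar> \<le> M" for a b
    using abs_triangle_ineq4[of "\<rho> * a" b] that mult_left_mono[OF that(1), of "\<bar>\<rho>\<bar>"] by (simp add: abs_mult)
  then show "\<bar>kf \<rho> x\<bar> \<le> \<bar>\<rho>\<bar> * M + M" "\<bar>kg \<rho> x\<bar> \<le> \<bar>\<rho>\<bar> * M + M"
    unfolding kf_def kg_def using bdd by blast+
qed

end

subsection \<open>The closed loop as a delay equation\<close>

text \<open>\<kappa>1 and \<kappa>2 are parameters tied to the state only by \<open>dual\<close>.
  The same pair serves every delay and all initial data, which is the source of uniformity. \<delta>
  \<le> 1 keeps all memory windows within length tau + 1.\<close>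

locale closed_loop = plant +
  fixes K \<delta> :: real and \<phi> \<kappa>1 \<kappa>2 :: "real \<Rightarrow> real" and Ck :: real
  assumes U: "U = delayed_input \<delta> (U_BS2 \<rho> K Kuu Kuv Kvu Kvv) \<phi> u v" and \<delta>: "0 \<le> \<delta>" "\<delta> \<le> 1"
    and \<phi>: "L2_on {- \<delta>..0} \<phi>"
    and \<kappa>_meas[measurable]: "\<kappa>1 \<in> borel_measurable borel" "\<kappa>2 \<in> borel_measurable borel"
    and \<kappa>_bdd: "\<And>x. \<bar>\<kappa>1 x\<bar> \<le> Ck" "\<And>x. \<bar>\<kappa>2 x\<bar> \<le> Ck"
    and dual: "\<And>f g. set_integrable lborel {0..1} f \<Longrightarrow> set_integrable lborel {0..1} g \<Longrightarrow> f \<in> borel_measurable borel \<Longrightarrow> g \<in> borel_measurable borel \<Longrightarrow>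
      (LBINT \<xi>:{0..1}. kf \<rho> \<xi> * f \<xi> + kg \<rho> \<xi> * g \<xi>) = (LBINT x:{0..1}. \<kappa>1 x * bt Kuu Kuv f g x + \<kappa>2 x * bt Kvv Kvu g f x)"
    and small: "\<bar>\<rho> * q\<bar> + \<bar>K * q\<bar> < 1"
begin

abbreviation "N \<equiv> delay_kernel \<kappa>1 \<kappa>2"

lemma N_shift: "(LINT r|lborel. N r * bb (t - \<delta> - r)) = (LINT r|lborel. N (r - \<delta>) * bb (t - r))"
  using lborel_integral_real_affine[of 1 "\<lambda>r. N (r - \<delta>) * bb (t - r)" \<delta>] by (simp add: diff_diff_eq)

lemma N_diff: "(LINT r|lborel. N r * bb (t - r)) - (LINT r|lborel. N r * bb (t - \<delta> - r)) = (LINT r|lborel. (N r - N (r - \<delta>)) * bb (t - r))"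
proof -
  have 1: "integrable lborel (\<lambda>r. N r * bb (t - r))"
    by (rule convolution_integrable[OF _ delay_kernel_supp delay_kernel_bdd[OF \<kappa>_bdd]]; simp)
  have 2: "integrable lborel (\<lambda>r. N (r - \<delta>) * bb (t - r))"
  proof (rule convolution_integrable[where c = "tau + \<delta>"])
    show "\<bar>N (r - \<delta>)\<bar> \<le> \<bar>q * lam\<bar> * Ck + mu * Ck" for r by (rule delay_kernel_bdd[OF \<kappa>_bdd])
    show "N (r - \<delta>) = 0" if "r \<notin> {0..tau + \<delta>}" for r using that \<delta> by (intro delay_kernel_supp) auto
  qed measurable
  show ?thesis unfolding N_shift left_diff_distrib using 1 2 by simp
qed

lemma functional_eq:
  assumes t: "0 \<le> t"
  shows "\<rho> * (LBINT \<xi>:{0..1}. Kuu 1 \<xi> * u t \<xi> + Kuv 1 \<xi> * v t \<xi>) - (LBINT \<xi>:{0..1}. Kvu 1 \<xi> * u t \<xi> + Kvv 1 \<xi> * v t \<xi>)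
    = (LINT r|lborel. N r * bb (t - r))"
proof -
  note i = uv_integrable[OF t]
  have j: "set_integrable lborel {0..1} (\<lambda>x. Kuu 1 x * u t x)" "set_integrable lborel {0..1} (\<lambda>x. Kuv 1 x * v t x)"
    "set_integrable lborel {0..1} (\<lambda>x. Kvu 1 x * u t x)" "set_integrable lborel {0..1} (\<lambda>x. Kvv 1 x * v t x)"
    by (rule set_integrable_bounded_mult[where D = M]; use i bdd in simp)+
  have e: "kf \<rho> \<xi> * u t \<xi> + kg \<rho> \<xi> * v t \<xi> = \<rho> * (Kuu 1 \<xi> * u t \<xi> + Kuv 1 \<xi> * v t \<xi>) - (Kvu 1 \<xi> * u t \<xi> + Kvv 1 \<xi> * v t \<xi>)" for \<xi>
    by (simp add: kf_def kg_def algebra_simps)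
  have "(LBINT \<xi>:{0..1}. kf \<rho> \<xi> * u t \<xi> + kg \<rho> \<xi> * v t \<xi>) = \<rho> * (LBINT \<xi>:{0..1}. Kuu 1 \<xi> * u t \<xi> + Kuv 1 \<xi> * v t \<xi>) - (LBINT \<xi>:{0..1}. Kvu 1 \<xi> * u t \<xi> + Kvv 1 \<xi> * v t \<xi>)"
    unfolding e
    by (subst set_integral_diff(2)) (use j in \<open>auto intro!: set_integral_add(1)\<close>)
  moreover have "(LBINT \<xi>:{0..1}. kf \<rho> \<xi> * u t \<xi> + kg \<rho> \<xi> * v t \<xi>) = (LINT r|lborel. N r * bb (t - r))"
    unfolding dual[OF i sect_meas] by (rule functional_rep[OF \<kappa>_meas \<kappa>_bdd t])
  ultimately show ?thesis by simp
qed

text \<open>Here bb t = v(t,1) - I2 t and u(t,1) = q bb(t - tau) + I1 t, with I1, I2 the Volterra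
  integrals at x = 1. Reflection with \<rho> produces \<rho> I1 - I2, the functional expressed as N
  * bb, at time t, and the control subtracts it at time t - \<delta>.\<close>

lemma closed_loop_eq:
  "AE t in lborel. 0 < t \<longrightarrow> bb t = \<rho> * (q * bb (t - tau)) + (if t < \<delta> then (LINT r|lborel. N r * bb (t - r)) + \<phi> (t - \<delta>)
    else - K * (q * bb (t - tau - \<delta>)) + (LINT r|lborel. (N r - N (r - \<delta>)) * bb (t - r)))"
  using bc1 alpha_1 AE_lborel_affine[OF one_neq_zero alpha_1, of "- \<delta>"] AE_lborel_singleton[of \<delta>]
proof eventually_elim
  case (elim t)
  show ?case
  proof
    assume t: "0 < t"
    define I1 I2 where "I1 s = (LBINT \<xi>:{0..1}. Kuu 1 \<xi> * u s \<xi> + Kuv 1 \<xi> * v s \<xi>)"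
      and "I2 s = (LBINT \<xi>:{0..1}. Kvu 1 \<xi> * u s \<xi> + Kvv 1 \<xi> * v s \<xi>)" for s
    have A1: "A (u s) (v s) 1 = u s 1 - I1 s" for s by (simp add: bt_def I1_def)
    have B1: "B (v s) (u s) 1 = v s 1 - I2 s" for s by (simp add: bt_def I2_def add.commute)
    have bbt: "bb t = v t 1 - I2 t" using t by (simp add: bb_def B1)
    have v1: "v t 1 = \<rho> * u t 1 + U t" using elim(1) t by simp
    have u1: "u t 1 = q * bb (t - tau) + I1 t" using elim(2) t by (simp add: A1)
    have F: "\<rho> * I1 s - I2 s = (LINT r|lborel. N r * bb (s - r))" if "0 \<le> s" for s
      using functional_eq[OF that] by (simp add: I1_def I2_def)
    show "bb t = \<rho> * (q * bb (t - tau)) + (if t < \<delta> then (LINT r|lborel. N r * bb (t - r)) + \<phi> (t - \<delta>)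
      else - K * (q * bb (t - tau - \<delta>)) + (LINT r|lborel. (N r - N (r - \<delta>)) * bb (t - r)))"
    proof (cases "t < \<delta>")
      case True
      then have "U t = \<phi> (t - \<delta>)" by (simp add: U delayed_input_def)
      then have "bb t = \<rho> * (q * bb (t - tau)) + ((\<rho> * I1 t - I2 t) + \<phi> (t - \<delta>))"
        unfolding bbt v1 u1 by (simp add: algebra_simps)
      then show ?thesis using True t by (simp add: F)
    next
      case False
      then have s: "0 < t - \<delta>" using elim(4) by simp
      then have u1s: "u (t - \<delta>) 1 = q * bb (t - tau - \<delta>) + I1 (t - \<delta>)" using elim(3) by (simp add: A1 algebra_simps)
      have "U t = - K * u (t - \<delta>) 1 - (\<rho> - K) * I1 (t - \<delta>) + I2 (t - \<delta>)"
        using False by (simp add: U delayed_input_def U_BS2_def I1_def I2_def)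
      \<comment> \<open>Substituting u(t - \<delta>, 1), the multiples of K I1 cancel. This is the
        purpose of the factor \<rho> - K in the control law.\<close>
      then have "bb t = \<rho> * (q * bb (t - tau)) + (- K * (q * bb (t - tau - \<delta>)) + ((\<rho> * I1 t - I2 t) - (\<rho> * I1 (t - \<delta>) - I2 (t - \<delta>))))"
        unfolding bbt v1 u1 u1s by (simp add: algebra_simps)
      then show ?thesis using False t s by (simp add: F N_diff)
    qed
  qed
qed

text \<open>Half of the gap below 1, reserved as the weight of the convolution term in the weighted
  square; the other half is left for the decay rate.\<close>

definition "kk = (1 - (\<bar>\<rho> * q\<bar> + \<bar>K * q\<bar>)) / 2"

lemma kk: "0 < kk" "\<bar>\<rho> * q\<bar> + \<bar>K * q\<bar> + kk \<le> 1"
  using small by (auto simp: kk_def field_simps)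

text \<open>Squared contribution of the initial input: the weight 1/kk, doubled when the input is
  separated from the convolution. The indicator provides global measurability.\<close>

definition "g t = ennreal (2 / kk) * ennreal ((indicator {- \<delta>..0} (t - \<delta>) * \<phi> (t - \<delta>))\<^sup>2)"

lemma \<phi>_meas[measurable]: "(\<lambda>s. indicator {- \<delta>..0} s * \<phi> s) \<in> borel_measurable borel"
  using \<phi> by (simp add: L2_on_def set_borel_measurable_def)

lemma g_meas[measurable]: "g \<in> borel_measurable borel"
proof -
  have "(\<lambda>t. g t) \<in> borel_measurable borel" unfolding g_def
    using measurable_compose[OF _ \<phi>_meas, of "\<lambda>t. t - \<delta>" borel] by simp
  then show ?thesis .
qed

lemma g_integral: "(\<integral>\<^sup>+t\<in>{0..\<delta>}. g t \<partial>lborel) = ennreal (2 / kk * (L2norm_on {- \<delta>..0} \<phi>)\<^sup>2)"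
proof -
  let ?G = "\<lambda>s. ennreal ((indicator {- \<delta>..0} s * \<phi> s)\<^sup>2)"
  have "(\<integral>\<^sup>+t\<in>{0..\<delta>}. g t \<partial>lborel) = (\<integral>\<^sup>+t. ennreal (2 / kk) * (?G (- \<delta> + t) * indicator {0..\<delta>} t) \<partial>lborel)"
    by (rule nn_integral_cong) (simp add: g_def mult.assoc)
  also have "\<dots> = ennreal (2 / kk) * (\<integral>\<^sup>+t\<in>{0..\<delta>}. ?G (- \<delta> + t) \<partial>lborel)" by (rule nn_integral_cmult) measurable
  also have "(\<integral>\<^sup>+t\<in>{0..\<delta>}. ?G (- \<delta> + t) \<partial>lborel) = (\<integral>\<^sup>+s\<in>{- \<delta> + 0..- \<delta> + \<delta>}. ?G s \<partial>lborel)"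
    by (rule nn_integral_Icc_shift) measurable
  also have "\<dots> = (\<integral>\<^sup>+s\<in>{- \<delta>..0}. ennreal ((\<phi> s)\<^sup>2) \<partial>lborel)"
    by (rule nn_integral_cong) (auto simp: indicator_def)
  also have "\<dots> = ennreal ((L2norm_on {- \<delta>..0} \<phi>)\<^sup>2)" by (rule nn_integral_L2_on[OF \<phi>])
  finally show ?thesis using kk(1) by (subst ennreal_mult) auto
qed

text \<open>After time \<delta> the convolution enters only through the difference N - N(. -
  \<delta>), with small norm e2. Before that nothing is subtracted, and the full norm N2 appears,
  but for a duration \<delta> only.\<close>

lemma f_le:
  assumes e2: "(\<integral>\<^sup>+r. ennreal ((N r - N (r - \<delta>))\<^sup>2) \<partial>lborel) \<le> ennreal e2" "0 \<le> e2"
    and N2: "(\<integral>\<^sup>+r. ennreal ((N r)\<^sup>2) \<partial>lborel) \<le> ennreal N2" "0 \<le> N2"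
  shows "AE t in lborel. 0 < t \<longrightarrow> f t \<le> ennreal \<bar>\<rho> * q\<bar> * f (t - tau) + ennreal \<bar>K * q\<bar> * f (t - tau - \<delta>)
        + ennreal (e2 / kk) * (\<integral>\<^sup>+s\<in>{t - tau - \<delta>..t}. f s \<partial>lborel)
        + (if t < \<delta> then ennreal (2 * N2 / kk) * (\<integral>\<^sup>+s\<in>{t - tau - \<delta>..t}. f s \<partial>lborel) + g t else 0)"
  using closed_loop_eq
proof eventually_elim
  case (elim t)
  show ?case
  proof
    assume t: "0 < t"
    let ?J = "\<integral>\<^sup>+s\<in>{t - tau - \<delta>..t}. f s \<partial>lborel"
    have sq: "ennreal ((\<rho> * q * x + - K * q * y + z)\<^sup>2) \<le> ennreal \<bar>\<rho> * q\<bar> * ennreal (x\<^sup>2) + ennreal \<bar>K * q\<bar> * ennreal (y\<^sup>2) + ennreal (1 / kk) * ennreal (z\<^sup>2)" for x y z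
    proof -
      have "(\<rho> * q * x + - K * q * y + z)\<^sup>2 \<le> (\<bar>\<rho> * q\<bar> + \<bar>K * q\<bar> + kk) * (\<bar>\<rho> * q\<bar> * x\<^sup>2 + \<bar>K * q\<bar> * y\<^sup>2 + z\<^sup>2 / kk)"
        by (rule weighted_square_le) (use kk in \<open>auto simp: abs_mult\<close>)
      also have "\<dots> \<le> 1 * (\<bar>\<rho> * q\<bar> * x\<^sup>2 + \<bar>K * q\<bar> * y\<^sup>2 + z\<^sup>2 / kk)"
        using kk by (intro mult_right_mono) (auto intro!: add_nonneg_nonneg)
      finally have "ennreal ((\<rho> * q * x + - K * q * y + z)\<^sup>2) \<le> ennreal (\<bar>\<rho> * q\<bar> * x\<^sup>2 + \<bar>K * q\<bar> * y\<^sup>2 + 1 / kk * z\<^sup>2)"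
        by (intro ennreal_leI) simp
      also have "\<dots> = ennreal (\<bar>\<rho> * q\<bar> * x\<^sup>2) + ennreal (\<bar>K * q\<bar> * y\<^sup>2) + ennreal (1 / kk * z\<^sup>2)"
        using kk by (simp add: ennreal_plus[symmetric] del: ennreal_plus)
      finally show ?thesis using kk by (simp add: ennreal_mult[symmetric])
    qed
    show "f t \<le> ennreal \<bar>\<rho> * q\<bar> * f (t - tau) + ennreal \<bar>K * q\<bar> * f (t - tau - \<delta>) + ennreal (e2 / kk) * ?J
        + (if t < \<delta> then ennreal (2 * N2 / kk) * ?J + g t else 0)"
    proof (cases "t < \<delta>")
      case True
      define I where "I = (LINT r|lborel. N r * bb (t - r))"
      have I: "ennreal (I\<^sup>2) \<le> ennreal N2 * ?J"
      proof -
        have "ennreal (I\<^sup>2) \<le> (\<integral>\<^sup>+r. ennreal ((N r)\<^sup>2) \<partial>lborel) * (\<integral>\<^sup>+s\<in>{t - tau..t}. f s \<partial>lborel)"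
          unfolding I_def by (rule convolution_power2_le[OF _ delay_kernel_supp]) simp_all
        also have "\<dots> \<le> ennreal N2 * ?J"
          using \<delta> by (intro mult_mono N2(1) set_nn_integral_mono_set) auto
        finally show ?thesis .
      qed
      have "bb t = \<rho> * q * bb (t - tau) + - K * q * 0 + (I + \<phi> (t - \<delta>))" using elim t True by (simp add: I_def)
      then have "f t \<le> ennreal \<bar>\<rho> * q\<bar> * f (t - tau) + ennreal \<bar>K * q\<bar> * ennreal (0\<^sup>2) + ennreal (1 / kk) * ennreal ((I + \<phi> (t - \<delta>))\<^sup>2)"
        unfolding f_def by (simp only: sq)
      also have "ennreal (1 / kk) * ennreal ((I + \<phi> (t - \<delta>))\<^sup>2) \<le> ennreal (2 * N2 / kk) * ?J + g t"
      proof -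
        have "ennreal ((I + \<phi> (t - \<delta>))\<^sup>2) \<le> ennreal (2 * (I\<^sup>2 + (\<phi> (t - \<delta>))\<^sup>2))" by (intro ennreal_leI add_square_le)
        also have "\<dots> = 2 * ennreal (I\<^sup>2) + 2 * ennreal ((\<phi> (t - \<delta>))\<^sup>2)" by (simp add: ennreal_mult distrib_left)
        also have "\<dots> \<le> 2 * (ennreal N2 * ?J) + 2 * ennreal ((\<phi> (t - \<delta>))\<^sup>2)" by (intro add_mono mult_left_mono I) auto
        finally have "ennreal (1 / kk) * ennreal ((I + \<phi> (t - \<delta>))\<^sup>2) \<le> ennreal (1 / kk) * (2 * (ennreal N2 * ?J) + 2 * ennreal ((\<phi> (t - \<delta>))\<^sup>2))"
          by (intro mult_left_mono) auto
        also have "\<dots> = (ennreal (1 / kk) * 2 * ennreal N2) * ?J + (ennreal (1 / kk) * 2) * ennreal ((\<phi> (t - \<delta>))\<^sup>2)"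
          by (simp add: distrib_left mult.assoc)
        also have two: "ennreal (1 / kk) * 2 = ennreal (2 / kk)" using ennreal_mult[of "1 / kk" 2] kk by simp
        also have "ennreal (2 / kk) * ennreal N2 = ennreal (2 * N2 / kk)" using kk N2 by (simp add: ennreal_mult[symmetric])
        also have "ennreal (2 / kk) * ennreal ((\<phi> (t - \<delta>))\<^sup>2) = g t" using t True by (simp add: g_def)
        finally show ?thesis .
      qed
      finally have "f t \<le> ennreal \<bar>\<rho> * q\<bar> * f (t - tau) + (ennreal (2 * N2 / kk) * ?J + g t)" by (simp add: add_left_mono)
      also have "\<dots> \<le> (ennreal \<bar>\<rho> * q\<bar> * f (t - tau) + ennreal \<bar>K * q\<bar> * f (t - tau - \<delta>) + ennreal (e2 / kk) * ?J) + (ennreal (2 * N2 / kk) * ?J + g t)"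
        by (intro add_right_mono) (simp add: add.assoc)
      finally show ?thesis using True by simp
    next
      case False
      define I where "I = (LINT r|lborel. (N r - N (r - \<delta>)) * bb (t - r))"
      have "ennreal (I\<^sup>2) \<le> (\<integral>\<^sup>+r. ennreal ((N r - N (r - \<delta>))\<^sup>2) \<partial>lborel) * (\<integral>\<^sup>+s\<in>{t - (tau + \<delta>)..t}. f s \<partial>lborel)"
        unfolding I_def
      proof (rule convolution_power2_le)
        show "N r - N (r - \<delta>) = 0" if "r \<notin> {0..tau + \<delta>}" for r
          using that \<delta> delay_kernel_supp[of r] delay_kernel_supp[of "r - \<delta>"] by auto
      qed measurable
      also have "\<dots> \<le> ennreal e2 * (\<integral>\<^sup>+s\<in>{t - (tau + \<delta>)..t}. f s \<partial>lborel)" by (intro mult_right_mono e2) auto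
      finally have I: "ennreal (I\<^sup>2) \<le> ennreal e2 * ?J" by (simp add: diff_diff_eq)
      have "bb t = \<rho> * q * bb (t - tau) + - K * q * bb (t - tau - \<delta>) + I" using elim t False by (simp add: I_def)
      then have "f t \<le> ennreal \<bar>\<rho> * q\<bar> * f (t - tau) + ennreal \<bar>K * q\<bar> * f (t - tau - \<delta>) + ennreal (1 / kk) * ennreal (I\<^sup>2)"
        unfolding f_def by (simp only: sq)
      also have "ennreal (1 / kk) * ennreal (I\<^sup>2) \<le> ennreal (1 / kk) * (ennreal e2 * ?J)" by (intro mult_left_mono I) auto
      also have "\<dots> = ennreal (e2 / kk) * ?J"
      proof -
        have "ennreal (1 / kk) * ennreal e2 = ennreal (e2 / kk)" using kk e2(2) by (simp add: ennreal_mult[symmetric])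
        then show ?thesis by (simp only: mult.assoc[symmetric])
      qed
      finally show ?thesis using False by (simp add: add_left_mono)
    qed
  qed
qed

text \<open>The weighted bound is applied with cut-off T = t and its constants do not depend on t.
  Combined with the two comparisons between state and trace, it yields a pointwise decay in
  time.\<close>

lemma decay:
  fixes \<eta> e2 N2 gap t :: real
  defines "e \<equiv> exp (2 * \<eta> * (tau + 1))"
  assumes e2: "(\<integral>\<^sup>+r. ennreal ((N r - N (r - \<delta>))\<^sup>2) \<partial>lborel) \<le> ennreal e2" "0 \<le> e2"
    and N2: "(\<integral>\<^sup>+r. ennreal ((N r)\<^sup>2) \<partial>lborel) \<le> ennreal N2" "0 \<le> N2"
    and \<eta>: "0 < \<eta>" and gap: "0 < gap"
    and \<kappa>: "(\<bar>\<rho> * q\<bar> + \<bar>K * q\<bar> + e2 / kk * (tau + 1) + 2 * N2 / kk * \<delta>) * e \<le> 1 - gap"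
    and t: "0 \<le> t"
  shows "(state_norm (u t) (v t))\<^sup>2 \<le> (8 * exp (16 * M\<^sup>2) * (q\<^sup>2 * lam + mu)) * (e / gap)
      * ((1 / mu + 1 / (lam * q\<^sup>2)) * (2 + 8 * M\<^sup>2) + e * (2 / kk)) * exp (- 2 * \<eta> * t)
      * ((state_norm (u 0) (v 0))\<^sup>2 + (L2norm_on {- \<delta>..0} \<phi>)\<^sup>2)"
proof -
  let ?C = "8 * exp (16 * M\<^sup>2) * (q\<^sup>2 * lam + mu)" and ?D = "(1 / mu + 1 / (lam * q\<^sup>2)) * (2 + 8 * M\<^sup>2)"
  let ?k = "(\<bar>\<rho> * q\<bar> + \<bar>K * q\<bar> + e2 / kk * (tau + 1) + 2 * N2 / kk * \<delta>) * e"
  let ?S = "(state_norm (u 0) (v 0))\<^sup>2" and ?P = "(L2norm_on {- \<delta>..0} \<phi>)\<^sup>2"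
  have e: "1 \<le> e" using \<eta> tau_pos by (simp add: e_def)
  have C: "0 \<le> ?C" and D: "0 \<le> ?D" using lam mu by auto
  have "?k < 1" using \<kappa> gap by linarith
  have w: "(\<integral>\<^sup>+s\<in>{- tau..t}. ennreal (exp (2 * \<eta> * s)) * f s \<partial>lborel)
    \<le> ennreal (1 / (1 - ?k)) * ((\<integral>\<^sup>+s\<in>{- tau..0}. f s \<partial>lborel) + ennreal e * (\<integral>\<^sup>+s\<in>{0..\<delta>}. g s \<partial>lborel))"
    unfolding e_def
    by (rule weighted_decay[OF f_meas g_meas tau_pos \<delta> \<eta> _ _ _ _ t _ f_le[OF e2 N2] _ \<open>?k < 1\<close>[unfolded e_def]])
      (use kk e2 N2 f_finite in \<open>auto simp: f_def bb_0\<close>)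
  have "(\<integral>\<^sup>+s\<in>{- tau..0}. f s \<partial>lborel) + ennreal e * (\<integral>\<^sup>+s\<in>{0..\<delta>}. g s \<partial>lborel) \<le> ennreal (?D * ?S + e * (2 / kk * ?P))"
  proof -
    have "(\<integral>\<^sup>+s\<in>{- tau..0}. f s \<partial>lborel) \<le> ennreal (?D * ?S)"
      using f_init_le D unfolding w_state[OF order_refl] by (simp add: ennreal_mult)
    moreover have "ennreal e * (\<integral>\<^sup>+s\<in>{0..\<delta>}. g s \<partial>lborel) = ennreal (e * (2 / kk * ?P))"
      unfolding g_integral using e kk by (subst ennreal_mult) auto
    ultimately have "(\<integral>\<^sup>+s\<in>{- tau..0}. f s \<partial>lborel) + ennreal e * (\<integral>\<^sup>+s\<in>{0..\<delta>}. g s \<partial>lborel) \<le> ennreal (?D * ?S) + ennreal (e * (2 / kk * ?P))"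
      by (simp add: add_right_mono)
    also have "\<dots> = ennreal (?D * ?S + e * (2 / kk * ?P))" using D e kk by (intro ennreal_plus[symmetric]) auto
    finally show ?thesis .
  qed
  also have "\<dots> \<le> ennreal ((?D + e * (2 / kk)) * (?S + ?P))"
  proof (rule ennreal_leI)
    have "0 \<le> ?D * ?P" "0 \<le> e * (2 / kk) * ?S" using D e kk by auto
    then show "?D * ?S + e * (2 / kk * ?P) \<le> (?D + e * (2 / kk)) * (?S + ?P)" by (simp add: distrib_left distrib_right)
  qed
  finally have w2: "(\<integral>\<^sup>+s\<in>{- tau..t}. ennreal (exp (2 * \<eta> * s)) * f s \<partial>lborel) \<le> ennreal (1 / gap) * ennreal ((?D + e * (2 / kk)) * (?S + ?P))"
    using w \<kappa> gap by (elim order_trans) (intro mult_mono ennreal_leI, auto simp: frac_le)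
  have "(\<integral>\<^sup>+s\<in>{t - tau..t}. f s \<partial>lborel) \<le> (\<integral>\<^sup>+s. ennreal (e * exp (- 2 * \<eta> * t)) * (ennreal (exp (2 * \<eta> * s)) * f s * indicator {- tau..t} s) \<partial>lborel)"
  proof (rule nn_integral_mono)
    fix s
    show "f s * indicator {t - tau..t} s \<le> ennreal (e * exp (- 2 * \<eta> * t)) * (ennreal (exp (2 * \<eta> * s)) * f s * indicator {- tau..t} s)"
    proof (cases "s \<in> {t - tau..t}")
      case True
      \<comment> \<open>On the window s \<ge> t - tau, so the weight exp(2 \<eta> s) is at least
        exp(2 \<eta> t) / e. This extracts the exponential factor.\<close>
      have "0 \<le> 2 * \<eta> * (tau + 1 - t + s)" using True \<eta> by (intro mult_nonneg_nonneg) auto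
      then have "0 \<le> 2 * \<eta> * (tau + 1) + - 2 * \<eta> * t + 2 * \<eta> * s" by (simp add: algebra_simps)
      then have "1 \<le> e * exp (- 2 * \<eta> * t) * exp (2 * \<eta> * s)" unfolding e_def exp_add[symmetric] by simp
      then have "1 \<le> ennreal (e * exp (- 2 * \<eta> * t)) * ennreal (exp (2 * \<eta> * s))"
        using e by (subst ennreal_mult[symmetric]) auto
      then have "1 * f s \<le> ennreal (e * exp (- 2 * \<eta> * t)) * ennreal (exp (2 * \<eta> * s)) * f s" by (intro mult_right_mono) auto
      then show ?thesis using True t by (simp add: mult.assoc)
    qed simp
  qed
  also have "\<dots> = ennreal (e * exp (- 2 * \<eta> * t)) * (\<integral>\<^sup>+s\<in>{- tau..t}. ennreal (exp (2 * \<eta> * s)) * f s \<partial>lborel)"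
    by (rule nn_integral_cmult) measurable
  also have "\<dots> \<le> ennreal (e * exp (- 2 * \<eta> * t)) * (ennreal (1 / gap) * ennreal ((?D + e * (2 / kk)) * (?S + ?P)))"
    by (intro mult_left_mono w2) auto
  finally have "(\<integral>\<^sup>+s\<in>{t - tau..t}. f s \<partial>lborel) \<le> ennreal (e * exp (- 2 * \<eta> * t) * (1 / gap * ((?D + e * (2 / kk)) * (?S + ?P))))"
  proof -
    let ?X = "(?D + e * (2 / kk)) * (?S + ?P)"
    have X: "0 \<le> ?X" using D e kk lam mu by (intro mult_nonneg_nonneg add_nonneg_nonneg) auto
    have "ennreal (1 / gap) * ennreal ?X = ennreal (1 / gap * ?X)" using gap X by (intro ennreal_mult[symmetric]) auto
    moreover have "ennreal (e * exp (- 2 * \<eta> * t)) * ennreal (1 / gap * ?X) = ennreal (e * exp (- 2 * \<eta> * t) * (1 / gap * ?X))"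
      using gap X e by (intro ennreal_mult[symmetric]) auto
    ultimately show "(\<integral>\<^sup>+s\<in>{t - tau..t}. f s \<partial>lborel) \<le> ennreal (e * exp (- 2 * \<eta> * t)) * (ennreal (1 / gap) * ennreal ?X)
      \<Longrightarrow> (\<integral>\<^sup>+s\<in>{t - tau..t}. f s \<partial>lborel) \<le> ennreal (e * exp (- 2 * \<eta> * t) * (1 / gap * ?X))"
      by (simp only:)
  qed
  then have "ennreal ?C * (\<integral>\<^sup>+s\<in>{t - tau..t}. f s \<partial>lborel) \<le> ennreal ?C * ennreal (e * exp (- 2 * \<eta> * t) * (1 / gap * ((?D + e * (2 / kk)) * (?S + ?P))))"
    by (intro mult_left_mono) auto
  with state_le[OF t] have "ennreal ((state_norm (u t) (v t))\<^sup>2) \<le> ennreal ?C * ennreal (e * exp (- 2 * \<eta> * t) * (1 / gap * ((?D + e * (2 / kk)) * (?S + ?P))))"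
    unfolding w_state[OF t] by (rule order_trans)
  also have "\<dots> = ennreal (?C * (e * exp (- 2 * \<eta> * t) * (1 / gap * ((?D + e * (2 / kk)) * (?S + ?P)))))"
    using C e gap D kk by (intro ennreal_mult[symmetric]) auto
  finally have "(state_norm (u t) (v t))\<^sup>2 \<le> ?C * (e * exp (- 2 * \<eta> * t) * (1 / gap * ((?D + e * (2 / kk)) * (?S + ?P))))"
    using C e gap D kk by (subst (asm) ennreal_le_iff) auto
  then show ?thesis by (simp add: mult_ac)
qed

end

section \<open>Constants and decay uniform in the delay\<close>

lemma L2norm_on_nonneg: "0 \<le> L2norm_on S f"
  unfolding L2norm_on_def set_lebesgue_integral_def by (simp add: integral_nonneg_AE)

lemma L2norm_on_cong_AE:
  assumes "L2_on S f" "L2_on S g" "AE x in lborel. x \<in> S \<longrightarrow> f x = g x"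
  shows "L2norm_on S f = L2norm_on S g"
  unfolding L2norm_on_def set_lebesgue_integral_def
proof (rule arg_cong[where f = sqrt], rule integral_cong_AE)
  show "AE x in lborel. indicat_real S x *\<^sub>R (f x)\<^sup>2 = indicat_real S x *\<^sub>R (g x)\<^sup>2"
    using assms(3) by eventually_elim (auto simp: indicator_def)
qed (use assms in \<open>auto simp: L2_on_def set_integrable_def intro: borel_measurable_integrable\<close>)

text \<open>The quantifier order is the point: C and \<eta> are fixed before \<delta>, and the case
  \<delta> = 0 is included. The kernel N depends on the plant and \<rho> only, so that one bound for
  its norm and its translations suffices.\<close>

lemma (in backstep) uniform_decay:
  assumes small: "\<bar>\<rho> * q\<bar> + \<bar>K * q\<bar> < 1"
  shows "\<exists>\<delta>0>0. \<exists>C>0. \<exists>\<eta>>0. \<forall>\<delta> u0 v0 \<phi> u v t. 0 \<le> \<delta> \<longrightarrow> \<delta> \<le> \<delta>0 \<longrightarrow> L2_on {- \<delta>..0} \<phi> \<longrightarrow> L2_on {0..1} u0 \<longrightarrow> L2_on {0..1} v0 \<longrightarrow>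
    (\<lambda>(t, x). u t x) \<in> borel_measurable (borel \<Otimes>\<^sub>M borel) \<longrightarrow> (\<lambda>(t, x). v t x) \<in> borel_measurable (borel \<Otimes>\<^sub>M borel) \<longrightarrow>
    plant_solution lam mu q \<rho> \<sigma>pm \<sigma>mp u0 v0 (delayed_input \<delta> (U_BS2 \<rho> K Kuu Kuv Kvu Kvv) \<phi> u v) u v \<longrightarrow> 0 \<le> t \<longrightarrow>
    state_norm (u t) (v t) \<le> C * exp (- \<eta> * t) * (state_norm u0 v0 + L2norm_on {- \<delta>..0} \<phi>)"
proof -
  obtain \<kappa>1 \<kappa>2 Ck where \<kappa>[measurable]: "\<kappa>1 \<in> borel_measurable borel" "\<kappa>2 \<in> borel_measurable borel"
    and \<kappa>_bdd: "\<And>x. \<bar>\<kappa>1 x\<bar> \<le> Ck" "\<And>x. \<bar>\<kappa>2 x\<bar> \<le> Ck"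
    and dual: "\<And>f g. set_integrable lborel {0..1} f \<Longrightarrow> set_integrable lborel {0..1} g \<Longrightarrow> f \<in> borel_measurable borel \<Longrightarrow> g \<in> borel_measurable borel \<Longrightarrow>
      (LBINT \<xi>:{0..1}. kf \<rho> \<xi> * f \<xi> + kg \<rho> \<xi> * g \<xi>) = (LBINT x:{0..1}. \<kappa>1 x * bt Kuu Kuv f g x + \<kappa>2 x * bt Kvv Kvu g f x)"
    by (rule bt_duality[OF meas(3) meas(4) meas(5) meas(6) kfg_meas M bdd(3-6) kfg_bdd]) blast
  let ?N = "delay_kernel \<kappa>1 \<kappa>2"
  define r where "r = \<bar>\<rho> * q\<bar> + \<bar>K * q\<bar>"
  have r: "0 \<le> r" "r < 1" using small by (auto simp: r_def)
  define k where "k = (1 - r) / 2"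
  \<comment> \<open>E = 2 / (1 + r) is the largest weight growth spent: it lies in (1, 2] and
    satisfies r E = 1 - g0. The rate \<eta> is then determined by exp(2 \<eta> (tau + 1)) =
    E.\<close>
  define g0 where "g0 = (1 - r) / (1 + r)"
  define E where "E = 2 / (1 + r)"
  define \<eta> where "\<eta> = ln E / (2 * (tau + 1))"
  \<comment> \<open>The translation error and the initial interval receive g0/8 each. Since E \<le>
    2 they raise r E by at most g0/2, and the total contraction factor is at most 1 - g0/2.\<close>
  define e2 where "e2 = k * g0 / (8 * (tau + 1))"
  define B where "B = \<bar>q * lam\<bar> * Ck + mu * Ck"
  define N2 where "N2 = B\<^sup>2 * tau"
  have k: "0 < k" and g0: "0 < g0" and E: "1 < E" "E \<le> 2" and rE: "r * E = 1 - g0"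
    using r by (auto simp: k_def g0_def E_def field_simps)
  have "2 * \<eta> * (tau + 1) = ln E" using tau_pos by (simp add: \<eta>_def field_simps)
  then have \<eta>: "0 < \<eta>" "exp (2 * \<eta> * (tau + 1)) = E"
    using E tau_pos by (auto simp: \<eta>_def)
  define T where "T = tau + 1"
  have T: "0 < T" using tau_pos by (simp add: T_def)
  have e2: "0 < e2" "e2 / k * (tau + 1) = g0 / 8" using k g0 T unfolding e2_def T_def[symmetric] by auto
  have N2: "0 \<le> N2" using tau_pos by (simp add: N2_def)
  have N2_int: "(\<integral>\<^sup>+s. ennreal ((?N s)\<^sup>2) \<partial>lborel) \<le> ennreal N2"
  proof -
    have "(\<integral>\<^sup>+s. ennreal ((?N s)\<^sup>2) \<partial>lborel) \<le> (\<integral>\<^sup>+s. ennreal (B\<^sup>2) * indicator {0..tau} s \<partial>lborel)"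
    proof (rule nn_integral_mono)
      fix s show "ennreal ((?N s)\<^sup>2) \<le> ennreal (B\<^sup>2) * indicator {0..tau} s"
      proof (cases "s \<in> {0..tau}")
        case True
        have "\<bar>?N s\<bar>\<^sup>2 \<le> B\<^sup>2" using delay_kernel_bdd[OF \<kappa>_bdd, where r = s] unfolding B_def by (intro power_mono) auto
        then show ?thesis using True by (simp add: ennreal_leI)
      qed (simp add: delay_kernel_supp)
    qed
    also have "\<dots> = ennreal N2" using tau_pos by (simp add: nn_integral_cmult_indicator N2_def ennreal_mult)
    finally show ?thesis .
  qed
  obtain d where d: "0 < d" "\<And>\<delta>. 0 \<le> \<delta> \<Longrightarrow> \<delta> \<le> d \<Longrightarrow> (\<integral>\<^sup>+s. ennreal ((?N s - ?N (s - \<delta>))\<^sup>2) \<partial>lborel) \<le> ennreal e2"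
    using L2_translation_continuous[where c = tau, OF delay_kernel_meas[OF \<kappa>] delay_kernel_bdd[OF \<kappa>_bdd] delay_kernel_supp less_imp_le[OF tau_pos] e2(1)] by blast
  \<comment> \<open>In turn: memory windows of length at most tau + 1, translation error at most e2,
    and initial-interval contribution at most g0/8. The added 1 keeps the denominator positive when
    N2 = 0.\<close>
  define \<delta>0 where "\<delta>0 = min 1 (min d (g0 / (8 * (2 * N2 / k + 1))))"
  define Q where "Q = (8 * exp (16 * M\<^sup>2) * (q\<^sup>2 * lam + mu)) * (E / (g0 / 2)) * ((1 / mu + 1 / (lam * q\<^sup>2)) * (2 + 8 * M\<^sup>2) + E * (2 / k))"
  have Q: "0 \<le> Q" using lam mu q E g0 k by (simp add: Q_def)
  have \<delta>0: "0 < \<delta>0" using d g0 k N2 by (simp add: \<delta>0_def add_nonneg_pos)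
  have main: "state_norm (u t) (v t) \<le> (Q + 1) * exp (- \<eta> * t) * (state_norm u0 v0 + L2norm_on {- \<delta>..0} \<phi>)"
    if \<delta>: "0 \<le> \<delta>" "\<delta> \<le> \<delta>0" and \<phi>: "L2_on {- \<delta>..0} \<phi>" and L: "L2_on {0..1} u0" "L2_on {0..1} v0"
      and uv: "(\<lambda>(t, x). u t x) \<in> borel_measurable (borel \<Otimes>\<^sub>M borel)" "(\<lambda>(t, x). v t x) \<in> borel_measurable (borel \<Otimes>\<^sub>M borel)"
      and sol: "plant_solution lam mu q \<rho> \<sigma>pm \<sigma>mp u0 v0 (delayed_input \<delta> (U_BS2 \<rho> K Kuu Kuv Kvu Kvv) \<phi> u v) u v" and t: "0 \<le> t"
    for \<delta> u0 v0 \<phi> u v t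
  proof -
    let ?U = "delayed_input \<delta> (U_BS2 \<rho> K Kuu Kuv Kvu Kvv) \<phi> u v"
    have d1: "\<delta> \<le> 1" "\<delta> \<le> d" "\<delta> \<le> g0 / (8 * (2 * N2 / k + 1))" using \<delta> by (auto simp: \<delta>0_def)
    interpret plant: plant lam mu q M \<sigma>pm \<sigma>mp Kuu Kuv Kvu Kvv \<rho> u0 v0 ?U u v by unfold_locales (rule sol uv)+
    interpret cl: closed_loop lam mu q M \<sigma>pm \<sigma>mp Kuu Kuv Kvu Kvv \<rho> u0 v0 ?U u v K \<delta> \<phi> \<kappa>1 \<kappa>2 Ck
      by unfold_locales (use \<delta> d1 \<phi> \<kappa> \<kappa>_bdd dual small in auto)
    have kk: "cl.kk = k" by (simp add: cl.kk_def k_def r_def)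
    have "2 * N2 / k * \<delta> \<le> (2 * N2 / k + 1) * (g0 / (8 * (2 * N2 / k + 1)))"
      using d1(3) \<delta>(1) N2 k by (intro mult_mono) auto
    also have "\<dots> = g0 / 8"
    proof -
      have "0 < 2 * N2 / k + 1" using N2 k by (simp add: add_nonneg_pos)
      then show ?thesis by (metis mult.commute nonzero_mult_divide_mult_cancel_left times_divide_eq_right mult_1_right less_irrefl)
    qed
    finally have n: "2 * N2 / k * \<delta> \<le> g0 / 8" .
    have "(r + e2 / k * (tau + 1) + 2 * N2 / k * \<delta>) * E \<le> (r + g0 / 4) * E"
      unfolding e2(2) using n E by (intro mult_right_mono) auto
    also have "\<dots> \<le> 1 - g0 + g0 / 4 * 2" unfolding distrib_right rE using E g0 by (intro add_left_mono mult_left_mono) auto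
    finally have c: "(r + e2 / k * (tau + 1) + 2 * N2 / k * \<delta>) * E \<le> 1 - g0 / 2" by simp
    have e2': "(\<integral>\<^sup>+s. ennreal ((?N s - ?N (s - \<delta>))\<^sup>2) \<partial>lborel) \<le> ennreal e2" by (rule d(2)[OF \<delta>(1) d1(2)])
    have dec: "(state_norm (u t) (v t))\<^sup>2 \<le> Q * exp (- 2 * \<eta> * t) * ((state_norm (u 0) (v 0))\<^sup>2 + (L2norm_on {- \<delta>..0} \<phi>)\<^sup>2)"
      using cl.decay[OF e2' less_imp_le[OF e2(1)] N2_int N2 \<eta>(1) _ _ t, of "g0 / 2"] c g0 unfolding \<eta>(2) kk r_def Q_def by simp
    have init: "state_norm (u 0) (v 0) = state_norm u0 v0"
    proof -
      have ae: "AE x in lborel. x \<in> {0..1} \<longrightarrow> u 0 x = u0 x \<and> v 0 x = v0 x"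
        and L': "L2_on {0..1} (u 0)" "L2_on {0..1} (v 0)" using sol unfolding plant_solution_def by auto
      have "L2norm_on {0..1} (u 0) = L2norm_on {0..1} u0" by (rule L2norm_on_cong_AE[OF L'(1) L(1)]) (use ae in \<open>auto elim: eventually_mono\<close>)
      moreover have "L2norm_on {0..1} (v 0) = L2norm_on {0..1} v0" by (rule L2norm_on_cong_AE[OF L'(2) L(2)]) (use ae in \<open>auto elim: eventually_mono\<close>)
      ultimately show ?thesis by (simp add: state_norm_def)
    qed
    define S where "S = state_norm u0 v0"
    define F where "F = L2norm_on {- \<delta>..0} \<phi>"
    have nn: "0 \<le> S" "0 \<le> F" by (simp_all add: S_def F_def state_norm_def L2norm_on_nonneg)
    \<comment> \<open>Replaces the square root of Q by Q + 1, so that roots can be taken on both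
      sides.\<close>
    have Q2: "Q \<le> (Q + 1)\<^sup>2" using Q by (simp add: power2_eq_square algebra_simps)
    have "Q * exp (- 2 * \<eta> * t) * (S\<^sup>2 + F\<^sup>2) \<le> (Q + 1)\<^sup>2 * exp (- 2 * \<eta> * t) * (S + F)\<^sup>2"
      using Q nn by (intro mult_mono Q2) (auto simp: power2_sum)
    also have "\<dots> = ((Q + 1) * exp (- \<eta> * t) * (S + F))\<^sup>2"
      by (simp add: power_mult_distrib exp_double[symmetric] mult.assoc)
    finally have "(state_norm (u t) (v t))\<^sup>2 \<le> ((Q + 1) * exp (- \<eta> * t) * (S + F))\<^sup>2" using dec unfolding init S_def F_def by linarith
    then have "state_norm (u t) (v t) \<le> (Q + 1) * exp (- \<eta> * t) * (S + F)" by (rule power2_le_imp_le) (use Q nn in auto)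
    then show ?thesis by (simp add: S_def F_def)
  qed
  show ?thesis using \<delta>0 \<eta>(1) Q main by (intro exI[of _ \<delta>0] exI[of _ "Q + 1"] exI[of _ \<eta>] conjI) (auto simp del: minus_mult_left)
qed

subsection \<open>Well-posedness\<close>

definition ew :: "real \<Rightarrow> real \<Rightarrow> ennreal" where "ew \<gamma> t = ennreal (exp (- 2 * \<gamma> * t))"

lemma ew_meas[measurable]: "ew \<gamma> \<in> borel_measurable borel"
  unfolding ew_def[abs_def] by measurable

lemma ew_le_1: "0 \<le> \<gamma> \<Longrightarrow> 0 \<le> t \<Longrightarrow> ew \<gamma> t \<le> 1"
  by (simp add: ew_def)

lemma ew_add: "ew \<gamma> (s + t) = ew \<gamma> s * ew \<gamma> t"
  by (simp add: ew_def algebra_simps flip: exp_add ennreal_mult)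

lemma ew_integral_le:
  assumes "0 < \<gamma>" "0 < a"
  shows "(\<integral>\<^sup>+x\<in>{0..}. ew \<gamma> (x / a) \<partial>lborel) = ennreal (a / (2 * \<gamma>))"
proof -
  have "(\<integral>\<^sup>+x. ennreal (exp (- 2 * \<gamma> * (x / a))) * indicator {0..} x \<partial>lborel) = ennreal (0 - (- a / (2 * \<gamma>) * exp (- 2 * \<gamma> * (0 / a))))"
  proof (rule nn_integral_FTC_atLeast)
    show "((\<lambda>x. - a / (2 * \<gamma>) * exp (- 2 * \<gamma> * (x / a))) has_real_derivative exp (- 2 * \<gamma> * (x / a))) (at x)" for x
      using assms by (auto intro!: derivative_eq_intros)
    have "filterlim (\<lambda>x. (2 * \<gamma> / a) * x) at_top at_top"
      using assms by (intro filterlim_tendsto_pos_mult_at_top[OF tendsto_const] filterlim_ident) auto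
    then have "((\<lambda>x. exp (- ((2 * \<gamma> / a) * x))) \<longlongrightarrow> 0) at_top"
      by (intro filterlim_compose[OF exp_at_bot] filterlim_compose[OF filterlim_uminus_at_bot_at_top]) auto
    from tendsto_mult[OF tendsto_const[of "- a / (2 * \<gamma>)"] this]
    show "((\<lambda>x. - a / (2 * \<gamma>) * exp (- 2 * \<gamma> * (x / a))) \<longlongrightarrow> 0) at_top" by (simp add: mult_ac)
  qed (use assms in auto)
  then show ?thesis by (simp add: ew_def)
qed

text \<open>The square of the L2 norm in time with weight exp(-\<gamma> t). It is kept squared so
  that it remains an \<open>ennreal\<close> integral, and taken over the whole line because the
  iterates vanish at negative times.\<close>

definition cn :: "real \<Rightarrow> (real \<Rightarrow> ennreal) \<Rightarrow> ennreal" where "cn \<gamma> H = (\<integral>\<^sup>+t. ew \<gamma> t * (H t)\<^sup>2 \<partial>lborel)"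

lemma cn_mono: "(\<And>t. H t \<le> H' t) \<Longrightarrow> cn \<gamma> H \<le> cn \<gamma> H'"
  unfolding cn_def by (intro nn_integral_mono mult_left_mono power_mono) auto

lemma cn_meas:
  assumes [measurable]: "(\<lambda>(x, t). H x t) \<in> borel_measurable (borel \<Otimes>\<^sub>M borel)"
  shows "(\<lambda>x::real. cn \<gamma> (H x)) \<in> borel_measurable borel"
  unfolding cn_def by measurable

lemma cn_cmult:
  assumes [measurable]: "H \<in> borel_measurable borel"
  shows "cn \<gamma> (\<lambda>t. c * H t) = c\<^sup>2 * cn \<gamma> H"
proof -
  have "cn \<gamma> (\<lambda>t. c * H t) = (\<integral>\<^sup>+t. c\<^sup>2 * (ew \<gamma> t * (H t)\<^sup>2) \<partial>lborel)"
    unfolding cn_def by (rule nn_integral_cong) (simp add: power_mult_distrib mult_ac)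
  then show ?thesis by (simp add: cn_def nn_integral_cmult)
qed

text \<open>A delay s gains the factor exp(-2 \<gamma> s). Every smallness of the Picard estimate
  for large \<gamma> stems from it.\<close>

lemma cn_shift:
  assumes [measurable]: "H \<in> borel_measurable borel"
  shows "cn \<gamma> (\<lambda>t. H (t - s)) = ew \<gamma> s * cn \<gamma> H"
proof -
  have "cn \<gamma> (\<lambda>t. H (t - s)) = (\<integral>\<^sup>+t. ew \<gamma> (s + t) * (H t)\<^sup>2 \<partial>lborel)"
    unfolding cn_def using nn_integral_real_affine[of "\<lambda>t. ew \<gamma> t * (H (t - s))\<^sup>2" 1 s] by simp
  also have "\<dots> = (\<integral>\<^sup>+t. ew \<gamma> s * (ew \<gamma> t * (H t)\<^sup>2) \<partial>lborel)"
    by (simp add: ew_add mult.assoc)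
  also have "\<dots> = ew \<gamma> s * cn \<gamma> H" unfolding cn_def by (rule nn_integral_cmult) measurable
  finally show ?thesis .
qed

lemma cn_add_le:
  assumes [measurable]: "H \<in> borel_measurable borel" "H' \<in> borel_measurable borel"
  shows "cn \<gamma> (\<lambda>t. H t + H' t) \<le> 2 * cn \<gamma> H + 2 * cn \<gamma> H'"
proof -
  have "cn \<gamma> (\<lambda>t. H t + H' t) \<le> (\<integral>\<^sup>+t. 2 * (ew \<gamma> t * (H t)\<^sup>2) + 2 * (ew \<gamma> t * (H' t)\<^sup>2) \<partial>lborel)"
    unfolding cn_def
  proof (rule nn_integral_mono)
    fix t
    show "ew \<gamma> t * (H t + H' t)\<^sup>2 \<le> 2 * (ew \<gamma> t * (H t)\<^sup>2) + 2 * (ew \<gamma> t * (H' t)\<^sup>2)"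
      using mult_left_mono[OF ennreal_power2_add_le[of "H t" "H' t"], of "ew \<gamma> t"] by (simp add: distrib_left mult_ac)
  qed
  also have "\<dots> = 2 * cn \<gamma> H + 2 * cn \<gamma> H'" by (simp add: nn_integral_add nn_integral_cmult cn_def)
  finally show ?thesis .
qed

lemma cn_integral_le:
  assumes [measurable]: "(\<lambda>(y, t). H y t) \<in> borel_measurable (borel \<Otimes>\<^sub>M borel)" and s: "0 \<le> s"
  shows "cn \<gamma> (\<lambda>t. \<integral>\<^sup>+y\<in>{0..s}. H y t \<partial>lborel) \<le> ennreal s * (\<integral>\<^sup>+y\<in>{0..s}. cn \<gamma> (H y) \<partial>lborel)"
proof -
  have "cn \<gamma> (\<lambda>t. \<integral>\<^sup>+y\<in>{0..s}. H y t \<partial>lborel) \<le> (\<integral>\<^sup>+t. ew \<gamma> t * (ennreal (s - 0) * (\<integral>\<^sup>+y\<in>{0..s}. (H y t)\<^sup>2 \<partial>lborel)) \<partial>lborel)"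
    unfolding cn_def by (intro nn_integral_mono mult_left_mono nn_integral_Icc_power2_le s) measurable
  also have "\<dots> = (\<integral>\<^sup>+t. \<integral>\<^sup>+y. ennreal s * (ew \<gamma> t * (H y t)\<^sup>2 * indicator {0..s} y) \<partial>lborel \<partial>lborel)"
  proof (rule nn_integral_cong)
    fix t
    have "ew \<gamma> t * (ennreal (s - 0) * (\<integral>\<^sup>+y\<in>{0..s}. (H y t)\<^sup>2 \<partial>lborel)) = (ennreal s * ew \<gamma> t) * (\<integral>\<^sup>+y\<in>{0..s}. (H y t)\<^sup>2 \<partial>lborel)"
      by (simp add: mult_ac)
    also have "\<dots> = (\<integral>\<^sup>+y. (ennreal s * ew \<gamma> t) * ((H y t)\<^sup>2 * indicator {0..s} y) \<partial>lborel)"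
      by (rule nn_integral_cmult[symmetric]) measurable
    finally show "ew \<gamma> t * (ennreal (s - 0) * (\<integral>\<^sup>+y\<in>{0..s}. (H y t)\<^sup>2 \<partial>lborel)) = (\<integral>\<^sup>+y. ennreal s * (ew \<gamma> t * (H y t)\<^sup>2 * indicator {0..s} y) \<partial>lborel)"
      by (simp add: mult_ac)
  qed
  also have "\<dots> = (\<integral>\<^sup>+y. \<integral>\<^sup>+t. ennreal s * (ew \<gamma> t * (H y t)\<^sup>2 * indicator {0..s} y) \<partial>lborel \<partial>lborel)"
    by (rule lborel_pair.Fubini'[symmetric]) measurable
  also have "\<dots> = (\<integral>\<^sup>+y. ennreal s * (cn \<gamma> (H y) * indicator {0..s} y) \<partial>lborel)"
    by (simp add: cn_def nn_integral_cmult nn_integral_multc)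
  also have "\<dots> = ennreal s * (\<integral>\<^sup>+y\<in>{0..s}. cn \<gamma> (H y) \<partial>lborel)"
    using cn_meas[of H] by (intro nn_integral_cmult) auto
  finally show ?thesis .
qed

text \<open>One step of the Picard iteration along a characteristic of travel time \<open>s\<close>.\<close>
lemma cn_step:
  assumes [measurable]: "d \<in> borel_measurable borel" "F1 \<in> borel_measurable borel" "(\<lambda>(y, t). F2 y t) \<in> borel_measurable (borel \<Otimes>\<^sub>M borel)"
    and s: "0 \<le> s" and G: "\<And>t. G t \<le> d t + (c * F1 (t - s) + m * (\<integral>\<^sup>+y\<in>{0..s}. F2 y (t - y) \<partial>lborel))"
  shows "cn \<gamma> G \<le> 2 * cn \<gamma> d + 4 * (c\<^sup>2 * (ew \<gamma> s * cn \<gamma> F1)) + 4 * (m\<^sup>2 * (ennreal s * (\<integral>\<^sup>+y\<in>{0..s}. ew \<gamma> y * cn \<gamma> (F2 y) \<partial>lborel)))"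
proof -
  let ?I = "\<lambda>t. \<integral>\<^sup>+y\<in>{0..s}. F2 y (t - y) \<partial>lborel"
  have "cn \<gamma> G \<le> cn \<gamma> (\<lambda>t. d t + (c * F1 (t - s) + m * ?I t))" by (rule cn_mono) (rule G)
  also have "\<dots> \<le> 2 * cn \<gamma> d + 2 * cn \<gamma> (\<lambda>t. c * F1 (t - s) + m * ?I t)" by (rule cn_add_le) measurable
  also have "\<dots> \<le> 2 * cn \<gamma> d + 2 * (2 * cn \<gamma> (\<lambda>t. c * F1 (t - s)) + 2 * cn \<gamma> (\<lambda>t. m * ?I t))"
    by (intro add_left_mono mult_left_mono cn_add_le) auto
  also have "cn \<gamma> (\<lambda>t. c * F1 (t - s)) = c\<^sup>2 * (ew \<gamma> s * cn \<gamma> F1)" by (simp add: cn_cmult cn_shift)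
  also have "cn \<gamma> (\<lambda>t. m * ?I t) = m\<^sup>2 * cn \<gamma> ?I" by (rule cn_cmult) measurable
  also have "cn \<gamma> ?I \<le> ennreal s * (\<integral>\<^sup>+y\<in>{0..s}. cn \<gamma> (\<lambda>t. F2 y (t - y)) \<partial>lborel)"
    using s by (intro cn_integral_le) measurable
  also have "\<dots> = ennreal s * (\<integral>\<^sup>+y\<in>{0..s}. ew \<gamma> y * cn \<gamma> (F2 y) \<partial>lborel)" by (simp add: cn_shift)
  finally have "cn \<gamma> G \<le> 2 * cn \<gamma> d + 2 * (2 * (c\<^sup>2 * (ew \<gamma> s * cn \<gamma> F1)) + 2 * (m\<^sup>2 * (ennreal s * (\<integral>\<^sup>+y\<in>{0..s}. ew \<gamma> y * cn \<gamma> (F2 y) \<partial>lborel))))"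
    by (simp add: add_left_mono mult_left_mono)
  then show ?thesis by (simp add: distrib_left mult.assoc[symmetric] add.assoc)
qed

text \<open>In the variables y and x - a y the delay factor separates and integrates to 1 / (2
  \<gamma>). The interior coupling is thus small in the mean over x, although the factor is not
  small for short delays.\<close>

lemma triangle_fubini_le:
  fixes n :: "real \<Rightarrow> ennreal"
  assumes [measurable]: "n \<in> borel_measurable borel" and a: "0 < a" and \<gamma>: "0 < \<gamma>"
  shows "(\<integral>\<^sup>+x\<in>{0..1}. (\<integral>\<^sup>+y\<in>{0..x / a}. ew \<gamma> y * n (x - a * y) \<partial>lborel) \<partial>lborel) \<le> ennreal (1 / (2 * \<gamma>)) * (\<integral>\<^sup>+x\<in>{0..1}. n x \<partial>lborel)"
proof -
  have "(\<integral>\<^sup>+x\<in>{0..1}. (\<integral>\<^sup>+y\<in>{0..x / a}. ew \<gamma> y * n (x - a * y) \<partial>lborel) \<partial>lborel)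
    \<le> (\<integral>\<^sup>+x. \<integral>\<^sup>+y. ew \<gamma> y * indicator {0..} y * (n (x - a * y) * indicator {0..1} (x - a * y)) \<partial>lborel \<partial>lborel)"
  proof (rule nn_integral_mono)
    fix x :: real
    have "(\<integral>\<^sup>+y\<in>{0..x / a}. ew \<gamma> y * n (x - a * y) \<partial>lborel) * indicator {0..1} x
      = (\<integral>\<^sup>+y. ew \<gamma> y * n (x - a * y) * indicator {0..x / a} y * indicator {0..1} x \<partial>lborel)"
      by (rule nn_integral_multc[symmetric]) measurable
    also have "\<dots> \<le> (\<integral>\<^sup>+y. ew \<gamma> y * indicator {0..} y * (n (x - a * y) * indicator {0..1} (x - a * y)) \<partial>lborel)"
    proof (rule nn_integral_mono)
      fix y
      have "0 \<le> a * y \<and> a * y \<le> x" if "0 \<le> y" "y \<le> x / a" using that a by (simp add: pos_le_divide_eq mult.commute)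
      then show "ew \<gamma> y * n (x - a * y) * indicator {0..x / a} y * indicator {0..1} x
        \<le> ew \<gamma> y * indicator {0..} y * (n (x - a * y) * indicator {0..1} (x - a * y))"
        by (auto simp: indicator_def)
    qed
    finally show "(\<integral>\<^sup>+y\<in>{0..x / a}. ew \<gamma> y * n (x - a * y) \<partial>lborel) * indicator {0..1} x
      \<le> (\<integral>\<^sup>+y. ew \<gamma> y * indicator {0..} y * (n (x - a * y) * indicator {0..1} (x - a * y)) \<partial>lborel)" .
  qed
  also have "\<dots> = (\<integral>\<^sup>+y. \<integral>\<^sup>+x. ew \<gamma> y * indicator {0..} y * (n (x - a * y) * indicator {0..1} (x - a * y)) \<partial>lborel \<partial>lborel)"
    by (rule lborel_pair.Fubini'[symmetric]) measurable
  also have "\<dots> = (\<integral>\<^sup>+y. ew \<gamma> y * indicator {0..} y * (\<integral>\<^sup>+x\<in>{0..1}. n x \<partial>lborel) \<partial>lborel)"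
  proof (rule nn_integral_cong)
    fix y
    have "(\<integral>\<^sup>+x. n (x - a * y) * indicator {0..1} (x - a * y) \<partial>lborel) = (\<integral>\<^sup>+x\<in>{0..1}. n x \<partial>lborel)"
      using nn_integral_real_affine[of "\<lambda>x. n x * indicator {0..1} x" 1 "- a * y"] by simp
    then show "(\<integral>\<^sup>+x. ew \<gamma> y * indicator {0..} y * (n (x - a * y) * indicator {0..1} (x - a * y)) \<partial>lborel)
      = ew \<gamma> y * indicator {0..} y * (\<integral>\<^sup>+x\<in>{0..1}. n x \<partial>lborel)"
      by (subst nn_integral_cmult) auto
  qed
  also have "\<dots> = (\<integral>\<^sup>+y\<in>{0..}. ew \<gamma> (y / 1) \<partial>lborel) * (\<integral>\<^sup>+x\<in>{0..1}. n x \<partial>lborel)"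
    by (simp add: nn_integral_multc)
  also have "(\<integral>\<^sup>+y\<in>{0..}. ew \<gamma> (y / 1) \<partial>lborel) = ennreal (1 / (2 * \<gamma>))" by (rule ew_integral_le[OF \<gamma>]) simp
  finally show ?thesis .
qed

text \<open>Quantitative smallness for boundary terms, which are delayed by a full crossing
  time.\<close>

lemma ew_le:
  assumes "0 < \<gamma>" "0 < s"
  shows "ew \<gamma> s \<le> ennreal (1 / (2 * \<gamma> * s))"
proof -
  have "2 * \<gamma> * s \<le> exp (2 * \<gamma> * s)" using exp_ge_add_one_self[of "2 * \<gamma> * s"] by linarith
  then have "inverse (exp (2 * \<gamma> * s)) \<le> inverse (2 * \<gamma> * s)" using assms by (intro le_imp_inverse_le) auto
  then show ?thesis by (simp add: ew_def exp_minus inverse_eq_divide ennreal_leI)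
qed

lemma SUP_power2_ennreal:
  fixes f :: "nat \<Rightarrow> ennreal"
  assumes "incseq f"
  shows "(SUP n. f n)\<^sup>2 = (SUP n. (f n)\<^sup>2)"
proof (rule antisym)
  have "(SUP n. f n)\<^sup>2 = (SUP m. (SUP n. f n) * f m)" by (simp add: power2_eq_square SUP_mult_left_ennreal)
  also have "\<dots> = (SUP m. SUP n. f n * f m)" by (simp add: SUP_mult_right_ennreal)
  also have "\<dots> \<le> (SUP n. (f n)\<^sup>2)"
  proof (intro SUP_least)
    fix m n
    have "f n * f m \<le> f (max m n) * f (max m n)" using assms by (intro mult_mono) (auto simp: incseq_def)
    also have "\<dots> \<le> (SUP n. (f n)\<^sup>2)" by (rule SUP_upper2[of "max m n"]) (auto simp: power2_eq_square)
    finally show "f n * f m \<le> (SUP n. (f n)\<^sup>2)" .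
  qed
  finally show "(SUP n. f n)\<^sup>2 \<le> (SUP n. (f n)\<^sup>2)" .
  show "(SUP n. (f n)\<^sup>2) \<le> (SUP n. f n)\<^sup>2" by (intro SUP_least power_mono SUP_upper) auto
qed

lemma cn_SUP:
  assumes [measurable]: "\<And>n. H n \<in> borel_measurable borel" and inc: "\<And>t. incseq (\<lambda>n. H n t)"
  shows "cn \<gamma> (\<lambda>t. SUP n. H n t) = (SUP n. cn \<gamma> (H n))"
proof -
  have "ew \<gamma> t * (SUP n. H n t)\<^sup>2 = (SUP n. ew \<gamma> t * (H n t)\<^sup>2)" for t
    by (simp add: SUP_power2_ennreal[OF inc] SUP_mult_left_ennreal)
  then have "cn \<gamma> (\<lambda>t. SUP n. H n t) = (\<integral>\<^sup>+t. (SUP n. ew \<gamma> t * (H n t)\<^sup>2) \<partial>lborel)" by (simp add: cn_def)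
  also have "\<dots> = (SUP n. cn \<gamma> (H n))" unfolding cn_def
    by (rule nn_integral_monotone_convergence_SUP)
      (use inc in \<open>auto simp: incseq_def le_fun_def intro!: mult_left_mono power_mono\<close>)
  finally show ?thesis .
qed

lemma cn_add5_le:
  assumes [measurable]: "a \<in> borel_measurable borel" "b \<in> borel_measurable borel" "c \<in> borel_measurable borel"
    "d \<in> borel_measurable borel" "e \<in> borel_measurable borel"
  shows "cn \<gamma> (\<lambda>t. a t + (b t + (c t + (d t + e t)))) \<le> 2 * cn \<gamma> a + 2 * (2 * cn \<gamma> b + 2 * (2 * cn \<gamma> c + 2 * (2 * cn \<gamma> d + 2 * cn \<gamma> e)))"
proof -
  have step: "cn \<gamma> (\<lambda>t. h t + r t) \<le> 2 * cn \<gamma> h + 2 * R"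
    if "h \<in> borel_measurable borel" "r \<in> borel_measurable borel" "cn \<gamma> r \<le> R" for h r R
    using order_trans[OF cn_add_le[OF that(1,2)] add_left_mono[OF mult_left_mono[OF that(3)]]] by simp
  show ?thesis
    by (rule step, measurable, rule step, measurable, rule step, measurable, rule cn_add_le, measurable)
qed

text \<open>Existence for an arbitrary feedback with bounded densities l1, l2 and a multiple of
  u(t,1), applied with delay \<delta>. The kernel equations do not enter; \<delta> = 0 is allowed,
  and no smallness of \<rho> or K is assumed.\<close>

locale wellposed =
  fixes lam mu q \<rho> K \<delta> M :: real and \<sigma>pm \<sigma>mp l1 l2 u0 v0 \<phi> :: "real \<Rightarrow> real"
  assumes lam: "0 < lam" and mu: "0 < mu" and \<delta>: "0 \<le> \<delta>" and M: "0 < M"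
    and meas[measurable]: "\<sigma>pm \<in> borel_measurable borel" "\<sigma>mp \<in> borel_measurable borel" "l1 \<in> borel_measurable borel" "l2 \<in> borel_measurable borel"
      "u0 \<in> borel_measurable borel" "v0 \<in> borel_measurable borel" "\<phi> \<in> borel_measurable borel"
    and bdd: "\<And>x. \<bar>\<sigma>pm x\<bar> \<le> M" "\<And>x. \<bar>\<sigma>mp x\<bar> \<le> M" "\<And>x. \<bar>l1 x\<bar> \<le> M" "\<And>x. \<bar>l2 x\<bar> \<le> M"
    and L2: "(\<integral>\<^sup>+x\<in>{0..1}. ennreal ((u0 x)\<^sup>2) \<partial>lborel) < \<infinity>" "(\<integral>\<^sup>+x\<in>{0..1}. ennreal ((v0 x)\<^sup>2) \<partial>lborel) < \<infinity>"
      "(\<integral>\<^sup>+x\<in>{- \<delta>..0}. ennreal ((\<phi> x)\<^sup>2) \<partial>lborel) < \<infinity>"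
begin

text \<open>Component 0 is $u$, component 1 is $v$, and component 2 is the boundary value $v(t,1)$, which ignores its second argument.
  All components vanish for negative times, so that the initial data enter as source terms.\<close>

definition dd :: "nat \<Rightarrow> real \<times> real \<Rightarrow> real" where
  "dd i z = (if i = 0 then (if 0 \<le> fst z \<and> 0 < snd z - lam * fst z then u0 (snd z - lam * fst z) else 0)
    else if i = 1 then (if 0 \<le> fst z \<and> snd z + mu * fst z < 1 then v0 (snd z + mu * fst z) else 0)
    else if i = 2 then (if 0 \<le> fst z \<and> fst z < \<delta> then \<phi> (fst z - \<delta>) else 0) else 0)"

text \<open>Rows 0 and 1 trace a characteristic back to its inflow boundary: j = 0 is the boundary
  value there, j = 1 the source integral over elapsed time y. Row 2 is the feedback, with j = 0..3
  for the \<rho>, K, l1 and l2 terms. Point values are integrals against the indicator of [0,1],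
  which has mass 1.\<close>

definition cc :: "nat \<Rightarrow> nat \<Rightarrow> real \<times> real \<Rightarrow> real \<Rightarrow> real" where
  "cc i j z y =
    (if i = 0 then (if j = 0 then q * indicator {0..1} y
        else if j = 1 then (if 0 \<le> y \<and> y \<le> snd z / lam then \<sigma>pm (snd z - lam * y) else 0) else 0)
     else if i = 1 then (if j = 0 then indicator {0..1} y
        else if j = 1 then (if 0 \<le> y \<and> y \<le> (1 - snd z) / mu then \<sigma>mp (snd z + mu * y) else 0) else 0)
     else if i = 2 then (if j = 0 then \<rho> * indicator {0..1} y else if j = 1 then - K * indicator {0..1} y
        else if j = 2 then l1 y * indicator {0..1} y else l2 y * indicator {0..1} y)
     else 0)"

definition ki :: "nat \<Rightarrow> nat \<Rightarrow> nat" where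
  "ki i j = (if i = 0 then 1 else if i = 1 then (if j = 0 then 2 else 0) else if j = 3 then 1 else 0)"

definition hh :: "nat \<Rightarrow> nat \<Rightarrow> real \<times> real \<Rightarrow> real \<Rightarrow> real \<times> real" where
  "hh i j z y =
    (if i = 0 then (if j = 0 then (fst z - snd z / lam, 0) else (fst z - y, snd z - lam * y))
     else if i = 1 then (if j = 0 then (fst z - (1 - snd z) / mu, 0) else (fst z - y, snd z + mu * y))
     else (if j = 0 then (fst z, 1) else if j = 1 then (fst z - \<delta>, 1) else (fst z - \<delta>, y)))"

sublocale P: picard "borel \<Otimes>\<^sub>M borel" 4 dd cc ki hh
proof
  show "dd i \<in> borel_measurable (borel \<Otimes>\<^sub>M borel)" for i
    unfolding dd_def[abs_def] by measurable
  show "(\<lambda>(z, y). cc i j z y) \<in> borel_measurable ((borel \<Otimes>\<^sub>M borel) \<Otimes>\<^sub>M borel)" for i j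
    unfolding cc_def by measurable
  show "(\<lambda>(z, y). hh i j z y) \<in> (borel \<Otimes>\<^sub>M borel) \<Otimes>\<^sub>M borel \<rightarrow>\<^sub>M borel \<Otimes>\<^sub>M borel" for i j
    unfolding hh_def by measurable
qed (simp add: space_pair_measure)

lemma sum4: "(\<Sum>j<4. F j) = F 0 + F 1 + F 2 + F (3::nat)" for F :: "nat \<Rightarrow> 'a::comm_monoid_add"
  by (simp add: eval_nat_numeral add.assoc)

lemma point_mass:
  "(\<integral>\<^sup>+y. ennreal \<bar>a * indicator {0..1} y\<bar> * H \<partial>(lborel :: real measure)) = ennreal \<bar>a\<bar> * H"
proof -
  have "(\<integral>\<^sup>+y. ennreal \<bar>a * indicator {0..1} y\<bar> * H \<partial>(lborel :: real measure)) = (\<integral>\<^sup>+y. ennreal \<bar>a\<bar> * H * indicator {0..1} y \<partial>(lborel :: real measure))"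
    by (rule nn_integral_cong) (auto simp: indicator_def)
  then show ?thesis by (simp add: nn_integral_cmult)
qed

lemma P0:
  "P.P F 0 (t, x) = ennreal \<bar>q\<bar> * F 1 (t - x / lam, 0)
    + (\<integral>\<^sup>+y. ennreal \<bar>if 0 \<le> y \<and> y \<le> x / lam then \<sigma>pm (x - lam * y) else 0\<bar> * F 1 (t - y, x - lam * y) \<partial>lborel)"
  unfolding picard_op_def sum4 using point_mass[of q "F 1 (t - x / lam, 0)"] by (simp add: cc_def ki_def hh_def cong: if_cong)

lemma P1:
  "P.P F 1 (t, x) = F 2 (t - (1 - x) / mu, 0)
    + (\<integral>\<^sup>+y. ennreal \<bar>if 0 \<le> y \<and> y \<le> (1 - x) / mu then \<sigma>mp (x + mu * y) else 0\<bar> * F 0 (t - y, x + mu * y) \<partial>lborel)"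
  unfolding picard_op_def sum4 using point_mass[of 1 "F 2 (t - (1 - x) / mu, 0)"] by (simp add: cc_def ki_def hh_def cong: if_cong)

lemma P2:
  "P.P F 2 (t, x) = ennreal \<bar>\<rho>\<bar> * F 0 (t, 1) + ennreal \<bar>K\<bar> * F 0 (t - \<delta>, 1)
    + (\<integral>\<^sup>+y. ennreal \<bar>l1 y * indicator {0..1} y\<bar> * F 0 (t - \<delta>, y) \<partial>lborel)
    + (\<integral>\<^sup>+y. ennreal \<bar>l2 y * indicator {0..1} y\<bar> * F 1 (t - \<delta>, y) \<partial>lborel)"
  unfolding picard_op_def sum4 using point_mass[of \<rho> "F 0 (t, 1)"] point_mass[of K "F 0 (t - \<delta>, 1)"] by (simp add: cc_def ki_def hh_def cong: if_cong)

lemma coeff_le: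
  fixes H :: "real \<Rightarrow> ennreal" and a :: "real \<Rightarrow> real" and s :: real
  assumes [measurable]: "H \<in> borel_measurable borel" and "\<And>y. \<bar>a y\<bar> \<le> M" and "\<And>y. y \<notin> {0..s} \<Longrightarrow> a y = 0"
  shows "(\<integral>\<^sup>+y. ennreal \<bar>a y\<bar> * H y \<partial>lborel) \<le> ennreal M * (\<integral>\<^sup>+y\<in>{0..s}. H y \<partial>lborel)"
proof -
  have "(\<integral>\<^sup>+y. ennreal \<bar>a y\<bar> * H y \<partial>lborel) \<le> (\<integral>\<^sup>+y. ennreal M * (H y * indicator {0..s} y) \<partial>lborel)"
  proof (rule nn_integral_mono)
    fix y show "ennreal \<bar>a y\<bar> * H y \<le> ennreal M * (H y * indicator {0..s} y)"
      using assms(2)[of y] assms(3)[of y] by (cases "y \<in> {0..s}") (auto intro!: mult_right_mono ennreal_leI)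
  qed
  also have "\<dots> = ennreal M * (\<integral>\<^sup>+y\<in>{0..s}. H y \<partial>lborel)" by (rule nn_integral_cmult) measurable
  finally show ?thesis .
qed

definition "D = ennreal (1 / lam) * (\<integral>\<^sup>+x\<in>{0..1}. ennreal ((u0 x)\<^sup>2) \<partial>lborel)
  + ennreal (1 / mu) * (\<integral>\<^sup>+x\<in>{0..1}. ennreal ((v0 x)\<^sup>2) \<partial>lborel) + (\<integral>\<^sup>+x\<in>{- \<delta>..0}. ennreal ((\<phi> x)\<^sup>2) \<partial>lborel)"

lemma D_finite: "D < \<infinity>"
  using L2 by (simp add: D_def ennreal_mult_less_top)

text \<open>At fixed x the data terms are affine reparametrizations in time of u0, v0 or \<phi>, so
  their time norms are bounded by D for every x in question and every \<gamma> \<ge> 0.\<close>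

lemma dd_le:
  assumes \<gamma>: "0 \<le> \<gamma>"
  shows "x \<le> 1 \<Longrightarrow> cn \<gamma> (\<lambda>t. ennreal \<bar>dd 0 (t, x)\<bar>) \<le> D" "0 \<le> x \<Longrightarrow> cn \<gamma> (\<lambda>t. ennreal \<bar>dd 1 (t, x)\<bar>) \<le> D"
    "cn \<gamma> (\<lambda>t. ennreal \<bar>dd 2 (t, x)\<bar>) \<le> D"
proof -
  have gen: "cn \<gamma> (\<lambda>t. ennreal \<bar>d t\<bar>) \<le> ennreal (1 / \<bar>a\<bar>) * (\<integral>\<^sup>+y\<in>S. ennreal ((w y)\<^sup>2) \<partial>lborel)"
    if [measurable]: "w \<in> borel_measurable borel" "S \<in> sets borel" and a: "a \<noteq> 0" and d: "\<And>t. d t = 0 \<or> (0 \<le> t \<and> b + a * t \<in> S \<and> d t = w (b + a * t))"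
    for d w :: "real \<Rightarrow> real" and S a b
  proof -
    have "cn \<gamma> (\<lambda>t. ennreal \<bar>d t\<bar>) \<le> (\<integral>\<^sup>+t. ennreal ((w (b + a * t))\<^sup>2) * indicator S (b + a * t) \<partial>lborel)"
      unfolding cn_def
    proof (rule nn_integral_mono)
      fix t show "ew \<gamma> t * (ennreal \<bar>d t\<bar>)\<^sup>2 \<le> ennreal ((w (b + a * t))\<^sup>2) * indicator S (b + a * t)"
        using d[of t]
      proof
        assume "0 \<le> t \<and> b + a * t \<in> S \<and> d t = w (b + a * t)"
        then show ?thesis using mult_right_mono[OF ew_le_1[OF \<gamma>, of t], of "ennreal ((d t)\<^sup>2)"] by (simp add: ennreal_power)
      qed simp
    qed
    moreover have "(\<integral>\<^sup>+y\<in>S. ennreal ((w y)\<^sup>2) \<partial>lborel) = ennreal \<bar>a\<bar> * (\<integral>\<^sup>+t. ennreal ((w (b + a * t))\<^sup>2) * indicator S (b + a * t) \<partial>lborel)"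
      by (rule nn_integral_real_affine[OF _ a]) measurable
    moreover have "ennreal (1 / \<bar>a\<bar>) * ennreal \<bar>a\<bar> = 1" using a by (simp flip: ennreal_mult)
    ultimately show ?thesis by (simp add: mult.assoc[symmetric])
  qed
  show "cn \<gamma> (\<lambda>t. ennreal \<bar>dd 0 (t, x)\<bar>) \<le> D" if "x \<le> 1"
  proof -
    have "cn \<gamma> (\<lambda>t. ennreal \<bar>dd 0 (t, x)\<bar>) \<le> ennreal (1 / \<bar>- lam\<bar>) * (\<integral>\<^sup>+y\<in>{0..1}. ennreal ((u0 y)\<^sup>2) \<partial>lborel)"
    proof (rule gen[where b = x])
      show "dd 0 (t, x) = 0 \<or> (0 \<le> t \<and> x + - lam * t \<in> {0..1} \<and> dd 0 (t, x) = u0 (x + - lam * t))" for t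
        using that lam mult_nonneg_nonneg[of lam t] by (auto simp: dd_def simp del: mult_nonneg_nonneg)
    qed (use lam in auto)
    also have "\<dots> \<le> D" using lam by (simp add: D_def add.assoc)
    finally show ?thesis .
  qed
  show "cn \<gamma> (\<lambda>t. ennreal \<bar>dd 1 (t, x)\<bar>) \<le> D" if "0 \<le> x"
  proof -
    have "cn \<gamma> (\<lambda>t. ennreal \<bar>dd 1 (t, x)\<bar>) \<le> ennreal (1 / \<bar>mu\<bar>) * (\<integral>\<^sup>+y\<in>{0..1}. ennreal ((v0 y)\<^sup>2) \<partial>lborel)"
    proof (rule gen[where b = x])
      show "dd 1 (t, x) = 0 \<or> (0 \<le> t \<and> x + mu * t \<in> {0..1} \<and> dd 1 (t, x) = v0 (x + mu * t))" for t
        using that mu mult_nonneg_nonneg[of mu t] by (auto simp: dd_def simp del: mult_nonneg_nonneg)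
    qed (use mu in auto)
    also have "\<dots> \<le> D" using mu by (simp add: D_def add_increasing add_increasing2)
    finally show ?thesis .
  qed
  have "cn \<gamma> (\<lambda>t. ennreal \<bar>dd 2 (t, x)\<bar>) \<le> ennreal (1 / \<bar>1\<bar>) * (\<integral>\<^sup>+y\<in>{- \<delta>..0}. ennreal ((\<phi> y)\<^sup>2) \<partial>lborel)"
  proof (rule gen[where b = "- \<delta>"])
    show "dd 2 (t, x) = 0 \<or> (0 \<le> t \<and> - \<delta> + 1 * t \<in> {- \<delta>..0} \<and> dd 2 (t, x) = \<phi> (- \<delta> + 1 * t))" for t
      by (auto simp: dd_def)
  qed auto
  also have "\<dots> \<le> D" by (simp add: D_def add_increasing)
  finally show "cn \<gamma> (\<lambda>t. ennreal \<bar>dd 2 (t, x)\<bar>) \<le> D" .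
qed

definition col :: "real \<Rightarrow> (nat \<Rightarrow> real \<times> real \<Rightarrow> ennreal) \<Rightarrow> nat \<Rightarrow> real \<Rightarrow> ennreal" where
  "col \<gamma> F i x = cn \<gamma> (\<lambda>t. F i (t, x))"

text \<open>The interior norm. The estimates close on four numbers: J, the trace of u at x = 1, the
  trace of v at x = 0, and the boundary value.\<close>

definition J :: "real \<Rightarrow> (nat \<Rightarrow> real \<times> real \<Rightarrow> ennreal) \<Rightarrow> ennreal" where
  "J \<gamma> F = (\<integral>\<^sup>+x\<in>{0..1}. (col \<gamma> F 0 x + col \<gamma> F 1 x) \<partial>lborel)"

lemma col_meas[measurable]:
  assumes [measurable]: "F i \<in> borel_measurable (borel \<Otimes>\<^sub>M borel)"
  shows "col \<gamma> F i \<in> borel_measurable borel"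
proof -
  have "(\<lambda>x. col \<gamma> F i x) \<in> borel_measurable borel" unfolding col_def by (rule cn_meas) measurable
  then show ?thesis .
qed

lemma dsect_meas[measurable]: "(\<lambda>t. dd i (t, x)) \<in> borel_measurable borel"
  using measurable_compose[OF _ P.d_meas[of i], of "\<lambda>t. (t, x)" borel] by simp

text \<open>Only an inequality between F and G is assumed, so the same estimates apply to
  consecutive iterates and, by monotonicity, to F = G = \<open>P.S n\<close>. The latter yields a
  bound uniform in n.\<close>

context
  fixes \<gamma> :: real and F G :: "nat \<Rightarrow> real \<times> real \<Rightarrow> ennreal"
  assumes \<gamma>: "0 < \<gamma>" and F_meas[measurable]: "\<And>i. F i \<in> borel_measurable (borel \<Otimes>\<^sub>M borel)"
    and G: "\<And>i z. G i z \<le> ennreal \<bar>dd i z\<bar> + P.P F i z"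
begin

lemma J_part: "(\<integral>\<^sup>+x\<in>{0..1}. col \<gamma> F 0 x \<partial>lborel) \<le> J \<gamma> F" "(\<integral>\<^sup>+x\<in>{0..1}. col \<gamma> F 1 x \<partial>lborel) \<le> J \<gamma> F"
  unfolding J_def by (intro nn_integral_mono mult_right_mono; simp)+

lemma col0:
  assumes x: "0 \<le> x" "x \<le> 1"
  shows "col \<gamma> G 0 x \<le> 2 * D + 4 * (ennreal (q\<^sup>2) * (ew \<gamma> (x / lam) * col \<gamma> F 1 0))
    + 4 * (ennreal (M\<^sup>2 / lam) * (\<integral>\<^sup>+y\<in>{0..x / lam}. ew \<gamma> y * col \<gamma> F 1 (x - lam * y) \<partial>lborel))"
proof -
  have s: "0 \<le> x / lam" using x lam by simp
  have "col \<gamma> G 0 x \<le> 2 * cn \<gamma> (\<lambda>t. ennreal \<bar>dd 0 (t, x)\<bar>) + 4 * ((ennreal \<bar>q\<bar>)\<^sup>2 * (ew \<gamma> (x / lam) * cn \<gamma> (\<lambda>t. F 1 (t, 0))))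
    + 4 * ((ennreal M)\<^sup>2 * (ennreal (x / lam) * (\<integral>\<^sup>+y\<in>{0..x / lam}. ew \<gamma> y * cn \<gamma> (\<lambda>t. F 1 (t, x - lam * y)) \<partial>lborel)))"
    unfolding col_def
  proof (rule cn_step[OF _ _ _ s])
    fix t
    have "(\<integral>\<^sup>+y. ennreal \<bar>if 0 \<le> y \<and> y \<le> x / lam then \<sigma>pm (x - lam * y) else 0\<bar> * F 1 (t - y, x - lam * y) \<partial>lborel)
      \<le> ennreal M * (\<integral>\<^sup>+y\<in>{0..x / lam}. F 1 (t - y, x - lam * y) \<partial>lborel)"
      by (rule coeff_le) (use bdd M in auto)
    then show "G 0 (t, x) \<le> ennreal \<bar>dd 0 (t, x)\<bar> + (ennreal \<bar>q\<bar> * F 1 (t - x / lam, 0) + ennreal M * (\<integral>\<^sup>+y\<in>{0..x / lam}. F 1 (t - y, x - lam * y) \<partial>lborel))"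
      using G[of 0 "(t, x)"] unfolding P0 by (meson add_left_mono order_trans)
  qed measurable
  also have "\<dots> \<le> 2 * D + 4 * (ennreal (q\<^sup>2) * (ew \<gamma> (x / lam) * col \<gamma> F 1 0))
    + 4 * (ennreal (M\<^sup>2 / lam) * (\<integral>\<^sup>+y\<in>{0..x / lam}. ew \<gamma> y * col \<gamma> F 1 (x - lam * y) \<partial>lborel))"
  proof (intro add_mono mult_left_mono)
    show "cn \<gamma> (\<lambda>t. ennreal \<bar>dd 0 (t, x)\<bar>) \<le> D" using dd_le(1) \<gamma> x by simp
    show "(ennreal \<bar>q\<bar>)\<^sup>2 * (ew \<gamma> (x / lam) * cn \<gamma> (\<lambda>t. F 1 (t, 0))) \<le> ennreal (q\<^sup>2) * (ew \<gamma> (x / lam) * col \<gamma> F 1 0)"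
      by (simp add: col_def ennreal_power)
    have "(ennreal M)\<^sup>2 * ennreal (x / lam) \<le> ennreal (M\<^sup>2 / lam)"
    proof -
      have "M\<^sup>2 * (x / lam) \<le> M\<^sup>2 * (1 / lam)" using x lam by (intro mult_left_mono divide_right_mono) auto
      then have "ennreal (M\<^sup>2 * (x / lam)) \<le> ennreal (M\<^sup>2 * (1 / lam))" by (rule ennreal_leI)
      moreover have "(ennreal M)\<^sup>2 * ennreal (x / lam) = ennreal (M\<^sup>2 * (x / lam))"
        using M s by (subst ennreal_mult) (auto simp: ennreal_power)
      ultimately show ?thesis by simp
    qed
    then show "(ennreal M)\<^sup>2 * (ennreal (x / lam) * (\<integral>\<^sup>+y\<in>{0..x / lam}. ew \<gamma> y * cn \<gamma> (\<lambda>t. F 1 (t, x - lam * y)) \<partial>lborel))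
      \<le> ennreal (M\<^sup>2 / lam) * (\<integral>\<^sup>+y\<in>{0..x / lam}. ew \<gamma> y * col \<gamma> F 1 (x - lam * y) \<partial>lborel)"
      unfolding col_def mult.assoc[symmetric] by (intro mult_right_mono) auto
  qed auto
  finally show ?thesis .
qed

lemma col1:
  assumes x: "0 \<le> x" "x \<le> 1"
  shows "col \<gamma> G 1 x \<le> 2 * D + 4 * (ew \<gamma> ((1 - x) / mu) * col \<gamma> F 2 0)
    + 4 * (ennreal (M\<^sup>2 / mu) * (\<integral>\<^sup>+y\<in>{0..(1 - x) / mu}. ew \<gamma> y * col \<gamma> F 0 (x + mu * y) \<partial>lborel))"
proof -
  have s: "0 \<le> (1 - x) / mu" using x mu by simp
  have "col \<gamma> G 1 x \<le> 2 * cn \<gamma> (\<lambda>t. ennreal \<bar>dd 1 (t, x)\<bar>) + 4 * (1\<^sup>2 * (ew \<gamma> ((1 - x) / mu) * cn \<gamma> (\<lambda>t. F 2 (t, 0))))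
    + 4 * ((ennreal M)\<^sup>2 * (ennreal ((1 - x) / mu) * (\<integral>\<^sup>+y\<in>{0..(1 - x) / mu}. ew \<gamma> y * cn \<gamma> (\<lambda>t. F 0 (t, x + mu * y)) \<partial>lborel)))"
    unfolding col_def
  proof (rule cn_step[OF _ _ _ s])
    fix t
    have "(\<integral>\<^sup>+y. ennreal \<bar>if 0 \<le> y \<and> y \<le> (1 - x) / mu then \<sigma>mp (x + mu * y) else 0\<bar> * F 0 (t - y, x + mu * y) \<partial>lborel)
      \<le> ennreal M * (\<integral>\<^sup>+y\<in>{0..(1 - x) / mu}. F 0 (t - y, x + mu * y) \<partial>lborel)"
      by (rule coeff_le) (use bdd M in auto)
    then show "G 1 (t, x) \<le> ennreal \<bar>dd 1 (t, x)\<bar> + (1 * F 2 (t - (1 - x) / mu, 0) + ennreal M * (\<integral>\<^sup>+y\<in>{0..(1 - x) / mu}. F 0 (t - y, x + mu * y) \<partial>lborel))"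
      using G[of 1 "(t, x)"] unfolding P1 mult_1_left by (meson add_left_mono order_trans)
  qed measurable
  also have "\<dots> \<le> 2 * D + 4 * (ew \<gamma> ((1 - x) / mu) * col \<gamma> F 2 0)
    + 4 * (ennreal (M\<^sup>2 / mu) * (\<integral>\<^sup>+y\<in>{0..(1 - x) / mu}. ew \<gamma> y * col \<gamma> F 0 (x + mu * y) \<partial>lborel))"
  proof (intro add_mono mult_left_mono)
    show "cn \<gamma> (\<lambda>t. ennreal \<bar>dd 1 (t, x)\<bar>) \<le> D" using dd_le(2) \<gamma> x by simp
    show "1\<^sup>2 * (ew \<gamma> ((1 - x) / mu) * cn \<gamma> (\<lambda>t. F 2 (t, 0))) \<le> ew \<gamma> ((1 - x) / mu) * col \<gamma> F 2 0"
      by (simp add: col_def)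
    have "(ennreal M)\<^sup>2 * ennreal ((1 - x) / mu) \<le> ennreal (M\<^sup>2 / mu)"
    proof -
      have "M\<^sup>2 * ((1 - x) / mu) \<le> M\<^sup>2 * (1 / mu)" using x mu by (intro mult_left_mono divide_right_mono) auto
      then have "ennreal (M\<^sup>2 * ((1 - x) / mu)) \<le> ennreal (M\<^sup>2 * (1 / mu))" by (rule ennreal_leI)
      moreover have "(ennreal M)\<^sup>2 * ennreal ((1 - x) / mu) = ennreal (M\<^sup>2 * ((1 - x) / mu))"
        using M s by (subst ennreal_mult) (auto simp: ennreal_power)
      ultimately show ?thesis by simp
    qed
    then show "(ennreal M)\<^sup>2 * (ennreal ((1 - x) / mu) * (\<integral>\<^sup>+y\<in>{0..(1 - x) / mu}. ew \<gamma> y * cn \<gamma> (\<lambda>t. F 0 (t, x + mu * y)) \<partial>lborel))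
      \<le> ennreal (M\<^sup>2 / mu) * (\<integral>\<^sup>+y\<in>{0..(1 - x) / mu}. ew \<gamma> y * col \<gamma> F 0 (x + mu * y) \<partial>lborel)"
      unfolding col_def mult.assoc[symmetric] by (intro mult_right_mono) auto
  qed auto
  finally show ?thesis .
qed

text \<open>No factor here becomes small for large \<gamma>: the \<rho> term has no delay and
  \<delta> may be 0. Smallness must come from the crossing times in the other two traces.\<close>

lemma col2:
  "col \<gamma> G 2 x \<le> 2 * D + ennreal (4 * \<rho>\<^sup>2 + 8 * K\<^sup>2) * col \<gamma> F 0 1 + ennreal (16 * M\<^sup>2) * J \<gamma> F"
proof -
  let ?I = "\<lambda>i t. \<integral>\<^sup>+y\<in>{0..1}. F i (t - \<delta>, y) \<partial>lborel"
  have I: "cn \<gamma> (\<lambda>t. ennreal M * ?I i t) \<le> ennreal (M\<^sup>2) * (\<integral>\<^sup>+y\<in>{0..1}. col \<gamma> F i y \<partial>lborel)" for i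
  proof -
    have "cn \<gamma> (\<lambda>t. ennreal M * ?I i t) = (ennreal M)\<^sup>2 * cn \<gamma> (?I i)" by (rule cn_cmult) measurable
    also have "cn \<gamma> (?I i) \<le> ennreal 1 * (\<integral>\<^sup>+y\<in>{0..1}. cn \<gamma> (\<lambda>t. F i (t - \<delta>, y)) \<partial>lborel)"
      by (rule cn_integral_le) (simp_all, measurable)
    also have "\<dots> \<le> (\<integral>\<^sup>+y\<in>{0..1}. col \<gamma> F i y \<partial>lborel)"
    proof -
      have "cn \<gamma> (\<lambda>t. F i (t - \<delta>, y)) \<le> col \<gamma> F i y" for y
      proof -
        have "cn \<gamma> (\<lambda>t. F i (t - \<delta>, y)) = ew \<gamma> \<delta> * col \<gamma> F i y" unfolding col_def by (rule cn_shift) measurable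
        also have "\<dots> \<le> 1 * col \<gamma> F i y" using \<gamma> \<delta> by (intro mult_right_mono ew_le_1) auto
        finally show ?thesis by simp
      qed
      then show ?thesis by (auto intro!: nn_integral_mono mult_right_mono)
    qed
    finally show ?thesis using M by (simp add: ennreal_power mult_left_mono)
  qed
  have K: "cn \<gamma> (\<lambda>t. ennreal \<bar>K\<bar> * F 0 (t - \<delta>, 1)) \<le> ennreal (K\<^sup>2) * col \<gamma> F 0 1"
  proof -
    have "cn \<gamma> (\<lambda>t. ennreal \<bar>K\<bar> * F 0 (t - \<delta>, 1)) = (ennreal \<bar>K\<bar>)\<^sup>2 * cn \<gamma> (\<lambda>t. F 0 (t - \<delta>, 1))" by (rule cn_cmult) measurable
    also have "cn \<gamma> (\<lambda>t. F 0 (t - \<delta>, 1)) = ew \<gamma> \<delta> * col \<gamma> F 0 1" unfolding col_def by (rule cn_shift) measurable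
    also have "\<dots> \<le> 1 * col \<gamma> F 0 1" using \<gamma> \<delta> by (intro mult_right_mono ew_le_1) auto
    finally show ?thesis by (simp add: ennreal_power mult_left_mono)
  qed
  have R: "cn \<gamma> (\<lambda>t. ennreal \<bar>\<rho>\<bar> * F 0 (t, 1)) = ennreal (\<rho>\<^sup>2) * col \<gamma> F 0 1"
    unfolding col_def by (subst cn_cmult) (auto simp: ennreal_power)
  have pt: "G 2 (t, x) \<le> ennreal \<bar>dd 2 (t, x)\<bar> + (ennreal \<bar>\<rho>\<bar> * F 0 (t, 1) + (ennreal \<bar>K\<bar> * F 0 (t - \<delta>, 1) + (ennreal M * ?I 0 t + ennreal M * ?I 1 t)))" for t
  proof -
    have "(\<integral>\<^sup>+y. ennreal \<bar>l1 y * indicator {0..1} y\<bar> * F 0 (t - \<delta>, y) \<partial>lborel) \<le> ennreal M * ?I 0 t"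
      by (rule coeff_le) (use bdd M in \<open>auto simp: indicator_def\<close>)
    moreover have "(\<integral>\<^sup>+y. ennreal \<bar>l2 y * indicator {0..1} y\<bar> * F 1 (t - \<delta>, y) \<partial>lborel) \<le> ennreal M * ?I 1 t"
      by (rule coeff_le) (use bdd M in \<open>auto simp: indicator_def\<close>)
    ultimately show ?thesis using G[of 2 "(t, x)"] unfolding P2 add.assoc
      by (elim order_trans) (intro add_left_mono add_mono)
  qed
  have "col \<gamma> G 2 x \<le> cn \<gamma> (\<lambda>t. ennreal \<bar>dd 2 (t, x)\<bar> + (ennreal \<bar>\<rho>\<bar> * F 0 (t, 1) + (ennreal \<bar>K\<bar> * F 0 (t - \<delta>, 1) + (ennreal M * ?I 0 t + ennreal M * ?I 1 t))))"
    unfolding col_def by (rule cn_mono) (rule pt)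
  also have "\<dots> \<le> 2 * cn \<gamma> (\<lambda>t. ennreal \<bar>dd 2 (t, x)\<bar>) + 2 * (2 * cn \<gamma> (\<lambda>t. ennreal \<bar>\<rho>\<bar> * F 0 (t, 1))
      + 2 * (2 * cn \<gamma> (\<lambda>t. ennreal \<bar>K\<bar> * F 0 (t - \<delta>, 1)) + 2 * (2 * cn \<gamma> (\<lambda>t. ennreal M * ?I 0 t) + 2 * cn \<gamma> (\<lambda>t. ennreal M * ?I 1 t))))"
    by (rule cn_add5_le) measurable
  also have "\<dots> \<le> 2 * D + 2 * (2 * (ennreal (\<rho>\<^sup>2) * col \<gamma> F 0 1) + 2 * (2 * (ennreal (K\<^sup>2) * col \<gamma> F 0 1)
      + 2 * (2 * (ennreal (M\<^sup>2) * (\<integral>\<^sup>+y\<in>{0..1}. col \<gamma> F 0 y \<partial>lborel)) + 2 * (ennreal (M\<^sup>2) * (\<integral>\<^sup>+y\<in>{0..1}. col \<gamma> F 1 y \<partial>lborel)))))"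
    unfolding R using \<gamma> by (intro add_mono mult_left_mono I K dd_le(3)) auto
  also have "\<dots> = 2 * D + (4 * ennreal (\<rho>\<^sup>2) + 8 * ennreal (K\<^sup>2)) * col \<gamma> F 0 1
      + 16 * ennreal (M\<^sup>2) * ((\<integral>\<^sup>+y\<in>{0..1}. col \<gamma> F 0 y \<partial>lborel) + (\<integral>\<^sup>+y\<in>{0..1}. col \<gamma> F 1 y \<partial>lborel))"
    by (simp add: distrib_left distrib_right mult.assoc[symmetric] add.assoc)
  also have "(\<integral>\<^sup>+y\<in>{0..1}. col \<gamma> F 0 y \<partial>lborel) + (\<integral>\<^sup>+y\<in>{0..1}. col \<gamma> F 1 y \<partial>lborel) = J \<gamma> F"
    unfolding J_def distrib_right by (rule nn_integral_add[symmetric]) measurable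
  also have "4 * ennreal (\<rho>\<^sup>2) + 8 * ennreal (K\<^sup>2) = ennreal (4 * \<rho>\<^sup>2 + 8 * K\<^sup>2)" by (simp add: ennreal_mult)
  also have "16 * ennreal (M\<^sup>2) = ennreal (16 * M\<^sup>2)" by (simp add: ennreal_mult)
  finally show ?thesis .
qed

end

end

text \<open>The chain z from x, x from y, y from z contains one large step, from x to z, and two
  small ones. A weighted sum of the four quantities is therefore bounded by data plus half of
  itself.\<close>

lemma picard_bound_real:
  fixes x y z j D C :: real
  assumes C: "1 \<le> C" and nn: "0 \<le> x" "0 \<le> y" "0 \<le> z" "0 \<le> j" "0 \<le> D"
    and z: "z \<le> 2 * D + C * x + C * j" and y: "y \<le> 2 * D + 1 / (64 * C\<^sup>2) * z + C * j"
    and x: "x \<le> 2 * D + 1 / (64 * C\<^sup>2) * y + C * j" and j: "j \<le> 4 * D + 1 / (64 * C\<^sup>2) * (y + z + j)"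
  shows "x + y + z + j \<le> 200 * C\<^sup>2 * D"
proof -
  define \<epsilon> where "\<epsilon> = 1 / (64 * C\<^sup>2)"
  have C2: "1 \<le> C\<^sup>2" "C \<le> C\<^sup>2" using C by (simp_all add: one_le_power self_le_power)
  have e1: "16 * C\<^sup>2 * \<epsilon> = 1 / 4" using C by (simp add: \<epsilon>_def)
  have e0: "0 \<le> \<epsilon>" by (simp add: \<epsilon>_def)
  have e2: "\<epsilon> \<le> 1 / 64" using C2 by (simp add: \<epsilon>_def divide_simps)
  have e3: "C * \<epsilon> \<le> 1 / 64" using mult_right_mono[OF C2(2) e0] e1 by simp
  \<comment> \<open>x is weighted by 2 C so that the term C x in the bound for z is only half of it;
    16 C^2 in front of j similarly dominates all interior terms. With \<epsilon> = 1 / (64 C^2),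
    even 16 C^2 \<epsilon> is just 1/4.\<close>
  define N where "N = z + 2 * C * x + y + 16 * C\<^sup>2 * j"
  have "2 * C * x \<le> 2 * C * (2 * D + \<epsilon> * y + C * j)" using x C by (intro mult_left_mono) (auto simp: \<epsilon>_def)
  moreover have "16 * C\<^sup>2 * j \<le> 16 * C\<^sup>2 * (4 * D + \<epsilon> * (y + z + j))" using j by (intro mult_left_mono) (auto simp: \<epsilon>_def)
  ultimately have "N \<le> (2 * D + C * x + C * j) + 2 * C * (2 * D + \<epsilon> * y + C * j) + (2 * D + \<epsilon> * z + C * j) + 16 * C\<^sup>2 * (4 * D + \<epsilon> * (y + z + j))"
    using z y unfolding N_def \<epsilon>_def[symmetric] by linarith
  also have "\<dots> = (4 + 4 * C + 64 * C\<^sup>2) * D + C * x + (2 * (C * \<epsilon>) + 16 * C\<^sup>2 * \<epsilon>) * y + (\<epsilon> + 16 * C\<^sup>2 * \<epsilon>) * z + (2 * C + 2 * C\<^sup>2 + 16 * C\<^sup>2 * \<epsilon>) * j"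
    by (simp add: algebra_simps power2_eq_square)
  also have "\<dots> \<le> (72 * C\<^sup>2) * D + C * x + (1 / 2) * y + (1 / 2) * z + (8 * C\<^sup>2) * j"
    using C2 e2 e3 nn unfolding e1 by (intro add_mono mult_right_mono) auto
  finally have "N \<le> (72 * C\<^sup>2) * D + C * x + (1 / 2) * y + (1 / 2) * z + (8 * C\<^sup>2) * j" .
  moreover have "N = z + 2 * (C * x) + y + 16 * (C\<^sup>2 * j)" "(8 * C\<^sup>2) * j = 8 * (C\<^sup>2 * j)" by (simp_all add: N_def)
  ultimately have "N / 2 \<le> 72 * C\<^sup>2 * D" by linarith
  then have N: "N \<le> 2 * (72 * C\<^sup>2 * D)" by linarith
  have "x \<le> 2 * C * x" "j \<le> 16 * C\<^sup>2 * j"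
    using mult_right_mono[of 1 "2 * C" x] mult_right_mono[of 1 "16 * C\<^sup>2" j] C C2 nn by simp_all
  then have "x + y + z + j \<le> N" unfolding N_def by linarith
  also note N
  also have "2 * (72 * C\<^sup>2 * D) \<le> 200 * C\<^sup>2 * D" using nn by simp
  finally show ?thesis .
qed

context wellposed
begin

text \<open>Dominates the coefficients that do not shrink with the weight. The weight
  \<open>gw\<close> is then chosen so large that each of the shrinking coefficients, divided by 2
  \<open>gw\<close>, is at most 1 / (64 Cw^2).\<close>

definition "Cw = 1 + 4 * q\<^sup>2 + 4 * \<rho>\<^sup>2 + 8 * K\<^sup>2 + 16 * M\<^sup>2 + 4 * M\<^sup>2 / lam\<^sup>2 + 4 * M\<^sup>2 / mu\<^sup>2"

definition "gw = (4 * q\<^sup>2 * lam + 4 * mu + 4 * M\<^sup>2 / lam + 4 * M\<^sup>2 / mu + 1) * (32 * Cw\<^sup>2)"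

lemma Cw: "1 \<le> Cw" "4 * \<rho>\<^sup>2 + 8 * K\<^sup>2 \<le> Cw" "16 * M\<^sup>2 \<le> Cw" "4 * M\<^sup>2 / lam\<^sup>2 \<le> Cw" "4 * M\<^sup>2 / mu\<^sup>2 \<le> Cw"
  unfolding Cw_def by (simp_all add: add_nonneg_nonneg add_increasing add_increasing2)

lemma gw: "0 < gw"
  unfolding gw_def using lam mu Cw(1) by (intro mult_pos_pos add_nonneg_pos add_nonneg_nonneg) auto

lemma gw_le:
  assumes "0 \<le> a" "a \<le> 4 * q\<^sup>2 * lam + 4 * mu + 4 * M\<^sup>2 / lam + 4 * M\<^sup>2 / mu"
  shows "a / (2 * gw) \<le> 1 / (64 * Cw\<^sup>2)"
proof -
  define b where "b = 4 * q\<^sup>2 * lam + 4 * mu + 4 * M\<^sup>2 / lam + 4 * M\<^sup>2 / mu + 1"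
  have b: "a \<le> b" "0 < b" using assms by (auto simp: b_def)
  have "a / (2 * gw) = a / b * (1 / (64 * Cw\<^sup>2))" unfolding gw_def b_def[symmetric] by simp
  also have "\<dots> \<le> 1 * (1 / (64 * Cw\<^sup>2))" using b by (intro mult_right_mono) auto
  finally show ?thesis by simp
qed

context
  fixes F G :: "nat \<Rightarrow> real \<times> real \<Rightarrow> ennreal"
  assumes F_meas[measurable]: "\<And>i. F i \<in> borel_measurable (borel \<Otimes>\<^sub>M borel)"
    and G: "\<And>i z. G i z \<le> ennreal \<bar>dd i z\<bar> + P.P F i z"
begin

text \<open>At x = 1 the reflected trace is delayed by the full crossing time 1/lam, which makes its
  coefficient small. The interior term is not small here, but it is bounded by J.\<close>

lemma end0:
  "col gw G 0 1 \<le> 2 * D + ennreal (1 / (64 * Cw\<^sup>2)) * col gw F 1 0 + ennreal Cw * J gw F"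
proof -
  have "ennreal lam * (\<integral>\<^sup>+y\<in>{0..1 / lam}. ew gw y * col gw F 1 (1 - lam * y) \<partial>lborel) \<le> J gw F"
  proof -
    have "(\<integral>\<^sup>+y\<in>{0..1 / lam}. ew gw y * col gw F 1 (1 - lam * y) \<partial>lborel) \<le> (\<integral>\<^sup>+y. col gw F 1 (1 + - lam * y) * indicator {0..1} (1 + - lam * y) \<partial>lborel)"
    proof (rule nn_integral_mono)
      fix y
      show "ew gw y * col gw F 1 (1 - lam * y) * indicator {0..1 / lam} y \<le> col gw F 1 (1 + - lam * y) * indicator {0..1} (1 + - lam * y)"
        using lam gw mult_right_mono[OF ew_le_1[of gw y], of "col gw F 1 (1 - lam * y)"] by (auto simp: indicator_def field_simps)
    qed
    then have "ennreal lam * (\<integral>\<^sup>+y\<in>{0..1 / lam}. ew gw y * col gw F 1 (1 - lam * y) \<partial>lborel) \<le> ennreal \<bar>- lam\<bar> * (\<integral>\<^sup>+y. col gw F 1 (1 + - lam * y) * indicator {0..1} (1 + - lam * y) \<partial>lborel)"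
      using lam by (intro mult_mono) auto
    also have "\<dots> = (\<integral>\<^sup>+x\<in>{0..1}. col gw F 1 x \<partial>lborel)"
      using lam by (intro nn_integral_real_affine[symmetric]) auto
    also have "\<dots> \<le> J gw F" by (rule J_part[OF gw F_meas G])
    finally show ?thesis .
  qed
  note I = this
  have "col gw G 0 1 \<le> 2 * D + 4 * (ennreal (q\<^sup>2) * (ew gw (1 / lam) * col gw F 1 0))
    + 4 * (ennreal (M\<^sup>2 / lam) * (\<integral>\<^sup>+y\<in>{0..1 / lam}. ew gw y * col gw F 1 (1 - lam * y) \<partial>lborel))"
    using col0[OF gw F_meas G, of 1] by simp
  also have "\<dots> \<le> 2 * D + ennreal (1 / (64 * Cw\<^sup>2)) * col gw F 1 0 + ennreal Cw * J gw F"
  proof (intro add_mono order_refl)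
    have "4 * (ennreal (q\<^sup>2) * ew gw (1 / lam)) \<le> 4 * (ennreal (q\<^sup>2) * ennreal (1 / (2 * gw * (1 / lam))))"
      using gw lam by (intro mult_left_mono ew_le) auto
    also have "\<dots> = ennreal (4 * q\<^sup>2 * lam / (2 * gw))"
      using gw lam by (simp add: ennreal_mult[symmetric] ennreal_numeral[symmetric] del: ennreal_numeral)
    also have "\<dots> \<le> ennreal (1 / (64 * Cw\<^sup>2))" using lam mu by (intro ennreal_leI gw_le) auto
    finally show "4 * (ennreal (q\<^sup>2) * (ew gw (1 / lam) * col gw F 1 0)) \<le> ennreal (1 / (64 * Cw\<^sup>2)) * col gw F 1 0"
      unfolding mult.assoc[symmetric] by (intro mult_right_mono) auto
    have e: "4 * ennreal (M\<^sup>2 / lam) = ennreal (4 * M\<^sup>2 / lam\<^sup>2) * ennreal lam"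
      using lam by (simp add: ennreal_mult[symmetric] ennreal_numeral[symmetric] power2_eq_square del: ennreal_numeral)
    show "4 * (ennreal (M\<^sup>2 / lam) * (\<integral>\<^sup>+y\<in>{0..1 / lam}. ew gw y * col gw F 1 (1 - lam * y) \<partial>lborel)) \<le> ennreal Cw * J gw F"
      unfolding mult.assoc[of 4, symmetric] e mult.assoc[of "ennreal (4 * M\<^sup>2 / lam\<^sup>2)"] using Cw by (intro mult_mono I ennreal_leI) auto
  qed
  finally show ?thesis .
qed

lemma end1:
  "col gw G 1 0 \<le> 2 * D + ennreal (1 / (64 * Cw\<^sup>2)) * col gw F 2 0 + ennreal Cw * J gw F"
proof -
  have "ennreal mu * (\<integral>\<^sup>+y\<in>{0..1 / mu}. ew gw y * col gw F 0 (0 + mu * y) \<partial>lborel) \<le> J gw F"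
  proof -
    have "(\<integral>\<^sup>+y\<in>{0..1 / mu}. ew gw y * col gw F 0 (0 + mu * y) \<partial>lborel) \<le> (\<integral>\<^sup>+y. col gw F 0 (0 + mu * y) * indicator {0..1} (0 + mu * y) \<partial>lborel)"
    proof (rule nn_integral_mono)
      fix y
      show "ew gw y * col gw F 0 (0 + mu * y) * indicator {0..1 / mu} y \<le> col gw F 0 (0 + mu * y) * indicator {0..1} (0 + mu * y)"
        using mu gw mult_right_mono[OF ew_le_1[of gw y], of "col gw F 0 (0 + mu * y)"] by (auto simp: indicator_def field_simps)
    qed
    then have "ennreal mu * (\<integral>\<^sup>+y\<in>{0..1 / mu}. ew gw y * col gw F 0 (0 + mu * y) \<partial>lborel) \<le> ennreal \<bar>mu\<bar> * (\<integral>\<^sup>+y. col gw F 0 (0 + mu * y) * indicator {0..1} (0 + mu * y) \<partial>lborel)"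
      using mu by (intro mult_mono) auto
    also have "\<dots> = (\<integral>\<^sup>+x\<in>{0..1}. col gw F 0 x \<partial>lborel)"
      using mu by (intro nn_integral_real_affine[symmetric]) auto
    also have "\<dots> \<le> J gw F" by (rule J_part[OF gw F_meas G])
    finally show ?thesis .
  qed
  note I = this
  have "col gw G 1 0 \<le> 2 * D + 4 * (ew gw (1 / mu) * col gw F 2 0)
    + 4 * (ennreal (M\<^sup>2 / mu) * (\<integral>\<^sup>+y\<in>{0..1 / mu}. ew gw y * col gw F 0 (0 + mu * y) \<partial>lborel))"
    using col1[OF gw F_meas G, of 0] by simp
  also have "\<dots> \<le> 2 * D + ennreal (1 / (64 * Cw\<^sup>2)) * col gw F 2 0 + ennreal Cw * J gw F"
  proof (intro add_mono order_refl)
    have "4 * ew gw (1 / mu) \<le> 4 * ennreal (1 / (2 * gw * (1 / mu)))"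
      using gw mu by (intro mult_left_mono ew_le) auto
    also have "\<dots> = ennreal (4 * mu / (2 * gw))"
      using gw mu by (simp add: ennreal_mult[symmetric] ennreal_numeral[symmetric] del: ennreal_numeral)
    also have "\<dots> \<le> ennreal (1 / (64 * Cw\<^sup>2))" using lam mu by (intro ennreal_leI gw_le) auto
    finally show "4 * (ew gw (1 / mu) * col gw F 2 0) \<le> ennreal (1 / (64 * Cw\<^sup>2)) * col gw F 2 0"
      unfolding mult.assoc[symmetric] by (intro mult_right_mono) auto
    have e: "4 * ennreal (M\<^sup>2 / mu) = ennreal (4 * M\<^sup>2 / mu\<^sup>2) * ennreal mu"
      using mu by (simp add: ennreal_mult[symmetric] ennreal_numeral[symmetric] power2_eq_square del: ennreal_numeral)
    show "4 * (ennreal (M\<^sup>2 / mu) * (\<integral>\<^sup>+y\<in>{0..1 / mu}. ew gw y * col gw F 0 (0 + mu * y) \<partial>lborel)) \<le> ennreal Cw * J gw F"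
      unfolding mult.assoc[of 4, symmetric] e mult.assoc[of "ennreal (4 * M\<^sup>2 / mu\<^sup>2)"] using Cw by (intro mult_mono I ennreal_leI) auto
  qed
  finally show ?thesis .
qed

text \<open>Near the inflow boundary the delay is short and the weight gives nothing; averaging over
  x repairs this, since exp(-2 \<gamma> x / a) integrates to at most a / (2 \<gamma>). The interior
  terms shrink by the triangle estimate.\<close>

lemma J_le:
  assumes G_meas[measurable]: "\<And>i. G i \<in> borel_measurable (borel \<Otimes>\<^sub>M borel)"
  shows "J gw G \<le> 4 * D + ennreal (1 / (64 * Cw\<^sup>2)) * (col gw F 1 0 + col gw F 2 0 + J gw F)"
proof -
  let ?n = "\<lambda>i. \<integral>\<^sup>+x\<in>{0..1}. col gw F i x \<partial>lborel"
  have K0: "(\<integral>\<^sup>+x\<in>{0..1}. ew gw (x / a) \<partial>lborel) \<le> ennreal (a / (2 * gw))" if "0 < a" for a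
    unfolding ew_integral_le[OF gw that, symmetric] by (rule set_nn_integral_mono_set) auto
  have K1: "(\<integral>\<^sup>+x\<in>{0..1}. ew gw ((1 - x) / a) \<partial>lborel) \<le> ennreal (a / (2 * gw))" if "0 < a" for a
  proof -
    have "(\<integral>\<^sup>+x\<in>{0..1}. ew gw ((1 - x) / a) \<partial>lborel) = (\<integral>\<^sup>+x\<in>{1 - 1..1 - 0}. ew gw (x / a) \<partial>lborel)"
      by (rule nn_integral_Icc_reflect[of "\<lambda>x. ew gw (x / a)"]) measurable
    then show ?thesis using K0[OF that] by simp
  qed
  have T0: "(\<integral>\<^sup>+x\<in>{0..1}. (\<integral>\<^sup>+y\<in>{0..x / lam}. ew gw y * col gw F 1 (x - lam * y) \<partial>lborel) \<partial>lborel) \<le> ennreal (1 / (2 * gw)) * ?n 1"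
    by (rule triangle_fubini_le[OF _ lam gw]) measurable
  have T1: "(\<integral>\<^sup>+x\<in>{0..1}. (\<integral>\<^sup>+y\<in>{0..(1 - x) / mu}. ew gw y * col gw F 0 (x + mu * y) \<partial>lborel) \<partial>lborel) \<le> ennreal (1 / (2 * gw)) * ?n 0"
  proof -
    let ?H = "\<lambda>x. \<integral>\<^sup>+y\<in>{0..x / mu}. ew gw y * col gw F 0 (1 - (x - mu * y)) \<partial>lborel"
    have [measurable]: "?H \<in> borel_measurable borel"
    proof -
      have "?H = (\<lambda>x. \<integral>\<^sup>+y. (if 0 \<le> y \<and> y \<le> x / mu then ew gw y * col gw F 0 (1 - (x - mu * y)) else 0) \<partial>lborel)"
        by (intro ext nn_integral_cong) (auto simp: indicator_def)
      then show ?thesis by simp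
    qed
    have "(\<integral>\<^sup>+x\<in>{0..1}. (\<integral>\<^sup>+y\<in>{0..(1 - x) / mu}. ew gw y * col gw F 0 (x + mu * y) \<partial>lborel) \<partial>lborel) = (\<integral>\<^sup>+x\<in>{0..1}. ?H (1 - x) \<partial>lborel)"
      by (intro nn_integral_cong) (simp add: algebra_simps)
    also have "\<dots> = (\<integral>\<^sup>+x\<in>{1 - 1..1 - 0}. ?H x \<partial>lborel)" by (rule nn_integral_Icc_reflect) measurable
    also have "\<dots> \<le> ennreal (1 / (2 * gw)) * (\<integral>\<^sup>+x\<in>{0..1}. col gw F 0 (1 - x) \<partial>lborel)"
      using triangle_fubini_le[OF _ mu gw, of "\<lambda>x. col gw F 0 (1 - x)"] by simp
    also have "(\<integral>\<^sup>+x\<in>{0..1}. col gw F 0 (1 - x) \<partial>lborel) = (\<integral>\<^sup>+x\<in>{1 - 1..1 - 0}. col gw F 0 x \<partial>lborel)"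
      by (rule nn_integral_Icc_reflect) measurable
    also have "\<dots> = ?n 0" by simp
    finally show ?thesis .
  qed
  have m0[measurable]: "(\<lambda>x. \<integral>\<^sup>+y\<in>{0..x / lam}. ew gw y * col gw F 1 (x - lam * y) \<partial>lborel) \<in> borel_measurable borel"
  proof -
    have "(\<lambda>x. \<integral>\<^sup>+y\<in>{0..x / lam}. ew gw y * col gw F 1 (x - lam * y) \<partial>lborel) = (\<lambda>x. \<integral>\<^sup>+y. (if 0 \<le> y \<and> y \<le> x / lam then ew gw y * col gw F 1 (x - lam * y) else 0) \<partial>lborel)"
      by (intro ext nn_integral_cong) (auto simp: indicator_def)
    then show ?thesis by simp
  qed
  have m1[measurable]: "(\<lambda>x. \<integral>\<^sup>+y\<in>{0..(1 - x) / mu}. ew gw y * col gw F 0 (x + mu * y) \<partial>lborel) \<in> borel_measurable borel"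
  proof -
    have "(\<lambda>x. \<integral>\<^sup>+y\<in>{0..(1 - x) / mu}. ew gw y * col gw F 0 (x + mu * y) \<partial>lborel) = (\<lambda>x. \<integral>\<^sup>+y. (if 0 \<le> y \<and> y \<le> (1 - x) / mu then ew gw y * col gw F 0 (x + mu * y) else 0) \<partial>lborel)"
      by (intro ext nn_integral_cong) (auto simp: indicator_def)
    then show ?thesis by simp
  qed
  have lin: "(\<integral>\<^sup>+x. a * indicator {0..1} x + b * (p x * indicator {0..1} x) + c * (r x * indicator {0..1} x) \<partial>lborel)
    = a + b * (\<integral>\<^sup>+x\<in>{0..1}. p x \<partial>lborel) + c * (\<integral>\<^sup>+x\<in>{0..1}. r x \<partial>lborel)"
    if [measurable]: "p \<in> borel_measurable borel" "r \<in> borel_measurable borel" for a b c and p r :: "real \<Rightarrow> ennreal"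
    by (simp add: nn_integral_add nn_integral_cmult)
  have rc: "a * b * c = a * c * b" for a b c :: ennreal by (simp only: mult_ac)
  have G0: "(\<integral>\<^sup>+x\<in>{0..1}. col gw G 0 x \<partial>lborel) \<le> 2 * D + ennreal (4 * q\<^sup>2 * lam / (2 * gw)) * col gw F 1 0 + ennreal (4 * M\<^sup>2 / lam / (2 * gw)) * ?n 1"
  proof -
    have "(\<integral>\<^sup>+x\<in>{0..1}. col gw G 0 x \<partial>lborel) \<le> (\<integral>\<^sup>+x. 2 * D * indicator {0..1} x + (4 * ennreal (q\<^sup>2) * col gw F 1 0) * (ew gw (x / lam) * indicator {0..1} x)
        + (4 * ennreal (M\<^sup>2 / lam)) * ((\<integral>\<^sup>+y\<in>{0..x / lam}. ew gw y * col gw F 1 (x - lam * y) \<partial>lborel) * indicator {0..1} x) \<partial>lborel)"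
    proof (rule nn_integral_mono)
      fix x :: real
      show "col gw G 0 x * indicator {0..1} x \<le> 2 * D * indicator {0..1} x + (4 * ennreal (q\<^sup>2) * col gw F 1 0) * (ew gw (x / lam) * indicator {0..1} x)
        + (4 * ennreal (M\<^sup>2 / lam)) * ((\<integral>\<^sup>+y\<in>{0..x / lam}. ew gw y * col gw F 1 (x - lam * y) \<partial>lborel) * indicator {0..1} x)"
        using col0[OF gw F_meas G, of x] by (cases "x \<in> {0..1}") (auto simp: mult_ac)
    qed
    also have "\<dots> = 2 * D + (4 * ennreal (q\<^sup>2) * col gw F 1 0) * (\<integral>\<^sup>+x\<in>{0..1}. ew gw (x / lam) \<partial>lborel)
        + (4 * ennreal (M\<^sup>2 / lam)) * (\<integral>\<^sup>+x\<in>{0..1}. (\<integral>\<^sup>+y\<in>{0..x / lam}. ew gw y * col gw F 1 (x - lam * y) \<partial>lborel) \<partial>lborel)"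
      by (rule lin) measurable
    also have "\<dots> \<le> 2 * D + (4 * ennreal (q\<^sup>2) * col gw F 1 0) * ennreal (lam / (2 * gw)) + (4 * ennreal (M\<^sup>2 / lam)) * (ennreal (1 / (2 * gw)) * ?n 1)"
      by (intro add_mono mult_left_mono K0 lam T0) auto
    also have "(4 * ennreal (q\<^sup>2) * col gw F 1 0) * ennreal (lam / (2 * gw)) = ennreal (4 * q\<^sup>2 * lam / (2 * gw)) * col gw F 1 0"
    proof -
      have "4 * ennreal (q\<^sup>2) * ennreal (lam / (2 * gw)) = ennreal (4 * q\<^sup>2 * lam / (2 * gw))"
        using lam gw by (simp add: ennreal_mult[symmetric] ennreal_numeral[symmetric] del: ennreal_numeral)
      then show ?thesis by (subst rc) simp
    qed
    also have "(4 * ennreal (M\<^sup>2 / lam)) * (ennreal (1 / (2 * gw)) * ?n 1) = ennreal (4 * M\<^sup>2 / lam / (2 * gw)) * ?n 1"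
    proof -
      have "4 * ennreal (M\<^sup>2 / lam) * ennreal (1 / (2 * gw)) = ennreal (4 * M\<^sup>2 / lam / (2 * gw))"
        using lam gw by (simp add: ennreal_mult[symmetric] ennreal_numeral[symmetric] del: ennreal_numeral)
      then show ?thesis by (simp only: mult.assoc[symmetric])
    qed
    finally show ?thesis .
  qed
  have G1: "(\<integral>\<^sup>+x\<in>{0..1}. col gw G 1 x \<partial>lborel) \<le> 2 * D + ennreal (4 * mu / (2 * gw)) * col gw F 2 0 + ennreal (4 * M\<^sup>2 / mu / (2 * gw)) * ?n 0"
  proof -
    have "(\<integral>\<^sup>+x\<in>{0..1}. col gw G 1 x \<partial>lborel) \<le> (\<integral>\<^sup>+x. 2 * D * indicator {0..1} x + (4 * col gw F 2 0) * (ew gw ((1 - x) / mu) * indicator {0..1} x)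
        + (4 * ennreal (M\<^sup>2 / mu)) * ((\<integral>\<^sup>+y\<in>{0..(1 - x) / mu}. ew gw y * col gw F 0 (x + mu * y) \<partial>lborel) * indicator {0..1} x) \<partial>lborel)"
    proof (rule nn_integral_mono)
      fix x :: real
      show "col gw G 1 x * indicator {0..1} x \<le> 2 * D * indicator {0..1} x + (4 * col gw F 2 0) * (ew gw ((1 - x) / mu) * indicator {0..1} x)
        + (4 * ennreal (M\<^sup>2 / mu)) * ((\<integral>\<^sup>+y\<in>{0..(1 - x) / mu}. ew gw y * col gw F 0 (x + mu * y) \<partial>lborel) * indicator {0..1} x)"
        using col1[OF gw F_meas G, of x] by (cases "x \<in> {0..1}") (auto simp: mult_ac)
    qed
    also have "\<dots> = 2 * D + (4 * col gw F 2 0) * (\<integral>\<^sup>+x\<in>{0..1}. ew gw ((1 - x) / mu) \<partial>lborel)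
        + (4 * ennreal (M\<^sup>2 / mu)) * (\<integral>\<^sup>+x\<in>{0..1}. (\<integral>\<^sup>+y\<in>{0..(1 - x) / mu}. ew gw y * col gw F 0 (x + mu * y) \<partial>lborel) \<partial>lborel)"
      by (rule lin) measurable
    also have "\<dots> \<le> 2 * D + (4 * col gw F 2 0) * ennreal (mu / (2 * gw)) + (4 * ennreal (M\<^sup>2 / mu)) * (ennreal (1 / (2 * gw)) * ?n 0)"
      by (intro add_mono mult_left_mono K1 mu T1) auto
    also have "(4 * col gw F 2 0) * ennreal (mu / (2 * gw)) = ennreal (4 * mu / (2 * gw)) * col gw F 2 0"
    proof -
      have "4 * ennreal (mu / (2 * gw)) = ennreal (4 * mu / (2 * gw))"
        using mu gw by (simp add: ennreal_mult[symmetric] ennreal_numeral[symmetric] del: ennreal_numeral)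
      then show ?thesis by (subst rc) simp
    qed
    also have "(4 * ennreal (M\<^sup>2 / mu)) * (ennreal (1 / (2 * gw)) * ?n 0) = ennreal (4 * M\<^sup>2 / mu / (2 * gw)) * ?n 0"
    proof -
      have "4 * ennreal (M\<^sup>2 / mu) * ennreal (1 / (2 * gw)) = ennreal (4 * M\<^sup>2 / mu / (2 * gw))"
        using mu gw by (simp add: ennreal_mult[symmetric] ennreal_numeral[symmetric] del: ennreal_numeral)
      then show ?thesis by (simp only: mult.assoc[symmetric])
    qed
    finally show ?thesis .
  qed
  let ?e = "ennreal (1 / (64 * Cw\<^sup>2))"
  have JG: "J gw G = (\<integral>\<^sup>+x\<in>{0..1}. col gw G 0 x \<partial>lborel) + (\<integral>\<^sup>+x\<in>{0..1}. col gw G 1 x \<partial>lborel)"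
    unfolding J_def distrib_right by (rule nn_integral_add) measurable
  have JF: "J gw F = ?n 0 + ?n 1"
    unfolding J_def distrib_right by (rule nn_integral_add) measurable
  have "J gw G \<le> (2 * D + ?e * col gw F 1 0 + ?e * ?n 1) + (2 * D + ?e * col gw F 2 0 + ?e * ?n 0)"
    unfolding JG using lam mu
    by (intro add_mono order_trans[OF G0] order_trans[OF G1] mult_right_mono ennreal_leI gw_le order_refl) auto
  also have "\<dots> = 4 * D + ?e * (col gw F 1 0 + col gw F 2 0 + J gw F)"
  proof -
    have "2 * D + 2 * D = 4 * D" by (simp flip: distrib_right)
    then show ?thesis unfolding JF distrib_left by (simp add: add_ac)
  qed
  finally show ?thesis .
qed

end

end

section \<open>From the Picard majorant to a solution\<close>

lemma cn_interval_le:
  assumes \<gamma>: "0 \<le> \<gamma>" and [measurable]: "H \<in> borel_measurable borel"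
  shows "(\<integral>\<^sup>+s\<in>{a..b}. (H s)\<^sup>2 \<partial>lborel) \<le> ew \<gamma> (- b) * cn \<gamma> H"
proof -
  have "(\<integral>\<^sup>+s\<in>{a..b}. (H s)\<^sup>2 \<partial>lborel) \<le> (\<integral>\<^sup>+s. ew \<gamma> (- b) * (ew \<gamma> s * (H s)\<^sup>2) \<partial>lborel)"
  proof (rule nn_integral_mono)
    fix s
    have "1 \<le> ew \<gamma> (- b) * ew \<gamma> s" if "s \<le> b"
    proof -
      have "0 \<le> - 2 * \<gamma> * (- b + s)" using that \<gamma> by (auto simp: mult_le_0_iff)
      then show ?thesis unfolding ew_add[symmetric] by (simp add: ew_def)
    qed
    then show "(H s)\<^sup>2 * indicator {a..b} s \<le> ew \<gamma> (- b) * (ew \<gamma> s * (H s)\<^sup>2)"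
      using mult_right_mono[of 1 "ew \<gamma> (- b) * ew \<gamma> s" "(H s)\<^sup>2"] by (auto simp: indicator_def mult.assoc)
  qed
  then show ?thesis by (simp add: nn_integral_cmult cn_def)
qed

lemma cn_finite_AE:
  assumes [measurable]: "H \<in> borel_measurable borel" and "cn \<gamma> H < \<infinity>"
  shows "AE t in lborel. H t < \<infinity>"
proof -
  have "AE t in lborel. ew \<gamma> t * (H t)\<^sup>2 \<noteq> \<infinity>"
    using assms by (intro nn_integral_noteq_infinite) (auto simp: cn_def)
  then show ?thesis
  proof eventually_elim
    case (elim t)
    have "ew \<gamma> t \<noteq> 0" by (simp add: ew_def)
    then show ?case using elim by (auto simp: ennreal_mult_eq_top_iff power2_eq_square less_top)
  qed
qed

context wellposed
begin

lemma col_S0: "col \<gamma> (P.S 0) i x = 0" "J \<gamma> (P.S 0) = 0"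
  by (simp_all add: J_def col_def cn_def)

text \<open>Finiteness of each iterate, not yet uniform in n. It allows the four norms to be handled
  as real numbers when the bound is closed.\<close>

lemma S_finite:
  "col gw (P.S n) 0 1 < \<infinity> \<and> col gw (P.S n) 1 0 < \<infinity> \<and> col gw (P.S n) 2 0 < \<infinity> \<and> J gw (P.S n) < \<infinity>"
proof (induction n)
  case 0 show ?case unfolding col_S0 by simp
next
  case (Suc n)
  have G: "P.S (Suc n) i z \<le> ennreal \<bar>dd i z\<bar> + P.P (P.S n) i z" for i z by simp
  note fin = Suc D_finite
  show ?case
  proof (intro conjI)
    show "col gw (P.S (Suc n)) 0 1 < \<infinity>"
      by (rule le_less_trans[OF end0[OF P.S_meas G]]) (use fin in \<open>simp add: ennreal_mult_less_top\<close>)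
    show "col gw (P.S (Suc n)) 1 0 < \<infinity>"
      by (rule le_less_trans[OF end1[OF P.S_meas G]]) (use fin in \<open>simp add: ennreal_mult_less_top\<close>)
    show "col gw (P.S (Suc n)) 2 0 < \<infinity>"
      by (rule le_less_trans[OF col2[OF gw P.S_meas G]]) (use fin in \<open>simp add: ennreal_mult_less_top\<close>)
    show "J gw (P.S (Suc n)) < \<infinity>"
      by (rule le_less_trans[OF J_le[OF P.S_meas G P.S_meas]]) (use fin in \<open>simp add: ennreal_mult_less_top\<close>)
  qed
qed

text \<open>Since the iterates increase, \<open>P.S n\<close> is bounded by data plus the operator
  applied to itself. Hence the real inequality applies for each n separately, and its bound does not
  depend on n.\<close>

lemma S_bound:
  "col gw (P.S n) 0 1 + col gw (P.S n) 1 0 + col gw (P.S n) 2 0 + J gw (P.S n) \<le> ennreal (200 * Cw\<^sup>2) * D"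
proof -
  obtain x y z j d where r: "col gw (P.S n) 0 1 = ennreal x" "col gw (P.S n) 1 0 = ennreal y" "col gw (P.S n) 2 0 = ennreal z" "J gw (P.S n) = ennreal j" "D = ennreal d"
    and nn: "0 \<le> x" "0 \<le> y" "0 \<le> z" "0 \<le> j" "0 \<le> d"
    using S_finite[of n] D_finite
    by (cases "col gw (P.S n) 0 1"; cases "col gw (P.S n) 1 0"; cases "col gw (P.S n) 2 0"; cases "J gw (P.S n)"; cases D) auto
  define e where "e = 1 / (64 * Cw\<^sup>2)"
  have C: "0 \<le> Cw" "0 \<le> e" using Cw(1) by (auto simp: e_def)
  note G = P.S_le_Suc[of n]
  have n2: "2 * ennreal d = ennreal (2 * d)" "4 * ennreal d = ennreal (4 * d)" using nn by (simp_all add: ennreal_mult)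
  have "ennreal x \<le> ennreal (2 * d) + ennreal e * ennreal y + ennreal Cw * ennreal j"
    using end0[OF P.S_meas G] unfolding r n2 e_def .
  also have "\<dots> = ennreal (2 * d + e * y + Cw * j)" using nn C by (simp add: ennreal_mult)
  finally have 1: "x \<le> 2 * d + e * y + Cw * j" using nn C by (subst (asm) ennreal_le_iff) auto
  have "ennreal y \<le> ennreal (2 * d) + ennreal e * ennreal z + ennreal Cw * ennreal j"
    using end1[OF P.S_meas G] unfolding r n2 e_def .
  also have "\<dots> = ennreal (2 * d + e * z + Cw * j)" using nn C by (simp add: ennreal_mult)
  finally have 2: "y \<le> 2 * d + e * z + Cw * j" using nn C by (subst (asm) ennreal_le_iff) auto
  have "ennreal z \<le> ennreal (2 * d) + ennreal (4 * \<rho>\<^sup>2 + 8 * K\<^sup>2) * ennreal x + ennreal (16 * M\<^sup>2) * ennreal j"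
    using col2[OF gw P.S_meas G, where x = 0] unfolding r n2 .
  also have "\<dots> \<le> ennreal (2 * d) + ennreal Cw * ennreal x + ennreal Cw * ennreal j"
    using Cw nn by (intro add_mono mult_right_mono ennreal_leI) auto
  also have "\<dots> = ennreal (2 * d + Cw * x + Cw * j)" using nn C by (simp add: ennreal_mult)
  finally have 3: "z \<le> 2 * d + Cw * x + Cw * j" using nn C by (subst (asm) ennreal_le_iff) auto
  have "ennreal j \<le> ennreal (4 * d) + ennreal e * (ennreal y + ennreal z + ennreal j)"
    using J_le[OF P.S_meas G P.S_meas] unfolding r n2 e_def .
  also have "\<dots> = ennreal (4 * d + e * (y + z + j))" using nn C by (simp add: ennreal_mult)
  finally have 4: "j \<le> 4 * d + e * (y + z + j)" using nn C by (subst (asm) ennreal_le_iff) auto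
  have "x + y + z + j \<le> 200 * Cw\<^sup>2 * d" by (rule picard_bound_real[OF Cw(1) nn 3 2[unfolded e_def] 1[unfolded e_def] 4[unfolded e_def]])
  then have "ennreal (x + y + z + j) \<le> ennreal (200 * Cw\<^sup>2 * d)" by (rule ennreal_leI)
  then show ?thesis unfolding r using nn by (simp add: ennreal_mult)
qed

abbreviation "Sm \<equiv> P.majorant"

lemma col_majorant: "col \<gamma> Sm i x = (SUP n. col \<gamma> (P.S n) i x)"
  unfolding col_def P.majorant_def by (rule cn_SUP) (use P.incseq_S in auto)

lemma majorant_finite:
  "col gw Sm 0 1 < \<infinity>" "col gw Sm 1 0 < \<infinity>" "col gw Sm 2 0 < \<infinity>"
  "(\<integral>\<^sup>+x\<in>{0..1}. col gw Sm 0 x \<partial>lborel) < \<infinity>" "(\<integral>\<^sup>+x\<in>{0..1}. col gw Sm 1 x \<partial>lborel) < \<infinity>"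
proof -
  define B where "B = ennreal (200 * Cw\<^sup>2) * D"
  have B: "B < \<infinity>" using D_finite by (simp add: B_def ennreal_mult_less_top)
  have le: "col gw (P.S n) 0 1 \<le> B" "col gw (P.S n) 1 0 \<le> B" "col gw (P.S n) 2 0 \<le> B" "J gw (P.S n) \<le> B" for n
  proof -
    have "a \<le> a + b + c + d \<and> b \<le> a + b + c + d \<and> c \<le> a + b + c + d \<and> d \<le> a + b + c + d" for a b c d :: ennreal
      by (simp add: add_increasing add_increasing2)
    then show "col gw (P.S n) 0 1 \<le> B" "col gw (P.S n) 1 0 \<le> B" "col gw (P.S n) 2 0 \<le> B" "J gw (P.S n) \<le> B"
      using S_bound[of n] unfolding B_def[symmetric] by (meson order_trans)+
  qed
  show "col gw Sm 0 1 < \<infinity>" "col gw Sm 1 0 < \<infinity>" "col gw Sm 2 0 < \<infinity>"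
    unfolding col_majorant by (rule le_less_trans[OF SUP_least B], rule le)+
  have int: "(\<integral>\<^sup>+x\<in>{0..1}. col gw Sm i x \<partial>lborel) < \<infinity>" if i: "i = 0 \<or> i = 1" for i
  proof -
    have "(\<integral>\<^sup>+x\<in>{0..1}. col gw Sm i x \<partial>lborel) = (\<integral>\<^sup>+x. (SUP n. col gw (P.S n) i x * indicator {0..1} x) \<partial>lborel)"
      by (simp add: col_majorant SUP_mult_right_ennreal)
    also have "\<dots> = (SUP n. \<integral>\<^sup>+x\<in>{0..1}. col gw (P.S n) i x \<partial>lborel)"
    proof (rule nn_integral_monotone_convergence_SUP)
      show "incseq (\<lambda>n x. col gw (P.S n) i x * indicator {0..1} x)"
        using P.incseq_S by (auto simp: incseq_def le_fun_def col_def intro!: mult_right_mono cn_mono)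
    qed measurable
    also have "\<dots> \<le> B"
    proof (rule SUP_least)
      fix n
      have G: "P.S n i z \<le> ennreal \<bar>dd i z\<bar> + P.P (P.S n) i z" for i z by (rule P.S_le_Suc)
      show "(\<integral>\<^sup>+x\<in>{0..1}. col gw (P.S n) i x \<partial>lborel) \<le> B"
        using i J_part[OF gw P.S_meas G] le(4)[of n] by (auto intro: order_trans)
    qed
    finally show ?thesis using B by (rule le_less_trans)
  qed
  show "(\<integral>\<^sup>+x\<in>{0..1}. col gw Sm 0 x \<partial>lborel) < \<infinity>" "(\<integral>\<^sup>+x\<in>{0..1}. col gw Sm 1 x \<partial>lborel) < \<infinity>"
    by (rule int; simp)+
qed

lemma Sm_finite_AE:
  "AE t in lborel. Sm 0 (t, 1) < \<infinity>" "AE t in lborel. Sm 1 (t, 0) < \<infinity>" "AE t in lborel. Sm 2 (t, 0) < \<infinity>"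
  by (rule cn_finite_AE[OF _ majorant_finite(1)[unfolded col_def]], measurable)
    (rule cn_finite_AE[OF _ majorant_finite(2)[unfolded col_def]], measurable,
     rule cn_finite_AE[OF _ majorant_finite(3)[unfolded col_def]], measurable)

text \<open>Causality: every argument in the system lies at the same or an earlier time, and stays
  in the spatial interval, while the data vanish at negative times.\<close>

lemma S_neg:
  "t < 0 \<Longrightarrow> 0 \<le> x \<Longrightarrow> x \<le> 1 \<Longrightarrow> P.S n 0 (t, x) = 0 \<and> P.S n 1 (t, x) = 0 \<and> P.S n 2 (t, x) = 0"
proof (induction n arbitrary: t x)
  case (Suc n)
  have s: "0 \<le> x / lam" "0 \<le> (1 - x) / mu" using Suc.prems lam mu by auto
  have 0: "P.P (P.S n) 0 (t, x) = 0"
  proof -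
    have "ennreal \<bar>if 0 \<le> y \<and> y \<le> x / lam then \<sigma>pm (x - lam * y) else 0\<bar> * P.S n 1 (t - y, x - lam * y) = 0" for y
    proof (cases "0 \<le> y \<and> y \<le> x / lam")
      case True
      then have "0 \<le> lam * y" "lam * y \<le> x" using lam by (auto simp: pos_le_divide_eq mult.commute)
      then show ?thesis using Suc.IH[of "t - y" "x - lam * y"] Suc.prems True by simp
    qed auto
    note z = this
    show ?thesis unfolding P0 z using Suc.IH[of "t - x / lam" 0] Suc.prems s by simp
  qed
  have 1: "P.P (P.S n) 1 (t, x) = 0"
  proof -
    have "ennreal \<bar>if 0 \<le> y \<and> y \<le> (1 - x) / mu then \<sigma>mp (x + mu * y) else 0\<bar> * P.S n 0 (t - y, x + mu * y) = 0" for y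
    proof (cases "0 \<le> y \<and> y \<le> (1 - x) / mu")
      case True
      then have "0 \<le> mu * y" "mu * y \<le> 1 - x" using mu by (auto simp: pos_le_divide_eq mult.commute)
      then show ?thesis using Suc.IH[of "t - y" "x + mu * y"] Suc.prems True by simp
    qed auto
    note z = this
    show ?thesis unfolding P1 z using Suc.IH[of "t - (1 - x) / mu" 0] Suc.prems s by simp
  qed
  have 2: "P.P (P.S n) 2 (t, x) = 0"
  proof -
    have "ennreal \<bar>l y * indicator {0..1} y\<bar> * P.S n i (t - \<delta>, y) = 0" if "i = 0 \<or> i = 1" for l i and y :: real
      using Suc.IH[of "t - \<delta>" y] Suc.prems \<delta> that by (cases "y \<in> {0..1}") auto
    note z = this
    show ?thesis unfolding P2 z[OF disjI1[OF refl]] z[OF disjI2[OF refl]] using Suc.IH[of t 1] Suc.IH[of "t - \<delta>" 1] Suc.prems \<delta> by simp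
  qed
  have "dd i (t, x) = 0" for i using Suc.prems by (simp add: dd_def)
  then show ?case unfolding P.S.simps 0 1 2 by simp
qed simp

lemma Sm_neg: "t < 0 \<Longrightarrow> 0 \<le> x \<Longrightarrow> x \<le> 1 \<Longrightarrow> Sm 0 (t, x) = 0 \<and> Sm 1 (t, x) = 0 \<and> Sm 2 (t, x) = 0"
  using S_neg[of t x] by (simp add: P.majorant_def)

definition "u t x = P.sol 0 (t, x)"
definition "v t x = P.sol 1 (t, x)"
definition "bv t = P.sol 2 (t, 0)"

lemma uv_le: "ennreal \<bar>u t x\<bar> \<le> Sm 0 (t, x)" "ennreal \<bar>v t x\<bar> \<le> Sm 1 (t, x)"
  unfolding u_def v_def by (rule P.sol_le_majorant)+

lemma uv_neg: "t < 0 \<Longrightarrow> 0 \<le> x \<Longrightarrow> x \<le> 1 \<Longrightarrow> u t x = 0 \<and> v t x = 0"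
  using uv_le[of t x] Sm_neg[of t x] by simp

lemma uv_meas[measurable]:
  "(\<lambda>(t, x). u t x) \<in> borel_measurable (borel \<Otimes>\<^sub>M borel)" "(\<lambda>(t, x). v t x) \<in> borel_measurable (borel \<Otimes>\<^sub>M borel)"
  unfolding u_def v_def by (simp_all add: case_prod_unfold)

lemma u_eq:
  assumes "Sm 0 (t, x) < \<infinity>"
  shows "integrable lborel (\<lambda>y. (if 0 \<le> y \<and> y \<le> x / lam then \<sigma>pm (x - lam * y) else 0) * v (t - y) (x - lam * y))"
    and "u t x = dd 0 (t, x) + q * v (t - x / lam) 0 + (LINT y|lborel. (if 0 \<le> y \<and> y \<le> x / lam then \<sigma>pm (x - lam * y) else 0) * v (t - y) (x - lam * y))"
  using P.sol_equation(1)[OF assms, of 1] P.sol_equation(2)[OF assms] unfolding sum4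
  by (simp_all add: cc_def ki_def hh_def u_def v_def cong: if_cong)

lemma v_eq:
  assumes "Sm 1 (t, x) < \<infinity>"
  shows "integrable lborel (\<lambda>y. (if 0 \<le> y \<and> y \<le> (1 - x) / mu then \<sigma>mp (x + mu * y) else 0) * u (t - y) (x + mu * y))"
    and "v t x = dd 1 (t, x) + bv (t - (1 - x) / mu) + (LINT y|lborel. (if 0 \<le> y \<and> y \<le> (1 - x) / mu then \<sigma>mp (x + mu * y) else 0) * u (t - y) (x + mu * y))"
  using P.sol_equation(1)[OF assms, of 1] P.sol_equation(2)[OF assms] unfolding sum4
  by (simp_all add: cc_def ki_def hh_def u_def v_def bv_def cong: if_cong)

lemma bv_eq:
  assumes "Sm 2 (t, 0) < \<infinity>"
  shows "bv t = dd 2 (t, 0) + \<rho> * u t 1 - K * u (t - \<delta>) 1 + (LBINT y:{0..1}. l1 y * u (t - \<delta>) y) + (LBINT y:{0..1}. l2 y * v (t - \<delta>) y)"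
  using P.sol_equation(2)[OF assms] unfolding sum4
  by (simp add: cc_def ki_def hh_def u_def v_def bv_def set_lebesgue_integral_def mult_ac)

text \<open>With the absolute time r = s - y as integration variable, s enters only through the data
  term and the upper limit of integration.\<close>

lemma Sm_u_line:
  "Sm 0 (s, c + lam * s) = ennreal \<bar>dd 0 (s, c + lam * s)\<bar> + (ennreal \<bar>q\<bar> * Sm 1 (- c / lam, 0)
    + (\<integral>\<^sup>+r. ennreal \<bar>if - c / lam \<le> r \<and> r \<le> s then \<sigma>pm (c + lam * r) else 0\<bar> * Sm 1 (r, c + lam * r) \<partial>lborel))"
proof -
  let ?H = "\<lambda>y. ennreal \<bar>if 0 \<le> y \<and> y \<le> (c + lam * s) / lam then \<sigma>pm (c + lam * s - lam * y) else 0\<bar> * Sm 1 (s - y, c + lam * s - lam * y)"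
  have a: "s - (c + lam * s) / lam = - c / lam" using lam by (simp add: field_simps)
  have "(\<integral>\<^sup>+y. ?H y \<partial>lborel) = (\<integral>\<^sup>+r. ?H (s + - 1 * r) \<partial>lborel)"
    using nn_integral_real_affine[of ?H "- 1" s] by simp
  also have "\<dots> = (\<integral>\<^sup>+r. ennreal \<bar>if - c / lam \<le> r \<and> r \<le> s then \<sigma>pm (c + lam * r) else 0\<bar> * Sm 1 (r, c + lam * r) \<partial>lborel)"
  proof (rule nn_integral_cong)
    fix r
    have e1: "c + lam * s - lam * (s + - 1 * r) = c + lam * r" by (simp add: algebra_simps)
    have e3: "s - (s + - 1 * r) = r" by simp
    have e2: "0 \<le> s + - 1 * r \<and> s + - 1 * r \<le> (c + lam * s) / lam \<longleftrightarrow> - c / lam \<le> r \<and> r \<le> s"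
      using lam by (auto simp: field_simps)
    show "?H (s + - 1 * r) = ennreal \<bar>if - c / lam \<le> r \<and> r \<le> s then \<sigma>pm (c + lam * r) else 0\<bar> * Sm 1 (r, c + lam * r)"
      by (simp only: e1 e2 e3)
  qed
  finally show ?thesis using P.majorant_fixpoint[of 0 "(s, c + lam * s)"] unfolding P0 a by simp
qed

lemma Sm_v_line:
  "Sm 1 (s, c + - mu * s) = ennreal \<bar>dd 1 (s, c + - mu * s)\<bar> + (Sm 2 ((c - 1) / mu, 0)
    + (\<integral>\<^sup>+r. ennreal \<bar>if (c - 1) / mu \<le> r \<and> r \<le> s then \<sigma>mp (c + - mu * r) else 0\<bar> * Sm 0 (r, c + - mu * r) \<partial>lborel))"
proof -
  let ?H = "\<lambda>y. ennreal \<bar>if 0 \<le> y \<and> y \<le> (1 - (c + - mu * s)) / mu then \<sigma>mp (c + - mu * s + mu * y) else 0\<bar> * Sm 0 (s - y, c + - mu * s + mu * y)"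
  have a: "s - (1 - (c + - mu * s)) / mu = (c - 1) / mu" using mu by (simp add: field_simps)
  have "(\<integral>\<^sup>+y. ?H y \<partial>lborel) = (\<integral>\<^sup>+r. ?H (s + - 1 * r) \<partial>lborel)"
    using nn_integral_real_affine[of ?H "- 1" s] by simp
  also have "\<dots> = (\<integral>\<^sup>+r. ennreal \<bar>if (c - 1) / mu \<le> r \<and> r \<le> s then \<sigma>mp (c + - mu * r) else 0\<bar> * Sm 0 (r, c + - mu * r) \<partial>lborel)"
  proof (rule nn_integral_cong)
    fix r
    have e1: "c + - mu * s + mu * (s + - 1 * r) = c + - mu * r" by (simp add: algebra_simps)
    have e3: "s - (s + - 1 * r) = r" by simp
    have e2: "0 \<le> s + - 1 * r \<and> s + - 1 * r \<le> (1 - (c + - mu * s)) / mu \<longleftrightarrow> (c - 1) / mu \<le> r \<and> r \<le> s"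
      using mu by (auto simp: field_simps)
    show "?H (s + - 1 * r) = ennreal \<bar>if (c - 1) / mu \<le> r \<and> r \<le> s then \<sigma>mp (c + - mu * r) else 0\<bar> * Sm 0 (r, c + - mu * r)"
      by (simp only: e1 e2 e3)
  qed
  finally show ?thesis using P.majorant_fixpoint[of 1 "(s, c + - mu * s)"] unfolding P1 a by simp
qed

end

lemma line_integral_diff:
  fixes s :: "real \<Rightarrow> real"
  assumes int: "integrable lborel (\<lambda>r. (if a \<le> r \<and> r \<le> s0 then s r else 0) * w r)"
    "integrable lborel (\<lambda>r. (if a \<le> r \<and> r \<le> s1 then s r else 0) * w r)" and le: "a \<le> s0" "s0 \<le> s1"
  shows "set_integrable lborel {s0..s1} (\<lambda>r. s r * w r)"
    and "(LINT r|lborel. (if a \<le> r \<and> r \<le> s1 then s r else 0) * w r) - (LINT r|lborel. (if a \<le> r \<and> r \<le> s0 then s r else 0) * w r)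
      = (LBINT r:{s0..s1}. s r * w r)"
proof -
  have eq: "indicator {s0..s1} r *\<^sub>R ((if a \<le> r \<and> r \<le> s1 then s r else 0) * w r) = indicator {s0..s1} r *\<^sub>R (s r * w r)" for r
    using le by (auto simp: indicator_def)
  have "integrable lborel (\<lambda>r. indicator {s0..s1} r *\<^sub>R ((if a \<le> r \<and> r \<le> s1 then s r else 0) * w r))"
    by (rule integrable_mult_indicator[OF _ int(2)]) simp
  then show i: "set_integrable lborel {s0..s1} (\<lambda>r. s r * w r)"
    unfolding eq set_integrable_def .
  have "(LINT r|lborel. (if a \<le> r \<and> r \<le> s1 then s r else 0) * w r) - (LINT r|lborel. (if a \<le> r \<and> r \<le> s0 then s r else 0) * w r)
    = (LINT r|lborel. (if a \<le> r \<and> r \<le> s1 then s r else 0) * w r - (if a \<le> r \<and> r \<le> s0 then s r else 0) * w r)"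
    by (rule Bochner_Integration.integral_diff[symmetric]) (rule int)+
  also have "\<dots> = (LINT r|lborel. indicator {s0..s1} r *\<^sub>R (s r * w r))"
  proof (rule integral_cong_AE)
    show "AE r in lborel. (if a \<le> r \<and> r \<le> s1 then s r else 0) * w r - (if a \<le> r \<and> r \<le> s0 then s r else 0) * w r
      = indicator {s0..s1} r *\<^sub>R (s r * w r)"
      using AE_lborel_singleton[of s0] by eventually_elim (use le in \<open>auto simp: indicator_def\<close>)
  next
    show "(\<lambda>r. indicator {s0..s1} r *\<^sub>R (s r * w r)) \<in> borel_measurable lborel"
      using i unfolding set_integrable_def by (rule borel_measurable_integrable)
  qed (intro borel_measurable_diff borel_measurable_integrable int)
  finally show "(LINT r|lborel. (if a \<le> r \<and> r \<le> s1 then s r else 0) * w r) - (LINT r|lborel. (if a \<le> r \<and> r \<le> s0 then s r else 0) * w r)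
      = (LBINT r:{s0..s1}. s r * w r)" by (simp add: set_lebesgue_integral_def)
qed

lemma integral_point_zero:
  fixes f :: "real \<Rightarrow> real"
  assumes "\<And>y. y \<noteq> a \<Longrightarrow> f y = 0"
  shows "(LINT y|lborel. f y) = 0"
  by (rule integral_eq_zero_AE, rule AE_mp[OF AE_lborel_singleton[of a]]) (use assms in auto)

lemma L2_on_dominated:
  fixes w :: "'a::euclidean_space \<Rightarrow> real"
  assumes "w \<in> borel_measurable borel" "S \<in> sets borel" and le: "\<And>x. ennreal \<bar>w x\<bar> \<le> H x" and fin: "(\<integral>\<^sup>+x\<in>S. (H x)\<^sup>2 \<partial>lborel) < \<infinity>"
  shows "L2_on S w"
proof (rule L2_onI)
  have "ennreal ((w x)\<^sup>2) \<le> (H x)\<^sup>2" for x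
    using power_mono[OF le[of x], of 2] by (simp add: ennreal_power)
  then have "(\<integral>\<^sup>+x\<in>S. ennreal ((w x)\<^sup>2) \<partial>lborel) \<le> (\<integral>\<^sup>+x\<in>S. (H x)\<^sup>2 \<partial>lborel)"
    by (intro nn_integral_mono mult_right_mono) auto
  then show "(\<integral>\<^sup>+x\<in>S. ennreal ((w x)\<^sup>2) \<partial>lborel) < \<infinity>" using fin by (rule le_less_trans)
qed fact+

lemma strip_finite:
  fixes F :: "real \<times> real \<Rightarrow> ennreal"
  assumes [measurable]: "F \<in> borel_measurable (borel \<Otimes>\<^sub>M borel)" and \<gamma>: "0 \<le> \<gamma>"
    and fin: "(\<integral>\<^sup>+z\<in>{0..1}. cn \<gamma> (\<lambda>t. F (t, z)) \<partial>lborel) < \<infinity>"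
  shows "(\<integral>\<^sup>+z\<in>{0..1}. (\<integral>\<^sup>+s\<in>{a..b}. (F (s, z))\<^sup>2 \<partial>lborel) \<partial>lborel) < \<infinity>"
proof -
  have "(\<integral>\<^sup>+s\<in>{a..b}. (F (s, z))\<^sup>2 \<partial>lborel) \<le> ew \<gamma> (- b) * cn \<gamma> (\<lambda>t. F (t, z))" for z
    by (rule cn_interval_le[OF \<gamma>]) measurable
  then have "(\<integral>\<^sup>+z\<in>{0..1}. (\<integral>\<^sup>+s\<in>{a..b}. (F (s, z))\<^sup>2 \<partial>lborel) \<partial>lborel) \<le> (\<integral>\<^sup>+z. ew \<gamma> (- b) * (cn \<gamma> (\<lambda>t. F (t, z)) * indicator {0..1} z) \<partial>lborel)"
    by (intro nn_integral_mono) (auto simp: indicator_def)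
  also have "\<dots> = ew \<gamma> (- b) * (\<integral>\<^sup>+z\<in>{0..1}. cn \<gamma> (\<lambda>t. F (t, z)) \<partial>lborel)"
  proof (rule nn_integral_cmult)
    have [measurable]: "(\<lambda>z. cn \<gamma> (\<lambda>t. F (t, z))) \<in> borel_measurable borel" by (rule cn_meas) measurable
    show "(\<lambda>z. cn \<gamma> (\<lambda>t. F (t, z)) * indicator {0..1} z) \<in> borel_measurable lborel" by measurable
  qed
  also have "\<dots> < \<infinity>" using fin by (simp add: ew_def ennreal_mult_less_top)
  finally show ?thesis .
qed

text \<open>Norms at a fixed time are not part of the Picard estimate. Integrating along
  characteristics of bounded length and shearing turns the slice integral into an area integral over
  a strip, which is finite.\<close>

lemma slice_finite:
  fixes F :: "real \<times> real \<Rightarrow> ennreal"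
  assumes [measurable]: "F \<in> borel_measurable (borel \<Otimes>\<^sub>M borel)" and \<gamma>: "0 \<le> \<gamma>" and a: "0 \<le> a"
    and fin: "(\<integral>\<^sup>+z\<in>{0..1}. cn \<gamma> (\<lambda>t. F (t, z)) \<partial>lborel) < \<infinity>"
  shows "(\<integral>\<^sup>+x\<in>{0..1}. (\<integral>\<^sup>+y\<in>{0..a}. F (t - y, x + b * y) * indicator {0..1} (x + b * y) \<partial>lborel)\<^sup>2 \<partial>lborel) < \<infinity>"
proof -
  let ?G = "\<lambda>y z. (F (t - y, z))\<^sup>2 * indicator {0..1} z"
  have sq: "(F (t - y, z) * indicator {0..1} z)\<^sup>2 = ?G y z" for y z by (simp add: indicator_def)
  have "(\<integral>\<^sup>+x\<in>{0..1}. (\<integral>\<^sup>+y\<in>{0..a}. F (t - y, x + b * y) * indicator {0..1} (x + b * y) \<partial>lborel)\<^sup>2 \<partial>lborel)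
    \<le> (\<integral>\<^sup>+x. ennreal a * (\<integral>\<^sup>+y\<in>{0..a}. ?G y (x + b * y) \<partial>lborel) \<partial>lborel)"
  proof (rule nn_integral_mono)
    fix x
    have "(\<integral>\<^sup>+y\<in>{0..a}. F (t - y, x + b * y) * indicator {0..1} (x + b * y) \<partial>lborel)\<^sup>2
      \<le> ennreal (a - 0) * (\<integral>\<^sup>+y\<in>{0..a}. (F (t - y, x + b * y) * indicator {0..1} (x + b * y))\<^sup>2 \<partial>lborel)"
      by (rule nn_integral_Icc_power2_le) (use a in \<open>auto\<close>)
    then show "(\<integral>\<^sup>+y\<in>{0..a}. F (t - y, x + b * y) * indicator {0..1} (x + b * y) \<partial>lborel)\<^sup>2 * indicator {0..1} x
      \<le> ennreal a * (\<integral>\<^sup>+y\<in>{0..a}. ?G y (x + b * y) \<partial>lborel)"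
      unfolding sq by (simp add: indicator_def)
  qed
  also have "\<dots> = ennreal a * (\<integral>\<^sup>+x. (\<integral>\<^sup>+y\<in>{0..a}. ?G y (x + b * y) \<partial>lborel) \<partial>lborel)"
    by (rule nn_integral_cmult) measurable
  also have "(\<integral>\<^sup>+x. (\<integral>\<^sup>+y\<in>{0..a}. ?G y (x + b * y) \<partial>lborel) \<partial>lborel) = (\<integral>\<^sup>+y. (\<integral>\<^sup>+x. ?G y (x + b * y) * indicator {0..a} y \<partial>lborel) \<partial>lborel)"
    by (rule lborel_pair.Fubini') measurable
  also have "\<dots> = (\<integral>\<^sup>+y. (\<integral>\<^sup>+z. ?G y z * indicator {0..a} y \<partial>lborel) \<partial>lborel)"
  proof (rule nn_integral_cong)
    fix y show "(\<integral>\<^sup>+x. ?G y (x + b * y) * indicator {0..a} y \<partial>lborel) = (\<integral>\<^sup>+z. ?G y z * indicator {0..a} y \<partial>lborel)"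
      using nn_integral_real_affine[of "\<lambda>z. ?G y z * indicator {0..a} y" 1 "b * y"] by (simp add: add.commute)
  qed
  also have "\<dots> = (\<integral>\<^sup>+z. (\<integral>\<^sup>+y. ?G y z * indicator {0..a} y \<partial>lborel) \<partial>lborel)"
    by (rule lborel_pair.Fubini') measurable
  also have "\<dots> = (\<integral>\<^sup>+z\<in>{0..1}. (\<integral>\<^sup>+y\<in>{0..a}. (F (t - y, z))\<^sup>2 \<partial>lborel) \<partial>lborel)"
    by (rule nn_integral_cong) (auto simp: indicator_def)
  also have "\<dots> = (\<integral>\<^sup>+z\<in>{0..1}. (\<integral>\<^sup>+s\<in>{t - a..t - 0}. (F (s, z))\<^sup>2 \<partial>lborel) \<partial>lborel)"
  proof (rule nn_integral_cong)
    fix z show "(\<integral>\<^sup>+y\<in>{0..a}. (F (t - y, z))\<^sup>2 \<partial>lborel) * indicator {0..1} z = (\<integral>\<^sup>+s\<in>{t - a..t - 0}. (F (s, z))\<^sup>2 \<partial>lborel) * indicator {0..1} z"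
      using nn_integral_Icc_reflect[of "\<lambda>s. (F (s, z))\<^sup>2" t 0 a] by simp
  qed
  also have "ennreal a * \<dots> < \<infinity>"
    using strip_finite[OF assms(1) \<gamma> fin, of "t - a" "t - 0"] by (simp add: ennreal_mult_less_top)
  finally show ?thesis .
qed

lemma three_squares_finite:
  assumes [measurable]: "a \<in> borel_measurable borel" "b \<in> borel_measurable borel" "c \<in> borel_measurable borel" "S \<in> sets borel"
    and fin: "(\<integral>\<^sup>+x\<in>S. (a x)\<^sup>2 \<partial>lborel) < \<infinity>" "(\<integral>\<^sup>+x\<in>S. (b x)\<^sup>2 \<partial>lborel) < \<infinity>" "(\<integral>\<^sup>+x\<in>S. (c x)\<^sup>2 \<partial>lborel) < \<infinity>"
    and le: "\<And>x. x \<in> S \<Longrightarrow> h x \<le> a x + (b x + c x)"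
  shows "(\<integral>\<^sup>+x\<in>S. (h x)\<^sup>2 \<partial>(lborel :: real measure)) < (\<infinity>::ennreal)"
proof -
  have "(\<integral>\<^sup>+x\<in>S. (h x)\<^sup>2 \<partial>lborel) \<le> (\<integral>\<^sup>+x. 2 * ((a x)\<^sup>2 * indicator S x) + (4 * ((b x)\<^sup>2 * indicator S x) + 4 * ((c x)\<^sup>2 * indicator S x)) \<partial>lborel)"
  proof (rule nn_integral_mono)
    fix x
    have "(h x)\<^sup>2 \<le> 2 * (a x)\<^sup>2 + 2 * (2 * (b x)\<^sup>2 + 2 * (c x)\<^sup>2)" if "x \<in> S"
      by (rule order_trans[OF power_mono[OF le[OF that]]], simp, rule order_trans[OF ennreal_power2_add_le])
        (intro add_left_mono mult_left_mono ennreal_power2_add_le, simp)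
    then show "(h x)\<^sup>2 * indicator S x \<le> 2 * ((a x)\<^sup>2 * indicator S x) + (4 * ((b x)\<^sup>2 * indicator S x) + 4 * ((c x)\<^sup>2 * indicator S x))"
      by (simp add: indicator_def distrib_left mult.assoc[symmetric])
  qed
  also have "\<dots> = 2 * (\<integral>\<^sup>+x\<in>S. (a x)\<^sup>2 \<partial>lborel) + (4 * (\<integral>\<^sup>+x\<in>S. (b x)\<^sup>2 \<partial>lborel) + 4 * (\<integral>\<^sup>+x\<in>S. (c x)\<^sup>2 \<partial>lborel))"
    by (simp add: nn_integral_add nn_integral_cmult)
  also have "\<dots> < \<infinity>" using fin by (simp add: ennreal_mult_less_top)
  finally show ?thesis .
qed

context wellposed
begin

lemma dd_line:
  "0 \<le> s \<Longrightarrow> dd 0 (s, c + lam * s) = (if 0 < c then u0 c else 0)"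
  "0 \<le> s \<Longrightarrow> dd 1 (s, c + - mu * s) = (if c < 1 then v0 c else 0)"
  by (simp_all add: dd_def)

text \<open>For s \<ge> 0 the data term depends on the label c alone, and the nonnegative integral
  grows with its upper limit.\<close>

lemma Sm_line_mono:
  assumes "0 \<le> s" "s \<le> s'"
  shows "Sm 0 (s, c + lam * s) \<le> Sm 0 (s', c + lam * s')" "Sm 1 (s, c + - mu * s) \<le> Sm 1 (s', c + - mu * s')"
  unfolding Sm_u_line[of s] Sm_u_line[of s'] Sm_v_line[of s] Sm_v_line[of s']
  using assms dd_line[of s c] dd_line[of s' c]
  by (auto intro!: add_left_mono nn_integral_mono mult_right_mono simp del: fun_upd_apply)

lemma u_line:
  assumes "0 \<le> s" and fin: "Sm 0 (s, c + lam * s) < \<infinity>"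
  shows "integrable lborel (\<lambda>r. (if - c / lam \<le> r \<and> r \<le> s then \<sigma>pm (c + lam * r) else 0) * v r (c + lam * r))"
    and "u s (c + lam * s) = (if 0 < c then u0 c else 0) + q * v (- c / lam) 0
      + (LINT r|lborel. (if - c / lam \<le> r \<and> r \<le> s then \<sigma>pm (c + lam * r) else 0) * v r (c + lam * r))"
proof -
  let ?G = "\<lambda>r. (if - c / lam \<le> r \<and> r \<le> s then \<sigma>pm (c + lam * r) else 0) * v r (c + lam * r)"
  have G: "(if 0 \<le> y \<and> y \<le> (c + lam * s) / lam then \<sigma>pm (c + lam * s - lam * y) else 0) * v (s - y) (c + lam * s - lam * y) = ?G (s + - 1 * y)" for y
  proof -
    have e1: "c + lam * s - lam * y = c + lam * (s + - 1 * y)" by (simp add: algebra_simps)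
    have e2: "0 \<le> y \<and> y \<le> (c + lam * s) / lam \<longleftrightarrow> - c / lam \<le> s + - 1 * y \<and> s + - 1 * y \<le> s"
      using lam by (auto simp: field_simps)
    have e3: "s - y = s + - 1 * y" by simp
    show ?thesis by (simp only: e1 e2 e3)
  qed
  have a: "s - (c + lam * s) / lam = - c / lam" using lam by (simp add: field_simps)
  have "integrable lborel (\<lambda>y. ?G (s + - 1 * y))" using u_eq(1)[OF fin] unfolding G .
  then show "integrable lborel ?G" using lborel_integrable_real_affine_iff[of "- 1" ?G s] by simp
  have "(LINT r|lborel. ?G r) = (LINT y|lborel. ?G (s + - 1 * y))" using lborel_integral_real_affine[of "- 1" ?G s] by simp
  then show "u s (c + lam * s) = (if 0 < c then u0 c else 0) + q * v (- c / lam) 0 + (LINT r|lborel. ?G r)"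
    using u_eq(2)[OF fin] unfolding G a dd_line[OF assms(1)] by simp
qed

lemma v_line:
  assumes "0 \<le> s" and fin: "Sm 1 (s, c + - mu * s) < \<infinity>"
  shows "integrable lborel (\<lambda>r. (if (c - 1) / mu \<le> r \<and> r \<le> s then \<sigma>mp (c + - mu * r) else 0) * u r (c + - mu * r))"
    and "v s (c + - mu * s) = (if c < 1 then v0 c else 0) + bv ((c - 1) / mu)
      + (LINT r|lborel. (if (c - 1) / mu \<le> r \<and> r \<le> s then \<sigma>mp (c + - mu * r) else 0) * u r (c + - mu * r))"
proof -
  let ?G = "\<lambda>r. (if (c - 1) / mu \<le> r \<and> r \<le> s then \<sigma>mp (c + - mu * r) else 0) * u r (c + - mu * r)"
  have G: "(if 0 \<le> y \<and> y \<le> (1 - (c + - mu * s)) / mu then \<sigma>mp (c + - mu * s + mu * y) else 0) * u (s - y) (c + - mu * s + mu * y) = ?G (s + - 1 * y)" for y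
  proof -
    have e1: "c + - mu * s + mu * y = c + - mu * (s + - 1 * y)" by (simp add: algebra_simps)
    have e2: "0 \<le> y \<and> y \<le> (1 - (c + - mu * s)) / mu \<longleftrightarrow> (c - 1) / mu \<le> s + - 1 * y \<and> s + - 1 * y \<le> s"
      using mu by (auto simp: field_simps)
    have e3: "s - y = s + - 1 * y" by simp
    show ?thesis by (simp only: e1 e2 e3)
  qed
  have a: "s - (1 - (c + - mu * s)) / mu = (c - 1) / mu" using mu by (simp add: field_simps)
  have "integrable lborel (\<lambda>y. ?G (s + - 1 * y))" using v_eq(1)[OF fin] unfolding G .
  then show "integrable lborel ?G" using lborel_integrable_real_affine_iff[of "- 1" ?G s] by simp
  have "(LINT r|lborel. ?G r) = (LINT y|lborel. ?G (s + - 1 * y))" using lborel_integral_real_affine[of "- 1" ?G s] by simp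
  then show "v s (c + - mu * s) = (if c < 1 then v0 c else 0) + bv ((c - 1) / mu) + (LINT r|lborel. ?G r)"
    using v_eq(2)[OF fin] unfolding G a dd_line[OF assms(1)] by simp
qed

text \<open>The outgoing trace of the majorant is finite at almost every exit time. By monotonicity
  the majorant is then finite on the whole characteristic up to its exit, hence the integral
  equation holds on almost every characteristic at all its points.\<close>

lemma line_finite_AE:
  "AE c in lborel. \<forall>s. 0 \<le> s \<longrightarrow> c + lam * s \<le> 1 \<longrightarrow> Sm 0 (s, c + lam * s) < \<infinity>"
  "AE c in lborel. \<forall>s. 0 \<le> s \<longrightarrow> 0 \<le> c + - mu * s \<longrightarrow> Sm 1 (s, c + - mu * s) < \<infinity>"
proof -
  have "AE c in lborel. Sm 0 (1 / lam + (- 1 / lam) * c, 1) < \<infinity>"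
    by (rule AE_lborel_affine[OF _ Sm_finite_AE(1)]) (use lam in auto)
  then show "AE c in lborel. \<forall>s. 0 \<le> s \<longrightarrow> c + lam * s \<le> 1 \<longrightarrow> Sm 0 (s, c + lam * s) < \<infinity>"
  proof eventually_elim
    case (elim c)
    show ?case
    proof (intro allI impI)
      fix s assume s: "0 \<le> s" "c + lam * s \<le> 1"
      let ?T = "1 / lam + (- 1 / lam) * c"
      have T: "s \<le> ?T" "c + lam * ?T = 1" using s lam by (auto simp: field_simps)
      have "Sm 0 (s, c + lam * s) \<le> Sm 0 (?T, c + lam * ?T)" by (rule Sm_line_mono(1)[OF s(1) T(1)])
      also have "\<dots> < \<infinity>" unfolding T(2) by (rule elim)
      finally show "Sm 0 (s, c + lam * s) < \<infinity>" .
    qed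
  qed
  have "AE c in lborel. Sm 1 (0 + (1 / mu) * c, 0) < \<infinity>"
    by (rule AE_lborel_affine[OF _ Sm_finite_AE(2)]) (use mu in auto)
  then show "AE c in lborel. \<forall>s. 0 \<le> s \<longrightarrow> 0 \<le> c + - mu * s \<longrightarrow> Sm 1 (s, c + - mu * s) < \<infinity>"
  proof eventually_elim
    case (elim c)
    show ?case
    proof (intro allI impI)
      fix s assume s: "0 \<le> s" "0 \<le> c + - mu * s"
      let ?T = "0 + (1 / mu) * c"
      have T: "s \<le> ?T" "c + - mu * ?T = 0" using s mu by (auto simp: field_simps)
      have "Sm 1 (s, c + - mu * s) \<le> Sm 1 (?T, c + - mu * ?T)" by (rule Sm_line_mono(2)[OF s(1) T(1)])
      also have "\<dots> < \<infinity>" unfolding T(2) by (rule elim)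
      finally show "Sm 1 (s, c + - mu * s) < \<infinity>" .
    qed
  qed
qed

lemma broad:
  "broad_solution 1 lam ({0..} \<times> {0..1}) u (\<lambda>t x. \<sigma>pm x * v t x)"
  "broad_solution 1 (- mu) ({0..} \<times> {0..1}) v (\<lambda>t x. \<sigma>mp x * u t x)"
proof -
  show "broad_solution 1 lam ({0..} \<times> {0..1}) u (\<lambda>t x. \<sigma>pm x * v t x)"
    unfolding broad_solution_def mult_1_left
    using line_finite_AE(1)
  proof eventually_elim
    case (elim c)
    show ?case
    proof (intro allI impI)
      fix s0 s1 :: real assume s: "s0 \<le> s1" "(s0, c + lam * s0) \<in> {0..} \<times> {0..1}" "(s1, c + lam * s1) \<in> {0..} \<times> {0..1}"
      have a: "- c / lam \<le> s0" using s(2) lam by (auto simp: field_simps)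
      have f: "0 \<le> s0" "Sm 0 (s0, c + lam * s0) < \<infinity>" "0 \<le> s1" "Sm 0 (s1, c + lam * s1) < \<infinity>" using s elim by auto
      note i = u_line(1)[OF f(1,2)] u_line(1)[OF f(3,4)]
      show "set_integrable lborel {s0..s1} (\<lambda>s. \<sigma>pm (c + lam * s) * v s (c + lam * s)) \<and>
        u s1 (c + lam * s1) - u s0 (c + lam * s0) = (LBINT s:{s0..s1}. \<sigma>pm (c + lam * s) * v s (c + lam * s))"
        using line_integral_diff[OF i a s(1)] unfolding u_line(2)[OF f(1,2)] u_line(2)[OF f(3,4)] by simp
    qed
  qed
  show "broad_solution 1 (- mu) ({0..} \<times> {0..1}) v (\<lambda>t x. \<sigma>mp x * u t x)"
    unfolding broad_solution_def mult_1_left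
    using line_finite_AE(2)
  proof eventually_elim
    case (elim c)
    show ?case
    proof (intro allI impI)
      fix s0 s1 :: real assume s: "s0 \<le> s1" "(s0, c + - mu * s0) \<in> {0..} \<times> {0..1}" "(s1, c + - mu * s1) \<in> {0..} \<times> {0..1}"
      have a: "(c - 1) / mu \<le> s0" using s(2) mu by (auto simp: field_simps)
      have f: "0 \<le> s0" "Sm 1 (s0, c + - mu * s0) < \<infinity>" "0 \<le> s1" "Sm 1 (s1, c + - mu * s1) < \<infinity>" using s elim by auto
      note i = v_line(1)[OF f(1,2)] v_line(1)[OF f(3,4)]
      show "set_integrable lborel {s0..s1} (\<lambda>s. \<sigma>mp (c + - mu * s) * u s (c + - mu * s)) \<and>
        v s1 (c + - mu * s1) - v s0 (c + - mu * s0) = (LBINT s:{s0..s1}. \<sigma>mp (c + - mu * s) * u s (c + - mu * s))"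
        using line_integral_diff[OF i a s(1)] unfolding v_line(2)[OF f(1,2)] v_line(2)[OF f(3,4)] by simp
    qed
  qed
qed

lemma bv_neg: "t < 0 \<Longrightarrow> bv t = 0"
  using P.sol_le_majorant[of 2 "(t, 0)"] Sm_neg[of t 0] by (simp add: bv_def)

text \<open>At time 0 the boundary and integral terms only involve negative times, apart from a
  single point, and vanish. The endpoints x = 0 and x = 1 are left out.\<close>

lemma initial: "AE x in lborel. x \<in> {0..1} \<longrightarrow> u 0 x = u0 x \<and> v 0 x = v0 x"
  using line_finite_AE AE_lborel_singleton[of 0] AE_lborel_singleton[of 1]
proof eventually_elim
  case (elim x)
  show ?case
  proof
    assume x: "x \<in> {0..1}"
    then have f: "Sm 0 (0, x + lam * 0) < \<infinity>" "Sm 1 (0, x + - mu * 0) < \<infinity>" using elim(1)[rule_format, of 0] elim(2)[rule_format, of 0] by auto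
    have n: "- x / lam < 0" "(x - 1) / mu < 0" using x elim lam mu by (auto simp: field_simps)
    have 0: "(LINT r|lborel. (if - x / lam \<le> r \<and> r \<le> 0 then \<sigma>pm (x + lam * r) else 0) * v r (x + lam * r)) = 0"
    proof (rule integral_point_zero[of 0])
      fix r :: real assume r: "r \<noteq> 0"
      have "v r (x + lam * r) = 0" if "- x / lam \<le> r" "r \<le> 0"
      proof -
        have "0 \<le> x + lam * r" using that lam by (simp add: field_simps)
        moreover have "lam * r \<le> 0" using that lam by (simp add: mult_nonneg_nonpos)
        ultimately show ?thesis using uv_neg[of r "x + lam * r"] x that r by auto
      qed
      then show "(if - x / lam \<le> r \<and> r \<le> 0 then \<sigma>pm (x + lam * r) else 0) * v r (x + lam * r) = 0" by auto
    qed
    have 1: "(LINT r|lborel. (if (x - 1) / mu \<le> r \<and> r \<le> 0 then \<sigma>mp (x + - mu * r) else 0) * u r (x + - mu * r)) = 0"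
    proof (rule integral_point_zero[of 0])
      fix r :: real assume r: "r \<noteq> 0"
      have "u r (x + - mu * r) = 0" if "(x - 1) / mu \<le> r" "r \<le> 0"
      proof -
        have "x + - mu * r \<le> 1" using that mu by (simp add: field_simps)
        moreover have "mu * r \<le> 0" using that mu by (simp add: mult_nonneg_nonpos)
        ultimately show ?thesis using uv_neg[of r "x + - mu * r"] x that r by auto
      qed
      then show "(if (x - 1) / mu \<le> r \<and> r \<le> 0 then \<sigma>mp (x + - mu * r) else 0) * u r (x + - mu * r) = 0" by auto
    qed
    have "0 < x" "x < 1" using x elim by auto
    then show "u 0 x = u0 x \<and> v 0 x = v0 x"
      using u_line(2)[OF order_refl f(1)] v_line(2)[OF order_refl f(2)] uv_neg[OF n(1), of 0] bv_neg[OF n(2)]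
      unfolding 0 1 by simp
  qed
qed

lemma boundary0: "AE t in lborel. 0 < t \<longrightarrow> u t 0 = q * v t 0"
proof -
  have "AE t in lborel. \<forall>s. 0 \<le> s \<longrightarrow> (0 + (- lam) * t) + lam * s \<le> 1 \<longrightarrow> Sm 0 (s, (0 + (- lam) * t) + lam * s) < \<infinity>"
    by (rule AE_lborel_affine[OF _ line_finite_AE(1)]) (use lam in auto)
  then show ?thesis
  proof eventually_elim
    case (elim t)
    show ?case
    proof
      assume t: "0 < t"
      have f: "Sm 0 (t, 0) < \<infinity>" using elim[rule_format, of t] t by simp
      have "(LINT y|lborel. (if 0 \<le> y \<and> y \<le> 0 / lam then \<sigma>pm (0 - lam * y) else 0) * v (t - y) (0 - lam * y)) = 0"
        by (rule integral_point_zero[of 0]) auto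
      moreover have "dd 0 (t, 0) = 0" using t lam mult_pos_pos[of lam t] by (simp add: dd_def del: mult_pos_pos)
      ultimately show "u t 0 = q * v t 0" using u_eq(2)[OF f] by simp
    qed
  qed
qed

abbreviation "feedback f g \<equiv> - K * f 1 + (LBINT y:{0..1}. l1 y * f y) + (LBINT y:{0..1}. l2 y * g y)"

text \<open>At x = 1 the elapsed time is 0, so v(t,1) is the third component. Before time \<delta>
  the delayed state is zero and the data term supplies \<phi>; afterwards the data term is zero and
  the feedback remains. This matches the case distinction in \<open>delayed_input\<close>.\<close>

lemma boundary1: "AE t in lborel. 0 < t \<longrightarrow> v t 1 = \<rho> * u t 1 + delayed_input \<delta> (\<lambda>f g. feedback f g) \<phi> u v t"
proof -
  have "AE t in lborel. \<forall>s. 0 \<le> s \<longrightarrow> 0 \<le> (1 + mu * t) + - mu * s \<longrightarrow> Sm 1 (s, (1 + mu * t) + - mu * s) < \<infinity>"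
    by (rule AE_lborel_affine[OF _ line_finite_AE(2)]) (use mu in auto)
  with Sm_finite_AE(3) show ?thesis
  proof eventually_elim
    case (elim t)
    show ?case
    proof
      assume t: "0 < t"
      have f: "Sm 1 (t, 1) < \<infinity>" using elim(2)[rule_format, of t] t by simp
      have "(LINT y|lborel. (if 0 \<le> y \<and> y \<le> (1 - 1) / mu then \<sigma>mp (1 + mu * y) else 0) * u (t - y) (1 + mu * y)) = 0"
        by (rule integral_point_zero[of 0]) auto
      moreover have "dd 1 (t, 1) = 0" using t mu mult_pos_pos[of mu t] by (simp add: dd_def del: mult_pos_pos)
      ultimately have v: "v t 1 = bv t" using v_eq(2)[OF f] by simp
      show "v t 1 = \<rho> * u t 1 + delayed_input \<delta> (\<lambda>f g. feedback f g) \<phi> u v t"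
      proof (cases "t < \<delta>")
        case True
        then have z: "u (t - \<delta>) y = 0 \<and> v (t - \<delta>) y = 0" if "0 \<le> y" "y \<le> 1" for y using uv_neg[of "t - \<delta>" y] that by simp
        have "(LBINT y:{0..1}. l1 y * u (t - \<delta>) y) = (LBINT y:{0..1::real}. 0)" "(LBINT y:{0..1}. l2 y * v (t - \<delta>) y) = (LBINT y:{0..1::real}. 0)"
          by (rule set_lebesgue_integral_cong; simp add: z)+
        then show ?thesis using v bv_eq[OF elim(1)] True t z[of 1] by (simp add: delayed_input_def dd_def)
      next
        case False
        then show ?thesis using v bv_eq[OF elim(1)] t by (simp add: delayed_input_def dd_def)
      qed
    qed
  qed
qed

text \<open>The fixed-point equation bounds a slice by three terms: translated initial data, a
  boundary trace read at affine times, and the source integral along characteristics.\<close>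

lemma slice_L2:
  assumes t: "0 \<le> t"
  shows "(\<integral>\<^sup>+x\<in>{0..1}. (Sm 0 (t, x))\<^sup>2 \<partial>lborel) < \<infinity>" "(\<integral>\<^sup>+x\<in>{0..1}. (Sm 1 (t, x))\<^sup>2 \<partial>lborel) < \<infinity>"
proof -
  have cmult: "(\<integral>\<^sup>+x\<in>{0..1::real}. (ennreal c * H x)\<^sup>2 \<partial>lborel) < \<infinity>"
    if [measurable]: "H \<in> borel_measurable borel" and "(\<integral>\<^sup>+x\<in>{0..1}. (H x)\<^sup>2 \<partial>lborel) < \<infinity>" for H c
  proof -
    have "(\<integral>\<^sup>+x\<in>{0..1}. (ennreal c * H x)\<^sup>2 \<partial>lborel) = (ennreal c)\<^sup>2 * (\<integral>\<^sup>+x\<in>{0..1}. (H x)\<^sup>2 \<partial>lborel)"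
      by (subst nn_integral_cmult[symmetric]) (auto simp: power_mult_distrib mult.assoc)
    moreover have "(ennreal c)\<^sup>2 < \<infinity>" by (simp add: power2_eq_square ennreal_mult_less_top)
    ultimately show ?thesis using that by (simp add: ennreal_mult_less_top)
  qed
  have trace: "(\<integral>\<^sup>+x\<in>{0..1}. (H (k + c * x))\<^sup>2 \<partial>lborel) < \<infinity>"
    if [measurable]: "H \<in> borel_measurable borel" and "cn gw H < \<infinity>" "c \<noteq> 0" for H k c
  proof -
    have "(\<integral>\<^sup>+r\<in>{min k (k + c)..max k (k + c)}. (H r)\<^sup>2 \<partial>lborel) < \<infinity>"
      by (rule le_less_trans[OF cn_interval_le[of gw]]) (use gw that in \<open>auto simp: ew_def ennreal_mult_less_top\<close>)
    then show ?thesis using nn_integral_unit_affine[of "\<lambda>r. (H r)\<^sup>2" c k] that by (simp add: ennreal_mult_less_top)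
  qed
  have data: "(\<integral>\<^sup>+x\<in>{0..1}. (ennreal \<bar>d x\<bar>)\<^sup>2 \<partial>lborel) < \<infinity>"
    if [measurable]: "w \<in> borel_measurable borel" and w: "(\<integral>\<^sup>+x\<in>{0..1}. ennreal ((w x)\<^sup>2) \<partial>lborel) < \<infinity>"
      and d: "\<And>x. x \<in> {0..1} \<Longrightarrow> d x = 0 \<or> (k + x \<in> {0..1} \<and> d x = w (k + x))" for d w :: "real \<Rightarrow> real" and k
  proof -
    have "(\<integral>\<^sup>+x\<in>{0..1}. (ennreal \<bar>d x\<bar>)\<^sup>2 \<partial>lborel) \<le> (\<integral>\<^sup>+x. ennreal ((w (k + 1 * x))\<^sup>2) * indicator {0..1} (k + 1 * x) \<partial>lborel)"
    proof (rule nn_integral_mono)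
      fix x show "(ennreal \<bar>d x\<bar>)\<^sup>2 * indicator {0..1} x \<le> ennreal ((w (k + 1 * x))\<^sup>2) * indicator {0..1} (k + 1 * x)"
        using d[of x] by (auto simp: indicator_def ennreal_power split: if_splits)
    qed
    also have "\<dots> = (\<integral>\<^sup>+x\<in>{0..1}. ennreal ((w x)\<^sup>2) \<partial>lborel)"
      using nn_integral_real_affine[of "\<lambda>x. ennreal ((w x)\<^sup>2) * indicator {0..1} x" 1 k] by simp
    finally show ?thesis using w by (rule le_less_trans)
  qed
  have dm[measurable]: "(\<lambda>x. dd i (t, x)) \<in> borel_measurable borel" for i
    using measurable_compose[OF _ P.d_meas[of i], of "\<lambda>x. (t, x)" borel] by simp
  show "(\<integral>\<^sup>+x\<in>{0..1}. (Sm 0 (t, x))\<^sup>2 \<partial>lborel) < \<infinity>"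
  proof (rule three_squares_finite)
    show "(\<integral>\<^sup>+x\<in>{0..1}. (ennreal \<bar>dd 0 (t, x)\<bar>)\<^sup>2 \<partial>lborel) < \<infinity>"
    proof (rule data[OF _ L2(1)])
      show "dd 0 (t, x) = 0 \<or> (- lam * t + x \<in> {0..1} \<and> dd 0 (t, x) = u0 (- lam * t + x))" if "x \<in> {0..1}" for x
        using that t lam mult_nonneg_nonneg[of lam t] by (auto simp: dd_def simp del: mult_nonneg_nonneg)
    qed measurable
    show "(\<integral>\<^sup>+x\<in>{0..1}. (ennreal \<bar>q\<bar> * Sm 1 (t + (- 1 / lam) * x, 0))\<^sup>2 \<partial>lborel) < \<infinity>"
    proof (rule cmult)
      show "(\<integral>\<^sup>+x\<in>{0..1}. (Sm 1 (t + (- 1 / lam) * x, 0))\<^sup>2 \<partial>lborel) < \<infinity>"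
        by (rule trace[of "\<lambda>s. Sm 1 (s, 0)"]) (use majorant_finite(2) lam in \<open>auto simp: col_def\<close>)
    qed measurable
    show "(\<integral>\<^sup>+x\<in>{0..1}. (ennreal M * (\<integral>\<^sup>+y\<in>{0..1 / lam}. Sm 1 (t - y, x + - lam * y) * indicator {0..1} (x + - lam * y) \<partial>lborel))\<^sup>2 \<partial>lborel) < \<infinity>"
    proof (rule cmult)
      show "(\<integral>\<^sup>+x\<in>{0..1}. (\<integral>\<^sup>+y\<in>{0..1 / lam}. Sm 1 (t - y, x + - lam * y) * indicator {0..1} (x + - lam * y) \<partial>lborel)\<^sup>2 \<partial>lborel) < \<infinity>"
        by (rule slice_finite[where \<gamma> = gw]) (use majorant_finite(5) lam gw in \<open>auto simp: col_def\<close>)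
    qed measurable
    fix x :: real assume x: "x \<in> {0..1}"
    have "(\<integral>\<^sup>+y. ennreal \<bar>if 0 \<le> y \<and> y \<le> x / lam then \<sigma>pm (x - lam * y) else 0\<bar> * Sm 1 (t - y, x - lam * y) \<partial>lborel)
      \<le> (\<integral>\<^sup>+y. ennreal M * (Sm 1 (t - y, x + - lam * y) * indicator {0..1} (x + - lam * y) * indicator {0..1 / lam} y) \<partial>lborel)"
    proof (rule nn_integral_mono)
      fix y
      show "ennreal \<bar>if 0 \<le> y \<and> y \<le> x / lam then \<sigma>pm (x - lam * y) else 0\<bar> * Sm 1 (t - y, x - lam * y)
        \<le> ennreal M * (Sm 1 (t - y, x + - lam * y) * indicator {0..1} (x + - lam * y) * indicator {0..1 / lam} y)"
      proof (cases "0 \<le> y \<and> y \<le> x / lam")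
        case True
        then have "0 \<le> lam * y" "lam * y \<le> x" "lam * y \<le> 1" using lam x by (auto simp: field_simps)
        then have "x + - lam * y \<in> {0..1}" using x by auto
        moreover have "y \<in> {0..1 / lam}" using True \<open>lam * y \<le> 1\<close> lam by (auto simp: field_simps)
        ultimately show ?thesis using True bdd(1)[of "x - lam * y"] by (auto intro!: mult_right_mono ennreal_leI)
      qed auto
    qed
    also have "\<dots> = ennreal M * (\<integral>\<^sup>+y\<in>{0..1 / lam}. Sm 1 (t - y, x + - lam * y) * indicator {0..1} (x + - lam * y) \<partial>lborel)"
      by (rule nn_integral_cmult) measurable
    finally show "Sm 0 (t, x) \<le> ennreal \<bar>dd 0 (t, x)\<bar> + (ennreal \<bar>q\<bar> * Sm 1 (t + (- 1 / lam) * x, 0)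
      + ennreal M * (\<integral>\<^sup>+y\<in>{0..1 / lam}. Sm 1 (t - y, x + - lam * y) * indicator {0..1} (x + - lam * y) \<partial>lborel))"
      using P.majorant_fixpoint[of 0 "(t, x)"] unfolding P0 by (simp add: add_left_mono)
  qed measurable
  show "(\<integral>\<^sup>+x\<in>{0..1}. (Sm 1 (t, x))\<^sup>2 \<partial>lborel) < \<infinity>"
  proof (rule three_squares_finite)
    show "(\<integral>\<^sup>+x\<in>{0..1}. (ennreal \<bar>dd 1 (t, x)\<bar>)\<^sup>2 \<partial>lborel) < \<infinity>"
    proof (rule data[OF _ L2(2)])
      show "dd 1 (t, x) = 0 \<or> (mu * t + x \<in> {0..1} \<and> dd 1 (t, x) = v0 (mu * t + x))" if "x \<in> {0..1}" for x
        using that t mu mult_nonneg_nonneg[of mu t] by (auto simp: dd_def add.commute simp del: mult_nonneg_nonneg)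
    qed measurable
    show "(\<integral>\<^sup>+x\<in>{0..1}. (ennreal 1 * Sm 2 ((t - 1 / mu) + (1 / mu) * x, 0))\<^sup>2 \<partial>lborel) < \<infinity>"
    proof (rule cmult)
      show "(\<integral>\<^sup>+x\<in>{0..1}. (Sm 2 ((t - 1 / mu) + (1 / mu) * x, 0))\<^sup>2 \<partial>lborel) < \<infinity>"
        by (rule trace[of "\<lambda>s. Sm 2 (s, 0)"]) (use majorant_finite(3) mu in \<open>auto simp: col_def\<close>)
    qed measurable
    show "(\<integral>\<^sup>+x\<in>{0..1}. (ennreal M * (\<integral>\<^sup>+y\<in>{0..1 / mu}. Sm 0 (t - y, x + mu * y) * indicator {0..1} (x + mu * y) \<partial>lborel))\<^sup>2 \<partial>lborel) < \<infinity>"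
    proof (rule cmult)
      show "(\<integral>\<^sup>+x\<in>{0..1}. (\<integral>\<^sup>+y\<in>{0..1 / mu}. Sm 0 (t - y, x + mu * y) * indicator {0..1} (x + mu * y) \<partial>lborel)\<^sup>2 \<partial>lborel) < \<infinity>"
        by (rule slice_finite[where \<gamma> = gw]) (use majorant_finite(4) mu gw in \<open>auto simp: col_def\<close>)
    qed measurable
    fix x :: real assume x: "x \<in> {0..1}"
    have "(\<integral>\<^sup>+y. ennreal \<bar>if 0 \<le> y \<and> y \<le> (1 - x) / mu then \<sigma>mp (x + mu * y) else 0\<bar> * Sm 0 (t - y, x + mu * y) \<partial>lborel)
      \<le> (\<integral>\<^sup>+y. ennreal M * (Sm 0 (t - y, x + mu * y) * indicator {0..1} (x + mu * y) * indicator {0..1 / mu} y) \<partial>lborel)"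
    proof (rule nn_integral_mono)
      fix y
      show "ennreal \<bar>if 0 \<le> y \<and> y \<le> (1 - x) / mu then \<sigma>mp (x + mu * y) else 0\<bar> * Sm 0 (t - y, x + mu * y)
        \<le> ennreal M * (Sm 0 (t - y, x + mu * y) * indicator {0..1} (x + mu * y) * indicator {0..1 / mu} y)"
      proof (cases "0 \<le> y \<and> y \<le> (1 - x) / mu")
        case True
        then have "0 \<le> mu * y" "mu * y \<le> 1 - x" "mu * y \<le> 1" using mu x by (auto simp: field_simps)
        then have "x + mu * y \<in> {0..1}" using x by auto
        moreover have "y \<in> {0..1 / mu}" using True \<open>mu * y \<le> 1\<close> mu by (auto simp: field_simps)
        ultimately show ?thesis using True bdd(2)[of "x + mu * y"] by (auto intro!: mult_right_mono ennreal_leI)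
      qed auto
    qed
    also have "\<dots> = ennreal M * (\<integral>\<^sup>+y\<in>{0..1 / mu}. Sm 0 (t - y, x + mu * y) * indicator {0..1} (x + mu * y) \<partial>lborel)"
      by (rule nn_integral_cmult) measurable
    finally have le: "(\<integral>\<^sup>+y. ennreal \<bar>if 0 \<le> y \<and> y \<le> (1 - x) / mu then \<sigma>mp (x + mu * y) else 0\<bar> * Sm 0 (t - y, x + mu * y) \<partial>lborel) \<le> \<dots>" .
    have e: "t - (1 - x) / mu = (t - 1 / mu) + (1 / mu) * x" by (simp add: diff_divide_distrib)
    show "Sm 1 (t, x) \<le> ennreal \<bar>dd 1 (t, x)\<bar> + (ennreal 1 * Sm 2 ((t - 1 / mu) + (1 / mu) * x, 0)
      + ennreal M * (\<integral>\<^sup>+y\<in>{0..1 / mu}. Sm 0 (t - y, x + mu * y) * indicator {0..1} (x + mu * y) \<partial>lborel))"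
      unfolding P.majorant_fixpoint[of 1 "(t, x)"] P1 e using le by (simp add: add_left_mono)
  qed measurable
qed

lemma rectangle_finite:
  assumes i: "i = 0 \<or> i = 1"
  shows "(\<integral>\<^sup>+z\<in>{0..T} \<times> {0..1}. (Sm i z)\<^sup>2 \<partial>lborel) < \<infinity>"
proof -
  have "(\<integral>\<^sup>+z\<in>{0..T} \<times> {0..1}. (Sm i z)\<^sup>2 \<partial>lborel) = (\<integral>\<^sup>+z. (Sm i z)\<^sup>2 * indicator ({0..T} \<times> {0..1}) z \<partial>(lborel \<Otimes>\<^sub>M lborel))"
    by (simp add: lborel_prod)
  also have "\<dots> = (\<integral>\<^sup>+x. (\<integral>\<^sup>+t. (Sm i (t, x))\<^sup>2 * indicator ({0..T} \<times> {0..1}) (t, x) \<partial>lborel) \<partial>lborel)"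
    by (rule lborel_pair.nn_integral_snd[symmetric]) measurable
  also have "\<dots> = (\<integral>\<^sup>+x\<in>{0..1}. (\<integral>\<^sup>+t\<in>{0..T}. (Sm i (t, x))\<^sup>2 \<partial>lborel) \<partial>lborel)"
    by (rule nn_integral_cong) (auto simp: indicator_def intro!: nn_integral_cong)
  also have "\<dots> < \<infinity>"
    by (rule strip_finite[where \<gamma> = gw]) (use i gw majorant_finite(4,5) in \<open>auto simp: col_def\<close>)
  finally show ?thesis .
qed

lemma solution: "plant_solution lam mu q \<rho> \<sigma>pm \<sigma>mp u0 v0 (delayed_input \<delta> (\<lambda>f g. feedback f g) \<phi> u v) u v"
proof -
  have m: "u t \<in> borel_measurable borel" "v t \<in> borel_measurable borel"
    "(\<lambda>t. u t 1) \<in> borel_measurable borel" "(\<lambda>t. v t 0) \<in> borel_measurable borel" for t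
    using measurable_compose[OF _ uv_meas(1), of "\<lambda>x. (t, x)" borel] measurable_compose[OF _ uv_meas(2), of "\<lambda>x. (t, x)" borel]
      measurable_compose[OF _ uv_meas(1), of "\<lambda>t. (t, 1)" borel] measurable_compose[OF _ uv_meas(2), of "\<lambda>t. (t, 0)" borel] by simp_all
  have 1: "L2_on {0..1} (u t)" "L2_on {0..1} (v t)" if "0 \<le> t" for t
    by (rule L2_on_dominated[OF m(1) _ uv_le(1) slice_L2(1)[OF that]], simp)
      (rule L2_on_dominated[OF m(2) _ uv_le(2) slice_L2(2)[OF that]], simp)
  have 2: "L2_on ({0..T} \<times> {0..1}) (\<lambda>(t, x). u t x)" "L2_on ({0..T} \<times> {0..1}) (\<lambda>(t, x). v t x)" for T
  proof -
    have b: "{0..T} \<times> {0..1::real} \<in> sets borel" by (intro borel_closed closed_Times) auto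
    show "L2_on ({0..T} \<times> {0..1}) (\<lambda>(t, x). u t x)"
      by (rule L2_on_dominated[OF _ b, where H = "Sm 0"]) (use uv_meas uv_le rectangle_finite[of 0 T] in \<open>auto simp: borel_prod\<close>)
    show "L2_on ({0..T} \<times> {0..1}) (\<lambda>(t, x). v t x)"
      by (rule L2_on_dominated[OF _ b, where H = "Sm 1"]) (use uv_meas uv_le rectangle_finite[of 1 T] in \<open>auto simp: borel_prod\<close>)
  qed
  have 3: "(\<integral>\<^sup>+s\<in>{0..T}. (H s)\<^sup>2 \<partial>lborel) < \<infinity>" if "H \<in> borel_measurable borel" "cn gw H < \<infinity>" for H T
    by (rule le_less_trans[OF cn_interval_le[of gw]]) (use gw that in \<open>auto simp: ew_def ennreal_mult_less_top\<close>)
  have 4: "L2_on {0..T} (\<lambda>t. u t 1)" for T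
    by (rule L2_on_dominated[OF m(3) _ uv_le(1) 3]) (use majorant_finite(1) in \<open>simp_all add: col_def\<close>)
  have 5: "L2_on {0..T} (\<lambda>t. v t 0)" for T
    by (rule L2_on_dominated[OF m(4) _ uv_le(2) 3]) (use majorant_finite(2) in \<open>simp_all add: col_def\<close>)
  have 6: "AE t in lborel. 0 < t \<longrightarrow> u t 0 = q * v t 0 \<and> v t 1 = \<rho> * u t 1 + delayed_input \<delta> (\<lambda>f g. feedback f g) \<phi> u v t"
    using boundary0 boundary1 by eventually_elim blast
  show ?thesis unfolding plant_solution_def using 1 2 4 5 6 broad initial by blast
qed

end

subsection \<open>Stabilization\<close>

lemma L2_on_cong: "(\<And>x. x \<in> S \<Longrightarrow> f x = g x) \<Longrightarrow> L2_on S f \<longleftrightarrow> L2_on S g"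
  unfolding L2_on_def set_borel_measurable_def set_integrable_def
  by (intro arg_cong2[of _ _ _ _ "(\<and>)"] arg_cong[where f = "\<lambda>h. h \<in> _"] arg_cong[where f = "integrable lborel"] ext) (auto simp: indicator_def)

lemma L2norm_on_cong: "(\<And>x. x \<in> S \<Longrightarrow> f x = g x) \<Longrightarrow> L2norm_on S f = L2norm_on S g"
  unfolding L2norm_on_def set_lebesgue_integral_def
  by (intro arg_cong[where f = sqrt] Bochner_Integration.integral_cong) (auto simp: indicator_def)

lemma Linf_on_cong: "(\<And>x. x \<in> S \<Longrightarrow> f x = g x) \<Longrightarrow> Linf_on S f \<Longrightarrow> Linf_on S g"
  unfolding Linf_on_def set_borel_measurable_def
proof (elim conjE, intro conjI)
  assume eq: "\<And>x. x \<in> S \<Longrightarrow> f x = g x" and m: "(\<lambda>x. indicator S x *\<^sub>R f x) \<in> borel_measurable borel" and b: "bounded (f ` S)"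
  have "(\<lambda>x. indicator S x *\<^sub>R f x) = (\<lambda>x. indicator S x *\<^sub>R g x)" using eq by (auto simp: indicator_def)
  with m show "(\<lambda>x. indicator S x *\<^sub>R g x) \<in> borel_measurable borel" by simp
  have "f ` S = g ` S" using eq by (auto simp: image_iff)
  with b show "bounded (g ` S)" by simp
qed

lemma Linf_on_truncate:
  assumes "Linf_on S f"
  shows "(\<lambda>x. indicator S x * f x) \<in> borel_measurable borel" "\<exists>B. \<forall>x. \<bar>indicator S x * f x\<bar> \<le> B"
proof -
  show "(\<lambda>x. indicator S x * f x) \<in> borel_measurable borel"
    using assms by (simp add: Linf_on_def set_borel_measurable_def)
  obtain B where "\<And>x. x \<in> S \<Longrightarrow> \<bar>f x\<bar> \<le> B" using assms by (auto simp: Linf_on_def bounded_iff)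
  then have "\<bar>indicator S x * f x\<bar> \<le> \<bar>B\<bar>" for x by (cases "x \<in> S") (auto intro: order_trans[OF _ abs_ge_self])
  then show "\<exists>B. \<forall>x. \<bar>indicator S x * f x\<bar> \<le> B" by blast
qed

text \<open>By convexity of S a characteristic between two points of S stays in S, so values outside
  S never enter the integral.\<close>

lemma broad_solution_cong:
  assumes "convex S" and fg: "\<And>y z. (y, z) \<in> S \<Longrightarrow> f y z = f' y z \<and> g y z = g' y z" and b: "broad_solution a b S f g"
  shows "broad_solution a b S f' g'"
  using b unfolding broad_solution_def
proof eventually_elim
  case (elim c)
  show ?case
  proof (intro allI impI)
    fix s0 s1 :: real assume s: "s0 \<le> s1" "(a * s0, c + b * s0) \<in> S" "(a * s1, c + b * s1) \<in> S"
    have "(a * s, c + b * s) \<in> S" if "s \<in> {s0..s1}" for s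
    proof (cases "s0 = s1")
      case True then show ?thesis using that s by auto
    next
      case False
      obtain w where "w * (s1 - s0) = s - s0" "0 \<le> w" "w \<le> 1"
        using \<open>s \<in> {s0..s1}\<close> False s(1) by (intro that[of "(s - s0) / (s1 - s0)"]) (auto simp: divide_le_eq)
      then have w: "0 \<le> w" "w \<le> 1" "s = (1 - w) * s0 + w * s1" by (auto simp: algebra_simps)
      have "(1 - w) *\<^sub>R (a * s0, c + b * s0) + w *\<^sub>R (a * s1, c + b * s1) \<in> S"
        using convexD_alt[OF assms(1) s(2,3) w(1,2)] .
      then show ?thesis unfolding w(3) by (simp add: algebra_simps)
    qed
    then have g: "s \<in> {s0..s1} \<Longrightarrow> g (a * s) (c + b * s) = g' (a * s) (c + b * s)" for s using fg by blast
    have "set_integrable lborel {s0..s1} (\<lambda>s. g (a * s) (c + b * s)) = set_integrable lborel {s0..s1} (\<lambda>s. g' (a * s) (c + b * s))"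
      by (rule set_integrable_cong) (auto simp: g)
    moreover have "(LBINT s:{s0..s1}. g (a * s) (c + b * s)) = (LBINT s:{s0..s1}. g' (a * s) (c + b * s))"
      by (rule set_lebesgue_integral_cong) (auto simp: g)
    ultimately show "set_integrable lborel {s0..s1} (\<lambda>s. g' (a * s) (c + b * s)) \<and>
      f' (a * s1) (c + b * s1) - f' (a * s0) (c + b * s0) = (LBINT s:{s0..s1}. g' (a * s) (c + b * s))"
      using elim[rule_format, OF s] fg[OF s(2)] fg[OF s(3)] by simp
  qed
qed

lemma convex_triangle: "convex triangle"
proof -
  have eq: "triangle = {z. inner (0, -1) z \<le> 0} \<inter> {z. inner (-1, 1) z \<le> 0} \<inter> {z. inner (1, 0) z \<le> (1::real)}"
    by (auto simp: triangle_def)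
  show ?thesis unfolding eq by (intro convex_Int convex_halfspace_le)
qed

lemma backstepping_kernels_cong:
  assumes k: "backstepping_kernels lam mu q \<sigma>pm \<sigma>mp Kuu Kuv Kvu Kvv"
    and \<sigma>: "\<And>x. x \<in> {0..1} \<Longrightarrow> \<sigma>pm x = \<sigma>pm' x \<and> \<sigma>mp x = \<sigma>mp' x"
    and K: "\<And>x y. (x, y) \<in> triangle \<Longrightarrow> Kuu x y = Kuu' x y \<and> Kuv x y = Kuv' x y \<and> Kvu x y = Kvu' x y \<and> Kvv x y = Kvv' x y"
  shows "backstepping_kernels lam mu q \<sigma>pm' \<sigma>mp' Kuu' Kuv' Kvu' Kvv'"
proof -
  have t: "y \<in> {0..1}" if "(x, y) \<in> triangle" for x y using that by (auto simp: triangle_def)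
  have d: "(x, x) \<in> triangle" "(x, 0) \<in> triangle" if "x \<in> {0..1}" for x using that by (auto simp: triangle_def)
  note k' = k[unfolded backstepping_kernels_def]
  have L: "Linf_on triangle (\<lambda>(x, y). k' x y)"
    if "Linf_on triangle (\<lambda>(x, y). k x y)" "\<And>x y. (x, y) \<in> triangle \<Longrightarrow> k x y = k' x y" for k k'
    by (rule Linf_on_cong[OF _ that(1)]) (use that(2) in auto)
  have 1: "Linf_on triangle (\<lambda>(x, y). Kuu' x y)" by (rule L[of Kuu]) (use k' K in auto)
  have 2: "Linf_on triangle (\<lambda>(x, y). Kuv' x y)" by (rule L[of Kuv]) (use k' K in auto)
  have 3: "Linf_on triangle (\<lambda>(x, y). Kvu' x y)" by (rule L[of Kvu]) (use k' K in auto)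
  have 4: "Linf_on triangle (\<lambda>(x, y). Kvv' x y)" by (rule L[of Kvv]) (use k' K in auto)
  have 5: "broad_solution lam lam triangle Kuu' (\<lambda>x \<xi>. - Kuv' x \<xi> * \<sigma>mp' \<xi>)"
    by (rule broad_solution_cong[OF convex_triangle, of Kuu _ "\<lambda>x \<xi>. - Kuv x \<xi> * \<sigma>mp \<xi>"]) (use k' K \<sigma> t in auto)
  have 6: "broad_solution lam (- mu) triangle Kuv' (\<lambda>x \<xi>. - Kuu' x \<xi> * \<sigma>pm' \<xi>)"
    by (rule broad_solution_cong[OF convex_triangle, of Kuv _ "\<lambda>x \<xi>. - Kuu x \<xi> * \<sigma>pm \<xi>"]) (use k' K \<sigma> t in auto)
  have 7: "broad_solution mu (- lam) triangle Kvu' (\<lambda>x \<xi>. Kvv' x \<xi> * \<sigma>mp' \<xi>)"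
    by (rule broad_solution_cong[OF convex_triangle, of Kvu _ "\<lambda>x \<xi>. Kvv x \<xi> * \<sigma>mp \<xi>"]) (use k' K \<sigma> t in auto)
  have 8: "broad_solution mu mu triangle Kvv' (\<lambda>x \<xi>. Kvu' x \<xi> * \<sigma>pm' \<xi>)"
    by (rule broad_solution_cong[OF convex_triangle, of Kvv _ "\<lambda>x \<xi>. Kvu x \<xi> * \<sigma>pm \<xi>"]) (use k' K \<sigma> t in auto)
  have "AE x in lborel. x \<in> {0..1} \<longrightarrow> Kvu x x = - \<sigma>mp x / (lam + mu) \<and> Kvv x 0 = lam * q / mu * Kvu x 0 \<and>
      Kuv x x = \<sigma>pm x / (lam + mu) \<and> Kuv x 0 = lam * q / mu * Kuu x 0" using k' by blast
  then have 9: "AE x in lborel. x \<in> {0..1} \<longrightarrow> Kvu' x x = - \<sigma>mp' x / (lam + mu) \<and> Kvv' x 0 = lam * q / mu * Kvu' x 0 \<and>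
      Kuv' x x = \<sigma>pm' x / (lam + mu) \<and> Kuv' x 0 = lam * q / mu * Kuu' x 0"
    by eventually_elim (use K d \<sigma> in auto)
  show ?thesis unfolding backstepping_kernels_def using 1 2 3 4 5 6 7 8 9 by blast
qed

text \<open>Used in both directions: to pass from a given solution to one extended by zero, and from
  a solution for truncated data to one for the original data.\<close>

lemma plant_solution_cong:
  assumes sol: "plant_solution lam mu q \<rho> \<sigma>pm \<sigma>mp u0 v0 (delayed_input \<delta> \<K> \<phi> u v) u v"
    and \<sigma>: "\<And>x. x \<in> {0..1} \<Longrightarrow> \<sigma>pm x = \<sigma>pm' x \<and> \<sigma>mp x = \<sigma>mp' x"
    and uv: "\<And>t x. 0 \<le> t \<Longrightarrow> x \<in> {0..1} \<Longrightarrow> u t x = u' t x \<and> v t x = v' t x"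
    and init: "\<And>x. x \<in> {0..1} \<Longrightarrow> u0 x = u0' x \<and> v0 x = v0' x"
    and \<phi>: "\<And>s. s \<in> {- \<delta>..0} \<Longrightarrow> \<phi> s = \<phi>' s"
    and \<K>: "\<And>t. 0 \<le> t \<Longrightarrow> \<K> (u t) (v t) = \<K>' (u' t) (v' t)"
  shows "plant_solution lam mu q \<rho> \<sigma>pm' \<sigma>mp' u0' v0' (delayed_input \<delta> \<K>' \<phi>' u' v') u' v'"
proof -
  note s = sol[unfolded plant_solution_def]
  have c: "convex ({0..} \<times> {0..1} :: (real \<times> real) set)" by (intro convex_Times) auto
  have 1: "L2_on {0..1} (u' t) \<and> L2_on {0..1} (v' t)" if "0 \<le> t" for t
    using s that L2_on_cong[of "{0..1}" "u t" "u' t"] L2_on_cong[of "{0..1}" "v t" "v' t"] uv[OF that] by blast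
  have 2: "L2_on ({0..T} \<times> {0..1}) (\<lambda>(t, x). u' t x) \<and> L2_on ({0..T} \<times> {0..1}) (\<lambda>(t, x). v' t x) \<and>
      L2_on {0..T} (\<lambda>t. u' t 1) \<and> L2_on {0..T} (\<lambda>t. v' t 0)" if "0 < T" for T
  proof -
    have "L2_on ({0..T} \<times> {0..1}) (\<lambda>(t, x). u t x) \<longleftrightarrow> L2_on ({0..T} \<times> {0..1}) (\<lambda>(t, x). u' t x)"
      "L2_on ({0..T} \<times> {0..1}) (\<lambda>(t, x). v t x) \<longleftrightarrow> L2_on ({0..T} \<times> {0..1}) (\<lambda>(t, x). v' t x)"
      "L2_on {0..T} (\<lambda>t. u t 1) \<longleftrightarrow> L2_on {0..T} (\<lambda>t. u' t 1)" "L2_on {0..T} (\<lambda>t. v t 0) \<longleftrightarrow> L2_on {0..T} (\<lambda>t. v' t 0)"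
      by (rule L2_on_cong; use uv in auto)+
    then show ?thesis using s that by blast
  qed
  have 3: "broad_solution 1 lam ({0..} \<times> {0..1}) u' (\<lambda>t x. \<sigma>pm' x * v' t x)"
    by (rule broad_solution_cong[OF c, of u _ "\<lambda>t x. \<sigma>pm x * v t x"]) (use s uv \<sigma> in auto)
  have 4: "broad_solution 1 (- mu) ({0..} \<times> {0..1}) v' (\<lambda>t x. \<sigma>mp' x * u' t x)"
    by (rule broad_solution_cong[OF c, of v _ "\<lambda>t x. \<sigma>mp x * u t x"]) (use s uv \<sigma> in auto)
  have U: "delayed_input \<delta> \<K> \<phi> u v t = delayed_input \<delta> \<K>' \<phi>' u' v' t" if "0 < t" for t
    using that \<phi>[of "t - \<delta>"] \<K>[of "t - \<delta>"] by (auto simp: delayed_input_def)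
  have "AE t in lborel. 0 < t \<longrightarrow> u t 0 = q * v t 0 \<and> v t 1 = \<rho> * u t 1 + delayed_input \<delta> \<K> \<phi> u v t" using s by blast
  then have 5: "AE t in lborel. 0 < t \<longrightarrow> u' t 0 = q * v' t 0 \<and> v' t 1 = \<rho> * u' t 1 + delayed_input \<delta> \<K>' \<phi>' u' v' t"
  proof eventually_elim
    case (elim t) then show ?case using uv[of t 0] uv[of t 1] U[of t] by auto
  qed
  have "AE x in lborel. x \<in> {0..1} \<longrightarrow> u 0 x = u0 x \<and> v 0 x = v0 x" using s by blast
  then have 6: "AE x in lborel. x \<in> {0..1} \<longrightarrow> u' 0 x = u0' x \<and> v' 0 x = v0' x"
    by eventually_elim (use uv[of 0] init in auto)
  show ?thesis unfolding plant_solution_def using 1 2 3 4 5 6 by blast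
qed

lemma U_BS2_cong:
  assumes "\<And>x. x \<in> {0..1} \<Longrightarrow> f x = f' x \<and> g x = g' x"
    and "\<And>y. y \<in> {0..1} \<Longrightarrow> Kuu 1 y = Kuu' 1 y \<and> Kuv 1 y = Kuv' 1 y \<and> Kvu 1 y = Kvu' 1 y \<and> Kvv 1 y = Kvv' 1 y"
  shows "U_BS2 \<rho> K Kuu Kuv Kvu Kvv f g = U_BS2 \<rho> K Kuu' Kuv' Kvu' Kvv' f' g'"
proof -
  have "(LBINT \<xi>:{0..1}. Kuu 1 \<xi> * f \<xi> + Kuv 1 \<xi> * g \<xi>) = (LBINT \<xi>:{0..1}. Kuu' 1 \<xi> * f' \<xi> + Kuv' 1 \<xi> * g' \<xi>)"
    "(LBINT \<xi>:{0..1}. Kvu 1 \<xi> * f \<xi> + Kvv 1 \<xi> * g \<xi>) = (LBINT \<xi>:{0..1}. Kvu' 1 \<xi> * f' \<xi> + Kvv' 1 \<xi> * g' \<xi>)"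
    by (rule set_lebesgue_integral_cong; use assms in simp)+
  then show ?thesis using assms(1)[of 1] by (simp add: U_BS2_def)
qed

lemma measurable_on_half_strip:
  fixes u :: "real \<Rightarrow> real \<Rightarrow> real"
  assumes "\<And>T. 0 < T \<Longrightarrow> L2_on ({0..T} \<times> {0..1}) (\<lambda>(t, x). u t x)"
  shows "(\<lambda>(t, x). indicator ({0..} \<times> {0..1}) (t, x) * u t x) \<in> borel_measurable (borel \<Otimes>\<^sub>M borel)"
proof (rule borel_measurable_LIMSEQ_real)
  show "(\<lambda>z. indicator ({0..real (Suc n)} \<times> {0..1}) z * (case z of (t, x) \<Rightarrow> u t x)) \<in> borel_measurable (borel \<Otimes>\<^sub>M borel)" for n
    using assms[of "real (Suc n)"] by (simp add: L2_on_def set_borel_measurable_def borel_prod)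
  fix z :: "real \<times> real"
  obtain n0 where n0: "fst z \<le> real n0" using real_arch_simple by blast
  show "(\<lambda>n. indicator ({0..real (Suc n)} \<times> {0..1}) z * (case z of (t, x) \<Rightarrow> u t x)) \<longlonglongrightarrow> (case z of (t, x) \<Rightarrow> indicator ({0..} \<times> {0..1}) (t, x) * u t x)"
  proof (rule tendsto_eventually)
    show "\<forall>\<^sub>F n in sequentially. indicator ({0..real (Suc n)} \<times> {0..1}) z * (case z of (t, x) \<Rightarrow> u t x) = (case z of (t, x) \<Rightarrow> indicator ({0..} \<times> {0..1}) (t, x) * u t x)"
      using eventually_ge_at_top[of n0]
    proof eventually_elim
      case (elim n)
      then have "real n0 \<le> real n" by simp
      then have "fst z \<le> real (Suc n)" using n0 by simp
      then show ?case by (cases z) (auto simp: indicator_def)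
    qed
  qed
qed

text \<open>The control law is regrouped by state component into the densities l1 and l2, with the
  enlarged bound M' for the combinations of two kernels.\<close>

lemma (in backstep) existence:
  assumes \<delta>: "0 \<le> \<delta>" and [measurable]: "u0 \<in> borel_measurable borel" "v0 \<in> borel_measurable borel" "\<phi> \<in> borel_measurable borel"
    and L2: "L2_on {0..1} u0" "L2_on {0..1} v0" "L2_on {- \<delta>..0} \<phi>"
  shows "\<exists>u v. plant_solution lam mu q \<rho> \<sigma>pm \<sigma>mp u0 v0 (delayed_input \<delta> (U_BS2 \<rho> K Kuu Kuv Kvu Kvv) \<phi> u v) u v"
proof -
  define l1 where "l1 \<xi> = - (\<rho> - K) * Kuu 1 \<xi> + Kvu 1 \<xi>" for \<xi>
  define l2 where "l2 \<xi> = - (\<rho> - K) * Kuv 1 \<xi> + Kvv 1 \<xi>" for \<xi>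
  define M' where "M' = (\<bar>\<rho> - K\<bar> + 1) * M"
  have M': "M \<le> M'" "0 < M'" using M by (auto simp: M'_def distrib_right intro: add_nonneg_pos)
  have l: "\<bar>- (\<rho> - K) * a + b\<bar> \<le> M'" if "\<bar>a\<bar> \<le> M" "\<bar>b\<bar> \<le> M" for a b
  proof -
    have "\<bar>- (\<rho> - K) * a + b\<bar> \<le> \<bar>\<rho> - K\<bar> * \<bar>a\<bar> + \<bar>b\<bar>"
      using abs_triangle_ineq[of "- (\<rho> - K) * a" b] by (simp add: abs_mult abs_minus_commute)
    also have "\<dots> \<le> \<bar>\<rho> - K\<bar> * M + M" using that by (intro add_mono mult_left_mono) auto
    finally show ?thesis by (simp add: M'_def distrib_right)
  qed
  have split: "- K * f 1 + (LBINT y:{0..1}. l1 y * f y) + (LBINT y:{0..1}. l2 y * g y) = U_BS2 \<rho> K Kuu Kuv Kvu Kvv f g"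
    if i: "set_integrable lborel {0..1} (\<lambda>y. Kuu 1 y * f y)" "set_integrable lborel {0..1} (\<lambda>y. Kuv 1 y * g y)"
      "set_integrable lborel {0..1} (\<lambda>y. Kvu 1 y * f y)" "set_integrable lborel {0..1} (\<lambda>y. Kvv 1 y * g y)" for f g
  proof -
    have lin: "(LBINT y:{0..1}. (c * a y + b y) * h y) = c * (LBINT y:{0..1}. a y * h y) + (LBINT y:{0..1}. b y * h y)"
      if "set_integrable lborel {0..1} (\<lambda>y. a y * h y)" "set_integrable lborel {0..1} (\<lambda>y. b y * h y)" for a b h :: "real \<Rightarrow> real" and c
      using set_integral_add(2)[OF set_integrable_mult_right[of c, OF that(1)] that(2)] by (simp add: distrib_right mult.assoc)
    show ?thesis
      unfolding U_BS2_def l1_def l2_def lin[OF i(1) i(3)] lin[OF i(2) i(4)] set_integral_add(2)[OF i(1,2)] set_integral_add(2)[OF i(3,4)]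
      by (simp add: algebra_simps)
  qed
  interpret W: wellposed lam mu q \<rho> K \<delta> M' \<sigma>pm \<sigma>mp l1 l2 u0 v0 \<phi>
  proof
    show "l1 \<in> borel_measurable borel" "l2 \<in> borel_measurable borel"
      unfolding l1_def[abs_def] l2_def[abs_def] by measurable
    show "\<bar>l1 x\<bar> \<le> M'" "\<bar>l2 x\<bar> \<le> M'" for x unfolding l1_def l2_def by (rule l; rule bdd)+
    show "\<bar>\<sigma>pm x\<bar> \<le> M'" "\<bar>\<sigma>mp x\<bar> \<le> M'" for x using bdd(1,2)[of x] M' by linarith+
  qed (use lam mu \<delta> M' nn_integral_L2_on[OF L2(1)] nn_integral_L2_on[OF L2(2)] nn_integral_L2_on[OF L2(3)] in auto)
  \<comment> \<open>The integral of a sum splits only for integrable summands. The two forms of the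
    feedback are therefore compared on the L2 states of the constructed solution, not for arbitrary
    arguments.\<close>
  have fb: "W.feedback (W.u t) (W.v t) = U_BS2 \<rho> K Kuu Kuv Kvu Kvv (W.u t) (W.v t)" if t: "0 \<le> t" for t
  proof -
    have [measurable]: "W.u t \<in> borel_measurable borel" "W.v t \<in> borel_measurable borel"
      using measurable_compose[OF _ W.uv_meas(1), of "\<lambda>x. (t, x)" borel] measurable_compose[OF _ W.uv_meas(2), of "\<lambda>x. (t, x)" borel] by simp_all
    have L: "L2_on {0..1} (W.u t)" "L2_on {0..1} (W.v t)" using W.solution t unfolding plant_solution_def by blast+
    have b: "set_integrable lborel {0..1} (\<lambda>x. k x * h x)"
      if [measurable]: "k \<in> borel_measurable borel" and "\<And>x. \<bar>k x\<bar> \<le> M" "h = W.u t \<or> h = W.v t" for k h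
      by (rule set_integrable_bounded_mult[OF L2_on_integrable]) (use that L in auto)
    show ?thesis by (rule split) (rule b, use bdd in simp_all)+
  qed
  have "plant_solution lam mu q \<rho> \<sigma>pm \<sigma>mp u0 v0 (delayed_input \<delta> (U_BS2 \<rho> K Kuu Kuv Kvu Kvv) \<phi> W.u W.v) W.u W.v"
    by (rule plant_solution_cong[OF W.solution]) (use fb in auto)
  then show ?thesis by blast
qed

theorem theorem4:
  fixes lam mu q \<rho> K :: real
    and \<sigma>pm \<sigma>mp :: "real \<Rightarrow> real"
    and Kuu Kuv Kvu Kvv :: "real \<Rightarrow> real \<Rightarrow> real"
  assumes "0 < lam" and "0 < mu"
    and "q \<noteq> 0" and "\<bar>\<rho> * q\<bar> < 1"
    and "Linf_on {0..1} \<sigma>pm" and "Linf_on {0..1} \<sigma>mp"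
    and "backstepping_kernels lam mu q \<sigma>pm \<sigma>mp Kuu Kuv Kvu Kvv"
    and "\<bar>K\<bar> < (1 - \<bar>\<rho> * q\<bar>) / \<bar>q\<bar>"
  shows "delay_robustly_stabilizes lam mu q \<rho> \<sigma>pm \<sigma>mp (U_BS2 \<rho> K Kuu Kuv Kvu Kvv)"
proof -
  \<comment> \<open>Extension by zero makes kernels Borel and bounded on the plane. Their equations
    survive because all conditions are posed inside the triangle.\<close>
  define trunc where "trunc k x y = indicator triangle (x, y) * (k x y :: real)" for k :: "real \<Rightarrow> real \<Rightarrow> real" and x y
  let ?\<sigma>pm = "\<lambda>x. indicator {0..1} x * \<sigma>pm x" and ?\<sigma>mp = "\<lambda>x. indicator {0..1} x * \<sigma>mp x"
  have L: "Linf_on triangle (\<lambda>(x, y). k x y)" if "k \<in> {Kuu, Kuv, Kvu, Kvv}" for k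
    using assms(7) that unfolding backstepping_kernels_def by blast
  have trunc: "(\<lambda>(x, y). trunc k x y) \<in> borel_measurable (borel \<Otimes>\<^sub>M borel)" "\<exists>B. \<forall>x y. \<bar>trunc k x y\<bar> \<le> B"
    if "k \<in> {Kuu, Kuv, Kvu, Kvv}" for k
    using Linf_on_truncate[OF L[OF that]] by (auto simp: trunc_def borel_prod case_prod_unfold)
  have trunc_eq: "trunc k x y = k x y" if "(x, y) \<in> triangle" for k x y using that by (simp add: trunc_def)
  obtain B1 B2 where B: "\<And>x. \<bar>?\<sigma>pm x\<bar> \<le> B1" "\<And>x. \<bar>?\<sigma>mp x\<bar> \<le> B2"
    using Linf_on_truncate(2)[OF assms(5)] Linf_on_truncate(2)[OF assms(6)] by blast
  obtain B3 B4 B5 B6 where B': "\<And>x y. \<bar>trunc Kuu x y\<bar> \<le> B3" "\<And>x y. \<bar>trunc Kuv x y\<bar> \<le> B4" "\<And>x y. \<bar>trunc Kvu x y\<bar> \<le> B5" "\<And>x y. \<bar>trunc Kvv x y\<bar> \<le> B6"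
    using trunc(2)[of Kuu] trunc(2)[of Kuv] trunc(2)[of Kvu] trunc(2)[of Kvv] by auto
  define M where "M = \<bar>B1\<bar> + \<bar>B2\<bar> + \<bar>B3\<bar> + \<bar>B4\<bar> + \<bar>B5\<bar> + \<bar>B6\<bar> + 1"
  have BM: "B1 \<le> M" "B2 \<le> M" "B3 \<le> M" "B4 \<le> M" "B5 \<le> M" "B6 \<le> M" "0 < M" by (auto simp: M_def)
  have one: "(1, y) \<in> triangle" if "y \<in> {0..1}" for y using that by (auto simp: triangle_def)
  interpret backstep lam mu q M ?\<sigma>pm ?\<sigma>mp "trunc Kuu" "trunc Kuv" "trunc Kvu" "trunc Kvv"
  proof
    show "backstepping_kernels lam mu q ?\<sigma>pm ?\<sigma>mp (trunc Kuu) (trunc Kuv) (trunc Kvu) (trunc Kvv)"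
      by (rule backstepping_kernels_cong[OF assms(7)]) (simp_all add: trunc_eq)
    show "?\<sigma>pm \<in> borel_measurable borel" "?\<sigma>mp \<in> borel_measurable borel"
      using Linf_on_truncate(1)[OF assms(5)] Linf_on_truncate(1)[OF assms(6)] by auto
    show "\<bar>?\<sigma>pm x\<bar> \<le> M" "\<bar>?\<sigma>mp x\<bar> \<le> M" for x using B(1)[of x] B(2)[of x] BM by linarith+
    show "\<bar>trunc Kuu x y\<bar> \<le> M" "\<bar>trunc Kuv x y\<bar> \<le> M" "\<bar>trunc Kvu x y\<bar> \<le> M" "\<bar>trunc Kvv x y\<bar> \<le> M" for x y
      using B'(1)[of x y] B'(2)[of x y] B'(3)[of x y] B'(4)[of x y] BM by linarith+
  qed (use assms trunc(1) BM in auto)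
  have small: "\<bar>\<rho> * q\<bar> + \<bar>K * q\<bar> < 1"
    using assms(3,8) by (simp add: abs_mult field_simps)
  obtain \<delta>0 C \<eta> where pos: "0 < \<delta>0" "0 < C" "0 < \<eta>" and dec: "\<And>\<delta> u0 v0 \<phi> u v t. 0 \<le> \<delta> \<Longrightarrow> \<delta> \<le> \<delta>0 \<Longrightarrow> L2_on {- \<delta>..0} \<phi> \<Longrightarrow> L2_on {0..1} u0 \<Longrightarrow> L2_on {0..1} v0 \<Longrightarrow>
    (\<lambda>(t, x). u t x) \<in> borel_measurable (borel \<Otimes>\<^sub>M borel) \<Longrightarrow> (\<lambda>(t, x). v t x) \<in> borel_measurable (borel \<Otimes>\<^sub>M borel) \<Longrightarrow>
    plant_solution lam mu q \<rho> ?\<sigma>pm ?\<sigma>mp u0 v0 (delayed_input \<delta> (U_BS2 \<rho> K (trunc Kuu) (trunc Kuv) (trunc Kvu) (trunc Kvv)) \<phi> u v) u v \<Longrightarrow> 0 \<le> t \<Longrightarrow>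
    state_norm (u t) (v t) \<le> C * exp (- \<eta> * t) * (state_norm u0 v0 + L2norm_on {- \<delta>..0} \<phi>)"
    using uniform_decay[OF small] by blast
  \<comment> \<open>Covers the undelayed loop and all small delays at once, with the same C and
    \<eta>.\<close>
  have "closed_loop_exp_stable lam mu q \<rho> \<sigma>pm \<sigma>mp (U_BS2 \<rho> K Kuu Kuv Kvu Kvv) \<delta>" if \<delta>: "0 \<le> \<delta>" "\<delta> \<le> \<delta>0" for \<delta>
  proof -
    have ex: "\<exists>u v. plant_solution lam mu q \<rho> \<sigma>pm \<sigma>mp u0 v0 (delayed_input \<delta> (U_BS2 \<rho> K Kuu Kuv Kvu Kvv) \<phi> u v) u v"
      if L2: "L2_on {0..1} u0" "L2_on {0..1} v0" "L2_on {- \<delta>..0} \<phi>" for u0 v0 \<phi>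
    proof -
      let ?u0 = "\<lambda>x. indicator {0..1} x * u0 x" and ?v0 = "\<lambda>x. indicator {0..1} x * v0 x" and ?\<phi> = "\<lambda>x. indicator {- \<delta>..0} x * \<phi> x"
      have "L2_on {0..1} ?u0" "L2_on {0..1} ?v0" "L2_on {- \<delta>..0} ?\<phi>"
        using L2 L2_on_cong[of "{0..1}" u0 ?u0] L2_on_cong[of "{0..1}" v0 ?v0] L2_on_cong[of "{- \<delta>..0}" \<phi> ?\<phi>] by simp_all
      then obtain u v where s: "plant_solution lam mu q \<rho> ?\<sigma>pm ?\<sigma>mp ?u0 ?v0 (delayed_input \<delta> (U_BS2 \<rho> K (trunc Kuu) (trunc Kuv) (trunc Kvu) (trunc Kvv)) ?\<phi> u v) u v"
        using existence[OF \<delta>(1), of ?u0 ?v0 ?\<phi> \<rho> K] L2 by (auto simp: L2_on_def set_borel_measurable_def)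
      have "plant_solution lam mu q \<rho> \<sigma>pm \<sigma>mp u0 v0 (delayed_input \<delta> (U_BS2 \<rho> K Kuu Kuv Kvu Kvv) \<phi> u v) u v"
        by (rule plant_solution_cong[OF s]) (auto simp: trunc_eq one intro!: U_BS2_cong)
      then show ?thesis by blast
    qed
    have est: "state_norm (u t) (v t) \<le> C * exp (- \<eta> * t) * (state_norm u0 v0 + L2norm_on {- \<delta>..0} \<phi>)"
      if L2: "L2_on {0..1} u0" "L2_on {0..1} v0" "L2_on {- \<delta>..0} \<phi>" and t: "0 \<le> t"
        and s: "plant_solution lam mu q \<rho> \<sigma>pm \<sigma>mp u0 v0 (delayed_input \<delta> (U_BS2 \<rho> K Kuu Kuv Kvu Kvv) \<phi> u v) u v" for u0 v0 \<phi> u v t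
    proof -
      \<comment> \<open>An arbitrary solution is measurable only on bounded strips of nonnegative
        time; its extension by zero is globally Borel and still a solution.\<close>
      let ?u = "\<lambda>t x. indicator ({0..} \<times> {0..1}) (t, x) * u t x" and ?v = "\<lambda>t x. indicator ({0..} \<times> {0..1}) (t, x) * v t x"
      have s': "plant_solution lam mu q \<rho> ?\<sigma>pm ?\<sigma>mp u0 v0 (delayed_input \<delta> (U_BS2 \<rho> K (trunc Kuu) (trunc Kuv) (trunc Kvu) (trunc Kvv)) \<phi> ?u ?v) ?u ?v"
        by (rule plant_solution_cong[OF s]) (auto simp: trunc_eq one intro!: U_BS2_cong)
      have m: "(\<lambda>(t, x). ?u t x) \<in> borel_measurable (borel \<Otimes>\<^sub>M borel)" "(\<lambda>(t, x). ?v t x) \<in> borel_measurable (borel \<Otimes>\<^sub>M borel)"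
        by (rule measurable_on_half_strip; use s in \<open>simp add: plant_solution_def\<close>)+
      have "state_norm (u t) (v t) = state_norm (?u t) (?v t)"
        using t L2norm_on_cong[of "{0..1}" "u t" "?u t"] L2norm_on_cong[of "{0..1}" "v t" "?v t"] by (simp add: state_norm_def)
      also have "\<dots> \<le> C * exp (- \<eta> * t) * (state_norm u0 v0 + L2norm_on {- \<delta>..0} \<phi>)"
        by (rule dec[OF \<delta> L2(3,1,2) m s' t])
      finally show ?thesis .
    qed
    show ?thesis unfolding closed_loop_exp_stable_def
    proof (rule exI[of _ C], rule exI[of _ \<eta>])
      show "0 < C \<and> 0 < \<eta> \<and> (\<forall>u0 v0 \<phi>. L2_on {0..1} u0 \<longrightarrow> L2_on {0..1} v0 \<longrightarrow> L2_on {- \<delta>..0} \<phi> \<longrightarrow>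
        (\<exists>u v. plant_solution lam mu q \<rho> \<sigma>pm \<sigma>mp u0 v0 (delayed_input \<delta> (U_BS2 \<rho> K Kuu Kuv Kvu Kvv) \<phi> u v) u v) \<and>
        (\<forall>u v. plant_solution lam mu q \<rho> \<sigma>pm \<sigma>mp u0 v0 (delayed_input \<delta> (U_BS2 \<rho> K Kuu Kuv Kvu Kvv) \<phi> u v) u v \<longrightarrow>
          (\<forall>t\<ge>0. state_norm (u t) (v t) \<le> C * exp (- \<eta> * t) * (state_norm u0 v0 + L2norm_on {- \<delta>..0} \<phi>))))"
        using pos(2,3) ex est by blast
    qed
  qed
  then show ?thesis unfolding delay_robustly_stabilizes_def using pos(1) by (auto intro!: exI[of _ \<delta>0])
qed

end
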